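(* Let $(A,\Delta)$ be a compact quantum semigroup such that the unital C*-algebra $A$ is finitely generated, let $B$ be a finite dimensional commutative C*-algebra, and let $(C,\Phi)$, with $\Phi:A\to B\otimes C$, be the quantum family of all maps from $\mathfrak{Q}B$ to $\mathfrak{Q}A$. Let $F:C\otimes B\to B\otimes C$ be the flip map, $F(c\otimes b)=b\otimes c$ ($b\in B$, $c\in C$), and let $m:B\otimes B\to B$ be the multiplication *-homomorphism, $m(b\otimes b')=bb'$ ($b,b'\in B$). Let $\Gamma:C\to C\otimes C$ be the unique unital *-homomorphism (given by the universal property of $(C,\Phi)$) such that $$(\mathrm{I}_B\otimes\Gamma)\,\Phi=(m\otimes \mathrm{I}_{C\otimes C})\,(\mathrm{I}_B\otimes F\otimes \mathrm{I}_C)\,(\Phi\otimes\Phi)\,\Delta$$ as maps $A\to B\otimes C\otimes C$. Then $(C,\Gamma)$ is a compact quantum semigroup.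
   Context: All C*-algebras are unital and all C*-algebra homomorphisms are unital. For a C*-algebra $A$, $\mathrm{I}_A$ denotes the identity homomorphism of $A$. $\otimes$ denotes the spatial (minimal) tensor product of C*-algebras, and for *-homomorphisms $\Phi:A\to B$ and $\Phi':A'\to B'$, $\Phi\otimes\Phi':A\otimes A'\to B\otimes B'$ is the *-homomorphism with $(\Phi\otimes\Phi')(a\otimes a')=\Phi(a)\otimes\Phi'(a')$. Compact quantum semigroup: a pair $(A,\Delta)$ consisting of a unital C*-algebra $A$ and a unital *-homomorphism $\Delta:A\to A\otimes A$ that is coassociative, i.e. $(\Delta\otimes \mathrm{I}_A)\Delta=(\mathrm{I}_A\otimes\Delta)\Delta$. Quantum family of all maps: $\mathfrak{Q}A$ is a purely symbolic notation for the "quantum space" corresponding to the unital C*-algebra $A$. For unital C*-algebras $A$ and $B$, a quantum family of all maps from $\mathfrak{Q}B$ to $\mathfrak{Q}A$ is a pair $(C,\Phi)$ consisting of a unital C*-algebra $C$ and a unital *-homomorphism $\Phi:A\to B\otimes C$ such that for every unital C*-algebra $D$ and every unital *-homomorphism $\Psi:A\to B\otimes D$ there is a unique unital *-homomorphism $\Lambda:C\to D$ with $(\mathrm{I}_B\otimes\Lambda)\Phi=\Psi$. It is unique up to isomorphism, and it is known to exist whenever $A$ is unital and finitely generated and $B$ is finite dimensional. *)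

theory Defs
  imports "HOL-Analysis.Analysis" "HOL-Algebra.Module"
begin

section \<open>Unital C*-algebras\<close>

record 'a cstar = "(complex, 'a) module" +
  star :: "'a \<Rightarrow> 'a"
  cnorm :: "'a \<Rightarrow> real"

text \<open>The zero algebra is allowed, as \<^const>\<open>ring\<close> does not require the unit to be nonzero.\<close>

locale cstar_algebra = ring A for A :: "'a cstar" (structure) +
  assumes smult_closed: "x \<in> carrier A \<Longrightarrow> c \<odot> x \<in> carrier A"
    and smult_l_distr: "x \<in> carrier A \<Longrightarrow> (c + d) \<odot> x = c \<odot> x \<oplus> d \<odot> x"
    and smult_r_distr:
      "\<lbrakk>x \<in> carrier A; y \<in> carrier A\<rbrakk> \<Longrightarrow> c \<odot> (x \<oplus> y) = c \<odot> x \<oplus> c \<odot> y"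
    and smult_assoc: "x \<in> carrier A \<Longrightarrow> (c * d) \<odot> x = c \<odot> (d \<odot> x)"
    and smult_one: "x \<in> carrier A \<Longrightarrow> 1 \<odot> x = x"
    and smult_mult_left:
      "\<lbrakk>x \<in> carrier A; y \<in> carrier A\<rbrakk> \<Longrightarrow> (c \<odot> x) \<otimes> y = c \<odot> (x \<otimes> y)"
    and smult_mult_right:
      "\<lbrakk>x \<in> carrier A; y \<in> carrier A\<rbrakk> \<Longrightarrow> x \<otimes> (c \<odot> y) = c \<odot> (x \<otimes> y)"
    and star_closed: "x \<in> carrier A \<Longrightarrow> star A x \<in> carrier A"
    and star_star: "x \<in> carrier A \<Longrightarrow> star A (star A x) = x"
    and star_add:
      "\<lbrakk>x \<in> carrier A; y \<in> carrier A\<rbrakk> \<Longrightarrow> star A (x \<oplus> y) = star A x \<oplus> star A y"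
    and star_smult: "x \<in> carrier A \<Longrightarrow> star A (c \<odot> x) = cnj c \<odot> star A x"
    and star_mult:
      "\<lbrakk>x \<in> carrier A; y \<in> carrier A\<rbrakk> \<Longrightarrow> star A (x \<otimes> y) = star A y \<otimes> star A x"
    and cnorm_nonneg: "x \<in> carrier A \<Longrightarrow> 0 \<le> cnorm A x"
    and cnorm_eq_0_iff: "x \<in> carrier A \<Longrightarrow> cnorm A x = 0 \<longleftrightarrow> x = \<zero>"
    and cnorm_triangle:
      "\<lbrakk>x \<in> carrier A; y \<in> carrier A\<rbrakk> \<Longrightarrow> cnorm A (x \<oplus> y) \<le> cnorm A x + cnorm A y"
    and cnorm_smult: "x \<in> carrier A \<Longrightarrow> cnorm A (c \<odot> x) = cmod c * cnorm A x"
    and cnorm_mult: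
      "\<lbrakk>x \<in> carrier A; y \<in> carrier A\<rbrakk> \<Longrightarrow> cnorm A (x \<otimes> y) \<le> cnorm A x * cnorm A y"
    and cstar_identity: "x \<in> carrier A \<Longrightarrow> cnorm A (star A x \<otimes> x) = (cnorm A x)\<^sup>2"
    and complete:
      "\<lbrakk>\<And>n :: nat. s n \<in> carrier A;
        \<And>e. 0 < e \<Longrightarrow> \<exists>N. \<forall>m\<ge>N. \<forall>n\<ge>N. cnorm A (s m \<ominus> s n) < e\<rbrakk>
       \<Longrightarrow> \<exists>x\<in>carrier A. (\<lambda>n. cnorm A (s n \<ominus> x)) \<longlonglongrightarrow> 0"

text \<open>Homomorphisms are extensional functions, so that two homomorphisms with the same domain
  are equal iff they agree on its carrier. They are unital because \<^const>\<open>ring_hom\<close> is.\<close>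

definition cstar_hom :: "'a cstar \<Rightarrow> 'b cstar \<Rightarrow> ('a \<Rightarrow> 'b) set" where
  "cstar_hom A B = {f \<in> ring_hom A B \<inter> extensional (carrier A).
     (\<forall>c. \<forall>x\<in>carrier A. f (c \<odot>\<^bsub>A\<^esub> x) = c \<odot>\<^bsub>B\<^esub> f x) \<and>
     (\<forall>x\<in>carrier A. f (star A x) = star B (f x))}"

definition id_hom :: "'a cstar \<Rightarrow> 'a \<Rightarrow> 'a" where
  "id_hom A = (\<lambda>x\<in>carrier A. x)"

text \<open>In the next definition \<open>K\<close> ranges over the unital C*-subalgebras of \<open>A\<close>: with the
  inherited operations and norm, being a C*-algebra amounts to being a norm-closed unital
  *-subalgebra.\<close>

definition cstar_finitely_generated :: "'a cstar \<Rightarrow> bool" where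
  "cstar_finitely_generated A \<longleftrightarrow>
     (\<exists>S. finite S \<and> S \<subseteq> carrier A \<and>
       (\<forall>K. S \<subseteq> K \<and> K \<subseteq> carrier A \<and> cstar_algebra (A\<lparr>carrier := K\<rparr>) \<longrightarrow> K = carrier A))"

definition cstar_finite_dimensional :: "'a cstar \<Rightarrow> bool" where
  "cstar_finite_dimensional A \<longleftrightarrow>
     (\<exists>S. finite S \<and> S \<subseteq> carrier A \<and>
       (\<forall>x\<in>carrier A. \<exists>c. x = (\<Oplus>\<^bsub>A\<^esub>s\<in>S. c s \<odot>\<^bsub>A\<^esub> s)))"

definition cstar_commutative :: "'a cstar \<Rightarrow> bool" where
  "cstar_commutative A \<longleftrightarrow> (\<forall>x\<in>carrier A. \<forall>y\<in>carrier A. x \<otimes>\<^bsub>A\<^esub> y = y \<otimes>\<^bsub>A\<^esub> x)"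


section \<open>Operators on the Hilbert spaces of square-summable families\<close>

definition ell2 :: "('i \<Rightarrow> complex) set" where
  "ell2 = {\<xi>. (\<lambda>i. (cmod (\<xi> i))\<^sup>2) summable_on UNIV}"

definition ell2_inner :: "('i \<Rightarrow> complex) \<Rightarrow> ('i \<Rightarrow> complex) \<Rightarrow> complex" where
  "ell2_inner \<xi> \<eta> = (\<Sum>\<^sub>\<infinity>i. cnj (\<xi> i) * \<eta> i)"

definition ell2_norm :: "('i \<Rightarrow> complex) \<Rightarrow> real" where
  "ell2_norm \<xi> = sqrt (\<Sum>\<^sub>\<infinity>i. (cmod (\<xi> i))\<^sup>2)"

text \<open>An operator is a function whose values outside \<^const>\<open>ell2\<close> are irrelevant.\<close>

type_synonym 'i operator = "('i \<Rightarrow> complex) \<Rightarrow> ('i \<Rightarrow> complex)"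

definition bounded_operator :: "'i operator \<Rightarrow> bool" where
  "bounded_operator T \<longleftrightarrow>
     (\<forall>\<xi>\<in>ell2. T \<xi> \<in> ell2) \<and>
     (\<forall>\<xi>\<in>ell2. \<forall>\<eta>\<in>ell2. T (\<lambda>i. \<xi> i + \<eta> i) = (\<lambda>i. T \<xi> i + T \<eta> i)) \<and>
     (\<forall>c. \<forall>\<xi>\<in>ell2. T (\<lambda>i. c * \<xi> i) = (\<lambda>i. c * T \<xi> i)) \<and>
     (\<exists>M. \<forall>\<xi>\<in>ell2. ell2_norm (T \<xi>) \<le> M * ell2_norm \<xi>)"

definition operator_norm :: "'i operator \<Rightarrow> real" where
  "operator_norm T = Sup {ell2_norm (T \<xi>) |\<xi>. \<xi> \<in> ell2 \<and> ell2_norm \<xi> \<le> 1}"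

text \<open>The Hilbert space tensor product of \<open>\<ell>\<^sup>2(I)\<close> and \<open>\<ell>\<^sup>2(J)\<close> is \<open>\<ell>\<^sup>2(I \<times> J)\<close>. On it \<open>S \<otimes> T\<close> is
  \<open>1 \<otimes> T\<close> (apply \<open>T\<close> to every row \<open>\<xi>(i', -)\<close>) followed by \<open>S \<otimes> 1\<close> (apply \<open>S\<close> to every column).\<close>

definition operator_tensor :: "'i operator \<Rightarrow> 'j operator \<Rightarrow> ('i \<times> 'j) operator" where
  "operator_tensor S T \<xi> = (\<lambda>(i, j). S (\<lambda>i'. T (\<lambda>j'. \<xi> (i', j')) j) i)"

text \<open>Representations may be degenerate. Hence those on \<open>\<ell>\<^sup>2(I)\<close> account for all
  representations on Hilbert spaces of dimension at most the cardinality of \<open>I\<close>.\<close>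

definition representation :: "'a cstar \<Rightarrow> ('a \<Rightarrow> 'i operator) \<Rightarrow> bool" where
  "representation A \<pi> \<longleftrightarrow>
     (\<forall>x\<in>carrier A. bounded_operator (\<pi> x)) \<and>
     (\<forall>x\<in>carrier A. \<forall>y\<in>carrier A. \<forall>\<xi>\<in>ell2. \<pi> (x \<oplus>\<^bsub>A\<^esub> y) \<xi> = (\<lambda>i. \<pi> x \<xi> i + \<pi> y \<xi> i)) \<and>
     (\<forall>c. \<forall>x\<in>carrier A. \<forall>\<xi>\<in>ell2. \<pi> (c \<odot>\<^bsub>A\<^esub> x) \<xi> = (\<lambda>i. c * \<pi> x \<xi> i)) \<and>
     (\<forall>x\<in>carrier A. \<forall>y\<in>carrier A. \<forall>\<xi>\<in>ell2. \<pi> (x \<otimes>\<^bsub>A\<^esub> y) \<xi> = \<pi> x (\<pi> y \<xi>)) \<and>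
     (\<forall>x\<in>carrier A. \<forall>\<xi>\<in>ell2. \<forall>\<eta>\<in>ell2.
        ell2_inner (\<pi> (star A x) \<xi>) \<eta> = ell2_inner \<xi> (\<pi> x \<eta>))"


section \<open>The spatial tensor product\<close>

text \<open>The spatial norm of \<open>\<Sum>k<n. a\<^sub>k \<otimes> b\<^sub>k\<close> is the supremum, over all representations \<open>\<pi>\<close> of \<open>A\<close>
  and \<open>\<rho>\<close> of \<open>B\<close>, of the operator norm of \<open>\<Sum>k<n. \<pi> a\<^sub>k \<otimes> \<rho> b\<^sub>k\<close>. For infinite \<open>'u\<close>
  representations on \<open>\<ell>\<^sup>2('u)\<close> suffice: a finite set of vectors generates an invariant subspace of
  dimension at most the cardinality of \<open>'u\<close>, because \<open>A\<close> and \<open>B\<close> have carriers in \<open>'u\<close>.\<close>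

definition spatial_norm ::
    "'u cstar \<Rightarrow> 'u cstar \<Rightarrow> nat \<Rightarrow> (nat \<Rightarrow> 'u) \<Rightarrow> (nat \<Rightarrow> 'u) \<Rightarrow> real" where
  "spatial_norm A B n a b =
     Sup {operator_norm (\<lambda>\<xi> p. \<Sum>k<n. operator_tensor (\<pi> (a k)) (\<rho> (b k)) \<xi> p) |
          (\<pi> :: 'u \<Rightarrow> 'u operator) (\<rho> :: 'u \<Rightarrow> 'u operator).
          representation A \<pi> \<and> representation B \<rho>}"

text \<open>\<open>is_spatial_tensor A B T t\<close>: the C*-algebra \<open>T\<close> is the completion of the algebraic tensor
  product of \<open>A\<close> and \<open>B\<close> in the spatial norm, with elementary tensors \<open>t a b\<close>. (That the algebraic
  tensor product embeds into \<open>T\<close> is contained in the norm condition, since the spatial norm is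
  a norm.)\<close>

definition is_spatial_tensor ::
    "'u cstar \<Rightarrow> 'u cstar \<Rightarrow> 'u cstar \<Rightarrow> ('u \<Rightarrow> 'u \<Rightarrow> 'u) \<Rightarrow> bool" where
  "is_spatial_tensor A B T t \<longleftrightarrow>
     cstar_algebra T \<and>
     (\<forall>a\<in>carrier A. \<forall>b\<in>carrier B. t a b \<in> carrier T) \<and>
     (\<forall>a\<in>carrier A. \<forall>a'\<in>carrier A. \<forall>b\<in>carrier B.
        t (a \<oplus>\<^bsub>A\<^esub> a') b = t a b \<oplus>\<^bsub>T\<^esub> t a' b) \<and>
     (\<forall>a\<in>carrier A. \<forall>b\<in>carrier B. \<forall>b'\<in>carrier B.
        t a (b \<oplus>\<^bsub>B\<^esub> b') = t a b \<oplus>\<^bsub>T\<^esub> t a b') \<and>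
     (\<forall>c. \<forall>a\<in>carrier A. \<forall>b\<in>carrier B.
        t (c \<odot>\<^bsub>A\<^esub> a) b = c \<odot>\<^bsub>T\<^esub> t a b \<and> t a (c \<odot>\<^bsub>B\<^esub> b) = c \<odot>\<^bsub>T\<^esub> t a b) \<and>
     (\<forall>a\<in>carrier A. \<forall>a'\<in>carrier A. \<forall>b\<in>carrier B. \<forall>b'\<in>carrier B.
        t a b \<otimes>\<^bsub>T\<^esub> t a' b' = t (a \<otimes>\<^bsub>A\<^esub> a') (b \<otimes>\<^bsub>B\<^esub> b')) \<and>
     t \<one>\<^bsub>A\<^esub> \<one>\<^bsub>B\<^esub> = \<one>\<^bsub>T\<^esub> \<and>
     (\<forall>a\<in>carrier A. \<forall>b\<in>carrier B. star T (t a b) = t (star A a) (star B b)) \<and>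
     (\<forall>(n :: nat) a b. (\<forall>k<n. a k \<in> carrier A) \<and> (\<forall>k<n. b k \<in> carrier B) \<longrightarrow>
        cnorm T (\<Oplus>\<^bsub>T\<^esub>k\<in>{..<n}. t (a k) (b k)) = spatial_norm A B n a b) \<and>
     (\<forall>x\<in>carrier T. \<forall>e>0. \<exists>(n :: nat) a b.
        (\<forall>k<n. a k \<in> carrier A) \<and> (\<forall>k<n. b k \<in> carrier B) \<and>
        cnorm T (x \<ominus>\<^bsub>T\<^esub> (\<Oplus>\<^bsub>T\<^esub>k\<in>{..<n}. t (a k) (b k))) < e)"

text \<open>The properties above determine \<open>(T, t)\<close> up to a unique isomorphism, so any choice will do.
  All algebras live in one universe \<open>'u\<close>, which has to be closed under countable sequences (as
  \<open>nat \<Rightarrow> 'x\<close> is) for the completion to fit into it.\<close>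

definition spatial_tensor_pair :: "'u cstar \<Rightarrow> 'u cstar \<Rightarrow> 'u cstar \<times> ('u \<Rightarrow> 'u \<Rightarrow> 'u)" where
  "spatial_tensor_pair A B = (SOME (T, t). is_spatial_tensor A B T t)"

definition tensor_alg :: "'u cstar \<Rightarrow> 'u cstar \<Rightarrow> 'u cstar" where
  "tensor_alg A B = fst (spatial_tensor_pair A B)"

definition tensor_elem :: "'u cstar \<Rightarrow> 'u cstar \<Rightarrow> 'u \<Rightarrow> 'u \<Rightarrow> 'u" where
  "tensor_elem A B = snd (spatial_tensor_pair A B)"

text \<open>\<open>tensor_hom A B A' B' f f'\<close> is \<open>f \<otimes> f'\<close> for \<open>f : A \<rightarrow> B\<close> and \<open>f' : A' \<rightarrow> B'\<close>.\<close>

definition tensor_hom ::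
    "'u cstar \<Rightarrow> 'u cstar \<Rightarrow> 'u cstar \<Rightarrow> 'u cstar \<Rightarrow> ('u \<Rightarrow> 'u) \<Rightarrow> ('u \<Rightarrow> 'u) \<Rightarrow> 'u \<Rightarrow> 'u" where
  "tensor_hom A B A' B' f f' =
     (THE h. h \<in> cstar_hom (tensor_alg A A') (tensor_alg B B') \<and>
        (\<forall>a\<in>carrier A. \<forall>a'\<in>carrier A'.
           h (tensor_elem A A' a a') = tensor_elem B B' (f a) (f' a')))"

text \<open>The identifications between \<open>(A \<otimes> B) \<otimes> C\<close> and \<open>A \<otimes> (B \<otimes> C)\<close>.\<close>

definition tensor_assoc :: "'u cstar \<Rightarrow> 'u cstar \<Rightarrow> 'u cstar \<Rightarrow> 'u \<Rightarrow> 'u" where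
  "tensor_assoc A B C =
     (THE h. h \<in> cstar_hom (tensor_alg (tensor_alg A B) C) (tensor_alg A (tensor_alg B C)) \<and>
        (\<forall>a\<in>carrier A. \<forall>b\<in>carrier B. \<forall>c\<in>carrier C.
           h (tensor_elem (tensor_alg A B) C (tensor_elem A B a b) c) =
           tensor_elem A (tensor_alg B C) a (tensor_elem B C b c)))"

definition tensor_assoc_inv :: "'u cstar \<Rightarrow> 'u cstar \<Rightarrow> 'u cstar \<Rightarrow> 'u \<Rightarrow> 'u" where
  "tensor_assoc_inv A B C =
     (THE h. h \<in> cstar_hom (tensor_alg A (tensor_alg B C)) (tensor_alg (tensor_alg A B) C) \<and>
        (\<forall>a\<in>carrier A. \<forall>b\<in>carrier B. \<forall>c\<in>carrier C.
           h (tensor_elem A (tensor_alg B C) a (tensor_elem B C b c)) =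
           tensor_elem (tensor_alg A B) C (tensor_elem A B a b) c))"

definition flip_hom :: "'u cstar \<Rightarrow> 'u cstar \<Rightarrow> 'u \<Rightarrow> 'u" where
  "flip_hom C B =
     (THE h. h \<in> cstar_hom (tensor_alg C B) (tensor_alg B C) \<and>
        (\<forall>c\<in>carrier C. \<forall>b\<in>carrier B. h (tensor_elem C B c b) = tensor_elem B C b c))"

text \<open>A homomorphism with the following property exists for commutative \<open>B\<close>.\<close>

definition mult_hom :: "'u cstar \<Rightarrow> 'u \<Rightarrow> 'u" where
  "mult_hom B =
     (THE h. h \<in> cstar_hom (tensor_alg B B) B \<and>
        (\<forall>b\<in>carrier B. \<forall>b'\<in>carrier B. h (tensor_elem B B b b') = b \<otimes>\<^bsub>B\<^esub> b'))"


section \<open>Compact quantum semigroups and quantum families of all maps\<close>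

definition compact_quantum_semigroup :: "'u cstar \<Rightarrow> ('u \<Rightarrow> 'u) \<Rightarrow> bool" where
  "compact_quantum_semigroup A \<Delta> \<longleftrightarrow>
     cstar_algebra A \<and>
     \<Delta> \<in> cstar_hom A (tensor_alg A A) \<and>
     (\<forall>a\<in>carrier A.
        tensor_assoc A A A (tensor_hom A (tensor_alg A A) A A \<Delta> (id_hom A) (\<Delta> a)) =
        tensor_hom A A A (tensor_alg A A) (id_hom A) \<Delta> (\<Delta> a))"

text \<open>\<open>(C, \<Phi>)\<close> is the quantum family of all maps from the quantum space of \<open>B\<close> to that of \<open>A\<close>; the
  universal property ranges over all unital C*-algebras \<open>D\<close> in the universe \<open>'u\<close>.\<close>

definition quantum_family_of_all_maps ::
    "'u cstar \<Rightarrow> 'u cstar \<Rightarrow> 'u cstar \<Rightarrow> ('u \<Rightarrow> 'u) \<Rightarrow> bool" where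
  "quantum_family_of_all_maps A B C \<Phi> \<longleftrightarrow>
     cstar_algebra C \<and>
     \<Phi> \<in> cstar_hom A (tensor_alg B C) \<and>
     (\<forall>D \<Psi>. cstar_algebra D \<and> \<Psi> \<in> cstar_hom A (tensor_alg B D) \<longrightarrow>
        (\<exists>!\<Lambda>. \<Lambda> \<in> cstar_hom C D \<and>
           (\<forall>a\<in>carrier A. tensor_hom B B C D (id_hom B) \<Lambda> (\<Phi> a) = \<Psi> a)))"

text \<open>The composite \<open>(m \<otimes> I\<^bsub>C\<otimes>C\<^esub>)(I\<^sub>B \<otimes> F \<otimes> I\<^sub>C)(\<Phi> \<otimes> \<Phi>)\<Delta> : A \<rightarrow> B \<otimes> (C \<otimes> C)\<close>. With the identifications
  made explicit, it passes through
  \<open>A \<otimes> A\<close>, \<open>(B \<otimes> C) \<otimes> (B \<otimes> C)\<close>, \<open>B \<otimes> (C \<otimes> (B \<otimes> C))\<close>, \<open>B \<otimes> ((C \<otimes> B) \<otimes> C)\<close>, \<open>B \<otimes> ((B \<otimes> C) \<otimes> C)\<close>,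
  \<open>B \<otimes> (B \<otimes> (C \<otimes> C))\<close>, \<open>(B \<otimes> B) \<otimes> (C \<otimes> C)\<close> and \<open>B \<otimes> (C \<otimes> C)\<close>.\<close>

definition product_hom ::
    "'u cstar \<Rightarrow> ('u \<Rightarrow> 'u) \<Rightarrow> 'u cstar \<Rightarrow> 'u cstar \<Rightarrow> ('u \<Rightarrow> 'u) \<Rightarrow> 'u \<Rightarrow> 'u" where
  "product_hom A \<Delta> B C \<Phi> =
     (let BC = tensor_alg B C; CB = tensor_alg C B; BB = tensor_alg B B; CC = tensor_alg C C;
          Phi_Phi = tensor_hom A BC A BC \<Phi> \<Phi>;
          assoc1 = tensor_assoc B C BC;
          assoc2 = tensor_hom B B (tensor_alg C BC) (tensor_alg CB C)
                     (id_hom B) (tensor_assoc_inv C B C);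
          id_F_id = tensor_hom B B (tensor_alg CB C) (tensor_alg BC C)
                      (id_hom B) (tensor_hom CB BC C C (flip_hom C B) (id_hom C));
          assoc3 = tensor_hom B B (tensor_alg BC C) (tensor_alg B CC)
                     (id_hom B) (tensor_assoc B C C);
          assoc4 = tensor_assoc_inv B B CC;
          m_id = tensor_hom BB B CC CC (mult_hom B) (id_hom CC)
      in (\<lambda>a\<in>carrier A. m_id (assoc4 (assoc3 (id_F_id (assoc2 (assoc1 (Phi_Phi (\<Delta> a)))))))))"

end

theory Submission
  imports Defs "HOL-Computational_Algebra.Fundamental_Theorem_Algebra"
begin

text \<open>For \<open>*\<close>-homomorphisms \<open>f : A \<rightarrow> B \<otimes> X\<close> and \<open>g : A \<rightarrow> B \<otimes> Y\<close> let
  \<open>f \<bullet> g = \<mu> (f \<otimes> g) \<Delta> : A \<rightarrow> B \<otimes> (X \<otimes> Y)\<close>, where \<open>\<mu>\<close> moves the two copies of \<open>B\<close> together and multiplies them.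
  Coassociativity of \<open>\<Delta>\<close> and associativity of the multiplication of \<open>B\<close> make \<open>\<bullet>\<close> associative, and \<open>\<mu>\<close> is natural
  in \<open>X\<close> and \<open>Y\<close>. As \<open>\<Gamma>\<close> satisfies \<open>(I \<otimes> \<Gamma>) \<Phi> = \<Phi> \<bullet> \<Phi>\<close>, both \<open>(\<Gamma> \<otimes> I) \<Gamma>\<close> and \<open>(I \<otimes> \<Gamma>) \<Gamma>\<close> induce
  \<open>\<Phi> \<bullet> \<Phi> \<bullet> \<Phi>\<close>, and they coincide by the universal property of \<open>(C, \<Phi>)\<close>.

  The tensor product, the associator, the flip and the multiplication map are specified by descriptions,
  which denote only because such maps exist. The spatial tensor product is realised on a
  direct sum of Hilbert spaces over all pairs of representations and transported along an injection into the
  type \<open>nat \<Rightarrow> 'x\<close>; the associator exists because the spatial norm may be computed from any norming family of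
  representations (a family of representations of \<open>D\<close> is norming for every matrix algebra over \<open>D\<close> as well); and the
  multiplication map exists because the norm of a finite-dimensional commutative \<open>B\<close> is attained at characters,
  obtained as joint eigenvectors of the multiplication operators.\<close>

section \<open>Elementary analysis in a C*-algebra\<close>

text \<open>The main analytic input is that unital *-homomorphisms do not increase norms. It is
  reached without spectral theory: a self-adjoint \<open>h\<close> of norm below 1 has a
  self-adjoint partner \<open>y\<close>, commuting with it, such that the squares of
  \<open>h\<close> and \<open>y\<close> add up to 1, and such an identity survives every
  homomorphism. Contractivity lets maps be extended from, and compared on, dense sets of finite
  sums. The obstacle is the associator. The norm on A \<otimes> (B \<otimes> C) involves all
  representations of B \<otimes> C, while a comparison with (A \<otimes> B) \<otimes> C is possible
  only for those built from a representation of B and one of C. Cutting the other tensor factor down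
  to finitely many coordinates leaves a matrix over B \<otimes> C. Two matrix norms obtained from
  different norming families differ by at most a constant factor, and passing to high powers shows
  that the factor is 1. The type \<open>nat \<Rightarrow> 'x\<close> plays two parts: it can code
  countable sequences of its own elements, so completions fit into it, and it is in bijection with
  its own square, so a tensor product of two representations acts again on the same Hilbert
  space.\<close>

definition clim :: "'a cstar \<Rightarrow> (nat \<Rightarrow> 'a) \<Rightarrow> 'a \<Rightarrow> bool" where
  "clim A s x \<longleftrightarrow> (\<forall>n. s n \<in> carrier A) \<and> x \<in> carrier A \<and>
     (\<lambda>n. cnorm A (s n \<ominus>\<^bsub>A\<^esub> x)) \<longlonglongrightarrow> 0"

context cstar_algebra
begin

lemma smult_zero: "x \<in> carrier A \<Longrightarrow> 0 \<odot> x = \<zero>"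
  by (metis add.r_cancel_one smult_closed smult_l_distr add.right_neutral)

lemma smult_minus1: "x \<in> carrier A \<Longrightarrow> (- 1) \<odot> x = \<ominus> x"
  by (metis smult_zero smult_closed smult_l_distr smult_one add.left_inverse minus_equality)

lemma smult_zero_right: "c \<odot> \<zero> = \<zero>"
  by (metis smult_zero mult_zero_right smult_assoc zero_closed)

lemma smult_minus: "x \<in> carrier A \<Longrightarrow> c \<odot> (\<ominus> x) = \<ominus> (c \<odot> x)"
  by (metis (no_types) smult_minus1 smult_assoc smult_closed mult.commute)

lemma smult_two: "x \<in> carrier A \<Longrightarrow> 2 \<odot> x = x \<oplus> x"
  using smult_l_distr[of x 1 1] by (simp add: smult_one)

lemma star_zero: "star A \<zero> = \<zero>"
  by (metis smult_zero star_smult star_closed zero_closed complex_cnj_zero)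

lemma star_minus: "x \<in> carrier A \<Longrightarrow> star A (\<ominus> x) = \<ominus> star A x"
  by (metis smult_minus1 star_smult star_closed complex_cnj_minus complex_cnj_one)

lemma star_one: "star A \<one> = \<one>"
  by (metis l_one one_closed r_one star_closed star_mult star_star)

lemma cnorm_zero: "cnorm A \<zero> = 0"
  using cnorm_eq_0_iff by blast

lemma cnorm_minus: "x \<in> carrier A \<Longrightarrow> cnorm A (\<ominus> x) = cnorm A x"
  by (metis smult_minus1 cnorm_smult norm_minus_cancel norm_one mult_1)

lemma cnorm_diff_commute:
  "\<lbrakk>x \<in> carrier A; y \<in> carrier A\<rbrakk> \<Longrightarrow> cnorm A (x \<ominus> y) = cnorm A (y \<ominus> x)"
  by (metis cnorm_minus minus_closed minus_eq a_inv_closed minus_add minus_minus a_comm)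

lemma cnorm_diff_triangle:
  assumes "x \<in> carrier A" "y \<in> carrier A" "z \<in> carrier A"
  shows "cnorm A (x \<ominus> z) \<le> cnorm A (x \<ominus> y) + cnorm A (y \<ominus> z)"
proof -
  have "x \<ominus> z = (x \<ominus> y) \<oplus> (y \<ominus> z)"
    using assms by (simp add: minus_eq a_assoc[symmetric]) (simp add: a_assoc l_neg)
  then show ?thesis using assms cnorm_triangle by simp
qed

lemma abs_cnorm_diff_le:
  assumes "x \<in> carrier A" "y \<in> carrier A"
  shows "\<bar>cnorm A x - cnorm A y\<bar> \<le> cnorm A (x \<ominus> y)"
  using cnorm_diff_triangle[of x y \<zero>] cnorm_diff_triangle[of y x \<zero>] assms
    cnorm_diff_commute[of x y] by (simp add: minus_eq)

text \<open>The C*-identity and submultiplicativity bound the square of the norm of \<open>y\<close>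
  by the product of the norms of \<open>star A y\<close> and \<open>y\<close>. Cancelling one
  factor, for \<open>y\<close> and for its star, gives both inequalities.\<close>

lemma cnorm_star: 
  assumes x: "x \<in> carrier A" shows "cnorm A (star A x) = cnorm A x"
proof -
  have le: "cnorm A y \<le> cnorm A (star A y)" if y: "y \<in> carrier A" for y
  proof (cases "cnorm A y = 0")
    case True then show ?thesis using cnorm_nonneg[of "star A y"] star_closed y by simp
  next
    case False
    have "(cnorm A y)\<^sup>2 \<le> cnorm A (star A y) * cnorm A y"
      using cstar_identity[OF y] cnorm_mult[of "star A y" y] star_closed y by simp
    then show ?thesis using False cnorm_nonneg[OF y] by (simp add: power2_eq_square)
  qed
  show ?thesis using le[of x] le[of "star A x"] x star_closed star_star by force
qed

text \<open>The C*-identity makes the norm of the unit idempotent. It may be 0, namely in the zero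
  algebra, hence an inequality.\<close>

lemma cnorm_one_le: "cnorm A \<one> \<le> 1"
proof -
  have "cnorm A \<one> * cnorm A \<one> = cnorm A \<one> * 1"
    using cstar_identity[of \<one>] by (simp add: star_one power2_eq_square)
  then show ?thesis by (metis mult_cancel_left order_refl zero_le_one)
qed

section \<open>Norm limits and continuity of the operations\<close>

lemma climI:
  assumes "\<And>n. s n \<in> carrier A" "x \<in> carrier A"
    and "\<And>n. cnorm A (s n \<ominus> x) \<le> e n" "e \<longlonglongrightarrow> 0"
  shows "clim A s x"
  unfolding clim_def
proof (intro conjI allI assms(1,2))
  show "(\<lambda>n. cnorm A (s n \<ominus> x)) \<longlonglongrightarrow> 0"
    by (rule tendsto_sandwich[OF _ _ tendsto_const assms(4)])
      (use assms in \<open>auto intro!: always_eventually cnorm_nonneg\<close>)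
qed

lemma clim_closed: "clim A s x \<Longrightarrow> s n \<in> carrier A" "clim A s x \<Longrightarrow> x \<in> carrier A"
  by (auto simp: clim_def)

lemma clim_tendsto: "clim A s x \<Longrightarrow> (\<lambda>n. cnorm A (s n \<ominus> x)) \<longlonglongrightarrow> 0"
  by (auto simp: clim_def)

lemma clim_const: "x \<in> carrier A \<Longrightarrow> clim A (\<lambda>_. x) x"
  by (simp add: clim_def minus_eq r_neg cnorm_zero)

lemma clim_add:
  assumes "clim A s x" "clim A r y" shows "clim A (\<lambda>n. s n \<oplus> r n) (x \<oplus> y)"
proof (rule climI)
  note c = clim_closed[OF assms(1)] clim_closed[OF assms(2)]
  show "(\<lambda>n. cnorm A (s n \<ominus> x) + cnorm A (r n \<ominus> y)) \<longlonglongrightarrow> 0"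
    using tendsto_add[OF clim_tendsto[OF assms(1)] clim_tendsto[OF assms(2)]] by simp
  show "cnorm A ((s n \<oplus> r n) \<ominus> (x \<oplus> y)) \<le> cnorm A (s n \<ominus> x) + cnorm A (r n \<ominus> y)" for n
  proof -
    have "(s n \<oplus> r n) \<ominus> (x \<oplus> y) = (s n \<ominus> x) \<oplus> (r n \<ominus> y)"
      using c by (simp add: minus_eq minus_add a_ac)
    then show ?thesis using c cnorm_triangle by simp
  qed
qed (use clim_closed[OF assms(1)] clim_closed[OF assms(2)] in auto)

lemma clim_smult:
  assumes "clim A s x" shows "clim A (\<lambda>n. c \<odot> s n) (c \<odot> x)"
proof (rule climI)
  note c = clim_closed[OF assms(1)]
  show "(\<lambda>n. cmod c * cnorm A (s n \<ominus> x)) \<longlonglongrightarrow> 0"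
    using tendsto_mult_right_zero[OF clim_tendsto[OF assms(1)]] by simp
  show "cnorm A (c \<odot> s n \<ominus> c \<odot> x) \<le> cmod c * cnorm A (s n \<ominus> x)" for n
  proof -
    have "c \<odot> s n \<ominus> c \<odot> x = c \<odot> (s n \<ominus> x)"
      using c by (simp add: minus_eq smult_r_distr smult_minus)
    then show ?thesis using c cnorm_smult by simp
  qed
qed (use clim_closed[OF assms(1)] smult_closed in auto)

lemma clim_star:
  assumes "clim A s x" shows "clim A (\<lambda>n. star A (s n)) (star A x)"
proof (rule climI)
  note c = clim_closed[OF assms(1)]
  show "(\<lambda>n. cnorm A (s n \<ominus> x)) \<longlonglongrightarrow> 0" using assms clim_tendsto by blast
  show "cnorm A (star A (s n) \<ominus> star A x) \<le> cnorm A (s n \<ominus> x)" for n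
  proof -
    have "star A (s n) \<ominus> star A x = star A (s n \<ominus> x)"
      using c by (simp add: minus_eq star_add star_minus)
    then show ?thesis using c cnorm_star by simp
  qed
qed (use clim_closed[OF assms(1)] star_closed in auto)

lemma clim_cnorm:
  assumes "clim A s x" shows "(\<lambda>n. cnorm A (s n)) \<longlonglongrightarrow> cnorm A x"
proof -
  have "(\<lambda>n. cnorm A (s n) - cnorm A x) \<longlonglongrightarrow> 0"
    by (rule Lim_null_comparison[OF _ clim_tendsto[OF assms]])
      (use abs_cnorm_diff_le clim_closed[OF assms] in auto)
  then show ?thesis using Lim_null by blast
qed

lemma clim_mult:
  assumes "clim A s x" "clim A r y" shows "clim A (\<lambda>n. s n \<otimes> r n) (x \<otimes> y)"
proof (rule climI)
  note c = clim_closed[OF assms(1)] clim_closed[OF assms(2)]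
  show "(\<lambda>n. cnorm A (s n) * cnorm A (r n \<ominus> y) + cnorm A (s n \<ominus> x) * cnorm A y) \<longlonglongrightarrow> 0"
    using tendsto_add[OF tendsto_mult[OF clim_cnorm[OF assms(1)] clim_tendsto[OF assms(2)]]
        tendsto_mult[OF clim_tendsto[OF assms(1)] tendsto_const]] by simp
  show "cnorm A (s n \<otimes> r n \<ominus> x \<otimes> y)
    \<le> cnorm A (s n) * cnorm A (r n \<ominus> y) + cnorm A (s n \<ominus> x) * cnorm A y" for n
  proof -
    have "s n \<otimes> r n \<ominus> x \<otimes> y = (s n \<otimes> r n \<oplus> (\<ominus> (s n \<otimes> y) \<oplus> s n \<otimes> y)) \<ominus> x \<otimes> y"
      using c by (simp add: l_neg)
    also have "\<dots> = s n \<otimes> (r n \<ominus> y) \<oplus> (s n \<ominus> x) \<otimes> y"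
      using c by (simp add: minus_eq r_distr l_distr r_minus l_minus a_assoc)
    finally have "cnorm A (s n \<otimes> r n \<ominus> x \<otimes> y)
      \<le> cnorm A (s n \<otimes> (r n \<ominus> y)) + cnorm A ((s n \<ominus> x) \<otimes> y)"
      using c cnorm_triangle by simp
    also have "\<dots> \<le> cnorm A (s n) * cnorm A (r n \<ominus> y) + cnorm A (s n \<ominus> x) * cnorm A y"
      using c by (intro add_mono cnorm_mult) auto
    finally show ?thesis .
  qed
qed (use clim_closed[OF assms(1)] clim_closed[OF assms(2)] in auto)

lemma clim_unique:
  assumes "clim A s x" "clim A s y" shows "x = y"
proof -
  note c = clim_closed[OF assms(1)] clim_closed[OF assms(2)]
  have "(\<lambda>n. cnorm A (s n \<ominus> x) + cnorm A (s n \<ominus> y)) \<longlonglongrightarrow> 0"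
    using tendsto_add[OF clim_tendsto[OF assms(1)] clim_tendsto[OF assms(2)]] by simp
  then have "cnorm A (x \<ominus> y) \<le> 0"
    by (rule Lim_bounded2[where N = 0])
      (use c cnorm_diff_triangle[of x _ y] cnorm_diff_commute[of x] in auto)
  then have "x \<ominus> y = \<zero>" using c cnorm_nonneg cnorm_eq_0_iff by (metis minus_closed order_antisym)
  then show ?thesis using c by (metis minus_eq minus_equality minus_minus a_inv_closed)
qed

lemma clim_shift: "clim A s x \<Longrightarrow> clim A (\<lambda>n. s (Suc n)) x"
  unfolding clim_def using LIMSEQ_Suc[of "\<lambda>n. cnorm A (s n \<ominus> x)"] by auto

text \<open>The square root of \<open>1 - x\<close> is \<open>1 - g\<close>, where \<open>g\<close> is the fixed point of the contraction
  \<open>g \<mapsto> (x + g\<^sup>2) / 2\<close>.\<close>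

lemma sqrt_one_minus:
  assumes x: "x \<in> carrier A" and sa: "star A x = x" and lt: "cnorm A x < 1"
  obtains y where "y \<in> carrier A" "star A y = y" "y \<otimes> y = \<one> \<ominus> x"
    "\<And>z. \<lbrakk>z \<in> carrier A; z \<otimes> x = x \<otimes> z\<rbrakk> \<Longrightarrow> z \<otimes> y = y \<otimes> z"
proof -
  define r where "r = cnorm A x"
  have r: "0 \<le> r" "r < 1" using cnorm_nonneg x lt by (auto simp: r_def)
  \<comment> \<open>The iterates start at 0, so each is a polynomial in \<open>x\<close> with real
    coefficients. They are therefore self-adjoint and commute with whatever commutes with
    \<open>x\<close>, and both properties pass to the limit.\<close>
  define g where "g = rec_nat \<zero> (\<lambda>_ g. (1/2) \<odot> (x \<oplus> g \<otimes> g))"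
  have g0: "g 0 = \<zero>" and gS: "g (Suc n) = (1/2) \<odot> (x \<oplus> g n \<otimes> g n)" for n
    by (simp_all add: g_def)
  have gc [simp]: "g n \<in> carrier A" for n
    by (induction n) (auto simp: g0 gS x smult_closed)
  have gn: "cnorm A (g n) \<le> r" for n
  proof (induction n)
    case 0 then show ?case using r by (simp add: g0 cnorm_zero)
  next
    case (Suc n)
    have "cnorm A (g (Suc n)) \<le> (1/2) * (cnorm A x + cnorm A (g n) * cnorm A (g n))"
      unfolding gS using x cnorm_triangle[of x "g n \<otimes> g n"] cnorm_mult[of "g n" "g n"]
      by (simp add: cnorm_smult)
    also have "\<dots> \<le> (1/2) * (r + r * r)"
      using mult_mono[OF Suc.IH Suc.IH] r cnorm_nonneg[of "g n"] by (simp add: r_def)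
    also have "\<dots> \<le> r" using r mult_left_le[of r r] by simp
    finally show ?case .
  qed
  \<comment> \<open>Half of u^2 - v^2 = u (u - v) + (u - v) v is at most \<open>r\<close> times the
    distance of \<open>u\<close> and \<open>v\<close>, because both iterates have norm at most
    \<open>r\<close>.\<close>
  have step: "cnorm A (g (Suc (Suc n)) \<ominus> g (Suc n)) \<le> r * cnorm A (g (Suc n) \<ominus> g n)" for n
  proof -
    let ?u = "g (Suc n)" and ?v = "g n"
    have eq: "?u \<otimes> ?u \<ominus> ?v \<otimes> ?v = ?u \<otimes> (?u \<ominus> ?v) \<oplus> (?u \<ominus> ?v) \<otimes> ?v"
    proof -
      have "?u \<otimes> ?u \<ominus> ?v \<otimes> ?v = (?u \<otimes> ?u \<oplus> (\<ominus> (?u \<otimes> ?v) \<oplus> ?u \<otimes> ?v)) \<ominus> ?v \<otimes> ?v"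
        by (simp add: l_neg)
      also have "\<dots> = ?u \<otimes> (?u \<ominus> ?v) \<oplus> (?u \<ominus> ?v) \<otimes> ?v"
        by (simp add: minus_eq r_distr l_distr r_minus l_minus a_assoc)
      finally show ?thesis .
    qed
    have "g (Suc (Suc n)) \<ominus> ?u = (1/2) \<odot> ((x \<oplus> ?u \<otimes> ?u) \<ominus> (x \<oplus> ?v \<otimes> ?v))"
      unfolding gS[of "Suc n"] gS[of n, symmetric]
      by (subst (2) gS, simp only: minus_eq) (simp add: x smult_r_distr smult_minus smult_closed)
    also have "(x \<oplus> ?u \<otimes> ?u) \<ominus> (x \<oplus> ?v \<otimes> ?v) = ?u \<otimes> ?u \<ominus> ?v \<otimes> ?v"
    proof -
      have "(x \<oplus> ?u \<otimes> ?u) \<ominus> (x \<oplus> ?v \<otimes> ?v) = (x \<oplus> \<ominus> x) \<oplus> (?u \<otimes> ?u \<ominus> ?v \<otimes> ?v)"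
        using x by (simp only: minus_eq minus_add gc m_closed a_inv_closed a_closed a_ac)
      then show ?thesis using x by (simp add: r_neg)
    qed
    finally have "cnorm A (g (Suc (Suc n)) \<ominus> ?u)
        = (1/2) * cnorm A (?u \<otimes> (?u \<ominus> ?v) \<oplus> (?u \<ominus> ?v) \<otimes> ?v)"
      unfolding eq by (simp add: cnorm_smult)
    also have "\<dots> \<le> (1/2) * (cnorm A ?u * cnorm A (?u \<ominus> ?v) + cnorm A (?u \<ominus> ?v) * cnorm A ?v)"
      using cnorm_triangle[of "?u \<otimes> (?u \<ominus> ?v)" "(?u \<ominus> ?v) \<otimes> ?v"]
        cnorm_mult[of ?u "?u \<ominus> ?v"] cnorm_mult[of "?u \<ominus> ?v" ?v] by simp
    also have "\<dots> \<le> (1/2) * (r * cnorm A (?u \<ominus> ?v) + cnorm A (?u \<ominus> ?v) * r)"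
      by (intro mult_left_mono add_mono mult_right_mono gn cnorm_nonneg) auto
    finally show ?thesis by simp
  qed
  have step': "cnorm A (g (Suc n) \<ominus> g n) \<le> r ^ n * r" for n
  proof (induction n)
    case 0 show ?case using gn[of 1] by (simp add: g0 minus_eq)
  next
    case (Suc n) show ?case
      using step[of n] mult_left_mono[OF Suc.IH r(1)] by simp
  qed
  have tail: "cnorm A (g (n + k) \<ominus> g n) \<le> (\<Sum>i<k. r ^ (n + i) * r)" for n k
  proof (induction k)
    case 0 show ?case by (simp add: minus_eq r_neg cnorm_zero)
  next
    case (Suc k)
    show ?case
      using cnorm_diff_triangle[of "g (n + Suc k)" "g (n + k)" "g n"] step'[of "n + k"] Suc.IH
      by simp
  qed
  have tail': "cnorm A (g (n + k) \<ominus> g n) \<le> r ^ n / (1 - r)" for n k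
  proof -
    have "(\<Sum>i<k. r ^ (n + i) * r) = r ^ n * r * (\<Sum>i<k. r ^ i)"
      by (simp add: sum_distrib_left power_add mult_ac)
    also have "\<dots> \<le> r ^ n * r * (1 / (1 - r))"
      using r sum_gp_strict[of r k] by (intro mult_left_mono) (auto simp: divide_right_mono)
    also have "\<dots> \<le> r ^ n * 1 * (1 / (1 - r))" using r by (intro mult_mono) auto
    finally show ?thesis using tail[of n k] by simp
  qed
  have lim0: "(\<lambda>n. r ^ n / (1 - r)) \<longlonglongrightarrow> 0"
    using r by (intro tendsto_divide_zero LIMSEQ_power_zero) auto
  have cauchy: "\<exists>N. \<forall>m\<ge>N. \<forall>n\<ge>N. cnorm A (g m \<ominus> g n) < e" if e: "0 < e" for e
  proof -
    obtain N where N: "r ^ N / (1 - r) < e / 2"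
      using order_tendstoD(2)[OF lim0, of "e/2"] e by (auto simp: eventually_sequentially)
    show ?thesis
    proof (intro exI allI impI)
      fix m n assume mn: "N \<le> m" "N \<le> n"
      have "cnorm A (g m \<ominus> g n) \<le> cnorm A (g m \<ominus> g N) + cnorm A (g n \<ominus> g N)"
        using cnorm_diff_triangle[of "g m" "g N" "g n"] cnorm_diff_commute[of "g N" "g n"] by simp
      also have "\<dots> \<le> r ^ N / (1 - r) + r ^ N / (1 - r)"
        using tail'[of N "m - N"] tail'[of N "n - N"] mn by simp
      also have "\<dots> < e" using N by linarith
      finally show "cnorm A (g m \<ominus> g n) < e" .
    qed
  qed
  obtain l where l: "l \<in> carrier A" and lim: "clim A g l"
    using complete[of g, OF gc cauchy] by (auto simp: clim_def)
  have fix_l: "l = (1/2) \<odot> (x \<oplus> l \<otimes> l)"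
  proof (rule clim_unique)
    show "clim A (\<lambda>n. g (Suc n)) l" using lim by (rule clim_shift)
    show "clim A (\<lambda>n. g (Suc n)) ((1/2) \<odot> (x \<oplus> l \<otimes> l))"
      unfolding gS by (intro clim_smult clim_add clim_mult clim_const lim x)
  qed
  have "star A (g n) = g n" for n
    by (induction n) (auto simp: g0 gS star_zero star_smult star_add star_mult sa x)
  then have "clim A g (star A l)" using clim_star[OF lim] by simp
  then have star_l: "star A l = l" using clim_unique lim by blast
  have comm: "z \<otimes> l = l \<otimes> z" if z: "z \<in> carrier A" "z \<otimes> x = x \<otimes> z" for z
  proof -
    have "z \<otimes> g n = g n \<otimes> z" for n
    proof (induction n)
      case (Suc n)
      have "z \<otimes> (g n \<otimes> g n) = (g n \<otimes> g n) \<otimes> z"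
        using Suc.IH z(1) by (metis gc m_assoc)
      then show ?case using z x by (simp add: gS smult_mult_left smult_mult_right r_distr l_distr)
    qed (use z in \<open>simp add: g0\<close>)
    then have "clim A (\<lambda>n. z \<otimes> g n) (l \<otimes> z)" using clim_mult[OF lim clim_const[OF z(1)]] by simp
    then show ?thesis by (rule clim_unique[OF clim_mult[OF clim_const[OF z(1)] lim]])
  qed
  show thesis
  proof
    show "\<one> \<ominus> l \<in> carrier A" using l by simp
    show "star A (\<one> \<ominus> l) = \<one> \<ominus> l" using l star_l by (simp add: minus_eq star_add star_one star_minus)
    \<comment> \<open>The fixed point equation in the form 2 l = x + l^2, which turns (1 - l)^2 = 1
      - 2 l + l^2 into 1 - x.\<close>
    have two: "l \<oplus> l = x \<oplus> l \<otimes> l"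
    proof -
      have "l \<oplus> l = 2 \<odot> l" using l by (simp add: smult_two)
      also have "\<dots> = (2 * (1/2)) \<odot> (x \<oplus> l \<otimes> l)"
        using l x by (subst fix_l) (simp only: smult_assoc a_closed m_closed)
      finally show ?thesis using l x by (simp add: smult_one)
    qed
    have "(\<one> \<ominus> l) \<otimes> (\<one> \<ominus> l) = (\<one> \<ominus> (l \<oplus> l)) \<oplus> l \<otimes> l"
      using l by (simp add: minus_eq r_distr l_distr r_minus l_minus minus_add a_ac)
    also have "\<dots> = \<one> \<ominus> x"
      using l x unfolding two by (simp add: minus_eq minus_add a_assoc l_neg)
    finally show "(\<one> \<ominus> l) \<otimes> (\<one> \<ominus> l) = \<one> \<ominus> x" .
    show "z \<otimes> (\<one> \<ominus> l) = (\<one> \<ominus> l) \<otimes> z" if "z \<in> carrier A" "z \<otimes> x = x \<otimes> z" for z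
      using l that(1) comm[OF that] by (simp add: minus_eq r_distr l_distr r_minus l_minus)
  qed
qed

text \<open>The element \<open>w = h + iy\<close> is normal with \<open>w* w = h\<^sup>2 + y\<^sup>2\<close> and real part \<open>h\<close>.\<close>

lemma cnorm_sq_le_sum_squares:
  assumes h: "h \<in> carrier A" "star A h = h" and y: "y \<in> carrier A" "star A y = y"
    and comm: "h \<otimes> y = y \<otimes> h"
  shows "(cnorm A h)\<^sup>2 \<le> cnorm A (h \<otimes> h \<oplus> y \<otimes> y)"
proof -
  define w where "w = h \<oplus> \<i> \<odot> y"
  have w: "w \<in> carrier A" using h y by (simp add: w_def smult_closed)
  have sw: "star A w = h \<oplus> (- \<i>) \<odot> y" using h y by (simp add: w_def star_add star_smult smult_closed)
  have "star A w \<otimes> w = (h \<otimes> h \<oplus> \<i> \<odot> (h \<otimes> y)) \<oplus> ((-\<i>) \<odot> (y \<otimes> h) \<oplus> y \<otimes> y)"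
    unfolding sw unfolding w_def using h y
    by (simp add: smult_closed l_distr r_distr smult_mult_left smult_mult_right smult_r_distr
        smult_assoc[symmetric] smult_one a_ac)
  also have "\<dots> = (h \<otimes> h \<oplus> y \<otimes> y) \<oplus> (\<i> \<odot> (h \<otimes> y) \<oplus> (-\<i>) \<odot> (h \<otimes> y))"
    using h y unfolding comm[symmetric] by (simp add: smult_closed smult_one a_ac)
  also have "\<i> \<odot> (h \<otimes> y) \<oplus> (-\<i>) \<odot> (h \<otimes> y) = \<zero>"
    using h y by (simp add: smult_l_distr[symmetric] smult_zero)
  finally have ww: "(cnorm A w)\<^sup>2 = cnorm A (h \<otimes> h \<oplus> y \<otimes> y)"
    using cstar_identity[OF w] h y by simp
  \<comment> \<open>Since \<open>w\<close> and its star have the same norm, taking the real part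
    does not increase the norm.\<close>
  have "2 \<odot> h = w \<oplus> star A w"
  proof -
    have "w \<oplus> star A w = (h \<oplus> h) \<oplus> (\<i> \<odot> y \<oplus> (-\<i>) \<odot> y)"
      unfolding sw unfolding w_def using h y by (simp add: smult_closed a_ac)
    also have "\<dots> = 2 \<odot> h" using h y
      by (simp add: smult_l_distr[symmetric] smult_zero smult_two)
    finally show ?thesis by simp
  qed
  then have "2 * cnorm A h \<le> cnorm A w + cnorm A w"
    using cnorm_triangle[of w "star A w"] w cnorm_smult[OF h(1), of 2] cnorm_star[OF w] by (simp add: star_closed)
  then have "(cnorm A h)\<^sup>2 \<le> (cnorm A w)\<^sup>2"
    using cnorm_nonneg[OF h(1)] by (intro power_mono) auto
  then show ?thesis using ww by simp
qed

end

section \<open>Unital *-homomorphisms and their contractivity\<close>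

lemma cstar_homD:
  assumes "f \<in> cstar_hom A B"
  shows "x \<in> carrier A \<Longrightarrow> f x \<in> carrier B"
    and "\<lbrakk>x \<in> carrier A; y \<in> carrier A\<rbrakk> \<Longrightarrow> f (x \<oplus>\<^bsub>A\<^esub> y) = f x \<oplus>\<^bsub>B\<^esub> f y"
    and "\<lbrakk>x \<in> carrier A; y \<in> carrier A\<rbrakk> \<Longrightarrow> f (x \<otimes>\<^bsub>A\<^esub> y) = f x \<otimes>\<^bsub>B\<^esub> f y"
    and "f \<one>\<^bsub>A\<^esub> = \<one>\<^bsub>B\<^esub>"
    and "x \<in> carrier A \<Longrightarrow> f (c \<odot>\<^bsub>A\<^esub> x) = c \<odot>\<^bsub>B\<^esub> f x"
    and "x \<in> carrier A \<Longrightarrow> f (star A x) = star B (f x)"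
    and "f \<in> extensional (carrier A)"
  using assms by (auto simp: cstar_hom_def ring_hom_def)

lemma cstar_homI:
  assumes "\<And>x. x \<in> carrier A \<Longrightarrow> f x \<in> carrier B"
    and "\<And>x y. \<lbrakk>x \<in> carrier A; y \<in> carrier A\<rbrakk> \<Longrightarrow> f (x \<oplus>\<^bsub>A\<^esub> y) = f x \<oplus>\<^bsub>B\<^esub> f y"
    and "\<And>x y. \<lbrakk>x \<in> carrier A; y \<in> carrier A\<rbrakk> \<Longrightarrow> f (x \<otimes>\<^bsub>A\<^esub> y) = f x \<otimes>\<^bsub>B\<^esub> f y"
    and "f \<one>\<^bsub>A\<^esub> = \<one>\<^bsub>B\<^esub>"
    and "\<And>c x. x \<in> carrier A \<Longrightarrow> f (c \<odot>\<^bsub>A\<^esub> x) = c \<odot>\<^bsub>B\<^esub> f x"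
    and "\<And>x. x \<in> carrier A \<Longrightarrow> f (star A x) = star B (f x)"
    and "f \<in> extensional (carrier A)"
  shows "f \<in> cstar_hom A B"
  using assms by (auto simp: cstar_hom_def ring_hom_def)

lemma cstar_hom_zero_minus:
  assumes f: "f \<in> cstar_hom A B" and "cstar_algebra A" "cstar_algebra B"
  shows "f \<zero>\<^bsub>A\<^esub> = \<zero>\<^bsub>B\<^esub>"
    and "\<lbrakk>x \<in> carrier A; y \<in> carrier A\<rbrakk> \<Longrightarrow> f (x \<ominus>\<^bsub>A\<^esub> y) = f x \<ominus>\<^bsub>B\<^esub> f y"
proof -
  interpret A: cstar_algebra A by fact
  interpret B: cstar_algebra B by fact
  note [simp] = cstar_homD(1)[OF f] cstar_homD(2)[OF f]
  show "f \<zero>\<^bsub>A\<^esub> = \<zero>\<^bsub>B\<^esub>"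
    using cstar_homD(5)[OF f A.zero_closed, of 0] by (simp add: A.smult_zero B.smult_zero)
  show "f (x \<ominus>\<^bsub>A\<^esub> y) = f x \<ominus>\<^bsub>B\<^esub> f y" if xy: "x \<in> carrier A" "y \<in> carrier A"
    using cstar_homD(5)[OF f xy(2), of "-1"] xy
    by (simp add: A.minus_eq B.minus_eq A.smult_minus1 B.smult_minus1)
qed

text \<open>If \<open>h\<close> is self-adjoint of norm below 1, the square root \<open>y\<close> of
  1 - h^2 commutes with \<open>h\<close>. The images of \<open>h\<close> and \<open>y\<close> still
  commute and their squares still add up to 1, so the image of \<open>h\<close> has norm at most 1.
  Scaling settles all self-adjoint elements, and the C*-identity reduces an arbitrary
  \<open>x\<close> to the self-adjoint product of its star with \<open>x\<close>.\<close>

lemma cstar_hom_contractive: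
  assumes f: "f \<in> cstar_hom A B" and "cstar_algebra A" "cstar_algebra B" and x: "x \<in> carrier A"
  shows "cnorm B (f x) \<le> cnorm A x"
proof -
  interpret A: cstar_algebra A by fact
  interpret B: cstar_algebra B by fact
  note fD = cstar_homD[OF f] and fm = cstar_hom_zero_minus[OF f assms(2,3)]
  have unit: "cnorm B (f h) \<le> 1"
    if h: "h \<in> carrier A" "star A h = h" "cnorm A h < 1" for h
  proof -
    have "cnorm A (h \<otimes>\<^bsub>A\<^esub> h) \<le> cnorm A h * cnorm A h" using h A.cnorm_mult by simp
    also have "\<dots> < 1" using h A.cnorm_nonneg[of h] mult_strict_mono[of "cnorm A h" 1 "cnorm A h" 1] by simp
    finally have lt: "cnorm A (h \<otimes>\<^bsub>A\<^esub> h) < 1" .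
    have hh: "h \<otimes>\<^bsub>A\<^esub> h \<in> carrier A" "star A (h \<otimes>\<^bsub>A\<^esub> h) = h \<otimes>\<^bsub>A\<^esub> h"
      using h by (simp_all add: A.star_mult)
    obtain y where y: "y \<in> carrier A" "star A y = y" "y \<otimes>\<^bsub>A\<^esub> y = \<one>\<^bsub>A\<^esub> \<ominus>\<^bsub>A\<^esub> h \<otimes>\<^bsub>A\<^esub> h"
        "\<And>z. \<lbrakk>z \<in> carrier A; z \<otimes>\<^bsub>A\<^esub> (h \<otimes>\<^bsub>A\<^esub> h) = (h \<otimes>\<^bsub>A\<^esub> h) \<otimes>\<^bsub>A\<^esub> z\<rbrakk> \<Longrightarrow> z \<otimes>\<^bsub>A\<^esub> y = y \<otimes>\<^bsub>A\<^esub> z"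
      by (rule A.sqrt_one_minus[OF hh lt]) blast
    have comm: "h \<otimes>\<^bsub>A\<^esub> y = y \<otimes>\<^bsub>A\<^esub> h" using y(4)[of h] h by (simp add: A.m_assoc)
    have eq: "h \<otimes>\<^bsub>A\<^esub> h \<oplus>\<^bsub>A\<^esub> y \<otimes>\<^bsub>A\<^esub> y = \<one>\<^bsub>A\<^esub>"
      unfolding y(3) using h by (simp add: A.minus_eq A.r_neg A.a_lcomm)
    have "f h \<otimes>\<^bsub>B\<^esub> f h \<oplus>\<^bsub>B\<^esub> f y \<otimes>\<^bsub>B\<^esub> f y = \<one>\<^bsub>B\<^esub>"
      using arg_cong[OF eq, of f] h(1) y(1) by (simp add: fD(2,3,4))
    moreover have "f h \<otimes>\<^bsub>B\<^esub> f y = f y \<otimes>\<^bsub>B\<^esub> f h"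
      using arg_cong[OF comm, of f] h(1) y(1) by (simp add: fD(3))
    ultimately have "(cnorm B (f h))\<^sup>2 \<le> 1"
      using B.cnorm_sq_le_sum_squares[of "f h" "f y"] h(1,2) y(1,2) B.cnorm_one_le
      by (simp add: fD(1) fD(6)[symmetric])
    then show ?thesis by (simp add: abs_square_le_1 abs_le_iff)
  qed
  have sa: "cnorm B (f h) \<le> cnorm A h" if h: "h \<in> carrier A" "star A h = h" for h
  proof (rule field_le_epsilon)
    fix e :: real assume e: "0 < e"
    \<comment> \<open>The summand \<open>e\<close> keeps \<open>M\<close> positive when
      \<open>h\<close> is 0 and makes the norm of \<open>h / M\<close> strictly less than 1.\<close>
    define M where "M = cnorm A h + e"
    have M: "0 < M" "cnorm A h < M" using e A.cnorm_nonneg[OF h(1)] by (auto simp: M_def)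
    have "cnorm B (f (complex_of_real (1 / M) \<odot>\<^bsub>A\<^esub> h)) \<le> 1"
      using M h A.smult_closed[of h "complex_of_real (1 / M)"]
      by (intro unit) (auto simp: A.smult_closed A.star_smult A.cnorm_smult norm_divide divide_less_eq)
    then have "cnorm B (f h) / M \<le> 1" using M(1) h by (simp add: fD B.cnorm_smult norm_divide)
    then show "cnorm B (f h) \<le> cnorm A h + e" using M(1) by (simp add: divide_le_eq M_def)
  qed
  have "(cnorm B (f x))\<^sup>2 = cnorm B (f (star A x \<otimes>\<^bsub>A\<^esub> x))"
    using x by (simp add: fD A.star_closed B.cstar_identity)
  also have "\<dots> \<le> (cnorm A x)\<^sup>2"
    using sa[of "star A x \<otimes>\<^bsub>A\<^esub> x"] x by (simp add: A.star_closed A.star_mult A.star_star A.cstar_identity)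
  finally show ?thesis using A.cnorm_nonneg[OF x] by (rule power2_le_imp_le)
qed

section \<open>Homomorphisms determined on dense subalgebras\<close>

text \<open>No scalar coefficients are built in: sets of elementary tensors absorb them.\<close>

inductive_set sums_of :: "'a cstar \<Rightarrow> 'a set \<Rightarrow> 'a set" for T S where
  zero: "\<zero>\<^bsub>T\<^esub> \<in> sums_of T S"
| add: "\<lbrakk>u \<in> sums_of T S; s \<in> S\<rbrakk> \<Longrightarrow> u \<oplus>\<^bsub>T\<^esub> s \<in> sums_of T S"

definition dense_sums :: "'a cstar \<Rightarrow> 'a set \<Rightarrow> bool" where
  "dense_sums T S \<longleftrightarrow> S \<subseteq> carrier T \<and>
     (\<forall>x\<in>carrier T. \<forall>e>0. \<exists>u\<in>sums_of T S. cnorm T (x \<ominus>\<^bsub>T\<^esub> u) < e)"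

context cstar_algebra
begin

lemma finsum_lessThan_Suc:
  assumes "\<And>k. k < Suc n \<Longrightarrow> x k \<in> carrier A"
  shows "(\<Oplus>k\<in>{..<Suc n}. x k) = (\<Oplus>k\<in>{..<n}. x k) \<oplus> x n"
  using assms by (simp add: lessThan_Suc finsum_insert Pi_def a_comm)

lemma finsum_lessThan_closed:
  "(\<And>k. k < n \<Longrightarrow> x k \<in> carrier A) \<Longrightarrow> (\<Oplus>k\<in>{..<n::nat}. x k) \<in> carrier A"
  by (auto intro: finsum_closed)

lemma sums_of_closed: "\<lbrakk>u \<in> sums_of A S; S \<subseteq> carrier A\<rbrakk> \<Longrightarrow> u \<in> carrier A"
  by (induction rule: sums_of.induct) auto

lemma finsum_in_sums_of:
  assumes "S \<subseteq> carrier A" "\<And>k. k < n \<Longrightarrow> x k \<in> S"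
  shows "(\<Oplus>k\<in>{..<n::nat}. x k) \<in> sums_of A S"
  using assms(2)
proof (induction n)
  case (Suc n)
  then show ?case
    using assms(1) by (subst finsum_lessThan_Suc) (auto intro!: sums_of.add)
qed (simp add: sums_of.zero)

lemma sums_ofD:
  assumes "u \<in> sums_of A S" "S \<subseteq> carrier A"
  shows "\<exists>(n::nat) x. (\<forall>k<n. x k \<in> S) \<and> u = (\<Oplus>k\<in>{..<n}. x k)"
  using assms(1)
proof (induction rule: sums_of.induct)
  case zero
  show ?case by (rule exI[of _ 0]) simp
next
  case (add u s)
  then obtain n x where x: "\<forall>k<n::nat. x k \<in> S" "u = (\<Oplus>k\<in>{..<n}. x k)" by auto
  have "(\<Oplus>k\<in>{..<Suc n}. (x(n := s)) k) = (\<Oplus>k\<in>{..<n}. (x(n := s)) k) \<oplus> s"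
    using x add assms by (subst finsum_lessThan_Suc) auto
  also have "(\<Oplus>k\<in>{..<n}. (x(n := s)) k) = u"
    unfolding x(2) using x(1) assms(2) by (intro finsum_cong') auto
  finally show ?case using x(1) add(2) by (intro exI[of _ "Suc n"] exI[of _ "x(n := s)"]) auto
qed

lemma sums_of_add:
  assumes "S \<subseteq> carrier A" "u \<in> sums_of A S" "v \<in> sums_of A S"
  shows "u \<oplus> v \<in> sums_of A S"
  using assms(3)
proof (induction rule: sums_of.induct)
  case zero then show ?case using assms sums_of_closed by simp
next
  case (add v s)
  then have "u \<oplus> (v \<oplus> s) = (u \<oplus> v) \<oplus> s" using assms sums_of_closed by (intro a_assoc[symmetric]) auto
  then show ?case using sums_of.add[OF add.IH add(2)] by simp
qed

lemma dense_sumsI: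
  assumes "S \<subseteq> carrier A"
    and "\<And>x e. \<lbrakk>x \<in> carrier A; 0 < e\<rbrakk> \<Longrightarrow> \<exists>(n::nat) y. (\<forall>k<n. y k \<in> S) \<and>
      cnorm A (x \<ominus> (\<Oplus>k\<in>{..<n}. y k)) < e"
  shows "dense_sums A S"
  unfolding dense_sums_def using assms finsum_in_sums_of by meson

lemma dense_sums_trans:
  assumes S: "dense_sums A S" and S': "S' \<subseteq> carrier A"
    and *: "\<And>s e. \<lbrakk>s \<in> S; 0 < e\<rbrakk> \<Longrightarrow> \<exists>u\<in>sums_of A S'. cnorm A (s \<ominus> u) < e"
  shows "dense_sums A S'"
proof -
  have Sc: "S \<subseteq> carrier A" using S by (simp add: dense_sums_def)
  have **: "\<forall>e>0. \<exists>v\<in>sums_of A S'. cnorm A (u \<ominus> v) < e" if "u \<in> sums_of A S" for u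
    using that
  proof (induction rule: sums_of.induct)
    case zero
    show ?case
      by (intro allI impI bexI[of _ \<zero>] sums_of.zero) (simp add: minus_eq cnorm_zero)
  next
    case (add u s)
    show ?case
    proof (intro allI impI)
      fix e :: real assume "e > 0"
      then have e: "e / 2 > 0" by simp
      obtain v where v: "v \<in> sums_of A S'" "cnorm A (u \<ominus> v) < e / 2" using add.IH e by blast
      obtain w where w: "w \<in> sums_of A S'" "cnorm A (s \<ominus> w) < e / 2" using *[OF add(2) e] by blast
      have c: "u \<in> carrier A" "s \<in> carrier A" "v \<in> carrier A" "w \<in> carrier A"
        using add Sc S' v w sums_of_closed by auto
      have "(u \<oplus> s) \<ominus> (v \<oplus> w) = (u \<ominus> v) \<oplus> (s \<ominus> w)"
        using c by (simp add: minus_eq minus_add a_ac)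
      then have "cnorm A ((u \<oplus> s) \<ominus> (v \<oplus> w)) < e"
        using cnorm_triangle[of "u \<ominus> v" "s \<ominus> w"] c v w by simp
      then show "\<exists>v\<in>sums_of A S'. cnorm A ((u \<oplus> s) \<ominus> v) < e"
        using sums_of_add[OF S' v(1) w(1)] by blast
    qed
  qed
  show ?thesis
    unfolding dense_sums_def
  proof (intro conjI S' ballI allI impI)
    fix x and e :: real assume x: "x \<in> carrier A" and "e > 0"
    then have e: "e / 2 > 0" by simp
    obtain u where u: "u \<in> sums_of A S" "cnorm A (x \<ominus> u) < e / 2"
      using S x e unfolding dense_sums_def by blast
    obtain v where v: "v \<in> sums_of A S'" "cnorm A (u \<ominus> v) < e / 2" using **[OF u(1)] e by blast
    have "cnorm A (x \<ominus> v) < e"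
      using cnorm_diff_triangle[of x u v] x u v sums_of_closed[OF u(1) Sc] sums_of_closed[OF v(1) S']
      by simp
    then show "\<exists>u\<in>sums_of A S'. cnorm A (x \<ominus> u) < e" using v by blast
  qed
qed

end

lemma cstar_hom_finsum:
  assumes f: "f \<in> cstar_hom A B" and "cstar_algebra A" "cstar_algebra B"
    and x: "\<And>k. k < n \<Longrightarrow> x k \<in> carrier A"
  shows "f (\<Oplus>\<^bsub>A\<^esub>k\<in>{..<n::nat}. x k) = (\<Oplus>\<^bsub>B\<^esub>k\<in>{..<n}. f (x k))"
proof -
  interpret A: cstar_algebra A by fact
  interpret B: cstar_algebra B by fact
  show ?thesis using x
  proof (induction n)
    case 0 then show ?case by (simp add: cstar_hom_zero_minus[OF assms(1-3)])
  next
    case (Suc n)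
    then show ?case
      by (simp add: A.finsum_lessThan_Suc B.finsum_lessThan_Suc cstar_homD[OF f] A.finsum_lessThan_closed)
  qed
qed

text \<open>By contractivity, the images of \<open>x\<close> under the two maps differ by at most
  twice the distance of \<open>x\<close> from any sum on which the maps agree.\<close>

lemma cstar_hom_eqI:
  assumes f: "f \<in> cstar_hom A B" and g: "g \<in> cstar_hom A B"
    and A: "cstar_algebra A" and B: "cstar_algebra B"
    and S: "dense_sums A S" and eq: "\<And>s. s \<in> S \<Longrightarrow> f s = g s"
  shows "f = g"
proof (rule extensionalityI[OF cstar_homD(7)[OF f] cstar_homD(7)[OF g]])
  interpret A: cstar_algebra A by fact
  interpret B: cstar_algebra B by fact
  have Sc: "S \<subseteq> carrier A" using S by (simp add: dense_sums_def)
  note c = A.sums_of_closed[OF _ Sc]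
  have eq': "f u = g u" if "u \<in> sums_of A S" for u
    using that
  proof (induction rule: sums_of.induct)
    case zero
    then show ?case
      using cstar_hom_zero_minus(1)[OF f A B] cstar_hom_zero_minus(1)[OF g A B] by simp
  next
    case (add u s)
    have "u \<in> carrier A" "s \<in> carrier A" using add Sc c by auto
    then show ?case using add.IH eq[OF add.hyps(2)] by (simp add: cstar_homD(2)[OF f] cstar_homD(2)[OF g])
  qed
  fix x assume x: "x \<in> carrier A"
  have cl: "f x \<in> carrier B" "g x \<in> carrier B" using x f g by (auto dest: cstar_homD)
  have "cnorm B (f x \<ominus>\<^bsub>B\<^esub> g x) \<le> 0 + e" if e: "0 < e" for e
  proof -
    obtain u where u: "u \<in> sums_of A S" "cnorm A (x \<ominus>\<^bsub>A\<^esub> u) < e / 2"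
      using S x e unfolding dense_sums_def by (meson half_gt_zero)
    have "cnorm B (f x \<ominus>\<^bsub>B\<^esub> g x) \<le> cnorm B (f x \<ominus>\<^bsub>B\<^esub> f u) + cnorm B (f u \<ominus>\<^bsub>B\<^esub> g x)"
      using cl c[OF u(1)] f by (intro B.cnorm_diff_triangle) (auto dest: cstar_homD)
    also have "f x \<ominus>\<^bsub>B\<^esub> f u = f (x \<ominus>\<^bsub>A\<^esub> u)"
      using cstar_hom_zero_minus(2)[OF f A B] x c[OF u(1)] by simp
    also have "f u \<ominus>\<^bsub>B\<^esub> g x = g (u \<ominus>\<^bsub>A\<^esub> x)"
      using cstar_hom_zero_minus(2)[OF g A B] x c[OF u(1)] eq'[OF u(1)] by simp
    also have "cnorm B (f (x \<ominus>\<^bsub>A\<^esub> u)) + cnorm B (g (u \<ominus>\<^bsub>A\<^esub> x))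
        \<le> cnorm A (x \<ominus>\<^bsub>A\<^esub> u) + cnorm A (u \<ominus>\<^bsub>A\<^esub> x)"
      using x c[OF u(1)] by (intro add_mono cstar_hom_contractive[OF f A B] cstar_hom_contractive[OF g A B]) auto
    also have "\<dots> \<le> e" using u(2) A.cnorm_diff_commute[OF x c[OF u(1)]] by simp
    finally show ?thesis by simp
  qed
  then have "cnorm B (f x \<ominus>\<^bsub>B\<^esub> g x) \<le> 0" by (rule field_le_epsilon)
  then have "f x \<ominus>\<^bsub>B\<^esub> g x = \<zero>\<^bsub>B\<^esub>"
    using cl B.cnorm_nonneg[of "f x \<ominus>\<^bsub>B\<^esub> g x"] B.cnorm_eq_0_iff by simp
  then show "f x = g x" using cl by (metis B.minus_eq B.minus_equality B.minus_minus B.a_inv_closed)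
qed

text \<open>The closure of \<open>G\<close> is the graph of the extension.\<close>

lemma graph_extension:
  assumes T: "cstar_algebra T" and R: "cstar_algebra R"
    and G: "G \<subseteq> carrier T \<times> carrier R"
    and G_one: "(\<one>\<^bsub>T\<^esub>, \<one>\<^bsub>R\<^esub>) \<in> G"
    and G_add: "\<And>u v u' v'. \<lbrakk>(u, v) \<in> G; (u', v') \<in> G\<rbrakk> \<Longrightarrow> (u \<oplus>\<^bsub>T\<^esub> u', v \<oplus>\<^bsub>R\<^esub> v') \<in> G"
    and G_mult: "\<And>u v u' v'. \<lbrakk>(u, v) \<in> G; (u', v') \<in> G\<rbrakk> \<Longrightarrow> (u \<otimes>\<^bsub>T\<^esub> u', v \<otimes>\<^bsub>R\<^esub> v') \<in> G"
    and G_smult: "\<And>c u v. (u, v) \<in> G \<Longrightarrow> (c \<odot>\<^bsub>T\<^esub> u, c \<odot>\<^bsub>R\<^esub> v) \<in> G"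
    and G_star: "\<And>u v. (u, v) \<in> G \<Longrightarrow> (star T u, star R v) \<in> G"
    and contr: "\<And>u v. (u, v) \<in> G \<Longrightarrow> cnorm R v \<le> cnorm T u"
    and dense: "\<And>x e. \<lbrakk>x \<in> carrier T; 0 < e\<rbrakk> \<Longrightarrow> \<exists>(u, v)\<in>G. cnorm T (x \<ominus>\<^bsub>T\<^esub> u) < e"
  shows "\<exists>h\<in>cstar_hom T R. \<forall>(u, v)\<in>G. h u = v"
proof -
  interpret T: cstar_algebra T by fact
  interpret R: cstar_algebra R by fact
  define H where "H = {(u, v). \<exists>p q. (\<forall>n. (p n, q n) \<in> G) \<and> clim T p u \<and> clim R q v}"
  have HI: "(u, v) \<in> H" if "\<And>n. (p n, q n) \<in> G" "clim T p u" "clim R q v" for p q u v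
    using that by (auto simp: H_def)
  have HE: "\<exists>p q. (\<forall>n. (p n, q n) \<in> G) \<and> clim T p u \<and> clim R q v" if "(u, v) \<in> H" for u v
    using that by (auto simp: H_def)
  have GH: "(u, v) \<in> H" if uv: "(u, v) \<in> G" for u v
    using uv G by (intro HI[of "\<lambda>_. u" "\<lambda>_. v"] T.clim_const R.clim_const) auto
  have Hc: "u \<in> carrier T" "v \<in> carrier R" if "(u, v) \<in> H" for u v
    using HE[OF that] T.clim_closed(2) R.clim_closed(2) by blast+
  have H_add: "(u \<oplus>\<^bsub>T\<^esub> u', v \<oplus>\<^bsub>R\<^esub> v') \<in> H" if h: "(u, v) \<in> H" "(u', v') \<in> H" for u v u' v'
  proof -
    obtain p q p' q' where "\<forall>n. (p n, q n) \<in> G" "clim T p u" "clim R q v"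
      "\<forall>n. (p' n, q' n) \<in> G" "clim T p' u'" "clim R q' v'" using HE[OF h(1)] HE[OF h(2)] by blast
    then show ?thesis
      by (intro HI[of "\<lambda>n. p n \<oplus>\<^bsub>T\<^esub> p' n" "\<lambda>n. q n \<oplus>\<^bsub>R\<^esub> q' n"] G_add T.clim_add R.clim_add) auto
  qed
  have H_mult: "(u \<otimes>\<^bsub>T\<^esub> u', v \<otimes>\<^bsub>R\<^esub> v') \<in> H" if h: "(u, v) \<in> H" "(u', v') \<in> H" for u v u' v'
  proof -
    obtain p q p' q' where "\<forall>n. (p n, q n) \<in> G" "clim T p u" "clim R q v"
      "\<forall>n. (p' n, q' n) \<in> G" "clim T p' u'" "clim R q' v'" using HE[OF h(1)] HE[OF h(2)] by blast
    then show ?thesis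
      by (intro HI[of "\<lambda>n. p n \<otimes>\<^bsub>T\<^esub> p' n" "\<lambda>n. q n \<otimes>\<^bsub>R\<^esub> q' n"] G_mult T.clim_mult R.clim_mult) auto
  qed
  have H_smult: "(c \<odot>\<^bsub>T\<^esub> u, c \<odot>\<^bsub>R\<^esub> v) \<in> H" if h: "(u, v) \<in> H" for c u v
  proof -
    obtain p q where "\<forall>n. (p n, q n) \<in> G" "clim T p u" "clim R q v" using HE[OF h(1)] by blast
    then show ?thesis
      by (intro HI[of "\<lambda>n. c \<odot>\<^bsub>T\<^esub> p n" "\<lambda>n. c \<odot>\<^bsub>R\<^esub> q n"] G_smult T.clim_smult R.clim_smult) auto
  qed
  have H_star: "(star T u, star R v) \<in> H" if h: "(u, v) \<in> H" for u v
  proof -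
    obtain p q where "\<forall>n. (p n, q n) \<in> G" "clim T p u" "clim R q v" using HE[OF h(1)] by blast
    then show ?thesis
      by (intro HI[of "\<lambda>n. star T (p n)" "\<lambda>n. star R (q n)"] G_star T.clim_star R.clim_star) auto
  qed
  have H_contr: "cnorm R v \<le> cnorm T u" if h: "(u, v) \<in> H" for u v
  proof -
    obtain p q where "\<forall>n. (p n, q n) \<in> G" "clim T p u" "clim R q v" using HE[OF h(1)] by blast
    then show ?thesis
      using contr by (intro LIMSEQ_le[OF R.clim_cnorm T.clim_cnorm]) auto
  qed
  \<comment> \<open>\<open>H\<close> is closed under differences, so two values over the same
    \<open>u\<close> differ by a value over 0, and contractivity forces this difference to
    vanish.\<close>
  have H_unique: "v = v'" if h: "(u, v) \<in> H" "(u, v') \<in> H" for u v v'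
  proof -
    note c = Hc[OF h(1)] Hc[OF h(2)]
    have "(u \<oplus>\<^bsub>T\<^esub> (- 1) \<odot>\<^bsub>T\<^esub> u, v \<oplus>\<^bsub>R\<^esub> (- 1) \<odot>\<^bsub>R\<^esub> v') \<in> H" using h by (intro H_add H_smult)
    from H_contr[OF this] have "cnorm R (v \<ominus>\<^bsub>R\<^esub> v') \<le> 0"
      using c by (simp add: T.smult_minus1 R.smult_minus1 T.r_neg T.cnorm_zero R.minus_eq)
    then have "v \<ominus>\<^bsub>R\<^esub> v' = \<zero>\<^bsub>R\<^esub>"
      using c R.cnorm_nonneg[of "v \<ominus>\<^bsub>R\<^esub> v'"] R.cnorm_eq_0_iff by simp
    then show ?thesis using c by (metis R.minus_eq R.minus_equality R.minus_minus R.a_inv_closed)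
  qed
  \<comment> \<open>Contractivity carries the Cauchy property from the approximants of
    \<open>x\<close> to their partners, which converge because \<open>R\<close> is complete.\<close>
  have H_total: "\<exists>v. (x, v) \<in> H" if x: "x \<in> carrier T" for x
  proof -
    have "\<exists>u v. (u, v) \<in> G \<and> cnorm T (x \<ominus>\<^bsub>T\<^esub> u) < inverse (real (Suc n))" for n
      using dense[OF x, of "inverse (real (Suc n))"] by auto
    then obtain p q where pq: "\<And>n. (p n, q n) \<in> G"
      "\<And>n. cnorm T (x \<ominus>\<^bsub>T\<^esub> p n) < inverse (real (Suc n))" by metis
    have pc: "p n \<in> carrier T" and qc: "q n \<in> carrier R" for n using pq(1) G by auto
    have lim_p: "clim T p x"
      using pq(2) pc x T.cnorm_diff_commute[OF x]
      by (intro T.climI[OF _ _ _ LIMSEQ_inverse_real_of_nat]) (auto intro: less_imp_le)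
    have dist: "cnorm R (q m \<ominus>\<^bsub>R\<^esub> q n) \<le> cnorm T (p m \<ominus>\<^bsub>T\<^esub> p n)" for m n
      using contr[OF G_add[OF pq(1)[of m] G_smult[OF pq(1)[of n], of "-1"]]] pc qc
      by (simp add: T.smult_minus1 R.smult_minus1 T.minus_eq R.minus_eq)
    have "\<exists>v\<in>carrier R. (\<lambda>n. cnorm R (q n \<ominus>\<^bsub>R\<^esub> v)) \<longlonglongrightarrow> 0"
    proof (rule R.complete[OF qc])
      fix e :: real assume e: "0 < e"
      obtain N where N: "\<forall>n\<ge>N. cnorm T (p n \<ominus>\<^bsub>T\<^esub> x) < e / 2"
        using order_tendstoD(2)[OF T.clim_tendsto[OF lim_p], of "e/2"] e
        by (auto simp: eventually_sequentially)
      show "\<exists>N. \<forall>m\<ge>N. \<forall>n\<ge>N. cnorm R (q m \<ominus>\<^bsub>R\<^esub> q n) < e"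
      proof (intro exI[of _ N] allI impI)
        fix m n assume mn: "m \<ge> N" "n \<ge> N"
        have "cnorm T (p m \<ominus>\<^bsub>T\<^esub> p n) \<le> cnorm T (p m \<ominus>\<^bsub>T\<^esub> x) + cnorm T (p n \<ominus>\<^bsub>T\<^esub> x)"
          using T.cnorm_diff_triangle[OF pc x pc, of m n] T.cnorm_diff_commute[OF x pc[of n]] by simp
        also have "\<dots> < e / 2 + e / 2" using N mn by (intro add_strict_mono) auto
        finally show "cnorm R (q m \<ominus>\<^bsub>R\<^esub> q n) < e" using dist[of m n] by simp
      qed
    qed
    then obtain v where "clim R q v" using qc by (auto simp: clim_def)
    then show ?thesis using HI[OF pq(1) lim_p] by blast
  qed
  define h where "h = (\<lambda>x\<in>carrier T. THE v. (x, v) \<in> H)"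
  have h_eq: "h x = v" if "(x, v) \<in> H" for x v
    using that Hc[OF that] H_unique by (auto simp: h_def)
  have h_H: "(x, h x) \<in> H" if "x \<in> carrier T" for x
    using H_total[OF that] h_eq by force
  have "h \<in> cstar_hom T R"
    using GH[OF G_one]
    by (intro cstar_homI h_eq H_add H_mult H_smult H_star h_H) (auto simp: Hc(2)[OF h_H], auto simp: h_def)
  moreover have "\<forall>(u, v)\<in>G. h u = v" using h_eq GH by blast
  ultimately show ?thesis by blast
qed

text \<open>A finite sum may be written in many ways, so corresponding sums are first paired in a
  relation \<open>G\<close>; the norm bound is what makes it single-valued. Indexing both families
  by the same set \<open>X\<close> lets one witness \<open>z\<close> match an operation in
  \<open>T\<close> and in \<open>R\<close> simultaneously.\<close>

lemma cstar_hom_extension: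
  assumes T: "cstar_algebra T" and R: "cstar_algebra R"
    and t: "\<And>x. x \<in> X \<Longrightarrow> t x \<in> carrier T" and s: "\<And>x. x \<in> X \<Longrightarrow> s x \<in> carrier R"
    and one: "\<exists>x\<in>X. t x = \<one>\<^bsub>T\<^esub> \<and> s x = \<one>\<^bsub>R\<^esub>"
    and mult: "\<And>x y. \<lbrakk>x \<in> X; y \<in> X\<rbrakk> \<Longrightarrow> \<exists>z\<in>X. t z = t x \<otimes>\<^bsub>T\<^esub> t y \<and> s z = s x \<otimes>\<^bsub>R\<^esub> s y"
    and smult: "\<And>c x. x \<in> X \<Longrightarrow> \<exists>z\<in>X. t z = c \<odot>\<^bsub>T\<^esub> t x \<and> s z = c \<odot>\<^bsub>R\<^esub> s x"
    and star: "\<And>x. x \<in> X \<Longrightarrow> \<exists>z\<in>X. t z = star T (t x) \<and> s z = star R (s x)"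
    and dense: "dense_sums T (t ` X)"
    and bound: "\<And>(n::nat) x. (\<And>k. k < n \<Longrightarrow> x k \<in> X) \<Longrightarrow>
      cnorm R (\<Oplus>\<^bsub>R\<^esub>k\<in>{..<n}. s (x k)) \<le> cnorm T (\<Oplus>\<^bsub>T\<^esub>k\<in>{..<n}. t (x k))"
  shows "\<exists>h\<in>cstar_hom T R. \<forall>x\<in>X. h (t x) = s x"
proof -
  interpret T: cstar_algebra T by fact
  interpret R: cstar_algebra R by fact
  define G where "G = {((\<Oplus>\<^bsub>T\<^esub>k\<in>{..<n::nat}. t (x k)), (\<Oplus>\<^bsub>R\<^esub>k\<in>{..<n}. s (x k))) |n x. \<forall>k<n. x k \<in> X}"
  have G_zero: "(\<zero>\<^bsub>T\<^esub>, \<zero>\<^bsub>R\<^esub>) \<in> G" unfolding G_def by (auto intro!: exI[of _ 0])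
  have G_step: "(u \<oplus>\<^bsub>T\<^esub> t x, v \<oplus>\<^bsub>R\<^esub> s x) \<in> G" if uv: "(u, v) \<in> G" and x: "x \<in> X" for u v x
  proof -
    obtain n y where y: "\<forall>k<n::nat. y k \<in> X" and
      eq: "u = (\<Oplus>\<^bsub>T\<^esub>k\<in>{..<n}. t (y k))" "v = (\<Oplus>\<^bsub>R\<^esub>k\<in>{..<n}. s (y k))" using uv by (auto simp: G_def)
    let ?y = "y(n := x)"
    have "(\<Oplus>\<^bsub>T\<^esub>k\<in>{..<Suc n}. t (?y k)) = (\<Oplus>\<^bsub>T\<^esub>k\<in>{..<n}. t (?y k)) \<oplus>\<^bsub>T\<^esub> t x"
      using x y t by (subst T.finsum_lessThan_Suc) auto
    also have "(\<Oplus>\<^bsub>T\<^esub>k\<in>{..<n}. t (?y k)) = u"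
      unfolding eq using y t by (intro T.finsum_cong') auto
    finally have 1: "u \<oplus>\<^bsub>T\<^esub> t x = (\<Oplus>\<^bsub>T\<^esub>k\<in>{..<Suc n}. t (?y k))" by simp
    have "(\<Oplus>\<^bsub>R\<^esub>k\<in>{..<Suc n}. s (?y k)) = (\<Oplus>\<^bsub>R\<^esub>k\<in>{..<n}. s (?y k)) \<oplus>\<^bsub>R\<^esub> s x"
      using x y s by (subst R.finsum_lessThan_Suc) auto
    also have "(\<Oplus>\<^bsub>R\<^esub>k\<in>{..<n}. s (?y k)) = v"
      unfolding eq using y s by (intro R.finsum_cong') auto
    finally have 2: "v \<oplus>\<^bsub>R\<^esub> s x = (\<Oplus>\<^bsub>R\<^esub>k\<in>{..<Suc n}. s (?y k))" by simp
    show ?thesis unfolding G_def 1 2 using x y by (intro CollectI exI[of _ "Suc n"] exI[of _ ?y]) auto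
  qed
  \<comment> \<open>Induction on the number of summands, for both members of a pair at once. The
    closure properties of \<open>G\<close> are checked by adding one generator at a time.\<close>
  have G_induct: "P u v"
    if uv: "(u, v) \<in> G" and P0: "P \<zero>\<^bsub>T\<^esub> \<zero>\<^bsub>R\<^esub>"
      and PS: "\<And>u v x. \<lbrakk>(u, v) \<in> G; u \<in> carrier T; v \<in> carrier R; P u v; x \<in> X\<rbrakk> \<Longrightarrow> P (u \<oplus>\<^bsub>T\<^esub> t x) (v \<oplus>\<^bsub>R\<^esub> s x)"
    for P u v
  proof -
    have "P (\<Oplus>\<^bsub>T\<^esub>k\<in>{..<n}. t (x k)) (\<Oplus>\<^bsub>R\<^esub>k\<in>{..<n}. s (x k))" if "\<forall>k<n. x k \<in> X" for n :: nat and x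
      using that
    proof (induction n)
      case 0 then show ?case using P0 by simp
    next
      case (Suc n)
      have "(\<Oplus>\<^bsub>T\<^esub>k\<in>{..<n}. t (x k), \<Oplus>\<^bsub>R\<^esub>k\<in>{..<n}. s (x k)) \<in> G"
        using Suc.prems unfolding G_def by (intro CollectI exI[of _ n] exI[of _ x]) auto
      then show ?case
        using Suc s t by (simp add: T.finsum_lessThan_Suc R.finsum_lessThan_Suc T.finsum_lessThan_closed
            R.finsum_lessThan_closed PS)
    qed
    then show ?thesis using uv by (auto simp: G_def)
  qed
  have Gc: "u \<in> carrier T \<and> v \<in> carrier R" if "(u, v) \<in> G" for u v
    by (rule G_induct[OF that]) (use t s in auto)
  have G_X: "(t x, s x) \<in> G" if "x \<in> X" for x
    using G_step[OF G_zero that] t s that by simp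
  have G_add: "(u \<oplus>\<^bsub>T\<^esub> u', v \<oplus>\<^bsub>R\<^esub> v') \<in> G" if g: "(u, v) \<in> G" "(u', v') \<in> G" for u v u' v'
  proof (rule G_induct[OF g(2)])
    show "(u \<oplus>\<^bsub>T\<^esub> \<zero>\<^bsub>T\<^esub>, v \<oplus>\<^bsub>R\<^esub> \<zero>\<^bsub>R\<^esub>) \<in> G" using Gc[OF g(1)] g(1) by simp
  next
    fix a b x assume *: "(u \<oplus>\<^bsub>T\<^esub> a, v \<oplus>\<^bsub>R\<^esub> b) \<in> G" "x \<in> X" "a \<in> carrier T" "b \<in> carrier R"
    then show "(u \<oplus>\<^bsub>T\<^esub> (a \<oplus>\<^bsub>T\<^esub> t x), v \<oplus>\<^bsub>R\<^esub> (b \<oplus>\<^bsub>R\<^esub> s x)) \<in> G"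
      using G_step[OF *(1,2)] Gc[OF g(1)] t s by (simp add: T.a_assoc R.a_assoc)
  qed
  have G_mult1: "(t x \<otimes>\<^bsub>T\<^esub> u, s x \<otimes>\<^bsub>R\<^esub> v) \<in> G" if x: "x \<in> X" and g: "(u, v) \<in> G" for x u v
  proof (rule G_induct[OF g])
    show "(t x \<otimes>\<^bsub>T\<^esub> \<zero>\<^bsub>T\<^esub>, s x \<otimes>\<^bsub>R\<^esub> \<zero>\<^bsub>R\<^esub>) \<in> G" using x t s G_zero by simp
  next
    fix a b y assume *: "(t x \<otimes>\<^bsub>T\<^esub> a, s x \<otimes>\<^bsub>R\<^esub> b) \<in> G" "y \<in> X" "a \<in> carrier T" "b \<in> carrier R"
    obtain z where "z \<in> X" "t z = t x \<otimes>\<^bsub>T\<^esub> t y" "s z = s x \<otimes>\<^bsub>R\<^esub> s y" using mult x * by blast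
    then show "(t x \<otimes>\<^bsub>T\<^esub> (a \<oplus>\<^bsub>T\<^esub> t y), s x \<otimes>\<^bsub>R\<^esub> (b \<oplus>\<^bsub>R\<^esub> s y)) \<in> G"
      using G_step[OF *(1), of z] * x t s by (simp add: T.r_distr R.r_distr)
  qed
  have G_mult: "(u' \<otimes>\<^bsub>T\<^esub> u, v' \<otimes>\<^bsub>R\<^esub> v) \<in> G" if g: "(u, v) \<in> G" "(u', v') \<in> G" for u v u' v'
  proof (rule G_induct[OF g(2)])
    show "(\<zero>\<^bsub>T\<^esub> \<otimes>\<^bsub>T\<^esub> u, \<zero>\<^bsub>R\<^esub> \<otimes>\<^bsub>R\<^esub> v) \<in> G" using Gc[OF g(1)] G_zero by simp
  next
    fix a b y assume *: "(a \<otimes>\<^bsub>T\<^esub> u, b \<otimes>\<^bsub>R\<^esub> v) \<in> G" "y \<in> X" "a \<in> carrier T" "b \<in> carrier R"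
    then show "((a \<oplus>\<^bsub>T\<^esub> t y) \<otimes>\<^bsub>T\<^esub> u, (b \<oplus>\<^bsub>R\<^esub> s y) \<otimes>\<^bsub>R\<^esub> v) \<in> G"
      using G_add[OF *(1) G_mult1[OF *(2) g(1)]] Gc[OF g(1)] t s by (simp add: T.l_distr R.l_distr)
  qed
  have G_smult: "(c \<odot>\<^bsub>T\<^esub> u, c \<odot>\<^bsub>R\<^esub> v) \<in> G" if g: "(u, v) \<in> G" for c u v
  proof (rule G_induct[OF g])
    show "(c \<odot>\<^bsub>T\<^esub> \<zero>\<^bsub>T\<^esub>, c \<odot>\<^bsub>R\<^esub> \<zero>\<^bsub>R\<^esub>) \<in> G" using G_zero by (simp add: T.smult_zero_right R.smult_zero_right)
  next
    fix a b y assume *: "(c \<odot>\<^bsub>T\<^esub> a, c \<odot>\<^bsub>R\<^esub> b) \<in> G" "y \<in> X" "a \<in> carrier T" "b \<in> carrier R"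
    obtain z where "z \<in> X" "t z = c \<odot>\<^bsub>T\<^esub> t y" "s z = c \<odot>\<^bsub>R\<^esub> s y" using smult * by blast
    then show "(c \<odot>\<^bsub>T\<^esub> (a \<oplus>\<^bsub>T\<^esub> t y), c \<odot>\<^bsub>R\<^esub> (b \<oplus>\<^bsub>R\<^esub> s y)) \<in> G"
      using G_step[OF *(1), of z] * t s by (simp add: T.smult_r_distr R.smult_r_distr)
  qed
  have G_star: "(star T u, star R v) \<in> G" if g: "(u, v) \<in> G" for u v
  proof (rule G_induct[OF g])
    show "(star T \<zero>\<^bsub>T\<^esub>, star R \<zero>\<^bsub>R\<^esub>) \<in> G" using G_zero by (simp add: T.star_zero R.star_zero)
  next
    fix a b y assume *: "(star T a, star R b) \<in> G" "y \<in> X" "a \<in> carrier T" "b \<in> carrier R"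
    obtain z where "z \<in> X" "t z = star T (t y)" "s z = star R (s y)" using star * by blast
    then show "(star T (a \<oplus>\<^bsub>T\<^esub> t y), star R (b \<oplus>\<^bsub>R\<^esub> s y)) \<in> G"
      using G_step[OF *(1), of z] * t s by (simp add: T.star_add R.star_add)
  qed
  have G_dense: "\<exists>(u, v)\<in>G. cnorm T (x \<ominus>\<^bsub>T\<^esub> u) < e" if x: "x \<in> carrier T" "0 < e" for x e
  proof -
    obtain u where u: "u \<in> sums_of T (t ` X)" "cnorm T (x \<ominus>\<^bsub>T\<^esub> u) < e"
      using dense x unfolding dense_sums_def by blast
    have "\<exists>v. (u, v) \<in> G" using u(1)
    proof (induction rule: sums_of.induct)
      case zero then show ?case using G_zero by blast
    next
      case (add u s) then show ?case using G_step by blast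
    qed
    then show ?thesis using u by blast
  qed
  have "\<exists>h\<in>cstar_hom T R. \<forall>(u, v)\<in>G. h u = v"
  proof (rule graph_extension[OF T R])
    show "G \<subseteq> carrier T \<times> carrier R" using Gc by auto
    show "(\<one>\<^bsub>T\<^esub>, \<one>\<^bsub>R\<^esub>) \<in> G" using one G_X by force
    show "cnorm R v \<le> cnorm T u" if "(u, v) \<in> G" for u v
      using that bound by (auto simp: G_def)
  qed (rule G_add G_mult G_smult G_star G_dense; assumption)+
  then obtain h where h: "h \<in> cstar_hom T R" "\<forall>(u, v)\<in>G. h u = v" by blast
  have "h (t x) = s x" if "x \<in> X" for x using bspec[OF h(2) G_X[OF that]] by simp
  then show ?thesis using h(1) by blast
qed

section \<open>The Hilbert space of square-summable families as a type\<close>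

lemma ell2_zero: "(\<lambda>_. 0) \<in> ell2"
  by (simp add: ell2_def)

lemma ell2_add:
  assumes "x \<in> ell2" "y \<in> ell2" shows "(\<lambda>i. x i + y i) \<in> ell2"
proof -
  have "(cmod (x i + y i))\<^sup>2 \<le> 2 * (cmod (x i))\<^sup>2 + 2 * (cmod (y i))\<^sup>2" for i
  proof -
    have "(cmod (x i + y i))\<^sup>2 \<le> (cmod (x i) + cmod (y i))\<^sup>2"
      by (intro power_mono norm_triangle_ineq) auto
    also have "\<dots> \<le> 2 * (cmod (x i))\<^sup>2 + 2 * (cmod (y i))\<^sup>2"
      using sum_squares_bound[of "cmod (x i)" "cmod (y i)"] by (simp add: power2_sum)
    finally show ?thesis .
  qed
  moreover have "(\<lambda>i. 2 * (cmod (x i))\<^sup>2 + 2 * (cmod (y i))\<^sup>2) summable_on UNIV"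
    using assms unfolding ell2_def by (intro summable_on_add summable_on_cmult_right) auto
  ultimately show ?thesis
    unfolding ell2_def using summable_on_comparison_test[where A = UNIV and g = "\<lambda>i. (cmod (x i + y i))\<^sup>2"] by simp
qed

lemma ell2_scale: "x \<in> ell2 \<Longrightarrow> (\<lambda>i. c * x i) \<in> ell2"
  unfolding ell2_def by (simp add: norm_mult power_mult_distrib summable_on_cmult_right)

lemma ell2_inner_abs_summable:
  assumes "x \<in> ell2" "y \<in> ell2" shows "(\<lambda>i. norm (cnj (x i) * y i)) summable_on UNIV"
proof (rule Infinite_Sum.abs_summable_on_comparison_test')
  show "(\<lambda>i. (cmod (x i))\<^sup>2 + (cmod (y i))\<^sup>2) summable_on UNIV"
    using assms unfolding ell2_def by (intro summable_on_add) auto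
  show "norm (cnj (x i) * y i) \<le> (cmod (x i))\<^sup>2 + (cmod (y i))\<^sup>2" for i
  proof -
    have "2 * (cmod (x i) * cmod (y i)) \<le> (cmod (x i))\<^sup>2 + (cmod (y i))\<^sup>2"
      using sum_squares_bound[of "cmod (x i)" "cmod (y i)"] by (simp add: mult.assoc)
    moreover have "0 \<le> cmod (x i) * cmod (y i)" by simp
    ultimately show ?thesis unfolding norm_mult complex_mod_cnj by linarith
  qed
qed

lemma ell2_inner_summable:
  "\<lbrakk>x \<in> ell2; y \<in> ell2\<rbrakk> \<Longrightarrow> (\<lambda>i. cnj (x i) * y i) summable_on UNIV"
  by (rule Infinite_Sum.abs_summable_summable[OF ell2_inner_abs_summable])

lemma ell2_bounded_sums:
  assumes "\<And>F. finite F \<Longrightarrow> (\<Sum>i\<in>F. (cmod (x i))\<^sup>2) \<le> M"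
  shows "x \<in> ell2" "(\<Sum>\<^sub>\<infinity>i. (cmod (x i))\<^sup>2) \<le> M"
proof -
  show x: "x \<in> ell2"
    unfolding ell2_def
    by (intro CollectI nonneg_bdd_above_summable_on bdd_aboveI2[of _ _ M]) (auto intro: assms)
  show "(\<Sum>\<^sub>\<infinity>i. (cmod (x i))\<^sup>2) \<le> M"
    by (rule infsum_le_finite_sums) (use x assms in \<open>auto simp: ell2_def\<close>)
qed

text \<open>As a type the space can be an instance of \<open>banach\<close>, so that bounded
  operators become points of the complete normed space of type \<open>\<Rightarrow>\<^sub>L\<close>,
  with limits and closures at hand.\<close>

typedef 'i l2 = "ell2 :: ('i \<Rightarrow> complex) set" morphisms ap mk
  using ell2_zero by blast

setup_lifting type_definition_l2

lemma l2_eqI: "(\<And>i. ap x i = ap y i) \<Longrightarrow> x = y"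
  by (metis ap_inject ext)

lemma ap_ell2 [simp]: "ap x \<in> ell2"
  using ap by blast

text \<open>The class \<open>real_inner\<close> retains only the real part, so the complex inner
  product is kept beside it. It is conjugate-linear in the first argument.\<close>

definition cip :: "'i l2 \<Rightarrow> 'i l2 \<Rightarrow> complex" where
  "cip x y = ell2_inner (ap x) (ap y)"

lift_definition scl :: "complex \<Rightarrow> 'i l2 \<Rightarrow> 'i l2" is "\<lambda>c x i. c * x i"
  by (rule ell2_scale)

instantiation l2 :: (type) ab_group_add
begin
lift_definition zero_l2 :: "'a l2" is "\<lambda>_. 0" by (rule ell2_zero)
lift_definition plus_l2 :: "'a l2 \<Rightarrow> 'a l2 \<Rightarrow> 'a l2" is "\<lambda>x y i. x i + y i" by (rule ell2_add)
lift_definition uminus_l2 :: "'a l2 \<Rightarrow> 'a l2" is "\<lambda>x i. - x i"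
  using ell2_scale[of _ "-1"] by simp
lift_definition minus_l2 :: "'a l2 \<Rightarrow> 'a l2 \<Rightarrow> 'a l2" is "\<lambda>x y i. x i - y i"
  using ell2_add[OF _ ell2_scale[of _ "-1"]] by simp
instance by standard (transfer; simp add: fun_eq_iff algebra_simps)+
end

lemma ap_simps [simp]: "ap 0 i = 0" "ap (x + y) i = ap x i + ap y i" "ap (- x) i = - ap x i"
  "ap (x - y) i = ap x i - ap y i" "ap (scl c x) i = c * ap x i"
  by (transfer; simp)+

lemma ap_sum: "ap (\<Sum>a\<in>S. f a) i = (\<Sum>a\<in>S. ap (f a) i)"
  by (induction S rule: infinite_finite_induct) auto

lemma cip_add_left: "cip (x + y) z = cip x z + cip y z"
  unfolding cip_def ell2_inner_def
  using infsum_add[OF ell2_inner_summable[of "ap x" "ap z"] ell2_inner_summable[of "ap y" "ap z"]]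
  by (simp add: ring_distribs)

lemma cip_scl_left: "cip (scl c x) z = cnj c * cip x z"
  unfolding cip_def ell2_inner_def by (simp add: mult.assoc infsum_cmult_right')

lemma cip_commute: "cip x y = cnj (cip y x)"
  unfolding cip_def ell2_inner_def by (simp add: mult.commute flip: infsum_cnj)

lemma cip_add_right: "cip x (y + z) = cip x y + cip x z"
  by (metis cip_add_left cip_commute complex_cnj_add)

lemma cip_scl_right: "cip x (scl c y) = c * cip x y"
  by (metis cip_commute cip_scl_left complex_cnj_cnj complex_cnj_mult)

lemma ap_summable: "(\<lambda>i. (cmod (ap x i))\<^sup>2) summable_on UNIV"
  using ap_ell2[of x] by (simp add: ell2_def)

lemma cip_self: "cip x x = complex_of_real (\<Sum>\<^sub>\<infinity>i. (cmod (ap x i))\<^sup>2)"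
proof -
  have "cip x x = (\<Sum>\<^sub>\<infinity>i. complex_of_real ((cmod (ap x i))\<^sup>2))"
    unfolding cip_def ell2_inner_def
    by (intro infsum_cong) (metis complex_norm_square mult.commute of_real_power)
  then show ?thesis using infsumI[OF has_sum_of_real[OF has_sum_infsum[OF ap_summable[of x]]]] by simp
qed

instantiation l2 :: (type) real_inner
begin
definition inner_l2 :: "'a l2 \<Rightarrow> 'a l2 \<Rightarrow> real" where "inner_l2 x y = Re (cip x y)"
definition scaleR_l2 :: "real \<Rightarrow> 'a l2 \<Rightarrow> 'a l2" where "scaleR_l2 r x = scl (complex_of_real r) x"
definition norm_l2 :: "'a l2 \<Rightarrow> real" where "norm_l2 x = sqrt (inner x x)"
definition dist_l2 :: "'a l2 \<Rightarrow> 'a l2 \<Rightarrow> real" where "dist_l2 x y = norm (x - y)"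
definition sgn_l2 :: "'a l2 \<Rightarrow> 'a l2" where "sgn_l2 x = scaleR (inverse (norm x)) x"
definition uniformity_l2 :: "('a l2 \<times> 'a l2) filter" where
  "uniformity_l2 = (INF e\<in>{0 <..}. principal {(x, y). dist x y < e})"
definition open_l2 :: "'a l2 set \<Rightarrow> bool" where
  "open_l2 S \<longleftrightarrow> (\<forall>x\<in>S. \<forall>\<^sub>F (x', y) in uniformity. x' = x \<longrightarrow> y \<in> S)"
instance
proof
  fix x y z :: "'a l2" and a b :: real
  show "dist x y = norm (x - y)" by (simp add: dist_l2_def)
  show "sgn x = scaleR (inverse (norm x)) x" by (simp add: sgn_l2_def)
  show "uniformity = (INF e\<in>{0 <..}. principal {(x, y :: 'a l2). dist x y < e})"
    by (simp add: uniformity_l2_def)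
  show "open U \<longleftrightarrow> (\<forall>x\<in>U. \<forall>\<^sub>F (x', y) in uniformity. x' = x \<longrightarrow> y \<in> U)" for U :: "'a l2 set"
    by (simp add: open_l2_def)
  show "norm x = sqrt (inner x x)" by (simp add: norm_l2_def)
  show "a *\<^sub>R (x + y) = a *\<^sub>R x + a *\<^sub>R y" "(a + b) *\<^sub>R x = a *\<^sub>R x + b *\<^sub>R x"
    "a *\<^sub>R b *\<^sub>R x = (a * b) *\<^sub>R x" "1 *\<^sub>R x = x"
    by (auto simp: scaleR_l2_def intro!: l2_eqI simp: algebra_simps)
  show "inner x y = inner y x" unfolding inner_l2_def by (subst cip_commute) simp
  show "inner (x + y) z = inner x z + inner y z" by (simp add: inner_l2_def cip_add_left)
  show "inner (a *\<^sub>R x) y = a * inner x y" by (simp add: inner_l2_def scaleR_l2_def cip_scl_left)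
  show "0 \<le> inner x x" by (simp add: inner_l2_def cip_self infsum_nonneg)
  show "inner x x = 0 \<longleftrightarrow> x = 0"
  proof
    assume "inner x x = 0"
    then have "(cmod (ap x i))\<^sup>2 = 0" for i
      using nonneg_infsum_le_0D[OF _ ap_summable[of x], of i] by (simp add: inner_l2_def cip_self)
    then show "x = 0" by (intro l2_eqI) simp
  qed (simp add: inner_l2_def cip_self)
qed
end

lemma norm_l2_sq: "(norm x)\<^sup>2 = (\<Sum>\<^sub>\<infinity>i. (cmod (ap x i))\<^sup>2)"
  by (simp add: power2_norm_eq_inner inner_l2_def cip_self)

lemma norm_eq_ell2_norm: "norm x = ell2_norm (ap x)"
  using norm_l2_sq[of x] by (simp add: ell2_norm_def real_sqrt_unique)

lemma norm_scl: "norm (scl c x) = cmod c * norm x"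
proof -
  have "(norm (scl c x))\<^sup>2 = (cmod c * norm x)\<^sup>2"
    by (simp add: norm_l2_sq power_mult_distrib norm_mult infsum_cmult_right')
  then show ?thesis by simp
qed

lemma scl_simps: "scl c (x + y) = scl c x + scl c y" "scl (c + d) x = scl c x + scl d x"
  "scl c (scl d x) = scl (c * d) x" "scl 1 x = x" "scl 0 x = 0" "scl c 0 = 0"
  "scl (complex_of_real r) x = r *\<^sub>R x"
  by (auto intro!: l2_eqI simp: algebra_simps scaleR_l2_def)

lemma sum_le_norm_l2: "finite F \<Longrightarrow> (\<Sum>i\<in>F. (cmod (ap x i))\<^sup>2) \<le> (norm x)\<^sup>2"
  unfolding norm_l2_sq by (intro finite_sum_le_infsum ap_summable) auto

lemma ap_norm_le: "cmod (ap x i) \<le> norm x"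
  using sum_le_norm_l2[of "{i}" x] by (auto intro: power2_le_imp_le)

lemma mk_norm_le:
  assumes "\<And>F. finite F \<Longrightarrow> (\<Sum>i\<in>F. (cmod (f i))\<^sup>2) \<le> M\<^sup>2" "0 \<le> M"
  shows "f \<in> ell2" "norm (mk f) \<le> M"
proof -
  show "f \<in> ell2" by (rule ell2_bounded_sums(1)[OF assms(1)])
  then have "(norm (mk f))\<^sup>2 \<le> M\<^sup>2"
    using ell2_bounded_sums(2)[OF assms(1)] by (simp add: norm_l2_sq mk_inverse)
  then show "norm (mk f) \<le> M" using assms(2) by (rule power2_le_imp_le)
qed

text \<open>A Cauchy sequence converges in each coordinate. Bounds on finite partial sums survive
  the coordinatewise limit, and being uniform in the finite set they give both square-summability of
  the limit and convergence in norm.\<close>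

instance l2 :: (type) banach
proof
  fix X :: "nat \<Rightarrow> 'a l2" assume X: "Cauchy X"
  have "Cauchy (\<lambda>n. ap (X n) i)" for i
  proof (rule metric_CauchyI)
    fix e :: real assume "0 < e"
    then obtain M where M: "\<forall>m\<ge>M. \<forall>n\<ge>M. dist (X m) (X n) < e" using X by (auto simp: Cauchy_def)
    have "dist (ap (X m) i) (ap (X n) i) \<le> dist (X m) (X n)" for m n
      using ap_norm_le[of "X m - X n" i] by (simp add: dist_norm)
    then show "\<exists>M. \<forall>m\<ge>M. \<forall>n\<ge>M. dist (ap (X m) i) (ap (X n) i) < e"
      using M by (meson le_less_trans)
  qed
  then have "\<exists>l. (\<lambda>n. ap (X n) i) \<longlonglongrightarrow> l" for i using Cauchy_convergent_iff convergent_def by blast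
  then obtain f where f: "\<And>i. (\<lambda>n. ap (X n) i) \<longlonglongrightarrow> f i" by metis
  \<comment> \<open>The index \<open>N\<close> must not depend on \<open>F\<close>: for fixed
    \<open>F\<close> one lets the second index of the Cauchy estimate tend to infinity.\<close>
  have tail: "\<exists>N. \<forall>n\<ge>N. \<forall>F. finite F \<longrightarrow> (\<Sum>i\<in>F. (cmod (ap (X n) i - f i))\<^sup>2) \<le> e\<^sup>2"
    if e: "0 < e" for e
  proof -
    obtain N where N: "\<forall>m\<ge>N. \<forall>n\<ge>N. dist (X m) (X n) < e"
      using X e by (auto simp: Cauchy_def)
    have "(\<Sum>i\<in>F. (cmod (ap (X n) i - f i))\<^sup>2) \<le> e\<^sup>2" if n: "n \<ge> N" and F: "finite F" for n F
    proof (rule LIMSEQ_le_const2)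
      show "(\<lambda>m. \<Sum>i\<in>F. (cmod (ap (X n) i - ap (X m) i))\<^sup>2)
          \<longlonglongrightarrow> (\<Sum>i\<in>F. (cmod (ap (X n) i - f i))\<^sup>2)"
        by (intro tendsto_intros f)
      have "(\<Sum>i\<in>F. (cmod (ap (X n) i - ap (X m) i))\<^sup>2) \<le> e\<^sup>2" if m: "m \<ge> N" for m
      proof -
        have "norm (X n - X m) \<le> e" using N m n by (auto simp: dist_norm intro: less_imp_le)
        then show ?thesis
          using sum_le_norm_l2[OF F, of "X n - X m"] power_mono[of "norm (X n - X m)" e 2] by simp
      qed
      then show "\<exists>N. \<forall>m\<ge>N. (\<Sum>i\<in>F. (cmod (ap (X n) i - ap (X m) i))\<^sup>2) \<le> e\<^sup>2" by blast
    qed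
    then show ?thesis by blast
  qed
  obtain N1 where N1: "\<And>F. finite F \<Longrightarrow> (\<Sum>i\<in>F. (cmod (ap (X N1) i - f i))\<^sup>2) \<le> 1\<^sup>2"
    using tail[of 1] by auto
  \<comment> \<open>The limit is recovered as \<open>X N1\<close> minus a difference already known
    to be square-summable.\<close>
  have "(\<lambda>i. ap (X N1) i + - 1 * (ap (X N1) i - f i)) \<in> ell2"
    by (intro ell2_add ell2_scale mk_norm_le(1)[OF N1]) auto
  then have fl: "f \<in> ell2" by simp
  have "X \<longlonglongrightarrow> mk f"
  proof (rule metric_LIMSEQ_I)
    fix r :: real assume "0 < r"
    then have r: "0 < r / 2" by simp
    obtain N where N: "\<And>n F. \<lbrakk>n \<ge> N; finite F\<rbrakk> \<Longrightarrow> (\<Sum>i\<in>F. (cmod (ap (X n) i - f i))\<^sup>2) \<le> (r/2)\<^sup>2"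
      using tail[OF r] by blast
    have "dist (X n) (mk f) < r" if "n \<ge> N" for n
    proof -
      have "X n - mk f = mk (\<lambda>i. ap (X n) i - f i)"
        using mk_norm_le(1)[OF N[OF that]] r fl by (intro l2_eqI) (simp add: mk_inverse)
      then show ?thesis using mk_norm_le(2)[OF N[OF that]] r by (simp add: dist_norm)
    qed
    then show "\<exists>no. \<forall>n\<ge>no. dist (X n) (mk f) < r" by blast
  qed
  then show "convergent X" by (rule convergentI)
qed

lift_definition dl :: "'i \<Rightarrow> 'i l2" is "\<lambda>k i. if i = k then 1 else 0"
  by (rule ell2_bounded_sums(1)[where M = 1])
    (simp add: if_distrib[of cmod] if_distrib[of "\<lambda>x. x\<^sup>2"] cong: if_cong)

lemma ap_dl [simp]: "ap (dl k) i = (if i = k then 1 else 0)"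
  by transfer simp

lemma cip_dl: "cip (dl k) x = ap x k"
proof -
  have "cip (dl k) x = (\<Sum>\<^sub>\<infinity>i\<in>{k}. ap x i)"
    unfolding cip_def ell2_inner_def by (rule infsum_cong_neutral) auto
  then show ?thesis by simp
qed

lemma norm_dl [simp]: "norm (dl k) = 1"
  by (simp add: norm_eq_sqrt_inner inner_l2_def cip_dl)

lemma norm_cip_le: "cmod (cip x y) \<le> norm x * norm y"
proof -
  \<comment> \<open>Rotating \<open>y\<close> by this phase makes the inner product real and
    nonnegative, which reduces the claim to the real Cauchy-Schwarz inequality. The value 1 in the
    degenerate case keeps \<open>c\<close> on the unit circle.\<close>
  define c where "c = (if cip x y = 0 then 1 else cnj (sgn (cip x y)))"
  have c: "cmod c = 1" by (simp add: c_def norm_sgn)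
  have "cip x (scl c y) = complex_of_real (cmod (cip x y))"
    by (simp add: c_def cip_scl_right sgn_div_norm complex_norm_square[symmetric] power2_eq_square
        scaleR_conv_of_real field_simps)
  then have "cmod (cip x y) = inner x (scl c y)" by (simp add: inner_l2_def)
  also have "\<dots> \<le> norm x * norm (scl c y)" by (rule norm_cauchy_schwarz)
  finally show ?thesis by (simp add: norm_scl c)
qed

lemma bounded_bilinear_cip: "bounded_bilinear cip"
  by (rule bounded_bilinear.intro)
    (auto simp: cip_add_left cip_add_right scaleR_l2_def cip_scl_left cip_scl_right
      scaleR_conv_of_real intro!: exI[of _ 1] norm_cip_le)

lemma cip_eqI: "(\<And>z. cip z x = cip z y) \<Longrightarrow> x = y"
  by (rule l2_eqI) (metis cip_dl)

lemma l2_approx: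
  assumes e: "0 < e"
  shows "\<exists>F. finite F \<and> (\<forall>F'. finite F' \<longrightarrow> F \<subseteq> F' \<longrightarrow> norm (x - (\<Sum>k\<in>F'. scl (ap x k) (dl k))) < e)"
proof -
  let ?n = "\<lambda>i. (cmod (ap x i))\<^sup>2"
  have "(?n has_sum (norm x)\<^sup>2) UNIV" using has_sum_infsum[OF ap_summable[of x]] norm_l2_sq[of x] by simp
  then have "\<forall>\<^sub>F F in finite_subsets_at_top UNIV. (norm x)\<^sup>2 - e\<^sup>2 < sum ?n F"
    using e unfolding has_sum_def by (intro order_tendstoD(1)) auto
  then obtain F where F: "finite F" "\<And>F'. finite F' \<Longrightarrow> F \<subseteq> F' \<Longrightarrow> (norm x)\<^sup>2 - e\<^sup>2 < sum ?n F'"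
    by (auto simp: eventually_finite_subsets_at_top)
  have "norm (x - (\<Sum>k\<in>F'. scl (ap x k) (dl k))) < e" if F': "finite F'" "F \<subseteq> F'" for F'
  proof -
    let ?y = "\<Sum>k\<in>F'. scl (ap x k) (dl k)"
    have y: "ap ?y i = (if i \<in> F' then ap x i else 0)" for i
      using F' by (simp add: ap_sum if_distrib[of "(*) _"] cong: if_cong)
    have "(norm (x - ?y))\<^sup>2 = infsum ?n (UNIV - F')"
      unfolding norm_l2_sq by (rule infsum_cong_neutral) (auto simp: y)
    also have "infsum ?n UNIV = infsum ?n F' + infsum ?n (UNIV - F')"
      using infsum_Un_disjoint[of ?n F' "UNIV - F'"] F' summable_on_subset_banach[OF ap_summable[of x]]
      by auto
    then have "infsum ?n (UNIV - F') = (norm x)\<^sup>2 - sum ?n F'" using F' by (simp add: norm_l2_sq)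
    also have "\<dots> < e\<^sup>2" using F(2)[OF F'] by simp
    finally show ?thesis using e by (rule power2_less_imp_less[OF _ less_imp_le])
  qed
  then show ?thesis using F(1) by blast
qed

text \<open>Finite combinations of the unit vectors are dense. Identities between continuous linear
  expressions are thereby reduced to the vectors \<open>dl k\<close>.\<close>

lemma l2_induct [case_names closed add scl dl]:
  assumes closed: "closed {x. P x}" and add: "\<And>x y. P x \<Longrightarrow> P y \<Longrightarrow> P (x + y)"
    and scl: "\<And>c x. P x \<Longrightarrow> P (scl c x)" and dl: "\<And>k. P (dl k)"
  shows "P (x :: 'i l2)"
proof -
  have fin: "P (\<Sum>k\<in>F. scl (c k) (dl k))" if "finite F" for F and c :: "'i \<Rightarrow> complex"
    using that
  proof (induction F)
    case empty
    then show ?case using scl[OF dl, of 0 undefined] by (simp add: scl_simps)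
  next
    case (insert k F)
    then show ?case by (simp add: add scl dl)
  qed
  have "x \<in> closure {x. P x}"
    unfolding closure_approachable
  proof (intro allI impI)
    fix e :: real assume "0 < e"
    then obtain F where "finite F" "norm (x - (\<Sum>k\<in>F. scl (ap x k) (dl k))) < e"
      using l2_approx[of e x] by blast
    then show "\<exists>y\<in>{x. P x}. dist y x < e"
      using fin by (intro bexI[of _ "\<Sum>k\<in>F. scl (ap x k) (dl k)"]) (auto simp: dist_norm norm_minus_commute)
  qed
  then show ?thesis using closed by (simp add: closure_closed)
qed

section \<open>Bounded operators and their adjoints\<close>

type_synonym 'i bop = "'i l2 \<Rightarrow>\<^sub>L 'i l2"

text \<open>Elements of the type \<open>\<Rightarrow>\<^sub>L\<close> are real-linear only, so
  complex linearity has to be recorded separately.\<close>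

definition clin :: "('i l2 \<Rightarrow>\<^sub>L 'j l2) \<Rightarrow> bool" where
  "clin f \<longleftrightarrow> (\<forall>c x. f (scl c x) = scl c (f x))"

text \<open>A relation instead of an operation: adjoints are exhibited explicitly for the operators
  that occur and carried through sums, products and limits, so the general existence theorem is
  avoided.\<close>

definition adj :: "('i l2 \<Rightarrow>\<^sub>L 'j l2) \<Rightarrow> ('j l2 \<Rightarrow>\<^sub>L 'i l2) \<Rightarrow> bool" where
  "adj f g \<longleftrightarrow> (\<forall>x y. cip (f x) y = cip x (g y))"

lemma bounded_linear_scl: "bounded_linear (scl c)"
  by (rule bounded_linear_intro[of _ "cmod c"])
    (simp_all add: scl_simps(1,3) scaleR_l2_def norm_scl mult.commute)

lift_definition sclL :: "complex \<Rightarrow> 'i bop" is scl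
  by (rule bounded_linear_scl)

declare sclL.rep_eq [simp]

definition opscl :: "complex \<Rightarrow> ('i l2 \<Rightarrow>\<^sub>L 'j l2) \<Rightarrow> ('i l2 \<Rightarrow>\<^sub>L 'j l2)" where
  "opscl c f = sclL c o\<^sub>L f"

lemma opscl_apply [simp]: "opscl c f x = scl c (f x)"
  by (simp add: opscl_def)

lemma clinD: "clin f \<Longrightarrow> f (scl c x) = scl c (f x)"
  by (simp add: clin_def)

lemma blinfun_eq_iff: "f = g \<longleftrightarrow> (\<forall>x. blinfun_apply f x = blinfun_apply g x)"
  by (auto intro: blinfun_eqI)

lemma blinfun_eq_dl:
  assumes "clin f" "clin g" "\<And>k. f (dl k) = g (dl k)"
  shows "f = g"
proof (rule blinfun_eqI)
  show "f x = g x" for x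
    by (induction x rule: l2_induct)
      (auto simp: blinfun.add_right clinD[OF assms(1)] clinD[OF assms(2)] assms(3)
        intro!: closed_Collect_eq continuous_intros)
qed

text \<open>Testing against all vectors \<open>y\<close> moves the scalar through the inner product
  twice, out of the first argument and back into it.\<close>

lemma adj_clin: "adj f g \<Longrightarrow> clin f"
  unfolding clin_def adj_def
  by (metis cip_commute cip_eqI cip_scl_left)

lemma adj_sym: "adj f g \<Longrightarrow> adj g f"
  unfolding adj_def by (metis cip_commute)

lemma adj_unique: "adj f g \<Longrightarrow> adj f h \<Longrightarrow> g = h"
  unfolding adj_def by (intro blinfun_eqI cip_eqI) metis

lemma adj_add: "adj f g \<Longrightarrow> adj f' g' \<Longrightarrow> adj (f + f') (g + g')"
  by (simp add: adj_def blinfun.add_left cip_add_left cip_add_right)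

lemma adj_zero: "adj 0 0"
  by (simp add: adj_def) (metis add_cancel_left_left cip_add_left cip_add_right)

lemma adj_sum: "(\<And>k. k \<in> S \<Longrightarrow> adj (f k) (g k)) \<Longrightarrow> adj (\<Sum>k\<in>S. f k) (\<Sum>k\<in>S. g k)"
  by (induction S rule: infinite_finite_induct) (auto simp: adj_zero adj_add)

lemma adj_comp: "adj f g \<Longrightarrow> adj f' g' \<Longrightarrow> adj (f o\<^sub>L f') (g' o\<^sub>L g)"
  by (simp add: adj_def)

lemma adj_opscl: "adj f g \<Longrightarrow> adj (opscl c f) (opscl (cnj c) g)"
  by (simp add: adj_def cip_scl_left cip_scl_right)

text \<open>The identity extends from unit vectors to all vectors in one argument at a time, by
  linearity and continuity.\<close>

lemma adj_dl:
  assumes f: "clin f" and g: "clin g" and eq: "\<And>k l. cip (f (dl k)) (dl l) = cip (dl k) (g (dl l))"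
  shows "adj f g"
proof -
  interpret cip: bounded_bilinear cip by (rule bounded_bilinear_cip)
  note cont = continuous_intros cip.continuous_on closed_Collect_eq
  have 1: "cip (f (dl k)) y = cip (dl k) (g y)" for k y
    by (induction y rule: l2_induct)
      (auto simp: eq clinD[OF g] cip_add_right cip_scl_right blinfun.add_right intro!: cont)
  have "cip (f x) y = cip x (g y)" for x y
    by (induction x rule: l2_induct)
      (auto simp: 1 clinD[OF f] cip_add_left cip_scl_left blinfun.add_right intro!: cont)
  then show ?thesis by (simp add: adj_def)
qed

lemma adj_tendsto:
  assumes "f \<longlonglongrightarrow> F" "g \<longlonglongrightarrow> G" "\<And>n. adj (f n) (g n)" shows "adj F G"
  unfolding adj_def
proof (intro allI)
  interpret cip: bounded_bilinear cip by (rule bounded_bilinear_cip)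
  fix x y
  have "(\<lambda>n. cip (f n x) y) \<longlonglongrightarrow> cip (F x) y" "(\<lambda>n. cip x (g n y)) \<longlonglongrightarrow> cip x (G y)"
    by (intro cip.tendsto tendsto_intros blinfun.tendsto assms)+
  moreover have "cip (f n x) y = cip x (g n y)" for n using assms(3) by (simp add: adj_def)
  ultimately show "cip (F x) y = cip x (G y)" using LIMSEQ_unique by fastforce
qed

text \<open>The squared length of \<open>f x\<close> is the inner product of \<open>x\<close> with
  \<open>g (f x)\<close>. This is the nontrivial half of the C*-identity for operators.\<close>

lemma adj_norm_sq_le:
  assumes "adj f g" shows "(norm f)\<^sup>2 \<le> norm (g o\<^sub>L f)"
proof -
  have "norm (f x) \<le> sqrt (norm (g o\<^sub>L f)) * norm x" for x
  proof -
    have "(norm (f x))\<^sup>2 = Re (cip x (g (f x)))"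
      using assms by (simp add: adj_def power2_norm_eq_inner inner_l2_def)
    also have "\<dots> \<le> norm x * norm ((g o\<^sub>L f) x)"
      using order_trans[OF complex_Re_le_cmod norm_cip_le[of x "g (f x)"]] by simp
    also have "\<dots> \<le> norm x * (norm (g o\<^sub>L f) * norm x)"
      by (intro mult_left_mono norm_blinfun) auto
    also have "\<dots> = (sqrt (norm (g o\<^sub>L f)) * norm x)\<^sup>2"
      by (simp add: power_mult_distrib power2_eq_square)
    finally show ?thesis by (rule power2_le_imp_le) simp
  qed
  then have "norm f \<le> sqrt (norm (g o\<^sub>L f))" by (intro norm_blinfun_bound) auto
  then show ?thesis by (metis norm_ge_zero real_sqrt_le_iff real_sqrt_abs abs_norm_cancel real_sqrt_power)
qed

lemma adj_norm:
  assumes "adj f g" shows "norm g = norm f" "norm (g o\<^sub>L f) = (norm f)\<^sup>2"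
proof -
  have le: "norm f \<le> norm g" if "adj f g" for f :: "'a l2 \<Rightarrow>\<^sub>L 'b l2" and g
  proof (cases "norm f = 0")
    case False
    have "(norm f)\<^sup>2 \<le> norm g * norm f"
      using adj_norm_sq_le[OF that] norm_blinfun_compose[of g f] by simp
    then show ?thesis using False by (simp add: power2_eq_square)
  qed simp
  have le': "norm g \<le> norm f"
  proof (cases "norm g = 0")
    case False
    have "(norm g)\<^sup>2 \<le> norm f * norm g"
      using adj_norm_sq_le[OF adj_sym[OF assms]] norm_blinfun_compose[of f g] by simp
    then show ?thesis using False by (simp add: power2_eq_square)
  qed simp
  show 1: "norm g = norm f" using le[OF assms] le' by simp
  show "norm (g o\<^sub>L f) = (norm f)\<^sup>2"
    using adj_norm_sq_le[OF assms] norm_blinfun_compose[of g f] 1 by (simp add: power2_eq_square)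
qed

lemma norm_opscl: "norm (opscl c f) = cmod c * norm f"
proof (cases "c = 0")
  case True
  then show ?thesis by (auto intro: blinfun_eqI simp: scl_simps)
next
  case False
  have le: "norm (opscl c f) \<le> cmod c * norm f" for c and f :: "'a l2 \<Rightarrow>\<^sub>L 'b l2"
    by (rule norm_blinfun_bound)
      (auto simp: norm_scl mult.assoc intro!: mult_left_mono norm_blinfun)
  have "f = opscl (inverse c) (opscl c f)" using False by (intro blinfun_eqI) (simp add: scl_simps)
  then have "norm f \<le> cmod (inverse c) * norm (opscl c f)" by (metis le)
  then have "cmod c * norm f \<le> cmod c * (cmod (inverse c) * norm (opscl c f))"
    by (intro mult_left_mono) auto
  also have "\<dots> = norm (opscl c f)" using False by (simp add: mult.assoc[symmetric] norm_mult[symmetric])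
  finally show ?thesis using le[of c f] by simp
qed

section \<open>C*-algebras of operators\<close>

text \<open>The unit is a parameter because representations may be degenerate: the unit of the
  algebra they generate is then an idempotent other than the identity operator. The description in
  \<open>star\<close> denotes whenever an adjoint exists, by \<open>adj_unique\<close>.\<close>

definition op_alg :: "'i bop set \<Rightarrow> 'i bop \<Rightarrow> 'i bop cstar" where
  "op_alg K e = \<lparr>carrier = K, mult = (o\<^sub>L), one = e, zero = 0, add = (+), smult = opscl,
     star = (\<lambda>f. THE g. adj f g), cnorm = norm\<rparr>"

lemma op_alg_simps [simp]:
  "carrier (op_alg K e) = K" "mult (op_alg K e) = (o\<^sub>L)" "one (op_alg K e) = e"
  "zero (op_alg K e) = 0" "add (op_alg K e) = (+)" "smult (op_alg K e) = opscl"
  "cnorm (op_alg K e) = norm"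
  by (simp_all add: op_alg_def)

lemma op_alg_star: "adj f g \<Longrightarrow> star (op_alg K e) f = g"
  using adj_unique by (auto simp: op_alg_def)

lemma opscl_distrib: "opscl (c + d) f = opscl c f + opscl d f"
  "opscl c (f + f') = opscl c f + opscl c f'"
  by (auto intro!: blinfun_eqI simp: scl_simps blinfun.add_left)

lemma opscl_assoc: "opscl (c * d) f = opscl c (opscl d f)" "opscl 1 f = f"
  "opscl (- 1) f = - f"
proof -
  have "scl (-1) x = - x" for x :: "'b l2" by (rule l2_eqI) simp
  then show "opscl (- 1) f = - f" by (intro blinfun_eqI) (simp add: blinfun.minus_left)
qed (auto intro!: blinfun_eqI simp: scl_simps)

lemma op_alg_cstar:
  assumes closed: "closed K" and e: "e \<in> K"
    and add: "\<And>f g. \<lbrakk>f \<in> K; g \<in> K\<rbrakk> \<Longrightarrow> f + g \<in> K"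
    and mult: "\<And>f g. \<lbrakk>f \<in> K; g \<in> K\<rbrakk> \<Longrightarrow> f o\<^sub>L g \<in> K"
    and scl: "\<And>c f. f \<in> K \<Longrightarrow> opscl c f \<in> K"
    and adj: "\<And>f. f \<in> K \<Longrightarrow> \<exists>g\<in>K. adj f g"
    and unit: "\<And>f. f \<in> K \<Longrightarrow> e o\<^sub>L f = f" "\<And>f. f \<in> K \<Longrightarrow> f o\<^sub>L e = f"
  shows "cstar_algebra (op_alg K e)"
proof -
  let ?A = "op_alg K e"
  have neg: "- f \<in> K" if "f \<in> K" for f using scl[OF that, of "-1"] by (simp add: opscl_assoc)
  have zero: "0 \<in> K" using add[OF e neg[OF e]] by simp
  interpret ring ?A
  proof (intro ringI abelian_groupI monoidI)
    show "\<exists>y\<in>carrier ?A. y \<oplus>\<^bsub>?A\<^esub> x = \<zero>\<^bsub>?A\<^esub>" if "x \<in> carrier ?A" for x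
      using neg that by (intro bexI[of _ "- x"]) auto
  qed (auto simp: zero e add mult unit algebra_simps blinfun_eq_iff blinfun.add_left blinfun.add_right)
  have minus: "x \<ominus>\<^bsub>?A\<^esub> y = x - y" if "x \<in> K" "y \<in> K" for x y
    using minus_equality[of "- y" y] neg that by (simp add: minus_eq)
  have clin: "clin f" if "f \<in> K" for f using adj[OF that] adj_clin by blast
  show ?thesis
  proof (unfold_locales)
    fix x y :: "'a bop" and c d :: complex
    assume "x \<in> carrier ?A" then have x: "x \<in> K" by simp
    obtain x' where x': "x' \<in> K" "adj x x'" using adj x by blast
    note [simp] = op_alg_star[OF x'(2)] op_alg_star[OF adj_sym[OF x'(2)]]
    show "c \<odot>\<^bsub>?A\<^esub> x \<in> carrier ?A" using x scl by simp
    show "(c + d) \<odot>\<^bsub>?A\<^esub> x = c \<odot>\<^bsub>?A\<^esub> x \<oplus>\<^bsub>?A\<^esub> d \<odot>\<^bsub>?A\<^esub> x" by (simp add: opscl_distrib)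
    show "(c * d) \<odot>\<^bsub>?A\<^esub> x = c \<odot>\<^bsub>?A\<^esub> (d \<odot>\<^bsub>?A\<^esub> x)" "1 \<odot>\<^bsub>?A\<^esub> x = x" by (simp_all add: opscl_assoc)
    show "star ?A x \<in> carrier ?A" "star ?A (star ?A x) = x" using x' by simp_all
    show "star ?A (c \<odot>\<^bsub>?A\<^esub> x) = cnj c \<odot>\<^bsub>?A\<^esub> star ?A x"
      using op_alg_star[OF adj_opscl[OF x'(2)]] by simp
    show "0 \<le> cnorm ?A x" "cnorm ?A x = 0 \<longleftrightarrow> x = \<zero>\<^bsub>?A\<^esub>" by simp_all
    show "cnorm ?A (c \<odot>\<^bsub>?A\<^esub> x) = cmod c * cnorm ?A x" by (simp add: norm_opscl)
    show "cnorm ?A (star ?A x \<otimes>\<^bsub>?A\<^esub> x) = (cnorm ?A x)\<^sup>2" using adj_norm(2)[OF x'(2)] by simp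
    assume "y \<in> carrier ?A" then have y: "y \<in> K" by simp
    obtain y' where y': "y' \<in> K" "adj y y'" using adj y by blast
    note [simp] = op_alg_star[OF y'(2)]
    show "c \<odot>\<^bsub>?A\<^esub> (x \<oplus>\<^bsub>?A\<^esub> y) = c \<odot>\<^bsub>?A\<^esub> x \<oplus>\<^bsub>?A\<^esub> c \<odot>\<^bsub>?A\<^esub> y" by (simp add: opscl_distrib)
    show "(c \<odot>\<^bsub>?A\<^esub> x) \<otimes>\<^bsub>?A\<^esub> y = c \<odot>\<^bsub>?A\<^esub> (x \<otimes>\<^bsub>?A\<^esub> y)" by (auto intro: blinfun_eqI)
    show "x \<otimes>\<^bsub>?A\<^esub> (c \<odot>\<^bsub>?A\<^esub> y) = c \<odot>\<^bsub>?A\<^esub> (x \<otimes>\<^bsub>?A\<^esub> y)"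
      by (auto intro!: blinfun_eqI simp: clinD[OF clin[OF x]])
    show "star ?A (x \<oplus>\<^bsub>?A\<^esub> y) = star ?A x \<oplus>\<^bsub>?A\<^esub> star ?A y"
      using op_alg_star[OF adj_add[OF x'(2) y'(2)]] by simp
    show "star ?A (x \<otimes>\<^bsub>?A\<^esub> y) = star ?A y \<otimes>\<^bsub>?A\<^esub> star ?A x"
      using op_alg_star[OF adj_comp[OF x'(2) y'(2)]] by simp
    show "cnorm ?A (x \<oplus>\<^bsub>?A\<^esub> y) \<le> cnorm ?A x + cnorm ?A y" by (simp add: norm_triangle_ineq)
    show "cnorm ?A (x \<otimes>\<^bsub>?A\<^esub> y) \<le> cnorm ?A x * cnorm ?A y" by (simp add: norm_blinfun_compose)
  next
    fix s :: "nat \<Rightarrow> 'a bop"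
    assume s: "\<And>n. s n \<in> carrier ?A" and C: "\<And>e. 0 < e \<Longrightarrow> \<exists>N. \<forall>m\<ge>N. \<forall>n\<ge>N. cnorm ?A (s m \<ominus>\<^bsub>?A\<^esub> s n) < e"
    have sK: "s n \<in> K" for n using s by simp
    have "Cauchy s" using C by (intro metric_CauchyI) (simp add: minus[OF sK sK] dist_norm)
    then obtain l where l: "s \<longlonglongrightarrow> l" using Cauchy_convergent_iff convergent_def by blast
    have lK: "l \<in> K" using closed_sequentially[OF closed sK l] .
    have "(\<lambda>n. norm (s n - l)) \<longlonglongrightarrow> 0" using l by (simp add: LIM_zero_iff tendsto_norm_zero)
    then show "\<exists>x\<in>carrier ?A. (\<lambda>n. cnorm ?A (s n \<ominus>\<^bsub>?A\<^esub> x)) \<longlonglongrightarrow> 0"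
      using lK by (intro bexI[of _ l]) (simp_all add: minus[OF sK lK])
  qed
qed

lemma op_alg_minus:
  assumes "cstar_algebra (op_alg K e)" "x \<in> K" "y \<in> K"
  shows "x \<ominus>\<^bsub>op_alg K e\<^esub> y = x - y"
proof -
  interpret cstar_algebra "op_alg K e" by fact
  have "\<ominus>\<^bsub>op_alg K e\<^esub> y = - y" using smult_minus1[of y] assms by (simp add: opscl_assoc)
  then show ?thesis by (simp add: minus_eq)
qed

lemma op_alg_finsum:
  assumes "cstar_algebra (op_alg K e)" "\<And>k. k < n \<Longrightarrow> x k \<in> K"
  shows "(\<Oplus>\<^bsub>op_alg K e\<^esub>k\<in>{..<n::nat}. x k) = (\<Sum>k<n. x k)"
proof -
  interpret cstar_algebra "op_alg K e" by fact
  show ?thesis using assms(2)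
    by (induction n) (simp_all add: finsum_lessThan_Suc)
qed

lemma closure_binary:
  fixes f :: "'a::metric_space \<Rightarrow> 'b::metric_space \<Rightarrow> 'c::metric_space"
  assumes "\<And>x y X Y. X \<longlonglongrightarrow> x \<Longrightarrow> Y \<longlonglongrightarrow> y \<Longrightarrow> (\<lambda>n. f (X n) (Y n)) \<longlonglongrightarrow> f x y"
    and "\<And>x y. x \<in> S \<Longrightarrow> y \<in> T \<Longrightarrow> f x y \<in> U"
    and "x \<in> closure S" "y \<in> closure T"
  shows "f x y \<in> closure U"
  using assms unfolding closure_sequential by (metis (no_types, lifting))

text \<open>As \<open>S\<close> is closed under products, complex scalars and adjoints, its real
  span is already a *-algebra with unit \<open>e\<close>, and all operations pass to the closure.
  The third conclusion is what allows \<open>star\<close> to be evaluated on the closure.\<close>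

lemma op_alg_generated:
  assumes e: "e \<in> S" and mult: "\<And>f g. \<lbrakk>f \<in> S; g \<in> S\<rbrakk> \<Longrightarrow> f o\<^sub>L g \<in> S"
    and scl: "\<And>c f. f \<in> S \<Longrightarrow> opscl c f \<in> S"
    and adj: "\<And>f. f \<in> S \<Longrightarrow> \<exists>g\<in>S. adj f g"
    and unit: "\<And>f. f \<in> S \<Longrightarrow> e o\<^sub>L f = f" "\<And>f. f \<in> S \<Longrightarrow> f o\<^sub>L e = f"
  shows "cstar_algebra (op_alg (closure (span S)) e)"
    and "dense_sums (op_alg (closure (span S)) e) S"
    and "h \<in> closure (span S) \<Longrightarrow> \<exists>g. adj h g"
proof -
  let ?K = "closure (span S)" let ?A = "op_alg ?K e"
  have SK: "S \<subseteq> ?K" using span_superset closure_subset by blast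
  have span_mult1: "f o\<^sub>L g \<in> span S" if f: "f \<in> S" and g: "g \<in> span S" for f g
    using g
  proof (induction rule: span_induct_alt)
    case base then show ?case by (simp add: span_zero)
  next
    case (step c x y)
    have "f o\<^sub>L (c *\<^sub>R x + y) = c *\<^sub>R (f o\<^sub>L x) + (f o\<^sub>L y)"
      by (rule blinfun_eqI) (simp add: blinfun.add_left blinfun.add_right blinfun.scaleR_left blinfun.scaleR_right)
    then show ?case using step mult[OF f] by (simp add: span_add span_scale span_base)
  qed
  have span_mult: "f o\<^sub>L g \<in> span S" if f: "f \<in> span S" and g: "g \<in> span S" for f g
    using f
  proof (induction rule: span_induct_alt)
    case base then show ?case by (simp add: span_zero)
  next
    case (step c x y)
    have "(c *\<^sub>R x + y) o\<^sub>L g = c *\<^sub>R (x o\<^sub>L g) + (y o\<^sub>L g)"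
      by (rule blinfun_eqI) (simp add: blinfun.add_left blinfun.scaleR_left)
    then show ?case using step span_mult1[OF _ g] by (simp add: span_add span_scale)
  qed
  have span_scl: "opscl c f \<in> span S" if f: "f \<in> span S" for c f
    using f
  proof (induction rule: span_induct_alt)
    case base
    have "opscl c (0 :: 'a bop) = 0" by (rule blinfun_eqI) (simp add: scl_simps)
    then show ?case by (simp add: span_zero)
  next
    case (step r x y)
    have "opscl c (r *\<^sub>R x + y) = r *\<^sub>R (opscl c x) + opscl c y"
      by (rule blinfun_eqI) (simp add: blinfun.add_left blinfun.scaleR_left scl_simps(1,3) scaleR_l2_def mult.commute)
    then show ?case using step scl by (simp add: span_add span_scale span_base)
  qed
  have span_adj: "\<exists>g\<in>span S. adj f g" if f: "f \<in> span S" for f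
    using f
  proof (induction rule: span_induct_alt)
    case base then show ?case using adj_zero span_zero by blast
  next
    case (step r x y)
    obtain g where g: "g \<in> S" "adj x g" using adj step by blast
    obtain h where h: "h \<in> span S" "adj y h" using step by blast
    have sc: "c *\<^sub>R f = opscl (complex_of_real c) f" for c and f :: "'a bop"
      by (rule blinfun_eqI) (simp add: blinfun.scaleR_left scl_simps)
    have "adj (r *\<^sub>R x + y) (r *\<^sub>R g + h)"
      using adj_add[OF adj_opscl[OF g(2), of "complex_of_real r"] h(2)] by (simp add: sc)
    then show ?case using g h by (meson span_add span_base span_scale)
  qed
  \<comment> \<open>Taking adjoints is isometric, so the adjoints of a convergent sequence are
    Cauchy, and their limit is the adjoint of the limit.\<close>
  have K_adj: "\<exists>g\<in>?K. adj f g" if f: "f \<in> ?K" for f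
  proof -
    obtain p where p: "\<And>n. p n \<in> span S" "p \<longlonglongrightarrow> f" using f by (auto simp: closure_sequential)
    obtain q where q: "\<And>n. q n \<in> span S" "\<And>n. adj (p n) (q n)" using span_adj[OF p(1)] by metis
    have "adj (p m - p n) (q m - q n)" for m n
      using adj_add[OF q(2)[of m] adj_opscl[OF q(2)[of n], of "-1"]] by (simp add: opscl_assoc(3))
    from adj_norm(1)[OF this] have "dist (q m) (q n) = dist (p m) (p n)" for m n by (simp add: dist_norm)
    then have "Cauchy q" using LIMSEQ_imp_Cauchy[OF p(2)] by (simp add: Cauchy_def)
    then obtain g where g: "q \<longlonglongrightarrow> g" using Cauchy_convergent_iff convergent_def by blast
    moreover have "g \<in> ?K" using g q(1) unfolding closure_sequential by blast
    ultimately show ?thesis using adj_tendsto[OF p(2) g q(2)] by blast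
  qed
  have unit': "e o\<^sub>L f = f \<and> f o\<^sub>L e = f" if f: "f \<in> ?K" for f
  proof -
    have sp: "e o\<^sub>L f = f \<and> f o\<^sub>L e = f" if "f \<in> span S" for f
      using that
    proof (induction rule: span_induct_alt)
      case (step r x y)
      then have "\<And>z. e (x z) = x z" "\<And>z. x (e z) = x z" "\<And>z. e (y z) = y z" "\<And>z. y (e z) = y z"
        using unit by (auto simp: blinfun_eq_iff)
      then show ?case
        by (auto simp: blinfun_eq_iff blinfun.add_left blinfun.add_right blinfun.scaleR_left blinfun.scaleR_right)
    qed auto
    have "span S \<subseteq> {f. e o\<^sub>L f = f \<and> f o\<^sub>L e = f}" using sp by blast
    then have "f \<in> closure {f. e o\<^sub>L f = f \<and> f o\<^sub>L e = f}" using f by (rule subsetD[OF closure_mono])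
    moreover have "closed {f. e o\<^sub>L f = f \<and> f o\<^sub>L e = f}"
      by (intro closed_Collect_conj closed_Collect_eq continuous_intros)
    ultimately show ?thesis by (simp add: closure_closed)
  qed
  show "\<exists>g. adj h g" if "h \<in> ?K" using K_adj[OF that] by blast
  show cs: "cstar_algebra ?A"
  proof (rule op_alg_cstar)
    show "f + g \<in> ?K" if "f \<in> ?K" "g \<in> ?K" for f g
      by (rule closure_binary[OF _ _ that]) (auto intro: tendsto_add span_add)
    show "f o\<^sub>L g \<in> ?K" if "f \<in> ?K" "g \<in> ?K" for f g
      by (rule closure_binary[OF _ _ that]) (auto intro: bounded_bilinear.tendsto[OF bounded_bilinear_blinfun_compose] span_mult)
    \<comment> \<open>A unary operation is fed to the binary closure lemma by means of a dummy first
      argument.\<close>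
    show "opscl c f \<in> ?K" if "f \<in> ?K" for c f
      by (rule closure_binary[where f = "\<lambda>_. opscl c" and S = "{0::real}" and x = 0, OF _ _ _ that])
        (auto intro!: tendsto_intros simp: opscl_def intro: span_scl[unfolded opscl_def] bounded_bilinear.tendsto[OF bounded_bilinear_blinfun_compose])
  qed (use SK e K_adj unit' in auto)
  interpret cstar_algebra ?A by (rule cs)
  have sums: "u \<in> sums_of ?A S" if "u \<in> span S" for u
    using that
  proof (induction rule: span_induct_alt)
    case base show ?case using sums_of.zero[of ?A S] by simp
  next
    case (step c x y)
    have "c *\<^sub>R x = opscl (complex_of_real c) x"
      by (rule blinfun_eqI) (simp add: blinfun.scaleR_left scl_simps)
    then show ?case using sums_of.add[OF step(2), of "c *\<^sub>R x"] scl[OF step(1)] by (simp add: add.commute)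
  qed
  show "dense_sums ?A S"
    unfolding dense_sums_def
  proof (intro conjI ballI allI impI)
    show "S \<subseteq> carrier ?A" using SK by simp
    fix x and \<epsilon> :: real assume x: "x \<in> carrier ?A" and "0 < \<epsilon>"
    then obtain u where u: "u \<in> span S" "dist u x < \<epsilon>" by (auto simp: closure_approachable)
    then have "cnorm ?A (x \<ominus>\<^bsub>?A\<^esub> u) < \<epsilon>"
      using op_alg_minus[OF cs, of x u] x closure_subset[of "span S"]
      by (auto simp: dist_norm norm_minus_commute)
    then show "\<exists>u\<in>sums_of ?A S. cnorm ?A (x \<ominus>\<^bsub>?A\<^esub> u) < \<epsilon>" using sums u by blast
  qed
qed

section \<open>Tensor products and direct sums of operators\<close>

lemma clin_comp: "clin f \<Longrightarrow> clin g \<Longrightarrow> clin (f o\<^sub>L g)"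
  by (simp add: clin_def)

lemma clin_add: "clin f \<Longrightarrow> clin g \<Longrightarrow> clin (f + g)"
  by (simp add: clin_def blinfun.add_left scl_simps)

lemma clin_zero: "clin 0"
  by (simp add: clin_def scl_simps)

lemma clin_sum: "(\<And>k. k \<in> S \<Longrightarrow> clin (f k)) \<Longrightarrow> clin (\<Sum>k\<in>S. f k)"
  by (induction S rule: infinite_finite_induct) (auto simp: clin_zero clin_add)

lemma clin_opscl: "clin f \<Longrightarrow> clin (opscl c f)"
  by (simp add: clin_def scl_simps mult.commute)

subsection \<open>Reindexing\<close>

text \<open>Contractive for injective \<open>g\<close> and unitary for bijective \<open>g\<close>;
  every change of index set below goes through it.\<close>

definition reidx :: "('i \<Rightarrow> 'j) \<Rightarrow> 'j l2 \<Rightarrow>\<^sub>L 'i l2" where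
  "reidx g = Blinfun (\<lambda>x. mk (\<lambda>i. ap x (g i)))"

lemma reidx_aux:
  assumes "inj g"
  shows "(\<lambda>i. ap x (g i)) \<in> ell2" "norm (mk (\<lambda>i. ap x (g i))) \<le> norm x"
proof -
  have "(\<Sum>i\<in>F. (cmod (ap x (g i)))\<^sup>2) \<le> (norm x)\<^sup>2" if "finite F" for F
    using sum_le_norm_l2[of "g ` F" x] that assms by (simp add: sum.reindex inj_on_subset[OF assms])
  from mk_norm_le[OF this] show "(\<lambda>i. ap x (g i)) \<in> ell2" "norm (mk (\<lambda>i. ap x (g i))) \<le> norm x"
    by auto
qed

lemma ap_reidx: assumes "inj g" shows "ap (reidx g x) i = ap x (g i)"
proof -
  note m = mk_inverse[OF reidx_aux(1)[OF assms]]
  have "bounded_linear (\<lambda>x. mk (\<lambda>i. ap x (g i)))"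
  proof (rule bounded_linear_intro[of _ 1])
    fix x y :: "'b l2" and r
    show "mk (\<lambda>i. ap (x + y) (g i)) = mk (\<lambda>i. ap x (g i)) + mk (\<lambda>i. ap y (g i))"
      by (rule l2_eqI) (simp only: m, simp only: ap_simps(2) m)
    show "mk (\<lambda>i. ap (r *\<^sub>R x) (g i)) = r *\<^sub>R mk (\<lambda>i. ap x (g i))"
      by (rule l2_eqI) (simp only: m, simp only: scaleR_l2_def ap_simps(5) m)
    show "norm (mk (\<lambda>i. ap x (g i))) \<le> norm x * 1" using reidx_aux(2)[OF assms] by simp
  qed
  then show ?thesis using reidx_aux(1)[OF assms] by (simp add: reidx_def bounded_linear_Blinfun_apply mk_inverse)
qed

lemma clin_reidx: "inj g \<Longrightarrow> clin (reidx g)"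
  by (auto simp: clin_def ap_reidx intro!: l2_eqI)

lemma norm_reidx_le: "inj g \<Longrightarrow> norm (reidx g x) \<le> norm x"
  using reidx_aux[of g x] by (metis ap_inverse ap_reidx ext)

lemma reidx_dl: "bij g \<Longrightarrow> reidx g (dl j) = dl (inv_into UNIV g j)"
  by (rule l2_eqI) (auto simp: ap_reidx bij_is_inj bij_is_surj surj_f_inv_f inv_f_f)

lemma reidx_inv: "bij g \<Longrightarrow> reidx g (reidx (inv_into UNIV g) x) = x" "bij g \<Longrightarrow> reidx (inv_into UNIV g) (reidx g y) = y"
  by (auto intro!: l2_eqI simp: ap_reidx bij_is_inj bij_imp_bij_inv surj_f_inv_f bij_is_surj)

lemma adj_reidx: "bij g \<Longrightarrow> adj (reidx g) (reidx (inv_into UNIV g))"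
  by (rule adj_dl)
    (auto simp: clin_reidx bij_is_inj bij_imp_bij_inv cip_dl ap_reidx reidx_dl inv_inv_eq
      surj_f_inv_f bij_is_surj)

text \<open>Conjugation by the unitary that a bijection induces.\<close>

definition cj :: "('i \<Rightarrow> 'j) \<Rightarrow> 'i bop \<Rightarrow> 'j bop" where
  "cj g f = reidx (inv_into UNIV g) o\<^sub>L f o\<^sub>L reidx g"

lemma cj_apply: "cj g f x = reidx (inv_into UNIV g) (f (reidx g x))"
  by (simp add: cj_def)

context
  fixes g :: "'i \<Rightarrow> 'j" assumes g: "bij g"
begin

lemma cj_comp: "cj g (f o\<^sub>L f') = cj g f o\<^sub>L cj g f'"
  by (rule blinfun_eqI) (simp add: cj_def reidx_inv(1)[OF g])

lemma cj_add: "cj g (f + f') = cj g f + cj g f'"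
  by (rule blinfun_eqI) (simp add: cj_def blinfun.add_left blinfun.add_right)

lemma cj_zero: "cj g 0 = 0"
  by (rule blinfun_eqI) (simp add: cj_def)

lemma cj_sum: "cj g (\<Sum>k\<in>S. f k) = (\<Sum>k\<in>S. cj g (f k))"
  by (induction S rule: infinite_finite_induct) (auto simp: cj_add cj_zero)

lemma cj_opscl: "cj g (opscl c f) = opscl c (cj g f)"
  by (rule blinfun_eqI) (simp add: cj_def clinD[OF clin_reidx] bij_is_inj bij_imp_bij_inv g)

lemma clin_cj: "clin f \<Longrightarrow> clin (cj g f)"
  unfolding cj_def by (intro clin_comp clin_reidx bij_is_inj bij_imp_bij_inv g)

lemma adj_cj: "adj f f' \<Longrightarrow> adj (cj g f) (cj g f')"
  using adj_reidx[OF g] adj_sym[OF adj_reidx[OF g]] by (simp add: adj_def cj_def)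

lemma norm_cj: "norm (cj g f) = norm f"
proof (rule antisym)
  have i: "inj g" "inj (inv_into UNIV g)" using g by (auto simp: bij_is_inj bij_imp_bij_inv)
  have le: "norm (cj g f x) \<le> norm f * norm x" for f x
    using norm_reidx_le[OF i(2), of "f (reidx g x)"] norm_blinfun[of f "reidx g x"]
      mult_left_mono[OF norm_reidx_le[OF i(1), of x], of "norm f"] by (simp add: cj_def)
  show "norm (cj g f) \<le> norm f" by (rule norm_blinfun_bound[OF _ le]) simp
  show "norm f \<le> norm (cj g f)"
  proof (rule norm_blinfun_bound)
    fix x
    have "f x = reidx g (cj g f (reidx (inv_into UNIV g) x))" by (simp add: cj_def reidx_inv[OF g])
    also have "norm \<dots> \<le> norm (cj g f) * norm (reidx (inv_into UNIV g) x)"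
      using norm_reidx_le[OF i(1)] norm_blinfun order_trans by blast
    also have "\<dots> \<le> norm (cj g f) * norm x"
      by (intro mult_left_mono norm_reidx_le i) auto
    finally show "norm (f x) \<le> norm (cj g f) * norm x" .
  qed simp
qed

end

subsection \<open>Direct sums\<close>

definition slice :: "('j \<times> 'i) l2 \<Rightarrow> 'j \<Rightarrow> 'i l2" where
  "slice x j = mk (\<lambda>i. ap x (j, i))"

lemma ap_slice [simp]: "ap (slice x j) i = ap x (j, i)"
proof -
  have "(\<lambda>i. ap x (j, i)) \<in> ell2"
    using ap_reidx[of "Pair j" x] reidx_aux(1)[of "Pair j" x] by (simp add: inj_on_def)
  then show ?thesis by (simp add: slice_def mk_inverse)
qed

lemma slice_simps: "slice (x + y) j = slice x j + slice y j" "slice (scl c x) j = scl c (slice x j)"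
  by (auto intro: l2_eqI)

lemma sum_norm_slice_le:
  assumes "finite J" shows "(\<Sum>j\<in>J. (norm (slice x j))\<^sup>2) \<le> (norm x)\<^sup>2"
proof -
  let ?f = "\<lambda>j i. (cmod (ap x (j, i)))\<^sup>2"
  have s: "(\<lambda>(j, i). ?f j i) summable_on UNIV" using ap_summable[of x] by (simp add: case_prod_unfold)
  have s': "(\<lambda>(j, i). ?f j i) summable_on J \<times> UNIV" by (rule summable_on_subset_banach[OF s]) auto
  have "(\<Sum>j\<in>J. (norm (slice x j))\<^sup>2) = (\<Sum>\<^sub>\<infinity>j\<in>J. infsum (?f j) UNIV)"
    using assms by (simp add: norm_l2_sq)
  also have "\<dots> = infsum (\<lambda>(j, i). ?f j i) (J \<times> UNIV)" by (rule infsum_Sigma'_banach[OF s'])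
  also have "\<dots> \<le> infsum (\<lambda>(j, i). ?f j i) UNIV"
    by (rule infsum_mono2[OF s' s]) auto
  also have "\<dots> = (norm x)\<^sup>2" by (simp add: norm_l2_sq case_prod_unfold)
  finally show ?thesis .
qed

text \<open>The block-diagonal operator on a direct sum of copies of one Hilbert space, meant for
  families that are bounded in norm.\<close>

definition diag :: "('j \<Rightarrow> 'i bop) \<Rightarrow> ('j \<times> 'i) bop" where
  "diag F = Blinfun (\<lambda>x. mk (\<lambda>(j, i). ap (F j (slice x j)) i))"

lemma diag_aux:
  fixes F :: "'j \<Rightarrow> 'i bop"
  assumes M: "\<And>j. norm (F j) \<le> M"
  shows "(\<lambda>(j, i). ap (F j (slice x j)) i) \<in> ell2" "norm (mk (\<lambda>(j, i). ap (F j (slice x j)) i)) \<le> M * norm x"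
proof -
  have M0: "0 \<le> M" using M norm_ge_zero order_trans by blast
  have "(\<Sum>p\<in>P. (cmod ((\<lambda>(j, i). ap (F j (slice x j)) i) p))\<^sup>2) \<le> (M * norm x)\<^sup>2" if P: "finite P" for P
  proof -
    \<comment> \<open>A finite set of index pairs lies in the rectangle spanned by its projections,
      and over a rectangle the sum splits into blocks.\<close>
    have "(\<Sum>p\<in>P. (cmod ((\<lambda>(j, i). ap (F j (slice x j)) i) p))\<^sup>2)
        \<le> (\<Sum>p\<in>fst ` P \<times> snd ` P. (cmod ((\<lambda>(j, i). ap (F j (slice x j)) i) p))\<^sup>2)"
      using P by (intro sum_mono2) (auto intro: rev_image_eqI)
    also have "\<dots> = (\<Sum>j\<in>fst ` P. \<Sum>i\<in>snd ` P. (cmod (ap (F j (slice x j)) i))\<^sup>2)"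
      by (simp add: sum.cartesian_product case_prod_unfold)
    also have "\<dots> \<le> (\<Sum>j\<in>fst ` P. (norm (F j (slice x j)))\<^sup>2)"
      using P by (intro sum_mono sum_le_norm_l2) auto
    also have "\<dots> \<le> (\<Sum>j\<in>fst ` P. M\<^sup>2 * (norm (slice x j))\<^sup>2)"
    proof (rule sum_mono)
      fix j
      have "norm (F j (slice x j)) \<le> M * norm (slice x j)"
        using norm_blinfun[of "F j" "slice x j"] mult_right_mono[OF M[of j], of "norm (slice x j)"] by simp
      then have "(norm (F j (slice x j)))\<^sup>2 \<le> (M * norm (slice x j))\<^sup>2" by (intro power_mono) auto
      then show "(norm (F j (slice x j)))\<^sup>2 \<le> M\<^sup>2 * (norm (slice x j))\<^sup>2" by (simp add: power_mult_distrib)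
    qed
    also have "\<dots> \<le> M\<^sup>2 * (norm x)\<^sup>2"
      unfolding sum_distrib_left[symmetric] using P by (intro mult_left_mono sum_norm_slice_le) auto
    finally show ?thesis by (simp add: power_mult_distrib)
  qed
  from mk_norm_le[OF this] M0
  show "(\<lambda>(j, i). ap (F j (slice x j)) i) \<in> ell2" "norm (mk (\<lambda>(j, i). ap (F j (slice x j)) i)) \<le> M * norm x"
    by auto
qed

lemma bounded_linear_diag:
  fixes F :: "'j \<Rightarrow> 'i bop"
  assumes M: "\<And>j. norm (F j) \<le> M"
  shows "bounded_linear (\<lambda>x. mk (\<lambda>(j, i). ap (F j (slice x j)) i))"
proof (rule bounded_linear_intro[of _ M])
  fix x y :: "('j \<times> 'i) l2" and r
  note m = mk_inverse[OF diag_aux(1)[OF M]]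
  show "mk (\<lambda>(j, i). ap (F j (slice (x + y) j)) i)
      = mk (\<lambda>(j, i). ap (F j (slice x j)) i) + mk (\<lambda>(j, i). ap (F j (slice y j)) i)"
    by (rule l2_eqI) (simp only: m, simp only: ap_simps(2) m slice_simps blinfun.add_right split: prod.splits, simp)
  have rr: "slice (r *\<^sub>R x) j = r *\<^sub>R slice x j" for j by (simp add: scaleR_l2_def slice_simps)
  show "mk (\<lambda>(j, i). ap (F j (slice (r *\<^sub>R x) j)) i) = r *\<^sub>R mk (\<lambda>(j, i). ap (F j (slice x j)) i)"
    by (intro l2_eqI) (simp only: m, simp only: rr blinfun.scaleR_right, simp only: scaleR_l2_def ap_simps(5) m split: prod.splits, simp)
  show "norm (mk (\<lambda>(j, i). ap (F j (slice x j)) i)) \<le> norm x * M"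
    using diag_aux(2)[OF M] by (simp add: mult.commute)
qed

lemma ap_diag: "bounded (range F) \<Longrightarrow> ap (diag F x) (j, i) = ap (F j (slice x j)) i"
proof -
  assume "bounded (range F)"
  then obtain M where M: "\<And>j. norm (F j) \<le> M" by (auto simp: bounded_iff)
  show ?thesis
    by (simp add: diag_def bounded_linear_Blinfun_apply[OF bounded_linear_diag[OF M]] mk_inverse[OF diag_aux(1)[OF M]])
qed

lemma slice_diag: "bounded (range F) \<Longrightarrow> slice (diag F x) j = F j (slice x j)"
  by (rule l2_eqI) (simp add: ap_diag)

lemma norm_diag_le: assumes M: "\<And>j. norm (F j) \<le> M" shows "norm (diag F) \<le> M"
proof (rule norm_blinfun_bound)
  show "0 \<le> M" using M norm_ge_zero order_trans by blast
  show "norm (diag F x) \<le> M * norm x" for x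
    using diag_aux(2)[OF M] by (simp add: diag_def bounded_linear_Blinfun_apply[OF bounded_linear_diag[OF M]])
qed

lemma diag_eqI: fixes f g :: "'k l2 \<Rightarrow>\<^sub>L ('j \<times> 'i) l2" shows "(\<And>x j. slice (f x) j = slice (g x) j) \<Longrightarrow> f = g"
proof (intro blinfun_eqI l2_eqI)
  fix x p assume *: "\<And>x j. slice (f x) j = slice (g x) j"
  show "ap (f x) p = ap (g x) p" using *[of x "fst p"] ap_slice by (metis prod.collapse)
qed

lemma bounded_range_ops:
  fixes F G :: "'j \<Rightarrow> 'i bop"
  assumes "bounded (range F)" "bounded (range G)"
  shows "bounded (range (\<lambda>j. F j + G j))" "bounded (range (\<lambda>j. F j o\<^sub>L G j))"
    "bounded (range (\<lambda>j. opscl c (F j)))"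
proof -
  obtain M N where "\<And>j. norm (F j) \<le> M" and "\<And>j. norm (G j) \<le> N"
    using assms by (auto simp: bounded_iff)
  note MN = this
  have M0: "0 \<le> M" using MN(1) norm_ge_zero order_trans by blast
  have "norm (F j + G j) \<le> M + N" for j by (rule norm_triangle_mono[OF MN])
  then show "bounded (range (\<lambda>j. F j + G j))" by (auto simp: bounded_iff)
  have "norm (F j o\<^sub>L G j) \<le> M * N" for j
    using norm_blinfun_compose[of "F j" "G j"] mult_mono[OF MN M0 norm_ge_zero] order_trans by blast
  then show "bounded (range (\<lambda>j. F j o\<^sub>L G j))" by (auto simp: bounded_iff)
  have "norm (opscl c (F j)) \<le> cmod c * M" for j
    unfolding norm_opscl by (intro mult_left_mono MN) auto
  then show "bounded (range (\<lambda>j. opscl c (F j)))" by (auto simp: bounded_iff)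
qed

lemma slice_zero: "slice 0 j = 0"
  by (rule l2_eqI) simp

lemma diag_zero: "diag (\<lambda>_. 0) = 0"
  by (rule diag_eqI) (subst slice_diag; simp add: slice_zero)

lemma diag_add: "bounded (range F) \<Longrightarrow> bounded (range G) \<Longrightarrow> diag (\<lambda>j. F j + G j) = diag F + diag G"
  by (rule diag_eqI) (simp add: slice_diag bounded_range_ops slice_simps blinfun.add_left)

lemma diag_comp: "bounded (range F) \<Longrightarrow> bounded (range G) \<Longrightarrow> diag (\<lambda>j. F j o\<^sub>L G j) = diag F o\<^sub>L diag G"
  by (rule diag_eqI) (simp add: slice_diag bounded_range_ops)

lemma diag_opscl: "bounded (range F) \<Longrightarrow> diag (\<lambda>j. opscl c (F j)) = opscl c (diag F)"
  by (rule diag_eqI) (simp add: slice_diag bounded_range_ops slice_simps)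

lemma clin_diag: "bounded (range F) \<Longrightarrow> (\<And>j. clin (F j)) \<Longrightarrow> clin (diag F)"
  unfolding clin_def by (intro allI l2_eqI) (auto simp: ap_diag slice_simps clinD[unfolded clin_def])

lemma bounded_range_sum:
  assumes "\<And>k. k < n \<Longrightarrow> bounded (range (F k))"
  shows "bounded (range (\<lambda>j. \<Sum>k<n::nat. F k j :: 'i bop))"
  using assms by (induction n) (auto intro: bounded_range_ops(1))

lemma diag_sum:
  fixes F :: "nat \<Rightarrow> 'j \<Rightarrow> 'i bop"
  assumes "\<And>k. k < n \<Longrightarrow> bounded (range (F k))"
  shows "diag (\<lambda>j. \<Sum>k<n. F k j) = (\<Sum>k<n. diag (F k))"
  using assms by (induction n) (auto simp: diag_zero diag_add bounded_range_sum)

subsection \<open>Tensor products of vectors\<close>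

definition vten :: "'i l2 \<Rightarrow> 'j l2 \<Rightarrow> ('i \<times> 'j) l2" where
  "vten x y = mk (\<lambda>(i, j). ap x i * ap y j)"

lemma vten_aux:
  "(\<lambda>(i, j). ap x i * ap y j) \<in> ell2" "norm (mk (\<lambda>(i, j). ap x i * ap y j)) \<le> norm x * norm y"
proof -
  have "(\<Sum>p\<in>P. (cmod ((\<lambda>(i, j). ap x i * ap y j) p))\<^sup>2) \<le> (norm x * norm y)\<^sup>2" if P: "finite P" for P
  proof -
    have "(\<Sum>p\<in>P. (cmod ((\<lambda>(i, j). ap x i * ap y j) p))\<^sup>2)
        \<le> (\<Sum>p\<in>fst ` P \<times> snd ` P. (cmod ((\<lambda>(i, j). ap x i * ap y j) p))\<^sup>2)"
      using P by (intro sum_mono2) (auto intro: rev_image_eqI)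
    also have "\<dots> = (\<Sum>i\<in>fst ` P. (cmod (ap x i))\<^sup>2) * (\<Sum>j\<in>snd ` P. (cmod (ap y j))\<^sup>2)"
      by (simp add: sum_product sum.cartesian_product case_prod_unfold norm_mult power_mult_distrib)
    also have "\<dots> \<le> (norm x)\<^sup>2 * (norm y)\<^sup>2"
      using P by (intro mult_mono sum_le_norm_l2 sum_nonneg) auto
    finally show ?thesis by (simp add: power_mult_distrib)
  qed
  from mk_norm_le[OF this] show "(\<lambda>(i, j). ap x i * ap y j) \<in> ell2"
    "norm (mk (\<lambda>(i, j). ap x i * ap y j)) \<le> norm x * norm y" by auto
qed

lemma ap_vten [simp]: "ap (vten x y) (i, j) = ap x i * ap y j"
  by (simp add: vten_def mk_inverse[OF vten_aux(1)])

lemma vten_eqI: "(\<And>i j. ap x (i, j) = ap y (i, j)) \<Longrightarrow> x = y"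
  by (rule l2_eqI) (metis prod.collapse)

lemma vten_add: "vten (x + x') y = vten x y + vten x' y" "vten x (y + y') = vten x y + vten x y'"
  by (rule vten_eqI; simp add: algebra_simps)+

lemma vten_scl: "vten (scl c x) y = scl c (vten x y)" "vten x (scl c y) = scl c (vten x y)"
  by (rule vten_eqI; simp)+

lemma vten_dl: "vten (dl i) (dl j) = dl (i, j)"
  by (rule vten_eqI) auto

lemma bounded_bilinear_vten: "bounded_bilinear vten"
  by (rule bounded_bilinear.intro)
    (auto simp: vten_add vten_scl scaleR_l2_def vten_aux(2)[folded vten_def] intro!: exI[of _ 1])

lemma cip_vten: "cip (vten x y) (vten x' y') = cip x x' * cip y y'"
proof -
  interpret cip: bounded_bilinear cip by (rule bounded_bilinear_cip)
  interpret vten: bounded_bilinear vten by (rule bounded_bilinear_vten)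
  note cont = continuous_intros cip.continuous_on vten.continuous_on closed_Collect_eq
  note [simp] = vten_add vten_scl cip_add_left cip_add_right cip_scl_left cip_scl_right
  have 1: "cip (vten (dl i) (dl j)) (vten x' y') = cip (dl i) x' * cip (dl j) y'" for i j
    by (simp add: vten_dl cip_dl)
  have 2: "cip (vten (dl i) y) (vten x' y') = cip (dl i) x' * cip y y'" for i
    by (induction y rule: l2_induct) (auto simp: 1 algebra_simps intro!: cont)
  show ?thesis
    by (induction x rule: l2_induct) (auto simp: 2 algebra_simps intro!: cont)
qed

lemma norm_vten: "norm (vten x y) = norm x * norm y"
proof -
  have "complex_of_real ((norm z)\<^sup>2) = cip z z" for z :: "'c l2" by (simp add: cip_self norm_l2_sq)
  then have "complex_of_real ((norm (vten x y))\<^sup>2) = complex_of_real ((norm x)\<^sup>2 * (norm y)\<^sup>2)"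
    by (metis cip_vten of_real_mult)
  then have "(norm (vten x y))\<^sup>2 = (norm x * norm y)\<^sup>2"
    by (simp only: of_real_eq_iff power_mult_distrib)
  then show ?thesis by simp
qed

lemma slice_vten: "slice (vten x y) j = scl (ap x j) y"
  by (rule l2_eqI) simp

lemma diag_vten: "bounded (range F) \<Longrightarrow> diag F (vten (dl j) y) = vten (dl j) (F j y)"
  by (rule vten_eqI) (simp add: ap_diag slice_vten scl_simps)

text \<open>Vectors supported in the single block \<open>j\<close> are mapped by \<open>F j\<close>
  alone.\<close>

lemma norm_diag_ge: assumes "bounded (range F)" shows "norm (F j) \<le> norm (diag F)"
proof (rule norm_blinfun_bound)
  show "norm (F j x) \<le> norm (diag F) * norm x" for x
    using norm_blinfun[of "diag F" "vten (dl j) x"] by (simp add: diag_vten[OF assms] norm_vten)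
qed simp

lemma adj_diag:
  fixes F G :: "'j \<Rightarrow> 'i bop"
  assumes "bounded (range F)" "bounded (range G)" "\<And>j. adj (F j) (G j)"
  shows "adj (diag F) (diag G)"
proof (rule adj_dl)
  have cl: "clin (F j)" "clin (G j)" for j using assms(3) adj_clin adj_sym by blast+
  show "clin (diag F)" "clin (diag G)" by (intro clin_diag assms cl)+
  fix k l :: "'j \<times> 'i"
  obtain k1 k2 l1 l2 where kl: "k = (k1, k2)" "l = (l1, l2)" by (cases k, cases l)
  show "cip (diag F (dl k)) (dl l) = cip (dl k) (diag G (dl l))"
    unfolding kl vten_dl[symmetric] diag_vten[OF assms(1)] diag_vten[OF assms(2)] cip_vten
    using assms(3)[of k1] by (auto simp: adj_def cip_dl)
qed

subsection \<open>Tensor products of operators\<close>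

text \<open>\<open>diag\<close> of a constant family is 1 \<otimes> \<open>T\<close>, and the same
  construction conjugated by the coordinate swap is \<open>S\<close> \<otimes> 1. This mirrors
  \<open>operator_tensor\<close> and yields the norm bound without any estimate on sums of product
  vectors.\<close>

definition ten :: "'i bop \<Rightarrow> 'j bop \<Rightarrow> ('i \<times> 'j) bop" where
  "ten S T = cj prod.swap (diag (\<lambda>_. S)) o\<^sub>L diag (\<lambda>_. T)"

lemma bij_prod_swap: "bij (prod.swap :: 'a \<times> 'b \<Rightarrow> 'b \<times> 'a)"
  by (rule bijI') auto

lemma inv_prod_swap: "inv_into UNIV (prod.swap :: 'a \<times> 'b \<Rightarrow> 'b \<times> 'a) = prod.swap"
  by (rule inv_equality) auto

lemma reidx_swap_vten: "reidx prod.swap (vten x y) = vten y x"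
  by (rule vten_eqI) (simp add: ap_reidx)

lemma clin_ten: "clin S \<Longrightarrow> clin T \<Longrightarrow> clin (ten S T)"
  unfolding ten_def by (intro clin_comp clin_cj clin_diag bij_prod_swap) auto

lemma diag_const_vten: "clin T \<Longrightarrow> diag (\<lambda>_. T) (vten x y) = vten x (T y)"
  by (rule vten_eqI) (simp add: ap_diag slice_vten clinD)

lemma ten_vten: "clin S \<Longrightarrow> clin T \<Longrightarrow> ten S T (vten x y) = vten (S x) (T y)"
  by (simp add: ten_def cj_apply inv_prod_swap reidx_swap_vten diag_const_vten)

lemma norm_ten_le:
  fixes S :: "'i bop" and T :: "'j bop"
  shows "norm (ten S T) \<le> norm S * norm T"
proof -
  have "norm (ten S T) \<le> norm (diag (\<lambda>_::'j. S)) * norm (diag (\<lambda>_::'i. T))"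
    unfolding ten_def
    by (rule order_trans[OF norm_blinfun_compose]) (simp add: norm_cj[OF bij_prod_swap])
  also have "\<dots> \<le> norm S * norm T"
    by (intro mult_mono norm_diag_le) auto
  finally show ?thesis .
qed

lemma ten_eqI:
  assumes "clin f" "clin g" "\<And>x y. f (vten x y) = g (vten x y)"
  shows "f = g"
proof (rule blinfun_eq_dl[OF assms(1,2)])
  show "f (dl k) = g (dl k)" for k using assms(3)[of "dl (fst k)" "dl (snd k)"] by (simp add: vten_dl)
qed

lemma ten_add:
  "\<lbrakk>clin S; clin S'; clin T\<rbrakk> \<Longrightarrow> ten (S + S') T = ten S T + ten S' T"
  "\<lbrakk>clin S; clin T; clin T'\<rbrakk> \<Longrightarrow> ten S (T + T') = ten S T + ten S T'"
  by (rule ten_eqI; simp add: clin_ten clin_add ten_vten blinfun.add_left vten_add)+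

lemma ten_opscl:
  "\<lbrakk>clin S; clin T\<rbrakk> \<Longrightarrow> ten (opscl c S) T = opscl c (ten S T)"
  "\<lbrakk>clin S; clin T\<rbrakk> \<Longrightarrow> ten S (opscl c T) = opscl c (ten S T)"
  by (rule ten_eqI; simp add: clin_ten clin_opscl ten_vten vten_scl)+

lemma ten_comp:
  "\<lbrakk>clin S; clin S'; clin T; clin T'\<rbrakk> \<Longrightarrow> ten S T o\<^sub>L ten S' T' = ten (S o\<^sub>L S') (T o\<^sub>L T')"
  by (rule ten_eqI) (simp_all add: clin_ten clin_comp ten_vten)

lemma adj_ten:
  assumes "adj S S'" "adj T T'" shows "adj (ten S T) (ten S' T')"
proof (rule adj_dl)
  have cl: "clin S" "clin S'" "clin T" "clin T'" using assms adj_clin adj_sym by blast+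
  then show "clin (ten S T)" "clin (ten S' T')" by (auto intro: clin_ten)
  show "cip (ten S T (dl k)) (dl l) = cip (dl k) (ten S' T' (dl l))" for k l
    using assms by (cases k; cases l) (simp add: vten_dl[symmetric] ten_vten cl cip_vten adj_def)
qed

lemma cj_swap_ten: "clin S \<Longrightarrow> clin T \<Longrightarrow> cj prod.swap (ten S T) = ten T S"
  by (rule ten_eqI) (simp_all add: clin_ten clin_cj bij_prod_swap cj_apply reidx_swap_vten ten_vten inv_prod_swap)

subsection \<open>Operators given as functions\<close>

definition opL :: "'i operator \<Rightarrow> 'i bop" where
  "opL T = Blinfun (\<lambda>x. mk (T (ap x)))"

lemma ap_opL:
  assumes T: "bounded_operator T" shows "ap (opL T x) = T (ap x)"
proof -
  note T' = T[unfolded bounded_operator_def]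
  have ell: "T (ap x) \<in> ell2" for x using T' by simp
  obtain M where M: "\<And>\<xi>. \<xi> \<in> ell2 \<Longrightarrow> ell2_norm (T \<xi>) \<le> M * ell2_norm \<xi>" using T' by blast
  have "bounded_linear (\<lambda>x. mk (T (ap x)))"
  proof (rule bounded_linear_intro[of _ M])
    fix x y :: "'a l2" and r
    have "ap (x + y) = (\<lambda>i. ap x i + ap y i)" "ap (r *\<^sub>R x) = (\<lambda>i. complex_of_real r * ap x i)"
      by (auto simp: scaleR_l2_def)
    then have eq: "T (ap (x + y)) = (\<lambda>i. T (ap x) i + T (ap y) i)"
        "T (ap (r *\<^sub>R x)) = (\<lambda>i. complex_of_real r * T (ap x) i)"
      using T' by auto
    note m = mk_inverse[OF ell]
    show "mk (T (ap (x + y))) = mk (T (ap x)) + mk (T (ap y))"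
      by (rule l2_eqI) (simp only: m, simp only: eq ap_simps(2) m)
    show "mk (T (ap (r *\<^sub>R x))) = r *\<^sub>R mk (T (ap x))"
      by (rule l2_eqI) (simp only: m, simp only: eq, simp only: scaleR_l2_def ap_simps(5) m)
    show "norm (mk (T (ap x))) \<le> norm x * M"
      using M[of "ap x"] ell by (simp add: norm_eq_ell2_norm mk_inverse mult.commute)
  qed
  then show ?thesis by (simp add: opL_def bounded_linear_Blinfun_apply mk_inverse ell)
qed

lemma operator_norm_eq:
  fixes f :: "'i bop"
  assumes "\<And>x. ap (f x) = T (ap x)" shows "operator_norm T = norm f"
proof -
  let ?S = "{ell2_norm (T \<xi>) |\<xi>. \<xi> \<in> ell2 \<and> ell2_norm \<xi> \<le> 1}"
  have S: "?S = {norm (f x) |x. norm x \<le> 1}" (is "_ = ?S'")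
  proof safe
    fix \<xi> :: "'i \<Rightarrow> complex" assume \<xi>: "\<xi> \<in> ell2" "ell2_norm \<xi> \<le> 1"
    then show "\<exists>x. ell2_norm (T \<xi>) = norm (f x) \<and> norm x \<le> 1"
      using assms[of "mk \<xi>"] by (intro exI[of _ "mk \<xi>"]) (simp add: norm_eq_ell2_norm mk_inverse)
  next
    fix x :: "'i l2" assume "norm x \<le> 1"
    then show "\<exists>\<xi>. norm (f x) = ell2_norm (T \<xi>) \<and> \<xi> \<in> ell2 \<and> ell2_norm \<xi> \<le> 1"
      using assms[of x] by (intro exI[of _ "ap x"]) (simp add: norm_eq_ell2_norm)
  qed
  have le: "norm (f x) \<le> norm f" if "norm x \<le> 1" for x
    using norm_blinfun[of f x] mult_left_mono[OF that norm_ge_zero[of f]] by simp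
  have bdd: "bdd_above ?S'" by (rule bdd_aboveI[of _ "norm f"]) (auto intro: le)
  have "norm f \<le> Sup ?S'"
  proof (rule norm_blinfun_bound)
    have "norm (f 0) \<in> ?S'" by (intro CollectI exI[of _ 0]) simp
    then show "0 \<le> Sup ?S'" using cSup_upper[OF _ bdd] by fastforce
    fix x
    show "norm (f x) \<le> Sup ?S' * norm x"
    proof (cases "x = 0")
      case False
      let ?y = "inverse (norm x) *\<^sub>R x"
      have "norm (f ?y) \<le> Sup ?S'" using False by (intro cSup_upper bdd) auto
      then show ?thesis using False by (simp add: blinfun.scaleR_right field_simps)
    qed simp
  qed
  moreover have "Sup ?S' \<le> norm f" by (rule cSup_least) (auto intro: le exI[of _ 0])
  ultimately show ?thesis unfolding operator_norm_def S by simp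
qed

lemma ap_ten_opL:
  assumes S: "bounded_operator S" and T: "bounded_operator T"
  shows "ap (ten (opL S) (opL T) x) p = operator_tensor S T (ap x) p"
proof -
  obtain i j where p: "p = (i, j)" by (cases p)
  let ?y = "diag (\<lambda>_. opL T) x"
  have 1: "ap ?y (i', j') = T (\<lambda>j'. ap x (i', j')) j'" for i' j'
  proof -
    have "ap (slice x i') = (\<lambda>j'. ap x (i', j'))" by auto
    then show ?thesis by (simp add: ap_diag ap_opL[OF T])
  qed
  have 2: "ap (slice (reidx prod.swap ?y) j) = (\<lambda>i'. T (\<lambda>j'. ap x (i', j')) j)"
    by (auto simp: ap_reidx 1)
  have "ap (ten (opL S) (opL T) x) (i, j) = ap (diag (\<lambda>_. opL S) (reidx prod.swap ?y)) (j, i)"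
    by (simp add: ten_def cj_apply inv_prod_swap ap_reidx)
  also have "\<dots> = S (\<lambda>i'. T (\<lambda>j'. ap x (i', j')) j) i"
    by (simp add: ap_diag ap_opL[OF S] 2)
  finally show ?thesis by (simp add: p operator_tensor_def)
qed

lemma operator_norm_tensor_sum:
  assumes "\<And>k. k < n \<Longrightarrow> bounded_operator (S k)" "\<And>k. k < n \<Longrightarrow> bounded_operator (T k)"
  shows "operator_norm (\<lambda>\<xi> p. \<Sum>k<n::nat. operator_tensor (S k) (T k) \<xi> p)
    = norm (\<Sum>k<n. ten (opL (S k)) (opL (T k)))"
  by (rule operator_norm_eq)
    (use assms in \<open>auto simp: fun_eq_iff blinfun.sum_left ap_sum ap_ten_opL intro!: sum.cong\<close>)

section \<open>Representations by operators\<close>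

text \<open>The counterpart of \<open>representation\<close> for typed operators. Degenerate
  representations are included, in particular the zero representation.\<close>

definition trep :: "'a cstar \<Rightarrow> ('a \<Rightarrow> 'i bop) \<Rightarrow> bool" where
  "trep A P \<longleftrightarrow>
     (\<forall>x\<in>carrier A. \<forall>y\<in>carrier A. P (x \<oplus>\<^bsub>A\<^esub> y) = P x + P y) \<and>
     (\<forall>c. \<forall>x\<in>carrier A. P (c \<odot>\<^bsub>A\<^esub> x) = opscl c (P x)) \<and>
     (\<forall>x\<in>carrier A. \<forall>y\<in>carrier A. P (x \<otimes>\<^bsub>A\<^esub> y) = P x o\<^sub>L P y) \<and>
     (\<forall>x\<in>carrier A. adj (P x) (P (star A x)))"

lemma trepD:
  assumes "trep A P"
  shows "\<lbrakk>x \<in> carrier A; y \<in> carrier A\<rbrakk> \<Longrightarrow> P (x \<oplus>\<^bsub>A\<^esub> y) = P x + P y"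
    and "x \<in> carrier A \<Longrightarrow> P (c \<odot>\<^bsub>A\<^esub> x) = opscl c (P x)"
    and "\<lbrakk>x \<in> carrier A; y \<in> carrier A\<rbrakk> \<Longrightarrow> P (x \<otimes>\<^bsub>A\<^esub> y) = P x o\<^sub>L P y"
    and "x \<in> carrier A \<Longrightarrow> adj (P x) (P (star A x))"
    and "x \<in> carrier A \<Longrightarrow> clin (P x)"
proof -
  note t = assms[unfolded trep_def]
  show "\<lbrakk>x \<in> carrier A; y \<in> carrier A\<rbrakk> \<Longrightarrow> P (x \<oplus>\<^bsub>A\<^esub> y) = P x + P y"
    "x \<in> carrier A \<Longrightarrow> P (c \<odot>\<^bsub>A\<^esub> x) = opscl c (P x)"
    "\<lbrakk>x \<in> carrier A; y \<in> carrier A\<rbrakk> \<Longrightarrow> P (x \<otimes>\<^bsub>A\<^esub> y) = P x o\<^sub>L P y"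
    "x \<in> carrier A \<Longrightarrow> adj (P x) (P (star A x))" using t by blast+
  show "clin (P x)" if "x \<in> carrier A" using t that by (intro adj_clin[of _ "P (star A x)"]) blast
qed

lemma opscl_zero: "opscl c 0 = 0"
  by (rule blinfun_eqI) (simp add: scl_simps)

lemma trep_zero_rep: "trep A (\<lambda>_. 0)"
  by (simp add: trep_def adj_zero opscl_zero)

lemma trep_zero:
  assumes "cstar_algebra A" "trep A P" shows "P \<zero>\<^bsub>A\<^esub> = 0"
proof -
  interpret cstar_algebra A by fact
  show ?thesis using trepD(1)[OF assms(2), of "\<zero>\<^bsub>A\<^esub>" "\<zero>\<^bsub>A\<^esub>"] by simp
qed

text \<open>With \<open>P \<one>\<close> in the role of the unit, \<open>P\<close> becomes a unital
  homomorphism into the C*-algebra generated by its image, and such homomorphisms are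
  contractive.\<close>

lemma trep_norm_le:
  assumes A: "cstar_algebra A" and P: "trep A P" and x: "x \<in> carrier A"
  shows "norm (P x) \<le> cnorm A x"
proof -
  interpret A: cstar_algebra A by fact
  note D = trepD[OF P]
  let ?S = "P ` carrier A" and ?e = "P \<one>\<^bsub>A\<^esub>"
  let ?R = "op_alg (closure (span ?S)) ?e"
  have gen: "cstar_algebra ?R"
  proof (rule op_alg_generated)
    show "f o\<^sub>L g \<in> ?S" if "f \<in> ?S" "g \<in> ?S" for f g
      using that by (auto simp flip: D(3))
    show "opscl c f \<in> ?S" if "f \<in> ?S" for c f
      using that A.smult_closed by (auto simp flip: D(2))
    show "\<exists>g\<in>?S. adj f g" if "f \<in> ?S" for f
      using that D(4) A.star_closed by blast
    show "?e o\<^sub>L f = f" "f o\<^sub>L ?e = f" if "f \<in> ?S" for f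
      using that by (auto simp flip: D(3))
  qed auto
  have "?S \<subseteq> closure (span ?S)" by (rule order_trans[OF span_superset closure_subset])
  then have "(\<lambda>x\<in>carrier A. P x) \<in> cstar_hom A ?R"
    by (intro cstar_homI) (auto simp: D(1-3) A.smult_closed A.star_closed op_alg_star[OF D(4)])
  from cstar_hom_contractive[OF this A gen x] x show ?thesis by simp
qed

lemma trep_of_representation:
  assumes A: "cstar_algebra A" and r: "representation A \<pi>"
  shows "trep A (\<lambda>x. opL (\<pi> x))"
proof -
  interpret A: cstar_algebra A by fact
  note r' = r[unfolded representation_def]
  have b: "bounded_operator (\<pi> x)" if "x \<in> carrier A" for x using r' that by blast
  note ap = ap_opL[OF b]
  show ?thesis
    unfolding trep_def
  proof (intro conjI ballI allI)
    fix x y c assume x: "x \<in> carrier A"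
    have "cip (opL (\<pi> (star A x)) \<xi>) \<eta> = cip \<xi> (opL (\<pi> x) \<eta>)" for \<xi> \<eta>
      using r' x by (simp add: cip_def ap A.star_closed)
    then show "adj (opL (\<pi> x)) (opL (\<pi> (star A x)))"
      by (intro adj_sym[of "opL (\<pi> (star A x))"]) (simp add: adj_def)
    show "opL (\<pi> (c \<odot>\<^bsub>A\<^esub> x)) = opscl c (opL (\<pi> x))"
      using r' x by (intro blinfun_eqI l2_eqI) (simp add: ap A.smult_closed)
    assume y: "y \<in> carrier A"
    show "opL (\<pi> (x \<oplus>\<^bsub>A\<^esub> y)) = opL (\<pi> x) + opL (\<pi> y)"
      using r' x y by (intro blinfun_eqI l2_eqI) (simp add: ap blinfun.add_left)
    show "opL (\<pi> (x \<otimes>\<^bsub>A\<^esub> y)) = opL (\<pi> x) o\<^sub>L opL (\<pi> y)"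
      using r' x y by (intro blinfun_eqI l2_eqI) (simp add: ap)
  qed
qed

text \<open>The translation back from typed operators. What \<open>mk\<close> does outside
  \<open>ell2\<close> is unspecified, and operators are compared on \<open>ell2\<close>
  only.\<close>

definition untyped :: "('a \<Rightarrow> 'i bop) \<Rightarrow> 'a \<Rightarrow> 'i operator" where
  "untyped P x \<xi> = ap (P x (mk \<xi>))"

lemma bounded_operator_untyped: assumes "clin (P x)" shows "bounded_operator (untyped P x)"
  unfolding bounded_operator_def
proof (intro conjI ballI allI)
  fix \<xi> \<eta> :: "'a \<Rightarrow> complex" and c assume \<xi>: "\<xi> \<in> ell2"
  show "untyped P x \<xi> \<in> ell2" by (simp add: untyped_def)
  have "mk (\<lambda>i. c * \<xi> i) = scl c (mk \<xi>)"
    using \<xi> by (intro l2_eqI) (simp add: mk_inverse ell2_scale)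
  then show "untyped P x (\<lambda>i. c * \<xi> i) = (\<lambda>i. c * untyped P x \<xi> i)"
    by (auto simp: untyped_def clinD[OF assms])
  assume \<eta>: "\<eta> \<in> ell2"
  have "mk (\<lambda>i. \<xi> i + \<eta> i) = mk \<xi> + mk \<eta>"
    using \<xi> \<eta> by (intro l2_eqI) (simp add: mk_inverse ell2_add)
  then show "untyped P x (\<lambda>i. \<xi> i + \<eta> i) = (\<lambda>i. untyped P x \<xi> i + untyped P x \<eta> i)"
    by (auto simp: untyped_def blinfun.add_right)
next
  have "ell2_norm (untyped P x \<xi>) \<le> norm (P x) * ell2_norm \<xi>" if "\<xi> \<in> ell2" for \<xi>
    using norm_blinfun[of "P x" "mk \<xi>"] that by (simp add: untyped_def norm_eq_ell2_norm mk_inverse)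
  then show "\<exists>M. \<forall>\<xi>\<in>ell2. ell2_norm (untyped P x \<xi>) \<le> M * ell2_norm \<xi>" by blast
qed

lemma opL_untyped: "clin (P x) \<Longrightarrow> opL (untyped P x) = P x"
  by (intro blinfun_eqI l2_eqI) (simp add: ap_opL[OF bounded_operator_untyped] untyped_def ap_inverse)

lemma representation_untyped:
  assumes A: "cstar_algebra A" and P: "trep A P"
  shows "representation A (untyped P)"
proof -
  interpret A: cstar_algebra A by fact
  note D = trepD[OF P]
  have "ell2_inner (untyped P (star A x) \<xi>) \<eta> = ell2_inner \<xi> (untyped P x \<eta>)"
    if "x \<in> carrier A" "\<xi> \<in> ell2" "\<eta> \<in> ell2" for x \<xi> \<eta>
  proof -
    have "cip (P (star A x) (mk \<xi>)) (mk \<eta>) = cip (mk \<xi>) (P x (mk \<eta>))"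
      using adj_sym[OF D(4)[OF that(1)]] by (simp add: adj_def)
    then show ?thesis using that by (simp add: cip_def untyped_def mk_inverse)
  qed
  then show ?thesis
    unfolding representation_def
    by (auto simp: bounded_operator_untyped D(5) untyped_def D(1-3) blinfun.add_left ap_inverse)
qed

section \<open>Existence of the spatial tensor product\<close>

text \<open>A bound independent of the two representations: with it, the set of norms that defines
  the spatial norm is bounded above and \<open>Sup\<close> is a genuine supremum.\<close>

lemma tensor_sum_norm_le:
  assumes A: "cstar_algebra A" and B: "cstar_algebra B" and P: "trep A P" and Q: "trep B Q"
    and a: "\<And>k. k < n \<Longrightarrow> a k \<in> carrier A" and b: "\<And>k. k < n \<Longrightarrow> b k \<in> carrier B"
  shows "norm (\<Sum>k<n::nat. ten (P (a k)) (Q (b k))) \<le> (\<Sum>k<n. cnorm A (a k) * cnorm B (b k))"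
proof (rule sum_norm_le)
  fix k assume "k \<in> {..<n}"
  then have k: "a k \<in> carrier A" "b k \<in> carrier B" using a b by auto
  have "norm (ten (P (a k)) (Q (b k))) \<le> norm (P (a k)) * norm (Q (b k))" by (rule norm_ten_le)
  also have "\<dots> \<le> cnorm A (a k) * cnorm B (b k)"
    using k by (intro mult_mono trep_norm_le[OF A P] trep_norm_le[OF B Q]
        cstar_algebra.cnorm_nonneg[OF A] norm_ge_zero)
  finally show "norm (ten (P (a k)) (Q (b k))) \<le> cnorm A (a k) * cnorm B (b k)" .
qed

definition tensor_norms :: "'u cstar \<Rightarrow> 'u cstar \<Rightarrow> nat \<Rightarrow> (nat \<Rightarrow> 'u) \<Rightarrow> (nat \<Rightarrow> 'u) \<Rightarrow> real set" where
  "tensor_norms A B n a b = {norm (\<Sum>k<n. ten (P (a k)) (Q (b k))) |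
    (P :: 'u \<Rightarrow> 'u bop) (Q :: 'u \<Rightarrow> 'u bop). trep A P \<and> trep B Q}"

lemma tensor_normsI:
  fixes P Q :: "'u \<Rightarrow> 'u bop"
  shows "trep A P \<Longrightarrow> trep B Q \<Longrightarrow> norm (\<Sum>k<n. ten (P (a k)) (Q (b k))) \<in> tensor_norms A B n a b"
  unfolding tensor_norms_def by (intro CollectI exI[of _ P] exI[of _ Q]) simp

lemma spatial_norm_eq:
  fixes A B :: "'u cstar"
  assumes A: "cstar_algebra A" and B: "cstar_algebra B"
    and a: "\<And>k. k < n \<Longrightarrow> a k \<in> carrier A" and b: "\<And>k. k < n \<Longrightarrow> b k \<in> carrier B"
  shows "spatial_norm A B n a b = Sup (tensor_norms A B n a b)"
proof -
  have "{operator_norm (\<lambda>\<xi> p. \<Sum>k<n. operator_tensor (\<pi> (a k)) (\<rho> (b k)) \<xi> p) |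
          (\<pi> :: 'u \<Rightarrow> 'u operator) (\<rho> :: 'u \<Rightarrow> 'u operator).
          representation A \<pi> \<and> representation B \<rho>} = tensor_norms A B n a b"
    (is "?L = ?R")
  proof (intro equalityI subsetI)
    fix r assume "r \<in> ?L"
    then obtain \<pi> :: "'u \<Rightarrow> 'u operator" and \<rho> :: "'u \<Rightarrow> 'u operator" where
      r: "r = operator_norm (\<lambda>\<xi> p. \<Sum>k<n. operator_tensor (\<pi> (a k)) (\<rho> (b k)) \<xi> p)" and
      rep: "representation A \<pi>" "representation B \<rho>" by blast
    have "r = norm (\<Sum>k<n. ten (opL (\<pi> (a k))) (opL (\<rho> (b k))))"
      unfolding r using a b rep by (intro operator_norm_tensor_sum) (auto simp: representation_def)
    then show "r \<in> ?R"
      using tensor_normsI[OF trep_of_representation[OF A rep(1)] trep_of_representation[OF B rep(2)]] by simp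
  next
    fix r assume "r \<in> ?R"
    then obtain P Q :: "'u \<Rightarrow> 'u bop" where
      r: "r = norm (\<Sum>k<n. ten (P (a k)) (Q (b k)))" and PQ: "trep A P" "trep B Q"
      unfolding tensor_norms_def by blast
    have "r = norm (\<Sum>k<n. ten (opL (untyped P (a k))) (opL (untyped Q (b k))))"
      unfolding r using a b trepD(5)[OF PQ(1)] trepD(5)[OF PQ(2)] by (simp add: opL_untyped)
    also have "\<dots> = operator_norm (\<lambda>\<xi> p. \<Sum>k<n. operator_tensor (untyped P (a k)) (untyped Q (b k)) \<xi> p)"
      using a b trepD(5)[OF PQ(1)] trepD(5)[OF PQ(2)]
      by (intro operator_norm_tensor_sum[symmetric] bounded_operator_untyped) auto
    finally show "r \<in> ?L"
      using representation_untyped[OF A PQ(1)] representation_untyped[OF B PQ(2)] by blast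
  qed
  then show ?thesis by (simp only: spatial_norm_def)
qed

lemma spatial_norm_ge:
  fixes A B :: "'u cstar" and P Q :: "'u \<Rightarrow> 'u bop"
  assumes A: "cstar_algebra A" and B: "cstar_algebra B"
    and a: "\<And>k. k < n \<Longrightarrow> a k \<in> carrier A" and b: "\<And>k. k < n \<Longrightarrow> b k \<in> carrier B"
    and P: "trep A P" and Q: "trep B Q"
  shows "norm (\<Sum>k<n. ten (P (a k)) (Q (b k))) \<le> spatial_norm A B n a b"
proof -
  have eq: "spatial_norm A B n a b = Sup (tensor_norms A B n a b)" by (rule spatial_norm_eq[OF A B a b])
  have "bdd_above (tensor_norms A B n a b)"
  proof (rule bdd_aboveI)
    fix r assume "r \<in> tensor_norms A B n a b"
    then obtain P Q :: "'u \<Rightarrow> 'u bop" where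
      r: "r = norm (\<Sum>k<n. ten (P (a k)) (Q (b k)))" and PQ: "trep A P" "trep B Q"
      unfolding tensor_norms_def by blast
    show "r \<le> (\<Sum>k<n. cnorm A (a k) * cnorm B (b k))"
      unfolding r by (rule tensor_sum_norm_le[OF A B PQ a b])
  qed
  then show ?thesis unfolding eq using tensor_normsI[OF P Q] by (intro cSup_upper)
qed

lemma spatial_norm_le:
  fixes A B :: "'u cstar"
  assumes A: "cstar_algebra A" and B: "cstar_algebra B"
    and a: "\<And>k. k < n \<Longrightarrow> a k \<in> carrier A" and b: "\<And>k. k < n \<Longrightarrow> b k \<in> carrier B"
    and le: "\<And>(P :: 'u \<Rightarrow> 'u bop) (Q :: 'u \<Rightarrow> 'u bop). \<lbrakk>trep A P; trep B Q\<rbrakk> \<Longrightarrow>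
      norm (\<Sum>k<n. ten (P (a k)) (Q (b k))) \<le> M"
  shows "spatial_norm A B n a b \<le> M"
proof -
  have eq: "spatial_norm A B n a b = Sup (tensor_norms A B n a b)" by (rule spatial_norm_eq[OF A B a b])
  show ?thesis
    unfolding eq
  proof (rule cSup_least)
    \<comment> \<open>\<open>Sup\<close> of the empty set would be unspecified; the zero
      representations provide an element.\<close>
    show "tensor_norms A B n a b \<noteq> {}" using tensor_normsI[OF trep_zero_rep trep_zero_rep] by blast
  qed (use le in \<open>auto simp: tensor_norms_def\<close>)
qed

subsection \<open>The concrete model\<close>

text \<open>The spatial tensor product acts on the direct sum of the spaces \<open>\<ell>\<^sup>2('u \<times> 'u)\<close> over all pairs
  of functions, with the zero operator at the pairs that are not representations.\<close>

definition model_block ::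
    "'u cstar \<Rightarrow> 'u cstar \<Rightarrow> 'u \<Rightarrow> 'u \<Rightarrow> ('u \<Rightarrow> 'u bop) \<times> ('u \<Rightarrow> 'u bop) \<Rightarrow> ('u \<times> 'u) bop" where
  "model_block A B a b j = (if trep A (fst j) \<and> trep B (snd j) then ten (fst j a) (snd j b) else 0)"

definition model_elem ::
    "'u cstar \<Rightarrow> 'u cstar \<Rightarrow> 'u \<Rightarrow> 'u \<Rightarrow> ((('u \<Rightarrow> 'u bop) \<times> ('u \<Rightarrow> 'u bop)) \<times> 'u \<times> 'u) bop" where
  "model_elem A B a b = diag (model_block A B a b)"

definition model_gen :: "'u cstar \<Rightarrow> 'u cstar \<Rightarrow> ((('u \<Rightarrow> 'u bop) \<times> ('u \<Rightarrow> 'u bop)) \<times> 'u \<times> 'u) bop set" where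
  "model_gen A B = {model_elem A B a b |a b. a \<in> carrier A \<and> b \<in> carrier B}"

definition model_alg :: "'u cstar \<Rightarrow> 'u cstar \<Rightarrow> ((('u \<Rightarrow> 'u bop) \<times> ('u \<Rightarrow> 'u bop)) \<times> 'u \<times> 'u) bop cstar" where
  "model_alg A B = op_alg (closure (span (model_gen A B))) (model_elem A B \<one>\<^bsub>A\<^esub> \<one>\<^bsub>B\<^esub>)"

context
  fixes A B :: "'u cstar"
  assumes A: "cstar_algebra A" and B: "cstar_algebra B"
begin

interpretation A: cstar_algebra A by (rule A)
interpretation B: cstar_algebra B by (rule B)

lemma bounded_model_block:
  assumes "a \<in> carrier A" "b \<in> carrier B" shows "bounded (range (model_block A B a b))"
proof -
  have "norm (model_block A B a b j) \<le> cnorm A a * cnorm B b" for j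
    using tensor_sum_norm_le[OF A B, of "fst j" "snd j" 1 "\<lambda>_. a" "\<lambda>_. b"] assms
      A.cnorm_nonneg B.cnorm_nonneg by (simp add: model_block_def)
  then show ?thesis by (auto simp: bounded_iff)
qed

lemma model_elem_add:
  assumes ab: "a \<in> carrier A" "b \<in> carrier B"
  shows "a' \<in> carrier A \<Longrightarrow> model_elem A B (a \<oplus>\<^bsub>A\<^esub> a') b = model_elem A B a b + model_elem A B a' b"
    and "b' \<in> carrier B \<Longrightarrow> model_elem A B a (b \<oplus>\<^bsub>B\<^esub> b') = model_elem A B a b + model_elem A B a b'"
proof -
  assume a': "a' \<in> carrier A"
  have "model_block A B (a \<oplus>\<^bsub>A\<^esub> a') b = (\<lambda>j. model_block A B a b j + model_block A B a' b j)"
    using ab a' by (intro ext) (auto simp: model_block_def trepD intro: ten_add trepD(5))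
  then show "model_elem A B (a \<oplus>\<^bsub>A\<^esub> a') b = model_elem A B a b + model_elem A B a' b"
    unfolding model_elem_def using ab a' by (simp only: diag_add bounded_model_block)
next
  assume b': "b' \<in> carrier B"
  have "model_block A B a (b \<oplus>\<^bsub>B\<^esub> b') = (\<lambda>j. model_block A B a b j + model_block A B a b' j)"
    using ab b' by (intro ext) (auto simp: model_block_def trepD intro: ten_add trepD(5))
  then show "model_elem A B a (b \<oplus>\<^bsub>B\<^esub> b') = model_elem A B a b + model_elem A B a b'"
    unfolding model_elem_def using ab b' by (simp only: diag_add bounded_model_block)
qed

lemma model_elem_smult:
  assumes ab: "a \<in> carrier A" "b \<in> carrier B"
  shows "model_elem A B (c \<odot>\<^bsub>A\<^esub> a) b = opscl c (model_elem A B a b)"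
    and "model_elem A B a (c \<odot>\<^bsub>B\<^esub> b) = opscl c (model_elem A B a b)"
proof -
  have "model_block A B (c \<odot>\<^bsub>A\<^esub> a) b = (\<lambda>j. opscl c (model_block A B a b j))"
    using ab by (intro ext) (auto simp: model_block_def trepD opscl_zero intro: ten_opscl trepD(5))
  then show "model_elem A B (c \<odot>\<^bsub>A\<^esub> a) b = opscl c (model_elem A B a b)"
    unfolding model_elem_def using ab by (simp only: diag_opscl bounded_model_block)
  have "model_block A B a (c \<odot>\<^bsub>B\<^esub> b) = (\<lambda>j. opscl c (model_block A B a b j))"
    using ab by (intro ext) (auto simp: model_block_def trepD opscl_zero intro: ten_opscl trepD(5))
  then show "model_elem A B a (c \<odot>\<^bsub>B\<^esub> b) = opscl c (model_elem A B a b)"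
    unfolding model_elem_def using ab by (simp only: diag_opscl bounded_model_block)
qed

lemma model_elem_mult:
  assumes ab: "a \<in> carrier A" "b \<in> carrier B" "a' \<in> carrier A" "b' \<in> carrier B"
  shows "model_elem A B a b o\<^sub>L model_elem A B a' b' = model_elem A B (a \<otimes>\<^bsub>A\<^esub> a') (b \<otimes>\<^bsub>B\<^esub> b')"
proof -
  have "model_block A B (a \<otimes>\<^bsub>A\<^esub> a') (b \<otimes>\<^bsub>B\<^esub> b') = (\<lambda>j. model_block A B a b j o\<^sub>L model_block A B a' b' j)"
    using ab by (intro ext) (auto simp: model_block_def trepD intro: ten_comp[symmetric] trepD(5))
  then show ?thesis
    unfolding model_elem_def using ab by (simp only: diag_comp bounded_model_block)
qed

lemma model_elem_adj:
  assumes "a \<in> carrier A" "b \<in> carrier B"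
  shows "adj (model_elem A B a b) (model_elem A B (star A a) (star B b))"
  unfolding model_elem_def using assms
  by (intro adj_diag bounded_model_block) (auto simp: A.star_closed B.star_closed model_block_def
      adj_zero intro!: adj_ten trepD(4))

lemma model_alg_cstar: "cstar_algebra (model_alg A B)"
  and dense_model_gen: "dense_sums (model_alg A B) (model_gen A B)"
  unfolding model_alg_def
proof (atomize (full), intro conjI op_alg_generated)
  let ?S = "model_gen A B" and ?e = "model_elem A B \<one>\<^bsub>A\<^esub> \<one>\<^bsub>B\<^esub>"
  show "?e \<in> ?S" "?e \<in> ?S" by (auto simp: model_gen_def)
  show "f o\<^sub>L g \<in> ?S" "f o\<^sub>L g \<in> ?S" if "f \<in> ?S" "g \<in> ?S" for f g
    using that A.m_closed B.m_closed by (force simp: model_gen_def model_elem_mult)+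
  show "opscl c f \<in> ?S" "opscl c f \<in> ?S" if "f \<in> ?S" for c f
    using that A.smult_closed by (force simp: model_gen_def simp flip: model_elem_smult(1))+
  show "\<exists>g\<in>?S. adj f g" "\<exists>g\<in>?S. adj f g" if "f \<in> ?S" for f
    using that A.star_closed B.star_closed model_elem_adj by (fastforce simp: model_gen_def)+
  show "?e o\<^sub>L f = f" "?e o\<^sub>L f = f" "f o\<^sub>L ?e = f" "f o\<^sub>L ?e = f" if "f \<in> ?S" for f
    using that by (auto simp: model_gen_def model_elem_mult)
qed

lemma model_elem_closed:
  "\<lbrakk>a \<in> carrier A; b \<in> carrier B\<rbrakk> \<Longrightarrow> model_elem A B a b \<in> carrier (model_alg A B)"
  using dense_model_gen by (auto simp: dense_sums_def model_gen_def)

text \<open>The norm of a block-diagonal operator is the supremum of the norms of its blocks. The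
  blocks that were filled with 0 leave this supremum unchanged because the spatial norm is
  nonnegative.\<close>

lemma norm_model_sum:
  assumes a: "\<And>k. k < n \<Longrightarrow> a k \<in> carrier A" and b: "\<And>k. k < n \<Longrightarrow> b k \<in> carrier B"
  shows "norm (\<Sum>k<n::nat. model_elem A B (a k) (b k)) = spatial_norm A B n a b"
proof -
  let ?F = "\<lambda>j. \<Sum>k<n. model_block A B (a k) (b k) j"
  have eq: "(\<Sum>k<n. model_elem A B (a k) (b k)) = diag ?F"
    using a b by (simp add: model_elem_def diag_sum bounded_model_block)
  have F: "?F (P, Q) = (if trep A P \<and> trep B Q then \<Sum>k<n. ten (P (a k)) (Q (b k)) else 0)" for P Q
    by (cases "trep A P"; cases "trep B Q"; simp add: model_block_def)
  have bd: "bounded (range ?F)"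
    using a b by (intro bounded_range_sum bounded_model_block)
  have sp0: "0 \<le> spatial_norm A B n a b"
    by (rule order_trans[OF norm_ge_zero spatial_norm_ge[OF A B a b trep_zero_rep trep_zero_rep]])
  show ?thesis
    unfolding eq
  proof (rule antisym)
    have "norm (?F j) \<le> spatial_norm A B n a b" for j
      using spatial_norm_ge[OF A B a b, where P = "fst j" and Q = "snd j"] sp0 F[of "fst j" "snd j"] by auto
    then show "norm (diag ?F) \<le> spatial_norm A B n a b" by (rule norm_diag_le)
    show "spatial_norm A B n a b \<le> norm (diag ?F)"
    proof (rule spatial_norm_le[OF A B a b])
      fix P Q :: "'u \<Rightarrow> 'u bop" assume "trep A P" "trep B Q"
      then show "norm (\<Sum>k<n. ten (P (a k)) (Q (b k))) \<le> norm (diag ?F)"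
        using norm_diag_ge[OF bd, of "(P, Q)"] F[of P Q] by simp
    qed
  qed
qed

end

subsection \<open>Transport along an injection\<close>

text \<open>The inverse is taken relative to the carrier, so \<open>g\<close> has to be injective
  there only. This matters because the whole operator type is far too large to embed.\<close>

definition transport :: "('a \<Rightarrow> 'b) \<Rightarrow> 'a cstar \<Rightarrow> 'b cstar" where
  "transport g T = (let i = inv_into (carrier T) g in
     \<lparr>carrier = g ` carrier T, mult = \<lambda>x y. g (i x \<otimes>\<^bsub>T\<^esub> i y), one = g \<one>\<^bsub>T\<^esub>, zero = g \<zero>\<^bsub>T\<^esub>,
      add = \<lambda>x y. g (i x \<oplus>\<^bsub>T\<^esub> i y), smult = \<lambda>c x. g (c \<odot>\<^bsub>T\<^esub> i x), star = \<lambda>x. g (star T (i x)),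
      cnorm = \<lambda>x. cnorm T (i x)\<rparr>)"

context
  fixes g :: "'a \<Rightarrow> 'b" and T
  assumes T: "cstar_algebra T" and g: "inj_on g (carrier T)"
begin

interpretation T: cstar_algebra T by (rule T)

lemma transport_simps [simp]:
  "carrier (transport g T) = g ` carrier T"
  "\<one>\<^bsub>transport g T\<^esub> = g \<one>\<^bsub>T\<^esub>" "\<zero>\<^bsub>transport g T\<^esub> = g \<zero>\<^bsub>T\<^esub>"
  "\<lbrakk>x \<in> carrier T; y \<in> carrier T\<rbrakk> \<Longrightarrow> g x \<otimes>\<^bsub>transport g T\<^esub> g y = g (x \<otimes>\<^bsub>T\<^esub> y)"
  "\<lbrakk>x \<in> carrier T; y \<in> carrier T\<rbrakk> \<Longrightarrow> g x \<oplus>\<^bsub>transport g T\<^esub> g y = g (x \<oplus>\<^bsub>T\<^esub> y)"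
  "x \<in> carrier T \<Longrightarrow> c \<odot>\<^bsub>transport g T\<^esub> g x = g (c \<odot>\<^bsub>T\<^esub> x)"
  "x \<in> carrier T \<Longrightarrow> star (transport g T) (g x) = g (star T x)"
  "x \<in> carrier T \<Longrightarrow> cnorm (transport g T) (g x) = cnorm T x"
  using g by (simp_all add: transport_def Let_def inv_into_f_f)

lemma transport_cstar: "cstar_algebra (transport g T)"
proof -
  let ?T = "transport g T"
  interpret ring ?T
  proof (intro ringI abelian_groupI monoidI)
    show "\<exists>y\<in>carrier ?T. y \<oplus>\<^bsub>?T\<^esub> x = \<zero>\<^bsub>?T\<^esub>" if x: "x \<in> carrier ?T" for x
    proof -
      obtain x' where "x = g x'" "x' \<in> carrier T" using x by auto
      then show ?thesis by (intro bexI[of _ "g (\<ominus>\<^bsub>T\<^esub> x')"]) (auto simp: T.l_neg)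
    qed
  qed (auto simp: T.a_ac T.m_assoc T.l_distr T.r_distr)
  have neg: "\<ominus>\<^bsub>?T\<^esub> g x = g (\<ominus>\<^bsub>T\<^esub> x)" if "x \<in> carrier T" for x
    using that by (intro minus_equality) (auto simp: T.l_neg)
  have minus: "g x \<ominus>\<^bsub>?T\<^esub> g y = g (x \<ominus>\<^bsub>T\<^esub> y)" if "x \<in> carrier T" "y \<in> carrier T" for x y
    using that by (simp add: minus_eq T.minus_eq neg)
  show ?thesis
  proof (unfold_locales)
    fix s :: "nat \<Rightarrow> 'b"
    assume s: "\<And>n. s n \<in> carrier ?T"
      and C: "\<And>e. 0 < e \<Longrightarrow> \<exists>N. \<forall>m\<ge>N. \<forall>n\<ge>N. cnorm ?T (s m \<ominus>\<^bsub>?T\<^esub> s n) < e"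
    have "\<exists>r. r \<in> carrier T \<and> s n = g r" for n using s[of n] by auto
    then obtain r where r: "\<And>n. r n \<in> carrier T" "\<And>n. s n = g (r n)" by metis
    have "\<exists>l\<in>carrier T. (\<lambda>n. cnorm T (r n \<ominus>\<^bsub>T\<^esub> l)) \<longlonglongrightarrow> 0"
      by (rule T.complete[OF r(1)]) (use C in \<open>simp add: r minus\<close>)
    then show "\<exists>x\<in>carrier ?T. (\<lambda>n. cnorm ?T (s n \<ominus>\<^bsub>?T\<^esub> x)) \<longlonglongrightarrow> 0"
      by (auto simp: r minus)
  qed (auto simp: T.smult_closed T.smult_l_distr T.smult_r_distr T.smult_assoc T.smult_one
      T.smult_mult_left T.smult_mult_right T.star_closed T.star_star T.star_add T.star_smult T.star_mult
      T.cnorm_nonneg T.cnorm_eq_0_iff T.cnorm_triangle T.cnorm_smult T.cnorm_mult T.cstar_identity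
      inj_on_eq_iff[OF g])
qed

lemma transport_hom: "(\<lambda>x\<in>carrier T. g x) \<in> cstar_hom T (transport g T)"
  by (rule cstar_homI) (auto simp: T.smult_closed T.star_closed)

end

subsection \<open>Coding sequences of finite sums of elementary tensors\<close>

text \<open>A position is read as a triple: the stage \<open>m\<close>, a channel \<open>c\<close>
  and a payload \<open>v\<close>. Channel 0 stores the number of summands as an indicator function,
  for which two distinct values \<open>p\<close> and \<open>q\<close> are needed; channel 1 stores
  the left factors, and the remaining channels store the right factors.\<close>

lemma inj_code_sequences:
  assumes pq: "(p :: 'x) \<noteq> q"
  shows "\<exists>E :: (nat \<Rightarrow> nat \<times> (nat \<Rightarrow> nat \<Rightarrow> 'x) \<times> (nat \<Rightarrow> nat \<Rightarrow> 'x)) \<Rightarrow> nat \<Rightarrow> 'x. inj E"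
proof -
  define E :: "(nat \<Rightarrow> nat \<times> (nat \<Rightarrow> nat \<Rightarrow> 'x) \<times> (nat \<Rightarrow> nat \<Rightarrow> 'x)) \<Rightarrow> nat \<Rightarrow> 'x" where
    "E \<sigma> z = (let (m, w) = prod_decode z; (c, v) = prod_decode w; (k, l) = prod_decode v in
       if c = 0 then if v = fst (\<sigma> m) then p else q
       else if c = 1 then fst (snd (\<sigma> m)) k l else snd (snd (\<sigma> m)) k l)" for \<sigma> z
  have E0: "E \<sigma> (prod_encode (m, prod_encode (0, v))) = (if v = fst (\<sigma> m) then p else q)" for \<sigma> m v
    by (simp add: E_def split: prod.split)
  have E1: "E \<sigma> (prod_encode (m, prod_encode (1, prod_encode (k, l)))) = fst (snd (\<sigma> m)) k l" for \<sigma> m k l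
    by (simp add: E_def)
  have E2: "E \<sigma> (prod_encode (m, prod_encode (2, prod_encode (k, l)))) = snd (snd (\<sigma> m)) k l" for \<sigma> m k l
    by (simp add: E_def)
  have "inj E"
  proof (rule injI, rule ext)
    fix \<sigma> \<tau> m assume eq: "E \<sigma> = E \<tau>"
    have "fst (\<sigma> m) = fst (\<tau> m)"
      using fun_cong[OF eq, of "prod_encode (m, prod_encode (0, fst (\<sigma> m)))"] pq
      unfolding E0 by (auto split: if_splits)
    moreover have "fst (snd (\<sigma> m)) = fst (snd (\<tau> m))"
      by (intro ext) (metis E1 eq)
    moreover have "snd (snd (\<sigma> m)) = snd (snd (\<tau> m))"
      by (intro ext) (metis E2 eq)
    ultimately show "\<sigma> m = \<tau> m" by (simp add: prod_eq_iff)
  qed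
  then show ?thesis by blast
qed

text \<open>Every element of the completion is the limit of a sequence of finite sums of elementary
  tensors. Choosing one such sequence for each element is injective since limits are unique, and the
  chosen sequences can be coded in the universe.\<close>

lemma inj_on_model_alg:
  fixes A B :: "(nat \<Rightarrow> 'x) cstar"
  assumes A: "cstar_algebra A" and B: "cstar_algebra B"
  shows "\<exists>g :: _ \<Rightarrow> nat \<Rightarrow> 'x. inj_on g (carrier (model_alg A B))"
proof -
  interpret A: cstar_algebra A by (rule A)
  interpret B: cstar_algebra B by (rule B)
  let ?T = "model_alg A B"
  interpret T: cstar_algebra ?T by (rule model_alg_cstar[OF A B])
  note dense = dense_model_gen[OF A B]
  have Sc: "model_gen A B \<subseteq> carrier ?T" using dense by (simp add: dense_sums_def)
  define s where "s \<sigma> m = (\<Oplus>\<^bsub>?T\<^esub>k\<in>{..<fst (\<sigma> m)}. model_elem A B (fst (snd (\<sigma> m)) k) (snd (snd (\<sigma> m)) k))"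
    for \<sigma> :: "nat \<Rightarrow> nat \<times> (nat \<Rightarrow> nat \<Rightarrow> 'x) \<times> (nat \<Rightarrow> nat \<Rightarrow> 'x)" and m
  have ex: "\<exists>\<sigma>. clim ?T (s \<sigma>) f" if f: "f \<in> carrier ?T" for f
  proof -
    have "\<exists>\<sigma>m :: nat \<times> (nat \<Rightarrow> nat \<Rightarrow> 'x) \<times> (nat \<Rightarrow> nat \<Rightarrow> 'x). (\<forall>k<fst \<sigma>m. fst (snd \<sigma>m) k \<in> carrier A \<and> snd (snd \<sigma>m) k \<in> carrier B) \<and>
        cnorm ?T (f \<ominus>\<^bsub>?T\<^esub> (\<Oplus>\<^bsub>?T\<^esub>k\<in>{..<fst \<sigma>m}. model_elem A B (fst (snd \<sigma>m) k) (snd (snd \<sigma>m) k)))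
          < inverse (real (Suc m))" for m
    proof -
      obtain u where u: "u \<in> sums_of ?T (model_gen A B)" "cnorm ?T (f \<ominus>\<^bsub>?T\<^esub> u) < inverse (real (Suc m))"
        using dense f unfolding dense_sums_def by (metis inverse_positive_iff_positive of_nat_0_less_iff zero_less_Suc)
      obtain n x where x: "\<forall>k<n::nat. x k \<in> model_gen A B" "u = (\<Oplus>\<^bsub>?T\<^esub>k\<in>{..<n}. x k)"
        using T.sums_ofD[OF u(1) Sc] by blast
      have "\<forall>k. \<exists>a b. k < n \<longrightarrow> a \<in> carrier A \<and> b \<in> carrier B \<and> x k = model_elem A B a b"
        using x(1) unfolding model_gen_def by blast
      then obtain a b where ab: "\<And>k. k < n \<Longrightarrow> a k \<in> carrier A \<and> b k \<in> carrier B \<and> x k = model_elem A B (a k) (b k)"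
        by metis
      have "u = (\<Oplus>\<^bsub>?T\<^esub>k\<in>{..<n}. model_elem A B (a k) (b k))"
        unfolding x(2) using ab model_elem_closed[OF A B] by (intro T.finsum_cong') auto
      then show ?thesis using ab u(2) by (intro exI[of _ "(n, a, b)"]) auto
    qed
    then have "\<exists>\<sigma>. \<forall>m. (\<forall>k<fst (\<sigma> m). fst (snd (\<sigma> m)) k \<in> carrier A \<and> snd (snd (\<sigma> m)) k \<in> carrier B) \<and>
        cnorm ?T (f \<ominus>\<^bsub>?T\<^esub> s \<sigma> m) < inverse (real (Suc m))"
      unfolding s_def by (intro choice allI)
    then obtain \<sigma> where \<sigma>: "\<And>m k. k < fst (\<sigma> m) \<Longrightarrow> fst (snd (\<sigma> m)) k \<in> carrier A \<and> snd (snd (\<sigma> m)) k \<in> carrier B"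
      "\<And>m. cnorm ?T (f \<ominus>\<^bsub>?T\<^esub> s \<sigma> m) < inverse (real (Suc m))" by blast
    have sc: "s \<sigma> m \<in> carrier ?T" for m
      unfolding s_def using \<sigma>(1) model_elem_closed[OF A B] by (intro T.finsum_lessThan_closed) auto
    have "clim ?T (s \<sigma>) f"
      using \<sigma>(2) T.cnorm_diff_commute[OF f sc] sc f
      by (intro T.climI[OF _ _ _ LIMSEQ_inverse_real_of_nat]) (auto intro: less_imp_le)
    then show ?thesis by blast
  qed
  define code where "code f = (SOME \<sigma>. clim ?T (s \<sigma>) f)" for f
  have code: "clim ?T (s (code f)) f" if "f \<in> carrier ?T" for f
    unfolding code_def using ex[OF that] by (rule someI_ex)
  have inj: "inj_on code (carrier ?T)"
    by (rule inj_onI) (metis T.clim_unique code)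
  show ?thesis
  proof (cases "\<exists>p q :: 'x. p \<noteq> q")
    case True
    then obtain E :: "(nat \<Rightarrow> nat \<times> (nat \<Rightarrow> nat \<Rightarrow> 'x) \<times> (nat \<Rightarrow> nat \<Rightarrow> 'x)) \<Rightarrow> nat \<Rightarrow> 'x" where "inj E"
      using inj_code_sequences by metis
    then have "inj_on (E \<circ> code) (carrier ?T)" using inj by (simp add: comp_inj_on inj_on_subset)
    then show ?thesis by blast
  next
    case False
    \<comment> \<open>If \<open>'x\<close> has one element, so has the universe. Every element of
      \<open>B\<close> is then 0, all elementary tensors vanish, and the model is the zero
      algebra.\<close>
    then have all: "x = y" for x y :: "nat \<Rightarrow> 'x" by (intro ext) blast
    have "model_block A B a b = (\<lambda>_. 0)" for a b
    proof
      fix j :: "((nat \<Rightarrow> 'x) \<Rightarrow> (nat \<Rightarrow> 'x) bop) \<times> ((nat \<Rightarrow> 'x) \<Rightarrow> (nat \<Rightarrow> 'x) bop)"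
      have "snd j b = 0" if "trep B (snd j)" using trep_zero[OF B that] all[of b "\<zero>\<^bsub>B\<^esub>"] by simp
      moreover have "ten S 0 = 0" for S :: "(nat \<Rightarrow> 'x) bop"
        using norm_ten_le[of S 0] by simp
      ultimately show "model_block A B a b j = 0" by (auto simp: model_block_def)
    qed
    then have "model_gen A B \<subseteq> {0}" by (auto simp: model_gen_def model_elem_def diag_zero)
    then have "closure (span (model_gen A B)) \<subseteq> {0}"
      using closure_mono[OF span_mono[of "model_gen A B" "{0}"]] span_insert_0[of "{}"] by simp
    then show ?thesis by (auto simp: model_alg_def inj_on_def)
  qed
qed

theorem spatial_tensor_exists:
  fixes A B :: "(nat \<Rightarrow> 'x) cstar"
  assumes A: "cstar_algebra A" and B: "cstar_algebra B"
  shows "\<exists>T t. is_spatial_tensor A B T t"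
proof -
  interpret A: cstar_algebra A by (rule A)
  interpret B: cstar_algebra B by (rule B)
  let ?M = "model_alg A B"
  note M = model_alg_cstar[OF A B]
  interpret M: cstar_algebra ?M by (rule M)
  obtain g :: "_ \<Rightarrow> nat \<Rightarrow> 'x" where g: "inj_on g (carrier ?M)" using inj_on_model_alg[OF A B] by blast
  let ?T = "transport g ?M" and ?t = "\<lambda>a b. g (model_elem A B a b)"
  note tr = transport_simps[OF M g]
  note T = transport_cstar[OF M g]
  interpret T: cstar_algebra ?T by (rule T)
  note cl = model_elem_closed[OF A B]
  note ms = op_alg_simps[of "closure (span (model_gen A B))" "model_elem A B \<one>\<^bsub>A\<^esub> \<one>\<^bsub>B\<^esub>", folded model_alg_def]
  have sum_g: "(\<Oplus>\<^bsub>?T\<^esub>k\<in>{..<n}. g (x k)) = g (\<Oplus>\<^bsub>?M\<^esub>k\<in>{..<n}. x k)"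
    if "\<And>k. k < n \<Longrightarrow> x k \<in> carrier ?M" for n :: nat and x
  proof -
    have "(\<Oplus>\<^bsub>?T\<^esub>k\<in>{..<n}. (\<lambda>x\<in>carrier ?M. g x) (x k)) = (\<lambda>x\<in>carrier ?M. g x) (\<Oplus>\<^bsub>?M\<^esub>k\<in>{..<n}. x k)"
      using cstar_hom_finsum[OF transport_hom[OF M g] M T that] by simp
    moreover have "(\<Oplus>\<^bsub>?T\<^esub>k\<in>{..<n}. (\<lambda>x\<in>carrier ?M. g x) (x k)) = (\<Oplus>\<^bsub>?T\<^esub>k\<in>{..<n}. g (x k))"
      using that by (intro T.finsum_cong') (auto simp: tr)
    ultimately show ?thesis using that by (simp add: M.finsum_lessThan_closed)
  qed
  have norm_sum: "cnorm ?M (\<Oplus>\<^bsub>?M\<^esub>k\<in>{..<n}. model_elem A B (a k) (b k)) = spatial_norm A B n a b"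
    if "\<And>k. k < n \<Longrightarrow> a k \<in> carrier A" "\<And>k. k < n \<Longrightarrow> b k \<in> carrier B" for n :: nat and a b
    using op_alg_finsum[OF M[unfolded model_alg_def], of n "\<lambda>k. model_elem A B (a k) (b k)"]
      norm_model_sum[OF A B that] cl that by (simp add: ms flip: model_alg_def)
  have minus_g: "g x \<ominus>\<^bsub>?T\<^esub> g y = g (x \<ominus>\<^bsub>?M\<^esub> y)" if "x \<in> carrier ?M" "y \<in> carrier ?M" for x y
    using cstar_hom_zero_minus(2)[OF transport_hom[OF M g] M T that] that by simp
  have "is_spatial_tensor A B ?T ?t"
    unfolding is_spatial_tensor_def
  proof (intro conjI ballI allI impI)
    show "cstar_algebra ?T" by (rule T)
    show "?t \<one>\<^bsub>A\<^esub> \<one>\<^bsub>B\<^esub> = \<one>\<^bsub>?T\<^esub>" by (simp add: tr ms)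
  next
    fix a b assume ab: "a \<in> carrier A" "b \<in> carrier B"
    show "?t a b \<in> carrier ?T" using ab cl by (simp add: tr)
    have "star ?M (model_elem A B a b) = model_elem A B (star A a) (star B b)"
      unfolding model_alg_def by (rule op_alg_star[OF model_elem_adj[OF A B ab]])
    then show "star ?T (?t a b) = ?t (star A a) (star B b)"
      using cl[OF ab] by (simp add: tr)
    show "?t (c \<odot>\<^bsub>A\<^esub> a) b = c \<odot>\<^bsub>?T\<^esub> ?t a b" "?t a (c \<odot>\<^bsub>B\<^esub> b) = c \<odot>\<^bsub>?T\<^esub> ?t a b" for c
      using cl[OF ab] by (simp_all add: tr ms model_elem_smult[OF A B] ab)
    show "?t (a \<oplus>\<^bsub>A\<^esub> a') b = ?t a b \<oplus>\<^bsub>?T\<^esub> ?t a' b" if "a' \<in> carrier A" for a'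
      using that ab cl by (simp add: tr ms model_elem_add[OF A B])
    show "?t a (b \<oplus>\<^bsub>B\<^esub> b') = ?t a b \<oplus>\<^bsub>?T\<^esub> ?t a b'" if "b' \<in> carrier B" for b'
      using that ab cl by (simp add: tr ms model_elem_add[OF A B])
    show "?t a b \<otimes>\<^bsub>?T\<^esub> ?t a' b' = ?t (a \<otimes>\<^bsub>A\<^esub> a') (b \<otimes>\<^bsub>B\<^esub> b')" if "a' \<in> carrier A" "b' \<in> carrier B" for a' b'
      using that ab cl by (simp add: tr ms model_elem_mult[OF A B])
  next
    fix n :: nat and a b assume "(\<forall>k<n. a k \<in> carrier A) \<and> (\<forall>k<n. b k \<in> carrier B)"
    then have ab: "a k \<in> carrier A" "b k \<in> carrier B" if "k < n" for k using that by auto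
    show "cnorm ?T (\<Oplus>\<^bsub>?T\<^esub>k\<in>{..<n}. ?t (a k) (b k)) = spatial_norm A B n a b"
      using sum_g[of n "\<lambda>k. model_elem A B (a k) (b k)"] cl ab norm_sum[OF ab]
      by (simp add: tr M.finsum_lessThan_closed)
  next
    fix x and e :: real assume x: "x \<in> carrier ?T" and e: "0 < e"
    obtain y where y: "y \<in> carrier ?M" "x = g y" using x by (auto simp: tr)
    note dense = dense_model_gen[OF A B]
    have Sc: "model_gen A B \<subseteq> carrier ?M" using dense by (simp add: dense_sums_def)
    obtain u where u: "u \<in> sums_of ?M (model_gen A B)" "cnorm ?M (y \<ominus>\<^bsub>?M\<^esub> u) < e"
      using dense y e unfolding dense_sums_def by blast
    obtain n s where s: "\<forall>k<n::nat. s k \<in> model_gen A B" "u = (\<Oplus>\<^bsub>?M\<^esub>k\<in>{..<n}. s k)"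
      using M.sums_ofD[OF u(1) Sc] by blast
    have "\<forall>k. \<exists>a b. k < n \<longrightarrow> a \<in> carrier A \<and> b \<in> carrier B \<and> s k = model_elem A B a b"
      using s(1) unfolding model_gen_def by blast
    then obtain a b where ab: "\<And>k. k < n \<Longrightarrow> a k \<in> carrier A \<and> b k \<in> carrier B \<and> s k = model_elem A B (a k) (b k)"
      by metis
    have "u = (\<Oplus>\<^bsub>?M\<^esub>k\<in>{..<n}. model_elem A B (a k) (b k))"
      unfolding s(2) using ab cl by (intro M.finsum_cong') auto
    then have "(\<Oplus>\<^bsub>?T\<^esub>k\<in>{..<n}. ?t (a k) (b k)) = g u"
      using sum_g[of n "\<lambda>k. model_elem A B (a k) (b k)"] ab cl by simp
    moreover have "u \<in> carrier ?M" using M.sums_of_closed[OF u(1) Sc] .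
    ultimately have "cnorm ?T (x \<ominus>\<^bsub>?T\<^esub> (\<Oplus>\<^bsub>?T\<^esub>k\<in>{..<n}. ?t (a k) (b k))) < e"
      using u(2) y by (simp add: minus_g tr)
    then show "\<exists>(n :: nat) a b. (\<forall>k<n. a k \<in> carrier A) \<and> (\<forall>k<n. b k \<in> carrier B) \<and>
        cnorm ?T (x \<ominus>\<^bsub>?T\<^esub> (\<Oplus>\<^bsub>?T\<^esub>k\<in>{..<n}. ?t (a k) (b k))) < e"
      using ab by blast
  qed
  then show ?thesis by blast
qed

section \<open>Homomorphisms between spatial tensor products\<close>

lemma spatial_tensor:
  fixes A B :: "(nat \<Rightarrow> 'x) cstar"
  assumes "cstar_algebra A" "cstar_algebra B"
  shows "is_spatial_tensor A B (tensor_alg A B) (tensor_elem A B)"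
proof -
  have "\<exists>p. (\<lambda>(T, t). is_spatial_tensor A B T t) p" using spatial_tensor_exists[OF assms] by auto
  then have "(\<lambda>(T, t). is_spatial_tensor A B T t) (spatial_tensor_pair A B)"
    unfolding spatial_tensor_pair_def by (rule someI_ex)
  then show ?thesis by (simp add: tensor_alg_def tensor_elem_def case_prod_unfold)
qed

context
  fixes A B :: "(nat \<Rightarrow> 'x) cstar"
  assumes A: "cstar_algebra A" and B: "cstar_algebra B"
begin

lemmas spatial_tensor_unfolded = spatial_tensor[OF A B, unfolded is_spatial_tensor_def]
lemmas spatial_tensor_cstar = spatial_tensor_unfolded[THEN conjunct1]
lemmas spatial_tensor_closed = spatial_tensor_unfolded[THEN conjunct2, THEN conjunct1]
lemmas spatial_tensor_add_left = spatial_tensor_unfolded[THEN conjunct2, THEN conjunct2, THEN conjunct1]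
lemmas spatial_tensor_add_right = spatial_tensor_unfolded[THEN conjunct2, THEN conjunct2, THEN conjunct2, THEN conjunct1]
lemmas spatial_tensor_smult = spatial_tensor_unfolded[THEN conjunct2, THEN conjunct2, THEN conjunct2, THEN conjunct2, THEN conjunct1]
lemmas spatial_tensor_mult = spatial_tensor_unfolded[THEN conjunct2, THEN conjunct2, THEN conjunct2, THEN conjunct2, THEN conjunct2, THEN conjunct1]
lemmas spatial_tensor_one = spatial_tensor_unfolded[THEN conjunct2, THEN conjunct2, THEN conjunct2, THEN conjunct2, THEN conjunct2, THEN conjunct2, THEN conjunct1]
lemmas spatial_tensor_star = spatial_tensor_unfolded[THEN conjunct2, THEN conjunct2, THEN conjunct2, THEN conjunct2, THEN conjunct2, THEN conjunct2, THEN conjunct2, THEN conjunct1]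
lemmas spatial_tensor_norm = spatial_tensor_unfolded[THEN conjunct2, THEN conjunct2, THEN conjunct2, THEN conjunct2, THEN conjunct2, THEN conjunct2, THEN conjunct2, THEN conjunct2, THEN conjunct1]
lemmas spatial_tensor_approx = spatial_tensor_unfolded[THEN conjunct2, THEN conjunct2, THEN conjunct2, THEN conjunct2, THEN conjunct2, THEN conjunct2, THEN conjunct2, THEN conjunct2, THEN conjunct2]

lemma tensor_alg_cstar: "cstar_algebra (tensor_alg A B)"
  using spatial_tensor_cstar by blast

lemma tensor_elem_closed:
  "\<lbrakk>a \<in> carrier A; b \<in> carrier B\<rbrakk> \<Longrightarrow> tensor_elem A B a b \<in> carrier (tensor_alg A B)"
  using spatial_tensor_closed by blast

lemma tensor_elem_add_left:
  "\<lbrakk>a \<in> carrier A; a' \<in> carrier A; b \<in> carrier B\<rbrakk> \<Longrightarrow>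
    tensor_elem A B (a \<oplus>\<^bsub>A\<^esub> a') b = tensor_elem A B a b \<oplus>\<^bsub>tensor_alg A B\<^esub> tensor_elem A B a' b"
  using spatial_tensor_add_left by blast

lemma tensor_elem_add_right:
  "\<lbrakk>a \<in> carrier A; b \<in> carrier B; b' \<in> carrier B\<rbrakk> \<Longrightarrow>
    tensor_elem A B a (b \<oplus>\<^bsub>B\<^esub> b') = tensor_elem A B a b \<oplus>\<^bsub>tensor_alg A B\<^esub> tensor_elem A B a b'"
  using spatial_tensor_add_right by blast

lemma tensor_elem_smult:
  "\<lbrakk>a \<in> carrier A; b \<in> carrier B\<rbrakk> \<Longrightarrow>
    tensor_elem A B (c \<odot>\<^bsub>A\<^esub> a) b = c \<odot>\<^bsub>tensor_alg A B\<^esub> tensor_elem A B a b"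
  "\<lbrakk>a \<in> carrier A; b \<in> carrier B\<rbrakk> \<Longrightarrow>
    tensor_elem A B a (c \<odot>\<^bsub>B\<^esub> b) = c \<odot>\<^bsub>tensor_alg A B\<^esub> tensor_elem A B a b"
  using spatial_tensor_smult by blast+

lemma tensor_elem_mult:
  "\<lbrakk>a \<in> carrier A; b \<in> carrier B; a' \<in> carrier A; b' \<in> carrier B\<rbrakk> \<Longrightarrow>
    tensor_elem A B a b \<otimes>\<^bsub>tensor_alg A B\<^esub> tensor_elem A B a' b' = tensor_elem A B (a \<otimes>\<^bsub>A\<^esub> a') (b \<otimes>\<^bsub>B\<^esub> b')"
  using spatial_tensor_mult by blast

lemma tensor_elem_one: "tensor_elem A B \<one>\<^bsub>A\<^esub> \<one>\<^bsub>B\<^esub> = \<one>\<^bsub>tensor_alg A B\<^esub>"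
  using spatial_tensor_one by blast

lemma tensor_elem_star:
  "\<lbrakk>a \<in> carrier A; b \<in> carrier B\<rbrakk> \<Longrightarrow>
    star (tensor_alg A B) (tensor_elem A B a b) = tensor_elem A B (star A a) (star B b)"
  using spatial_tensor_star by blast

lemma cnorm_tensor_sum:
  assumes "\<And>k. k < n \<Longrightarrow> a k \<in> carrier A" "\<And>k. k < n \<Longrightarrow> b k \<in> carrier B"
  shows "cnorm (tensor_alg A B) (\<Oplus>\<^bsub>tensor_alg A B\<^esub>k\<in>{..<n::nat}. tensor_elem A B (a k) (b k))
    = spatial_norm A B n a b"
  using spatial_tensor_norm assms by blast

lemma dense_tensor_elem:
  "dense_sums (tensor_alg A B) ((\<lambda>(a, b). tensor_elem A B a b) ` (carrier A \<times> carrier B))"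
proof (rule cstar_algebra.dense_sumsI[OF tensor_alg_cstar])
  show "(\<lambda>(a, b). tensor_elem A B a b) ` (carrier A \<times> carrier B) \<subseteq> carrier (tensor_alg A B)"
    using tensor_elem_closed by auto
  fix x and e :: real assume "x \<in> carrier (tensor_alg A B)" "0 < e"
  then obtain n :: nat and a b where "\<forall>k<n. a k \<in> carrier A" "\<forall>k<n. b k \<in> carrier B"
    "cnorm (tensor_alg A B) (x \<ominus>\<^bsub>tensor_alg A B\<^esub> (\<Oplus>\<^bsub>tensor_alg A B\<^esub>k\<in>{..<n}. tensor_elem A B (a k) (b k))) < e"
    using spatial_tensor_approx by blast
  then show "\<exists>(n::nat) y. (\<forall>k<n. y k \<in> (\<lambda>(a, b). tensor_elem A B a b) ` (carrier A \<times> carrier B)) \<and>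
      cnorm (tensor_alg A B) (x \<ominus>\<^bsub>tensor_alg A B\<^esub> (\<Oplus>\<^bsub>tensor_alg A B\<^esub>k\<in>{..<n}. y k)) < e"
    by (intro exI[of _ n] exI[of _ "\<lambda>k. tensor_elem A B (a k) (b k)"]) auto
qed

lemma cnorm_tensor_elem_le:
  assumes "a \<in> carrier A" "b \<in> carrier B"
  shows "cnorm (tensor_alg A B) (tensor_elem A B a b) \<le> cnorm A a * cnorm B b"
proof -
  interpret T: cstar_algebra "tensor_alg A B" by (rule tensor_alg_cstar)
  have "cnorm (tensor_alg A B) (tensor_elem A B a b) = spatial_norm A B 1 (\<lambda>_. a) (\<lambda>_. b)"
    using cnorm_tensor_sum[of 1 "\<lambda>_. a" "\<lambda>_. b"] assms tensor_elem_closed[OF assms]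
      T.finsum_lessThan_Suc[of 0 "\<lambda>_. tensor_elem A B a b"] by simp
  also have "\<dots> \<le> cnorm A a * cnorm B b"
    using tensor_sum_norm_le[OF A B, of _ _ 1 "\<lambda>_. a" "\<lambda>_. b"] assms
    by (intro spatial_norm_le[OF A B]) auto
  finally show ?thesis .
qed

text \<open>Additivity in each variable need not be assumed: it follows from the norm bound.\<close>

lemma tensor_extension:
  assumes R: "cstar_algebra R"
    and s: "\<And>a b. \<lbrakk>a \<in> carrier A; b \<in> carrier B\<rbrakk> \<Longrightarrow> s a b \<in> carrier R"
    and one: "s \<one>\<^bsub>A\<^esub> \<one>\<^bsub>B\<^esub> = \<one>\<^bsub>R\<^esub>"
    and mult: "\<And>a b a' b'. \<lbrakk>a \<in> carrier A; b \<in> carrier B; a' \<in> carrier A; b' \<in> carrier B\<rbrakk> \<Longrightarrow>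
      s (a \<otimes>\<^bsub>A\<^esub> a') (b \<otimes>\<^bsub>B\<^esub> b') = s a b \<otimes>\<^bsub>R\<^esub> s a' b'"
    and smult: "\<And>c a b. \<lbrakk>a \<in> carrier A; b \<in> carrier B\<rbrakk> \<Longrightarrow> s (c \<odot>\<^bsub>A\<^esub> a) b = c \<odot>\<^bsub>R\<^esub> s a b"
    and star: "\<And>a b. \<lbrakk>a \<in> carrier A; b \<in> carrier B\<rbrakk> \<Longrightarrow> s (star A a) (star B b) = star R (s a b)"
    and bound: "\<And>(n::nat) a b. \<lbrakk>\<And>k. k < n \<Longrightarrow> a k \<in> carrier A; \<And>k. k < n \<Longrightarrow> b k \<in> carrier B\<rbrakk> \<Longrightarrow>
      cnorm R (\<Oplus>\<^bsub>R\<^esub>k\<in>{..<n}. s (a k) (b k)) \<le> spatial_norm A B n a b"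
  shows "\<exists>h. h \<in> cstar_hom (tensor_alg A B) R \<and>
    (\<forall>a\<in>carrier A. \<forall>b\<in>carrier B. h (tensor_elem A B a b) = s a b)"
proof -
  interpret A: cstar_algebra A by (rule A)
  interpret B: cstar_algebra B by (rule B)
  let ?X = "carrier A \<times> carrier B" let ?T = "tensor_alg A B"
  let ?t = "\<lambda>(a, b). tensor_elem A B a b" let ?s = "\<lambda>(a, b). s a b"
  have "\<exists>h\<in>cstar_hom ?T R. \<forall>x\<in>?X. h (?t x) = ?s x"
  proof (rule cstar_hom_extension[OF tensor_alg_cstar R])
    show "dense_sums ?T (?t ` ?X)" by (rule dense_tensor_elem)
    show "?t x \<in> carrier ?T" "?s x \<in> carrier R" if "x \<in> ?X" for x
      using that s tensor_elem_closed by auto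
    show "\<exists>x\<in>?X. ?t x = \<one>\<^bsub>?T\<^esub> \<and> ?s x = \<one>\<^bsub>R\<^esub>"
      using one tensor_elem_one by (intro bexI[of _ "(\<one>\<^bsub>A\<^esub>, \<one>\<^bsub>B\<^esub>)"]) auto
    show "\<exists>z\<in>?X. ?t z = ?t x \<otimes>\<^bsub>?T\<^esub> ?t y \<and> ?s z = ?s x \<otimes>\<^bsub>R\<^esub> ?s y" if "x \<in> ?X" "y \<in> ?X" for x y
      using that mult tensor_elem_mult
      by (intro bexI[of _ "(fst x \<otimes>\<^bsub>A\<^esub> fst y, snd x \<otimes>\<^bsub>B\<^esub> snd y)"]) auto
    show "\<exists>z\<in>?X. ?t z = c \<odot>\<^bsub>?T\<^esub> ?t x \<and> ?s z = c \<odot>\<^bsub>R\<^esub> ?s x" if "x \<in> ?X" for c x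
      using that smult tensor_elem_smult A.smult_closed
      by (intro bexI[of _ "(c \<odot>\<^bsub>A\<^esub> fst x, snd x)"]) auto
    show "\<exists>z\<in>?X. ?t z = star ?T (?t x) \<and> ?s z = star R (?s x)" if "x \<in> ?X" for x
      using that star tensor_elem_star A.star_closed B.star_closed
      by (intro bexI[of _ "(star A (fst x), star B (snd x))"]) auto
    show "cnorm R (\<Oplus>\<^bsub>R\<^esub>k\<in>{..<n}. ?s (x k)) \<le> cnorm ?T (\<Oplus>\<^bsub>?T\<^esub>k\<in>{..<n}. ?t (x k))"
      if "\<And>k. k < n \<Longrightarrow> x k \<in> ?X" for n :: nat and x
    proof -
      have ab: "fst (x k) \<in> carrier A" "snd (x k) \<in> carrier B" if "k < n" for k
        using \<open>\<And>k. k < n \<Longrightarrow> x k \<in> ?X\<close>[OF that] by auto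
      show ?thesis
        unfolding case_prod_unfold
        using bound[of n "\<lambda>k. fst (x k)" "\<lambda>k. snd (x k)", OF ab] cnorm_tensor_sum[of n "\<lambda>k. fst (x k)" "\<lambda>k. snd (x k)", OF ab]
        by simp
    qed
  qed
  then show ?thesis by auto
qed

lemma tensor_hom_eqI:
  assumes "cstar_algebra R" "f \<in> cstar_hom (tensor_alg A B) R" "g \<in> cstar_hom (tensor_alg A B) R"
    and "\<And>a b. \<lbrakk>a \<in> carrier A; b \<in> carrier B\<rbrakk> \<Longrightarrow> f (tensor_elem A B a b) = g (tensor_elem A B a b)"
  shows "f = g"
  by (rule cstar_hom_eqI[OF assms(2,3) tensor_alg_cstar assms(1) dense_tensor_elem])
    (use assms(4) in auto)

text \<open>The definite descriptions in the definitions of the canonical homomorphisms denote as soon as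
  a homomorphism with the required values exists.\<close>

lemma the_tensor_hom:
  assumes R: "cstar_algebra R"
    and ex: "\<exists>h. h \<in> cstar_hom (tensor_alg A B) R \<and>
      (\<forall>a\<in>carrier A. \<forall>b\<in>carrier B. h (tensor_elem A B a b) = s a b)"
    and h: "h = (THE h. h \<in> cstar_hom (tensor_alg A B) R \<and>
      (\<forall>a\<in>carrier A. \<forall>b\<in>carrier B. h (tensor_elem A B a b) = s a b))"
  shows "h \<in> cstar_hom (tensor_alg A B) R"
    and "\<lbrakk>a \<in> carrier A; b \<in> carrier B\<rbrakk> \<Longrightarrow> h (tensor_elem A B a b) = s a b"
proof -
  have "\<exists>!h. h \<in> cstar_hom (tensor_alg A B) R \<and>
      (\<forall>a\<in>carrier A. \<forall>b\<in>carrier B. h (tensor_elem A B a b) = s a b)"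
    using ex by (rule ex_ex1I) (rule tensor_hom_eqI[OF R]; simp)
  from theI'[OF this] show "h \<in> cstar_hom (tensor_alg A B) R"
    "\<lbrakk>a \<in> carrier A; b \<in> carrier B\<rbrakk> \<Longrightarrow> h (tensor_elem A B a b) = s a b"
    unfolding h by blast+
qed

lemma dense_tensor_elem_subsets:
  assumes SA: "dense_sums A SA" and SB: "dense_sums B SB"
  shows "dense_sums (tensor_alg A B) {tensor_elem A B a b |a b. a \<in> SA \<and> b \<in> SB}"
proof -
  interpret A: cstar_algebra A by (rule A)
  interpret B: cstar_algebra B by (rule B)
  let ?T = "tensor_alg A B" let ?t = "tensor_elem A B"
  interpret T: cstar_algebra ?T by (rule tensor_alg_cstar)
  let ?S = "{?t a b |a b. a \<in> SA \<and> b \<in> SB}"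
  have SAc: "SA \<subseteq> carrier A" and SBc: "SB \<subseteq> carrier B" using SA SB by (auto simp: dense_sums_def)
  have Sc: "?S \<subseteq> carrier ?T" using SAc SBc tensor_elem_closed by blast
  note cl = A.sums_of_closed[OF _ SAc] B.sums_of_closed[OF _ SBc]
  have zero_left: "?t \<zero>\<^bsub>A\<^esub> b = \<zero>\<^bsub>?T\<^esub>" if "b \<in> carrier B" for b
    using tensor_elem_smult(1)[of "\<zero>\<^bsub>A\<^esub>" b 0] that tensor_elem_closed by (simp add: A.smult_zero T.smult_zero)
  have zero_right: "?t a \<zero>\<^bsub>B\<^esub> = \<zero>\<^bsub>?T\<^esub>" if "a \<in> carrier A" for a
    using tensor_elem_smult(2)[of a "\<zero>\<^bsub>B\<^esub>" 0] that tensor_elem_closed by (simp add: B.smult_zero T.smult_zero)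
  have minus_left: "?t (a \<ominus>\<^bsub>A\<^esub> a') b = ?t a b \<ominus>\<^bsub>?T\<^esub> ?t a' b"
    if "a \<in> carrier A" "a' \<in> carrier A" "b \<in> carrier B" for a a' b
    using that tensor_elem_smult(1)[of a' b "-1"] tensor_elem_closed
    by (simp add: A.minus_eq T.minus_eq tensor_elem_add_left A.smult_minus1 T.smult_minus1)
  have minus_right: "?t a (b \<ominus>\<^bsub>B\<^esub> b') = ?t a b \<ominus>\<^bsub>?T\<^esub> ?t a b'"
    if "a \<in> carrier A" "b \<in> carrier B" "b' \<in> carrier B" for a b b'
    using that tensor_elem_smult(2)[of a b' "-1"] tensor_elem_closed
    by (simp add: B.minus_eq T.minus_eq tensor_elem_add_right B.smult_minus1 T.smult_minus1)
  have 1: "?t u b \<in> sums_of ?T ?S" if "u \<in> sums_of A SA" "b \<in> SB" for u b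
    using that(1)
  proof (induction rule: sums_of.induct)
    case zero
    have "b \<in> carrier B" using that(2) SBc by blast
    then show ?case using sums_of.zero[of ?T ?S] by (simp add: zero_left)
  next
    case (add u s)
    have eq: "?t (u \<oplus>\<^bsub>A\<^esub> s) b = ?t u b \<oplus>\<^bsub>?T\<^esub> ?t s b"
      using add cl(1) SAc SBc that(2) by (intro tensor_elem_add_left) auto
    have mem: "?t s b \<in> ?S" using add(2) that(2) by blast
    show ?case unfolding eq by (rule sums_of.add[OF add.IH mem])
  qed
  have 2: "?t u v \<in> sums_of ?T ?S" if u: "u \<in> sums_of A SA" and v: "v \<in> sums_of B SB" for u v
    using v
  proof (induction rule: sums_of.induct)
    case zero
    show ?case unfolding zero_right[OF cl(1)[OF u]] by (rule sums_of.zero)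
  next
    case (add v s)
    have eq: "?t u (v \<oplus>\<^bsub>B\<^esub> s) = ?t u v \<oplus>\<^bsub>?T\<^esub> ?t u s"
      using add cl u SBc by (intro tensor_elem_add_right) auto
    show ?case unfolding eq by (rule T.sums_of_add[OF Sc add.IH 1[OF u add(2)]])
  qed
  show ?thesis
  proof (rule T.dense_sums_trans[OF dense_tensor_elem Sc])
    fix s and e :: real assume s: "s \<in> (\<lambda>(a, b). ?t a b) ` (carrier A \<times> carrier B)" and e: "0 < e"
    then obtain a b where ab: "a \<in> carrier A" "b \<in> carrier B" "s = ?t a b" by auto
    \<comment> \<open>The added 1 keeps the denominator positive when \<open>b\<close> has norm
      0.\<close>
    have "0 < e / (2 * (cnorm B b + 1))" using e B.cnorm_nonneg[OF ab(2)] by (simp add: field_simps)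
    then obtain u where u: "u \<in> sums_of A SA" "cnorm A (a \<ominus>\<^bsub>A\<^esub> u) < e / (2 * (cnorm B b + 1))"
      using SA ab(1) unfolding dense_sums_def by blast
    note uc = cl(1)[OF u(1)]
    \<comment> \<open>The tolerance for \<open>v\<close> depends on the approximant \<open>u\<close>
      already chosen, since the second error term is the tensor of \<open>u\<close> with
      \<open>b - v\<close>.\<close>
    have "0 < e / (2 * (cnorm A u + 1))" using e A.cnorm_nonneg[OF uc] by (simp add: field_simps)
    then obtain v where v: "v \<in> sums_of B SB" "cnorm B (b \<ominus>\<^bsub>B\<^esub> v) < e / (2 * (cnorm A u + 1))"
      using SB ab(2) unfolding dense_sums_def by blast
    note vc = cl(2)[OF v(1)]
    have "cnorm ?T (s \<ominus>\<^bsub>?T\<^esub> ?t u v) \<le> cnorm ?T (?t a b \<ominus>\<^bsub>?T\<^esub> ?t u b) + cnorm ?T (?t u b \<ominus>\<^bsub>?T\<^esub> ?t u v)"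
      unfolding ab(3) using ab uc vc tensor_elem_closed by (intro T.cnorm_diff_triangle) auto
    also have "\<dots> = cnorm ?T (?t (a \<ominus>\<^bsub>A\<^esub> u) b) + cnorm ?T (?t u (b \<ominus>\<^bsub>B\<^esub> v))"
      using ab uc vc by (simp add: minus_left minus_right)
    also have "\<dots> \<le> cnorm A (a \<ominus>\<^bsub>A\<^esub> u) * cnorm B b + cnorm A u * cnorm B (b \<ominus>\<^bsub>B\<^esub> v)"
      using ab uc vc by (intro add_mono cnorm_tensor_elem_le) auto
    also have "\<dots> < e / 2 + e / 2"
    proof (rule add_strict_mono)
      have "cnorm A (a \<ominus>\<^bsub>A\<^esub> u) * cnorm B b \<le> cnorm A (a \<ominus>\<^bsub>A\<^esub> u) * (cnorm B b + 1)"
        using ab uc A.cnorm_nonneg by (intro mult_left_mono) auto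
      also have "\<dots> < e / 2" using u(2) B.cnorm_nonneg[OF ab(2)] by (simp add: field_simps)
      finally show "cnorm A (a \<ominus>\<^bsub>A\<^esub> u) * cnorm B b < e / 2" .
      have "cnorm A u * cnorm B (b \<ominus>\<^bsub>B\<^esub> v) \<le> (cnorm A u + 1) * cnorm B (b \<ominus>\<^bsub>B\<^esub> v)"
        using ab vc B.cnorm_nonneg by (intro mult_right_mono) auto
      also have "\<dots> < e / 2" using v(2) A.cnorm_nonneg[OF uc] by (simp add: field_simps)
      finally show "cnorm A u * cnorm B (b \<ominus>\<^bsub>B\<^esub> v) < e / 2" .
    qed
    finally have "cnorm ?T (s \<ominus>\<^bsub>?T\<^esub> ?t u v) < e" by simp
    then show "\<exists>u\<in>sums_of ?T ?S. cnorm ?T (s \<ominus>\<^bsub>?T\<^esub> u) < e" using 2[OF u(1) v(1)] by blast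
  qed
qed

end

section \<open>Functoriality of the tensor product, and the flip\<close>

lemma cstar_hom_compose:
  assumes f: "f \<in> cstar_hom A B" and g: "g \<in> cstar_hom B C" and A: "cstar_algebra A"
  shows "(\<lambda>x\<in>carrier A. g (f x)) \<in> cstar_hom A C"
proof -
  interpret A: cstar_algebra A by (rule A)
  show ?thesis
    by (rule cstar_homI) (auto simp: cstar_homD[OF f] cstar_homD[OF g] A.smult_closed A.star_closed)
qed

lemma id_hom_cstar_hom: "cstar_algebra A \<Longrightarrow> id_hom A \<in> cstar_hom A A"
  by (rule cstar_homI)
    (auto simp: id_hom_def cstar_algebra.smult_closed cstar_algebra.star_closed
      intro: ring.ring_simprules dest!: cstar_algebra.axioms(1))

lemma id_hom_apply: "x \<in> carrier A \<Longrightarrow> id_hom A x = x"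
  by (simp add: id_hom_def)

lemma trep_comp:
  assumes f: "f \<in> cstar_hom A B" and P: "trep B P"
  shows "trep A (\<lambda>x. P (f x))"
  unfolding trep_def using trepD[OF P] cstar_homD[OF f] by simp

text \<open>A pair of representations of the target algebras pulls back along \<open>f\<close> and
  \<open>f'\<close> to a pair for the source algebras. Hence every norm in the supremum for the
  target also occurs in the supremum for the source, which is the bound required for
  extension.\<close>

lemma tensor_hom_props:
  fixes A B A' B' :: "(nat \<Rightarrow> 'x) cstar"
  assumes A: "cstar_algebra A" and B: "cstar_algebra B" and A': "cstar_algebra A'" and B': "cstar_algebra B'"
    and f: "f \<in> cstar_hom A B" and f': "f' \<in> cstar_hom A' B'"
  shows "tensor_hom A B A' B' f f' \<in> cstar_hom (tensor_alg A A') (tensor_alg B B')"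
    and "\<lbrakk>a \<in> carrier A; a' \<in> carrier A'\<rbrakk> \<Longrightarrow>
      tensor_hom A B A' B' f f' (tensor_elem A A' a a') = tensor_elem B B' (f a) (f' a')"
proof -
  note BB = tensor_alg_cstar[OF B B']
  note fD = cstar_homD[OF f] and fD' = cstar_homD[OF f']
  have ex: "\<exists>h. h \<in> cstar_hom (tensor_alg A A') (tensor_alg B B') \<and>
    (\<forall>a\<in>carrier A. \<forall>a'\<in>carrier A'. h (tensor_elem A A' a a') = tensor_elem B B' (f a) (f' a'))"
  proof (rule tensor_extension[OF A A' BB])
    show "cnorm (tensor_alg B B') (\<Oplus>\<^bsub>tensor_alg B B'\<^esub>k\<in>{..<n}. tensor_elem B B' (f (a k)) (f' (b k)))
      \<le> spatial_norm A A' n a b"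
      if a: "\<And>k. k < n \<Longrightarrow> a k \<in> carrier A" and b: "\<And>k. k < n \<Longrightarrow> b k \<in> carrier A'" for n :: nat and a b
    proof -
      have "cnorm (tensor_alg B B') (\<Oplus>\<^bsub>tensor_alg B B'\<^esub>k\<in>{..<n}. tensor_elem B B' (f (a k)) (f' (b k)))
        = spatial_norm B B' n (\<lambda>k. f (a k)) (\<lambda>k. f' (b k))"
        using a b by (intro cnorm_tensor_sum[OF B B']) (auto simp: fD(1) fD'(1))
      also have "\<dots> \<le> spatial_norm A A' n a b"
        by (rule spatial_norm_le[OF B B'])
          (use a b spatial_norm_ge[OF A A' a b trep_comp[OF f] trep_comp[OF f']] in \<open>auto simp: fD(1) fD'(1)\<close>)
      finally show ?thesis .
    qed
  qed (auto simp: fD fD' tensor_elem_closed[OF B B'] tensor_elem_mult[OF B B'] tensor_elem_one[OF B B']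
      tensor_elem_star[OF B B'] tensor_elem_smult[OF B B'])
  note * = the_tensor_hom[OF A A' BB ex tensor_hom_def]
  show "tensor_hom A B A' B' f f' \<in> cstar_hom (tensor_alg A A') (tensor_alg B B')" by (rule *(1))
  show "\<lbrakk>a \<in> carrier A; a' \<in> carrier A'\<rbrakk> \<Longrightarrow>
      tensor_hom A B A' B' f f' (tensor_elem A A' a a') = tensor_elem B B' (f a) (f' a')" by (rule *(2))
qed

text \<open>For each pair of representations the two sums of operators are conjugate under the
  unitary that swaps the coordinates.\<close>

lemma spatial_norm_flip_le:
  fixes B C :: "'u cstar"
  assumes B: "cstar_algebra B" and C: "cstar_algebra C"
    and b: "\<And>k. k < n \<Longrightarrow> b k \<in> carrier B" and c: "\<And>k. k < n \<Longrightarrow> c k \<in> carrier C"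
  shows "spatial_norm B C n b c \<le> spatial_norm C B n c b"
proof (rule spatial_norm_le[OF B C b c])
  fix P Q :: "'u \<Rightarrow> 'u bop" assume P: "trep B P" and Q: "trep C Q"
  have "(\<Sum>k<n. ten (P (b k)) (Q (c k))) = cj prod.swap (\<Sum>k<n. ten (Q (c k)) (P (b k)))"
    using trepD(5)[OF P b] trepD(5)[OF Q c] by (simp add: cj_sum[OF bij_prod_swap] cj_swap_ten)
  then show "norm (\<Sum>k<n. ten (P (b k)) (Q (c k))) \<le> spatial_norm C B n c b"
    using spatial_norm_ge[OF C B c b Q P] by (simp add: norm_cj[OF bij_prod_swap])
qed

lemma flip_hom_props:
  fixes C B :: "(nat \<Rightarrow> 'x) cstar"
  assumes C: "cstar_algebra C" and B: "cstar_algebra B"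
  shows "flip_hom C B \<in> cstar_hom (tensor_alg C B) (tensor_alg B C)"
    and "\<lbrakk>c \<in> carrier C; b \<in> carrier B\<rbrakk> \<Longrightarrow> flip_hom C B (tensor_elem C B c b) = tensor_elem B C b c"
proof -
  interpret C: cstar_algebra C by (rule C)
  interpret B: cstar_algebra B by (rule B)
  note BC = tensor_alg_cstar[OF B C]
  have ex: "\<exists>h. h \<in> cstar_hom (tensor_alg C B) (tensor_alg B C) \<and>
    (\<forall>c\<in>carrier C. \<forall>b\<in>carrier B. h (tensor_elem C B c b) = tensor_elem B C b c)"
  proof (rule tensor_extension[OF C B BC])
    show "cnorm (tensor_alg B C) (\<Oplus>\<^bsub>tensor_alg B C\<^esub>k\<in>{..<n}. tensor_elem B C (b k) (c k))
      \<le> spatial_norm C B n c b"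
      if c: "\<And>k. k < n \<Longrightarrow> c k \<in> carrier C" and b: "\<And>k. k < n \<Longrightarrow> b k \<in> carrier B" for n :: nat and c b
      using cnorm_tensor_sum[OF B C b c] spatial_norm_flip_le[OF B C b c] by simp
  qed (auto simp: tensor_elem_closed[OF B C] tensor_elem_mult[OF B C] tensor_elem_one[OF B C]
      tensor_elem_star[OF B C] tensor_elem_smult[OF B C])
  note * = the_tensor_hom[OF C B BC ex flip_hom_def]
  show "flip_hom C B \<in> cstar_hom (tensor_alg C B) (tensor_alg B C)" by (rule *(1))
  show "\<lbrakk>c \<in> carrier C; b \<in> carrier B\<rbrakk> \<Longrightarrow> flip_hom C B (tensor_elem C B c b) = tensor_elem B C b c"
    by (rule *(2))
qed

section \<open>Independence of the spatial norm of the choice of norming representations\<close>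

lemma bounded_linear_rank_one: "bounded_linear (\<lambda>x. scl (ap x q) (dl p))"
  by (rule bounded_linear_intro[of _ 1])
    (simp_all add: scl_simps(2,3) scaleR_l2_def norm_scl ap_norm_le)

lift_definition mat_unit :: "'i \<Rightarrow> 'i \<Rightarrow> 'i bop" is "\<lambda>p q x. scl (ap x q) (dl p)"
  by (rule bounded_linear_rank_one)

declare mat_unit.rep_eq [simp]

lemma clin_mat_unit: "clin (mat_unit p q)"
  by (simp add: clin_def scl_simps)

lemma mat_unit_comp: "mat_unit p q o\<^sub>L mat_unit r s = (if q = r then mat_unit p s else 0)"
  by (rule blinfun_eqI) (auto simp: scl_simps)

lemma adj_mat_unit: "adj (mat_unit p q) (mat_unit q p)"
  by (rule adj_dl) (auto simp: clin_mat_unit cip_dl cip_scl_left)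

lemma norm_mat_unit_le: "norm (mat_unit p q) \<le> 1"
  by (rule norm_blinfun_bound) (auto simp: norm_scl ap_norm_le)

definition proj :: "'i set \<Rightarrow> 'i bop" where
  "proj F = (\<Sum>p\<in>F. mat_unit p p)"

lemma clin_proj: "clin (proj F)"
  unfolding proj_def by (intro clin_sum clin_mat_unit)

lemma proj_dl: "finite F \<Longrightarrow> proj F (dl i) = (if i \<in> F then dl i else 0)"
proof -
  assume F: "finite F"
  have "proj F (dl i) = (\<Sum>p\<in>F. if p = i then dl i else 0)"
    unfolding proj_def blinfun.sum_left
    by (rule sum.cong) (auto simp: scl_simps)
  then show ?thesis using F by simp
qed

lemma ap_proj: "finite F \<Longrightarrow> ap (proj F x) i = (if i \<in> F then ap x i else 0)"
proof -
  assume F: "finite F"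
  have "ap (proj F x) i = (\<Sum>p\<in>F. if p = i then ap x i else 0)"
    unfolding proj_def blinfun.sum_left ap_sum by (rule sum.cong) auto
  then show ?thesis using F by simp
qed

lemma norm_proj_le: assumes F: "finite F" shows "norm (proj F) \<le> 1"
proof -
  have "adj (proj F) (proj F)" unfolding proj_def by (intro adj_sum adj_mat_unit)
  moreover have "proj F o\<^sub>L proj F = proj F"
    by (rule blinfun_eqI, rule l2_eqI) (simp add: ap_proj F)
  ultimately have "norm (proj F) * norm (proj F) = norm (proj F) * 1"
    using adj_norm(2) by (metis mult.right_neutral power2_eq_square)
  then show ?thesis by (metis mult_cancel_left order_refl zero_le_one)
qed

text \<open>Compressing to finitely many coordinates leaves a finite scalar matrix. In a tensor
  product, the first factor then appears only through finite linear combinations of its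
  operators.\<close>

lemma proj_compress:
  assumes R: "clin R" and F: "finite F"
  shows "proj F o\<^sub>L R o\<^sub>L proj F = (\<Sum>p\<in>F. \<Sum>q\<in>F. opscl (ap (R (dl q)) p) (mat_unit p q))"
proof (rule blinfun_eq_dl)
  show "clin (proj F o\<^sub>L R o\<^sub>L proj F)" by (intro clin_comp clin_proj R)
  show "clin (\<Sum>p\<in>F. \<Sum>q\<in>F. opscl (ap (R (dl q)) p) (mat_unit p q))"
    by (intro clin_sum clin_opscl clin_mat_unit)
  fix k
  have "ap ((\<Sum>p\<in>F. \<Sum>q\<in>F. opscl (ap (R (dl q)) p) (mat_unit p q)) (dl k)) i
      = (if i \<in> F \<and> k \<in> F then ap (R (dl k)) i else 0)" for i
  proof -
    have "ap ((\<Sum>p\<in>F. \<Sum>q\<in>F. opscl (ap (R (dl q)) p) (mat_unit p q)) (dl k)) i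
        = (\<Sum>p\<in>F. \<Sum>q\<in>F. if p = i then if q = k then ap (R (dl k)) i else 0 else 0)"
      unfolding blinfun.sum_left ap_sum by (intro sum.cong refl) auto
    also have "\<dots> = (\<Sum>p\<in>F. if p = i then \<Sum>q\<in>F. if q = k then ap (R (dl k)) i else 0 else 0)"
      by (intro sum.cong refl) auto
    finally show ?thesis using F by simp
  qed
  then show "(proj F o\<^sub>L R o\<^sub>L proj F) (dl k) = (\<Sum>p\<in>F. \<Sum>q\<in>F. opscl (ap (R (dl q)) p) (mat_unit p q)) (dl k)"
    by (intro l2_eqI) (simp add: ap_proj proj_dl F)
qed

section \<open>Cutting the second tensor factor down to finitely many coordinates\<close>

definition cutoff :: "'i set \<Rightarrow> ('h \<times> 'i) bop" where
  "cutoff F = ten id_blinfun (proj F)"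

lemma clin_id: "clin id_blinfun"
  by (simp add: clin_def)

lemma norm_cutoff_le:
  fixes F :: "'i set"
  assumes F: "finite F" shows "norm (cutoff F :: ('h \<times> 'i) bop) \<le> 1"
proof -
  have "norm (id_blinfun :: 'h bop) \<le> 1" by (rule norm_blinfun_bound) auto
  then have "norm (id_blinfun :: 'h bop) * norm (proj F) \<le> 1 * 1"
    by (intro mult_mono norm_proj_le F) auto
  then show ?thesis using norm_ten_le[of "id_blinfun :: 'h bop" "proj F"] unfolding cutoff_def by simp
qed

lemma cutoff_dl: "finite F \<Longrightarrow> cutoff F (dl (h, i)) = (if i \<in> F then dl (h, i) else 0)"
  unfolding cutoff_def vten_dl[symmetric]
  by (simp add: ten_vten clin_id clin_proj proj_dl bounded_bilinear.zero_right[OF bounded_bilinear_vten])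

lemma cutoff_approx:
  fixes x :: "('h \<times> 'i) l2"
  assumes e: "0 < e"
  shows "\<exists>F. finite F \<and> (\<forall>F'. finite F' \<longrightarrow> F \<subseteq> F' \<longrightarrow> norm (x - cutoff F' x) < e)"
proof -
  obtain G where G: "finite G" "norm (x - (\<Sum>k\<in>G. scl (ap x k) (dl k))) < e / 2"
    using l2_approx[of "e / 2" x] e by auto
  let ?y = "\<Sum>k\<in>G. scl (ap x k) (dl k)"
  have "norm (x - cutoff F' x) < e" if F': "finite F'" "snd ` G \<subseteq> F'" for F'
  proof -
    have "clin (cutoff F' :: ('h \<times> 'i) bop)" unfolding cutoff_def by (intro clin_ten clin_id clin_proj)
    moreover have "cutoff F' (dl k) = dl k" if "k \<in> G" for k
      using cutoff_dl[OF F'(1), of "fst k" "snd k"] that F'(2) by auto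
    ultimately have y: "cutoff F' ?y = ?y"
      by (simp add: blinfun.sum_right clinD cong: sum.cong)
    \<comment> \<open>The cutoff fixes the finite combination \<open>?y\<close>, so it only acts on
      the remainder. Being contractive, it can at most double the error.\<close>
    have eq: "x - cutoff F' x = (x - ?y) - cutoff F' (x - ?y)" by (simp add: blinfun.diff_right y)
    have "norm (x - cutoff F' x) \<le> norm (x - ?y) + norm (cutoff F' (x - ?y))"
      unfolding eq by (rule norm_triangle_ineq4)
    also have "norm (cutoff F' (x - ?y)) \<le> 1 * norm (x - ?y)"
      using norm_blinfun[of "cutoff F'" "x - ?y"] mult_right_mono[OF norm_cutoff_le[OF F'(1)] norm_ge_zero]
      by (rule order_trans)
    finally show ?thesis using G(2) by simp
  qed
  then show ?thesis using G(1) by blast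
qed

text \<open>The cutoffs are contractions tending strongly to the identity. Their approximation
  property holds for all larger finite sets, so one set can serve both for \<open>x\<close> and for
  \<open>X x\<close>.\<close>

lemma norm_le_of_cutoffs:
  fixes X :: "('h \<times> 'i) bop"
  assumes M: "0 \<le> M" and le: "\<And>F. finite F \<Longrightarrow> norm (cutoff F o\<^sub>L X o\<^sub>L cutoff F) \<le> M"
  shows "norm X \<le> M"
proof (rule norm_blinfun_bound[OF M])
  fix x
  show "norm (X x) \<le> M * norm x"
  proof (rule field_le_epsilon)
    fix e :: real assume e: "0 < e"
    \<comment> \<open>Chosen so that the norm of \<open>X\<close> times this number is at most
      \<open>e / 2\<close>; the added 1 covers the case that \<open>X\<close> is 0.\<close>
    define \<delta> where "\<delta> = e / (2 * (norm X + 1))"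
    have "0 < norm X + 1" by (rule add_nonneg_pos) auto
    then have \<delta>: "0 < \<delta>" unfolding \<delta>_def by (intro divide_pos_pos[OF e]) simp
    obtain F1 where F1: "finite F1" "\<And>F'. finite F' \<Longrightarrow> F1 \<subseteq> F' \<Longrightarrow> norm (x - cutoff F' x) < \<delta>"
      using cutoff_approx[OF \<delta>] by blast
    have e2: "0 < e / 2" using e by simp
    obtain F2 where F2: "finite F2" "\<And>F'. finite F' \<Longrightarrow> F2 \<subseteq> F' \<Longrightarrow> norm (X x - cutoff F' (X x)) < e / 2"
      using cutoff_approx[OF e2] by blast
    let ?F = "F1 \<union> F2"
    have F: "finite ?F" using F1 F2 by simp
    let ?Q = "cutoff ?F :: ('h \<times> 'i) bop"
    have "X x = (X x - ?Q (X x)) + (?Q (X (x - ?Q x)) + (?Q o\<^sub>L X o\<^sub>L ?Q) x)"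
      by (simp add: blinfun.diff_right)
    then have "norm (X x) \<le> norm (X x - ?Q (X x)) + (norm (?Q (X (x - ?Q x))) + norm ((?Q o\<^sub>L X o\<^sub>L ?Q) x))"
      by (metis norm_triangle_ineq norm_triangle_mono order_refl)
    also have "norm (X x - ?Q (X x)) \<le> e / 2" using F2(2)[OF F] by simp
    also have "norm (?Q (X (x - ?Q x))) \<le> 1 * (norm X * \<delta>)"
    proof -
      have "norm (X (x - ?Q x)) \<le> norm X * \<delta>"
        using norm_blinfun[of X "x - ?Q x"] mult_left_mono[of "norm (x - ?Q x)" \<delta> "norm X"] F1(2)[OF F] by simp
      then have "norm ?Q * norm (X (x - ?Q x)) \<le> 1 * (norm X * \<delta>)"
        by (rule mult_mono[OF norm_cutoff_le[OF F]]) auto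
      with norm_blinfun[of ?Q "X (x - ?Q x)"] show ?thesis by (rule order_trans)
    qed
    also have "norm ((?Q o\<^sub>L X o\<^sub>L ?Q) x) \<le> M * norm x"
      using norm_blinfun[of "?Q o\<^sub>L X o\<^sub>L ?Q" x] mult_right_mono[OF le[OF F] norm_ge_zero] by (rule order_trans)
    also have "1 * (norm X * \<delta>) \<le> e / 2"
    proof -
      have "norm X * \<delta> \<le> (norm X + 1) * \<delta>" using \<delta> by simp
      also have "\<dots> = e / 2" using norm_ge_zero[of X] by (simp add: \<delta>_def field_simps add_nonneg_eq_0_iff)
      finally show ?thesis by simp
    qed
    finally show "norm (X x) \<le> M * norm x + e" by simp
  qed
qed

section \<open>Matrices over a C*-algebra\<close>

lemma trep_finsum:
  assumes D: "cstar_algebra D" and P: "trep D P" and "finite F" "\<And>r. r \<in> F \<Longrightarrow> x r \<in> carrier D"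
  shows "P (\<Oplus>\<^bsub>D\<^esub>r\<in>F. x r) = (\<Sum>r\<in>F. P (x r))"
proof -
  interpret D: cstar_algebra D by (rule D)
  show ?thesis
    using assms(3,4)
  proof (induction F)
    case empty then show ?case by (simp add: trep_zero[OF D P])
  next
    case (insert r F)
    then show ?case by (simp add: D.finsum_insert Pi_def trepD(1)[OF P] D.finsum_closed)
  qed
qed

text \<open>The amplification of \<open>P\<close> to square matrices indexed by \<open>F\<close>.
  Matrices are total functions, and entries with an index outside \<open>F\<close> are
  ignored.\<close>

definition mat_rep :: "'i set \<Rightarrow> ('d \<Rightarrow> 'h bop) \<Rightarrow> ('i \<Rightarrow> 'i \<Rightarrow> 'd) \<Rightarrow> ('h \<times> 'i) bop" where
  "mat_rep F P V = (\<Sum>p\<in>F. \<Sum>q\<in>F. ten (P (V p q)) (mat_unit p q))"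

definition mat_mult :: "'d cstar \<Rightarrow> 'i set \<Rightarrow> ('i \<Rightarrow> 'i \<Rightarrow> 'd) \<Rightarrow> ('i \<Rightarrow> 'i \<Rightarrow> 'd) \<Rightarrow> 'i \<Rightarrow> 'i \<Rightarrow> 'd" where
  "mat_mult D F V W p q = (\<Oplus>\<^bsub>D\<^esub>r\<in>F. V p r \<otimes>\<^bsub>D\<^esub> W r q)"

lemma ten_zero: "ten S 0 = 0" "ten 0 T = 0"
  using norm_ten_le[of S 0] norm_ten_le[of 0 T] by simp_all

lemma ten_sum_left:
  assumes "finite F" "\<And>k. k \<in> F \<Longrightarrow> clin (S k)" "clin T"
  shows "ten (\<Sum>k\<in>F. S k) T = (\<Sum>k\<in>F. ten (S k) T)"
  using assms by (induction F) (simp_all add: ten_zero ten_add clin_sum)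

lemma ten_sum_right:
  assumes "finite F" "\<And>k. k \<in> F \<Longrightarrow> clin (T k)" "clin S"
  shows "ten S (\<Sum>k\<in>F. T k) = (\<Sum>k\<in>F. ten S (T k))"
  using assms by (induction F) (simp_all add: ten_zero ten_add clin_sum)

context
  fixes D :: "'d cstar" and F :: "'i set"
  assumes D: "cstar_algebra D" and F: "finite F"
begin

interpretation D: cstar_algebra D by (rule D)

lemma mat_mult_closed:
  "\<lbrakk>\<And>p q. V p q \<in> carrier D; \<And>p q. W p q \<in> carrier D\<rbrakk> \<Longrightarrow> mat_mult D F V W p q \<in> carrier D"
  unfolding mat_mult_def by (intro D.finsum_closed) auto

lemma mat_rep_mult:
  assumes P: "trep D P" and V: "\<And>p q. V p q \<in> carrier D" and W: "\<And>p q. W p q \<in> carrier D"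
  shows "mat_rep F P (mat_mult D F V W) = mat_rep F P V o\<^sub>L mat_rep F P W"
proof -
  note cl = trepD(5)[OF P V] trepD(5)[OF P W]
  interpret comp: bounded_bilinear "(o\<^sub>L) :: ('h \<times> 'i) bop \<Rightarrow> ('h \<times> 'i) bop \<Rightarrow> _"
    by (rule bounded_bilinear_blinfun_compose)
  let ?t = "\<lambda>p r q. ten (P (V p r) o\<^sub>L P (W r q)) (mat_unit p q)"
  have "mat_rep F P V o\<^sub>L mat_rep F P W = (\<Sum>p\<in>F. \<Sum>r\<in>F. ten (P (V p r)) (mat_unit p r) o\<^sub>L mat_rep F P W)"
    unfolding mat_rep_def[of F P V] comp.sum_left ..
  also have "\<dots>
      = (\<Sum>p\<in>F. \<Sum>r\<in>F. \<Sum>s\<in>F. \<Sum>q\<in>F. ten (P (V p r)) (mat_unit p r) o\<^sub>L ten (P (W s q)) (mat_unit s q))"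
    unfolding mat_rep_def comp.sum_right ..
  also have "\<dots> = (\<Sum>p\<in>F. \<Sum>r\<in>F. \<Sum>s\<in>F. \<Sum>q\<in>F. if s = r then ?t p r q else 0)"
    by (intro sum.cong refl) (auto simp: ten_comp cl clin_mat_unit mat_unit_comp ten_zero)
  also have "\<dots> = (\<Sum>p\<in>F. \<Sum>r\<in>F. \<Sum>s\<in>F. if s = r then (\<Sum>q\<in>F. ?t p r q) else 0)"
    by (intro sum.cong refl) auto
  also have "\<dots> = (\<Sum>p\<in>F. \<Sum>r\<in>F. \<Sum>q\<in>F. ?t p r q)" using F by simp
  also have "\<dots> = (\<Sum>p\<in>F. \<Sum>q\<in>F. \<Sum>r\<in>F. ?t p r q)"
    by (intro sum.cong refl sum.swap)
  also have "\<dots> = mat_rep F P (mat_mult D F V W)"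
    unfolding mat_rep_def
  proof (intro sum.cong refl)
    fix p q
    have "P (mat_mult D F V W p q) = (\<Sum>r\<in>F. P (V p r) o\<^sub>L P (W r q))"
      unfolding mat_mult_def using V W F by (simp add: trep_finsum[OF D P] trepD(3)[OF P])
    then show "(\<Sum>r\<in>F. ?t p r q) = ten (P (mat_mult D F V W p q)) (mat_unit p q)"
      using F by (simp add: ten_sum_left clin_comp cl clin_mat_unit)
  qed
  finally show ?thesis by simp
qed

lemma mat_rep_adj:
  assumes P: "trep D P" and V: "\<And>p q. V p q \<in> carrier D"
  shows "adj (mat_rep F P V) (mat_rep F P (\<lambda>p q. star D (V q p)))"
proof -
  have "mat_rep F P (\<lambda>p q. star D (V q p)) = (\<Sum>p\<in>F. \<Sum>q\<in>F. ten (P (star D (V p q))) (mat_unit q p))"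
    unfolding mat_rep_def by (rule sum.swap)
  then show ?thesis
    unfolding mat_rep_def by (simp only:) (intro adj_sum adj_ten trepD(4)[OF P] V adj_mat_unit)
qed

text \<open>Applying the matrix to vectors of the form \<open>vten x (dl q)\<close> and cutting off
  at \<open>p\<close> isolates one entry, and neither operation increases norms.\<close>

lemma norm_mat_entry_le:
  assumes P: "trep D P" and V: "\<And>p q. V p q \<in> carrier D" and pq: "p \<in> F" "q \<in> F"
  shows "norm (P (V p q)) \<le> norm (mat_rep F P V)"
proof (rule norm_blinfun_bound)
  fix x
  interpret vten: bounded_bilinear vten by (rule bounded_bilinear_vten)
  have "mat_rep F P V (vten x (dl q)) = (\<Sum>p'\<in>F. \<Sum>q'\<in>F. if q' = q then vten (P (V p' q) x) (dl p') else 0)"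
    unfolding mat_rep_def blinfun.sum_left
    by (intro sum.cong refl)
      (auto simp: ten_vten trepD(5)[OF P V] clin_mat_unit scl_simps vten.zero_right)
  then have 1: "mat_rep F P V (vten x (dl q)) = (\<Sum>p'\<in>F. vten (P (V p' q) x) (dl p'))"
    using F pq by simp
  have "cutoff {p} (mat_rep F P V (vten x (dl q))) = (\<Sum>p'\<in>F. if p' = p then vten (P (V p q) x) (dl p) else 0)"
    unfolding 1 blinfun.sum_right cutoff_def
    by (intro sum.cong refl) (auto simp: ten_vten clin_id clin_proj proj_dl vten.zero_right)
  then have 2: "cutoff {p} (mat_rep F P V (vten x (dl q))) = vten (P (V p q) x) (dl p)" using F pq by simp
  have "norm (P (V p q) x) = norm (cutoff {p} (mat_rep F P V (vten x (dl q))))"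
    by (simp add: 2 norm_vten)
  also have "\<dots> \<le> 1 * norm (mat_rep F P V (vten x (dl q)))"
    using norm_blinfun mult_right_mono[OF norm_cutoff_le norm_ge_zero] by (rule order_trans) simp
  also have "\<dots> \<le> norm (mat_rep F P V) * norm x"
    using norm_blinfun[of "mat_rep F P V" "vten x (dl q)"] by (simp add: norm_vten)
  finally show "norm (P (V p q) x) \<le> norm (mat_rep F P V) * norm x" .
qed simp

text \<open>Only some factor that depends on \<open>F\<close> alone is wanted here, so the triangle
  inequality over all entries suffices.\<close>

lemma norm_mat_rep_le:
  assumes P: "trep D P" and V: "\<And>p q. V p q \<in> carrier D"
    and K: "\<And>p q. \<lbrakk>p \<in> F; q \<in> F\<rbrakk> \<Longrightarrow> cnorm D (V p q) \<le> K"
  shows "norm (mat_rep F P V) \<le> (real (card F))\<^sup>2 * K"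
proof -
  have "norm (mat_rep F P V) \<le> (\<Sum>p\<in>F. \<Sum>q\<in>F. K)"
    unfolding mat_rep_def
  proof (intro sum_norm_le)
    fix p q assume pq: "p \<in> F" "q \<in> F"
    have "norm (ten (P (V p q)) (mat_unit p q)) \<le> norm (P (V p q)) * norm (mat_unit p q)" by (rule norm_ten_le)
    also have "\<dots> \<le> norm (P (V p q)) * 1" by (intro mult_left_mono norm_mat_unit_le) auto
    also have "\<dots> \<le> K" using trep_norm_le[OF D P V, of p q] K[OF pq] by simp
    finally show "norm (ten (P (V p q)) (mat_unit p q)) \<le> K" .
  qed
  then show ?thesis by (simp add: power2_eq_square mult.assoc)
qed

end

text \<open>If \<open>a\<close> exceeded \<open>M\<close>, the powers of \<open>a / M\<close> would
  be unbounded, while the hypothesis keeps a sequence of them below \<open>K\<close>. Exponents of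
  the form 2^(n+1) are those produced by repeated squaring.\<close>

lemma le_of_power_bounds:
  fixes a M K :: real
  assumes a: "0 \<le> a" and M: "0 \<le> M" and le: "\<And>n::nat. a ^ (2 ^ Suc n) \<le> K * M ^ (2 ^ Suc n)"
  shows "a \<le> M"
proof (rule ccontr)
  assume "\<not> a \<le> M"
  then have aM: "M < a" by simp
  show False
  proof (cases "M = 0")
    case True
    then show False using le[of 0] aM by simp
  next
    case False
    then have M0: "0 < M" using M by simp
    obtain n where n: "K < (a / M) ^ n" using real_arch_pow[of "a / M" K] aM M0 by auto
    have "n \<le> 2 ^ Suc n" by (metis Suc_leD less_exp less_imp_le nat_le_iff_add power_increasing_iff trans_le_add1 less_Suc_eq_le)
    then have "(a / M) ^ n \<le> (a / M) ^ (2 ^ Suc n)" using aM M0 by (intro power_increasing) auto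
    also have "\<dots> \<le> K" using le[of n] M0 by (simp add: power_divide divide_le_eq)
    finally show False using n by simp
  qed
qed

text \<open>\<open>W\<^sub>0 = Z* Z\<close> and \<open>W\<^sub>n\<^sub>+\<^sub>1 = W\<^sub>n\<^sup>2\<close>. All norms on matrices being equivalent up to the factor \<open>|F|\<^sup>2\<close>,
  comparing \<open>\<parallel>W\<^sub>n\<parallel> = \<parallel>Z\<parallel>\<^bsup>2^(n+1)\<^esup>\<close> under two representations removes the factor.\<close>

lemma mat_rep_norm_le:
  fixes P :: "'d \<Rightarrow> 'h bop" and \<T> :: "('d \<Rightarrow> 'j bop) set" and F :: "'i set"
  assumes D: "cstar_algebra D" and P: "trep D P" and \<T>: "\<And>\<tau>. \<tau> \<in> \<T> \<Longrightarrow> trep D \<tau>"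
    and norming: "\<And>x K. \<lbrakk>x \<in> carrier D; 0 \<le> K; \<And>\<tau>. \<tau> \<in> \<T> \<Longrightarrow> norm (\<tau> x) \<le> K\<rbrakk> \<Longrightarrow> cnorm D x \<le> K"
    and F: "finite F" and Z: "\<And>p q. Z p q \<in> carrier D" and M: "0 \<le> M"
    and le: "\<And>\<tau>. \<tau> \<in> \<T> \<Longrightarrow> norm (mat_rep F \<tau> Z) \<le> M"
  shows "norm (mat_rep F P Z) \<le> M"
proof -
  interpret D: cstar_algebra D by (rule D)
  define W where "W = rec_nat (mat_mult D F (\<lambda>p q. star D (Z q p)) Z) (\<lambda>_ V. mat_mult D F V V)"
  have W0: "W 0 = mat_mult D F (\<lambda>p q. star D (Z q p)) Z" and WS: "W (Suc n) = mat_mult D F (W n) (W n)" for n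
    by (simp_all add: W_def)
  have Zs: "star D (Z q p) \<in> carrier D" for p q using Z D.star_closed by simp
  have Wc: "W n p q \<in> carrier D" for n p q
    by (induction n arbitrary: p q) (auto simp: W0 WS intro!: mat_mult_closed[OF D F] Z Zs)
  have norm_W: "norm (mat_rep F Q (W n)) = norm (mat_rep F Q Z) ^ (2 ^ Suc n)"
    if Q: "trep D Q" for Q :: "'d \<Rightarrow> 'k bop" and n
  proof -
    \<comment> \<open>Self-adjointness is carried along in the induction, since only for
      self-adjoint operators is the norm of the square the square of the norm.\<close>
    have "adj (mat_rep F Q (W n)) (mat_rep F Q (W n)) \<and> norm (mat_rep F Q (W n)) = norm (mat_rep F Q Z) ^ (2 ^ Suc n)"
    proof (induction n)
      case 0
      have "mat_rep F Q (W 0) = mat_rep F Q (\<lambda>p q. star D (Z q p)) o\<^sub>L mat_rep F Q Z"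
        unfolding W0 by (rule mat_rep_mult[OF D F Q Zs Z])
      then show ?case
        using adj_norm(2)[OF mat_rep_adj[OF D F Q Z]] mat_rep_adj[OF D F Q Z] adj_comp adj_sym by fastforce
    next
      case (Suc n)
      have "mat_rep F Q (W (Suc n)) = mat_rep F Q (W n) o\<^sub>L mat_rep F Q (W n)"
        unfolding WS by (rule mat_rep_mult[OF D F Q Wc Wc])
      then show ?case
        using Suc.IH adj_norm(2) adj_comp by (fastforce simp: power_mult[symmetric] mult.commute)
    qed
    then show ?thesis by blast
  qed
  have "norm (mat_rep F P Z) ^ (2 ^ Suc n) \<le> (real (card F))\<^sup>2 * M ^ (2 ^ Suc n)" for n
  proof -
    \<comment> \<open>The bound by \<open>M\<close> on the family yields, after squaring, a bound on
      every entry under each of its members. The norming hypothesis turns this into a bound on the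
      entry in \<open>D\<close>, hence one valid under \<open>P\<close> as well.\<close>
    have cn: "cnorm D (W n p q) \<le> M ^ (2 ^ Suc n)" if pq: "p \<in> F" "q \<in> F" for p q
    proof (rule norming[OF Wc])
      show "0 \<le> M ^ (2 ^ Suc n)" using M by simp
      fix \<tau> assume \<tau>: "\<tau> \<in> \<T>"
      have "norm (\<tau> (W n p q)) \<le> norm (mat_rep F \<tau> (W n))" by (rule norm_mat_entry_le[OF D F \<T>[OF \<tau>] Wc pq])
      also have "\<dots> \<le> M ^ (2 ^ Suc n)" unfolding norm_W[OF \<T>[OF \<tau>]] by (intro power_mono le \<tau>) auto
      finally show "norm (\<tau> (W n p q)) \<le> M ^ (2 ^ Suc n)" .
    qed
    have "norm (mat_rep F P (W n)) \<le> (real (card F))\<^sup>2 * M ^ (2 ^ Suc n)"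
      by (rule norm_mat_rep_le[OF D F P]) (rule Wc cn; assumption)+
    then show ?thesis unfolding norm_W[OF P] .
  qed
  then show ?thesis by (rule le_of_power_bounds[OF norm_ge_zero M])
qed

text \<open>A cutoff in the second factor replaces the sum of tensors by the amplification of a
  single matrix \<open>Z\<close> over \<open>D\<close>. That matrix does not depend on the
  representation, so the comparison of matrix norms applies to it.\<close>

lemma norm_tensor_sum_le_of_norming:
  fixes P :: "'d \<Rightarrow> 'h bop" and \<T> :: "('d \<Rightarrow> 'j bop) set" and R :: "nat \<Rightarrow> 'i bop"
  assumes D: "cstar_algebra D" and P: "trep D P" and \<T>: "\<And>\<tau>. \<tau> \<in> \<T> \<Longrightarrow> trep D \<tau>"
    and norming: "\<And>x K. \<lbrakk>x \<in> carrier D; 0 \<le> K; \<And>\<tau>. \<tau> \<in> \<T> \<Longrightarrow> norm (\<tau> x) \<le> K\<rbrakk> \<Longrightarrow> cnorm D x \<le> K"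
    and d: "\<And>k. k < n \<Longrightarrow> d k \<in> carrier D" and R: "\<And>k. k < n \<Longrightarrow> clin (R k)" and M: "0 \<le> M"
    and le: "\<And>\<tau>. \<tau> \<in> \<T> \<Longrightarrow> norm (\<Sum>k<n. ten (\<tau> (d k)) (R k)) \<le> M"
  shows "norm (\<Sum>k<n. ten (P (d k)) (R k)) \<le> M"
proof (rule norm_le_of_cutoffs[OF M])
  interpret D: cstar_algebra D by (rule D)
  fix F :: "'i set" assume F: "finite F"
  \<comment> \<open>Each \<open>R k\<close> contributes to the entry at \<open>p\<close> and
    \<open>q\<close> its own matrix coefficient as the scalar in front of
    \<open>d k\<close>.\<close>
  define Z where "Z p q = (\<Oplus>\<^bsub>D\<^esub>k\<in>{..<n}. ap (R k (dl q)) p \<odot>\<^bsub>D\<^esub> d k)" for p q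
  have Z: "Z p q \<in> carrier D" for p q
    unfolding Z_def using d D.smult_closed by (intro D.finsum_closed) auto
  have eq: "mat_rep F Q Z = cutoff F o\<^sub>L (\<Sum>k<n. ten (Q (d k)) (R k)) o\<^sub>L cutoff F"
    if Q: "trep D Q" for Q :: "'d \<Rightarrow> 'k bop"
  proof -
    note cl = trepD(5)[OF Q d]
    interpret comp: bounded_bilinear "(o\<^sub>L) :: ('k \<times> 'i) bop \<Rightarrow> ('k \<times> 'i) bop \<Rightarrow> _"
      by (rule bounded_bilinear_blinfun_compose)
    have "cutoff F o\<^sub>L (\<Sum>k<n. ten (Q (d k)) (R k)) o\<^sub>L cutoff F = (\<Sum>k<n. cutoff F o\<^sub>L ten (Q (d k)) (R k) o\<^sub>L cutoff F)"
      by (simp only: comp.sum_left comp.sum_right)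
    also have "\<dots> = (\<Sum>k<n. \<Sum>p\<in>F. \<Sum>q\<in>F. opscl (ap (R k (dl q)) p) (ten (Q (d k)) (mat_unit p q)))"
    proof (rule sum.cong[OF refl])
      fix k assume "k \<in> {..<n}"
      then have k: "k < n" by simp
      have i: "id_blinfun o\<^sub>L Q (d k) o\<^sub>L id_blinfun = Q (d k)" by (rule blinfun_eqI) simp
      have "cutoff F o\<^sub>L ten (Q (d k)) (R k) o\<^sub>L cutoff F = ten (Q (d k)) (proj F o\<^sub>L R k o\<^sub>L proj F)"
        unfolding cutoff_def by (simp add: ten_comp clin_comp clin_id clin_proj cl[OF k] R[OF k] i)
      also have "\<dots> = (\<Sum>p\<in>F. \<Sum>q\<in>F. opscl (ap (R k (dl q)) p) (ten (Q (d k)) (mat_unit p q)))"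
        using F by (simp add: proj_compress R[OF k] ten_sum_right clin_sum clin_opscl clin_mat_unit cl[OF k] ten_opscl)
      finally show "cutoff F o\<^sub>L ten (Q (d k)) (R k) o\<^sub>L cutoff F
          = (\<Sum>p\<in>F. \<Sum>q\<in>F. opscl (ap (R k (dl q)) p) (ten (Q (d k)) (mat_unit p q)))" .
    qed
    also have "\<dots> = (\<Sum>p\<in>F. \<Sum>k<n. \<Sum>q\<in>F. opscl (ap (R k (dl q)) p) (ten (Q (d k)) (mat_unit p q)))"
      by (rule sum.swap)
    also have "\<dots> = (\<Sum>p\<in>F. \<Sum>q\<in>F. \<Sum>k<n. opscl (ap (R k (dl q)) p) (ten (Q (d k)) (mat_unit p q)))"
      by (intro sum.cong refl sum.swap)
    also have "\<dots> = mat_rep F Q Z"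
      unfolding mat_rep_def
    proof (intro sum.cong refl)
      fix p q
      have "Q (Z p q) = (\<Sum>k<n. opscl (ap (R k (dl q)) p) (Q (d k)))"
        unfolding Z_def
        using trep_finsum[OF D Q, of "{..<n}" "\<lambda>k. ap (R k (dl q)) p \<odot>\<^bsub>D\<^esub> d k"] d D.smult_closed
        by (simp add: trepD(2)[OF Q])
      then have "ten (Q (Z p q)) (mat_unit p q) = (\<Sum>k<n. ten (opscl (ap (R k (dl q)) p) (Q (d k))) (mat_unit p q))"
        by (simp only:) (rule ten_sum_left; auto intro: clin_opscl cl clin_mat_unit)
      also have "\<dots> = (\<Sum>k<n. opscl (ap (R k (dl q)) p) (ten (Q (d k)) (mat_unit p q)))"
        by (rule sum.cong[OF refl]) (simp add: cl clin_mat_unit ten_opscl)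
      finally show "(\<Sum>k<n. opscl (ap (R k (dl q)) p) (ten (Q (d k)) (mat_unit p q))) = ten (Q (Z p q)) (mat_unit p q)" ..
    qed
    finally show ?thesis by simp
  qed
  have cutoff_le: "norm (cutoff F o\<^sub>L X o\<^sub>L cutoff F) \<le> norm X" for X :: "('k \<times> 'i) bop"
  proof -
    have "norm (cutoff F o\<^sub>L X o\<^sub>L cutoff F) \<le> norm (cutoff F o\<^sub>L X) * norm (cutoff F :: ('k \<times> 'i) bop)"
      by (rule norm_blinfun_compose)
    also have "\<dots> \<le> norm (cutoff F o\<^sub>L X) * 1" by (intro mult_left_mono norm_cutoff_le F) auto
    also have "\<dots> \<le> norm (cutoff F :: ('k \<times> 'i) bop) * norm X" using norm_blinfun_compose[of "cutoff F" X] by simp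
    also have "\<dots> \<le> 1 * norm X" by (intro mult_right_mono norm_cutoff_le F) auto
    finally show ?thesis by simp
  qed
  have "norm (mat_rep F P Z) \<le> M"
  proof (rule mat_rep_norm_le[OF D P \<T> norming F Z M])
    show "norm (mat_rep F \<tau> Z) \<le> M" if "\<tau> \<in> \<T>" for \<tau>
      unfolding eq[OF \<T>[OF that]] using cutoff_le le[OF that] by (rule order_trans)
  qed
  then show "norm (cutoff F o\<^sub>L (\<Sum>k<n. ten (P (d k)) (R k)) o\<^sub>L cutoff F) \<le> M" by (simp add: eq[OF P])
qed

section \<open>Associativity of the spatial tensor product\<close>

text \<open>Two sequences are interleaved along the two summands of \<open>sum_decode\<close>. A
  bijection, not merely an injection, is wanted so that conjugation by it is unitary and preserves
  norms.\<close>

lemma bij_pair_code: "\<exists>g :: (nat \<Rightarrow> 'x) \<times> (nat \<Rightarrow> 'x) \<Rightarrow> nat \<Rightarrow> 'x. bij g"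
proof -
  define g :: "(nat \<Rightarrow> 'x) \<times> (nat \<Rightarrow> 'x) \<Rightarrow> nat \<Rightarrow> 'x" where
    "g = (\<lambda>(u, v) n. case sum_decode n of Inl k \<Rightarrow> u k | Inr k \<Rightarrow> v k)"
  have gl: "g (u, v) (sum_encode (Inl k)) = u k" "g (u, v) (sum_encode (Inr k)) = v k" for u v k
    by (simp_all add: g_def)
  have "inj g"
  proof (rule injI)
    fix x y assume "g x = g y"
    then have "fst x k = fst y k" "snd x k = snd y k" for k
      using gl[of "fst x" "snd x" k] gl[of "fst y" "snd y" k] by simp_all
    then show "x = y" by (simp add: prod_eq_iff ext)
  qed
  moreover have "surj g"
  proof (rule surjI)
    fix w :: "nat \<Rightarrow> 'x"
    show "g ((\<lambda>k. w (sum_encode (Inl k))), (\<lambda>k. w (sum_encode (Inr k)))) = w"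
    proof
      fix n
      show "g ((\<lambda>k. w (sum_encode (Inl k))), (\<lambda>k. w (sum_encode (Inr k)))) n = w n"
        by (cases "sum_decode n") (simp_all add: g_def, metis sum_decode_inverse, metis sum_decode_inverse)
    qed
  qed
  ultimately show ?thesis by (auto simp: bij_def)
qed

text \<open>A pair of representations of \<open>A\<close> and \<open>B\<close> on \<open>\<ell>\<^sup>2('u)\<close> induces one of \<open>A \<otimes> B\<close> on \<open>\<ell>\<^sup>2('u \<times> 'u)\<close>,
  which \<open>g\<close> moves back to \<open>\<ell>\<^sup>2('u)\<close>.\<close>

lemma product_representation:
  fixes A B :: "(nat \<Rightarrow> 'x) cstar" and P Q :: "(nat \<Rightarrow> 'x) \<Rightarrow> (nat \<Rightarrow> 'x) bop"
    and g :: "(nat \<Rightarrow> 'x) \<times> (nat \<Rightarrow> 'x) \<Rightarrow> nat \<Rightarrow> 'x"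
  assumes A: "cstar_algebra A" and B: "cstar_algebra B" and P: "trep A P" and Q: "trep B Q" and g: "bij g"
  shows "\<exists>\<tau>. trep (tensor_alg A B) \<tau> \<and>
    (\<forall>a\<in>carrier A. \<forall>b\<in>carrier B. \<tau> (tensor_elem A B a b) = cj g (ten (P a) (Q b)))"
proof -
  interpret A: cstar_algebra A by (rule A)
  interpret B: cstar_algebra B by (rule B)
  note PD = trepD[OF P] and QD = trepD[OF Q]
  let ?s = "\<lambda>a b. cj g (ten (P a) (Q b))"
  let ?S = "{?s a b |a b. a \<in> carrier A \<and> b \<in> carrier B}" and ?e = "?s \<one>\<^bsub>A\<^esub> \<one>\<^bsub>B\<^esub>"
  have SI: "?s a b \<in> ?S" if "a \<in> carrier A" "b \<in> carrier B" for a b using that by blast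
  have mult: "?s a b o\<^sub>L ?s a' b' = ?s (a \<otimes>\<^bsub>A\<^esub> a') (b \<otimes>\<^bsub>B\<^esub> b')"
    if "a \<in> carrier A" "b \<in> carrier B" "a' \<in> carrier A" "b' \<in> carrier B" for a b a' b'
    using that by (simp add: cj_comp[OF g, symmetric] ten_comp PD QD)
  have smult: "?s (c \<odot>\<^bsub>A\<^esub> a) b = opscl c (?s a b)" if "a \<in> carrier A" "b \<in> carrier B" for c a b
    using that by (simp add: PD QD ten_opscl cj_opscl[OF g])
  have star: "adj (?s a b) (?s (star A a) (star B b))" if "a \<in> carrier A" "b \<in> carrier B" for a b
    using that by (intro adj_cj[OF g] adj_ten PD QD)
  let ?R = "op_alg (closure (span ?S)) ?e"
  have S_one: "?e \<in> ?S" by (intro SI) auto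
  have S_mult: "f o\<^sub>L h \<in> ?S" if fh: "f \<in> ?S" "h \<in> ?S" for f h
  proof -
    obtain a b a' b' where "f = ?s a b" "h = ?s a' b'" and c: "a \<in> carrier A" "b \<in> carrier B" "a' \<in> carrier A" "b' \<in> carrier B"
      using fh by blast
    then have "f o\<^sub>L h = ?s (a \<otimes>\<^bsub>A\<^esub> a') (b \<otimes>\<^bsub>B\<^esub> b')" using mult by simp
    then show ?thesis using SI[of "a \<otimes>\<^bsub>A\<^esub> a'" "b \<otimes>\<^bsub>B\<^esub> b'"] c by simp
  qed
  have S_scl: "opscl c f \<in> ?S" if f: "f \<in> ?S" for c f
  proof -
    obtain a b where "f = ?s a b" and c: "a \<in> carrier A" "b \<in> carrier B" using f by blast
    then have "opscl c f = ?s (c \<odot>\<^bsub>A\<^esub> a) b" using smult by simp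
    then show ?thesis using SI[OF A.smult_closed[OF c(1)] c(2), of c] by simp
  qed
  have S_adj: "\<exists>h\<in>?S. adj f h" if f: "f \<in> ?S" for f
  proof -
    obtain a b where "f = ?s a b" and c: "a \<in> carrier A" "b \<in> carrier B" using f by blast
    then show ?thesis using star[OF c] SI[OF A.star_closed[OF c(1)] B.star_closed[OF c(2)]] by blast
  qed
  have S_unit: "?e o\<^sub>L f = f" "f o\<^sub>L ?e = f" if f: "f \<in> ?S" for f
  proof -
    obtain a b where "f = ?s a b" and c: "a \<in> carrier A" "b \<in> carrier B" using f by blast
    then show "?e o\<^sub>L f = f" "f o\<^sub>L ?e = f" by (simp_all add: mult)
  qed
  note gen = op_alg_generated[OF S_one S_mult S_scl S_adj S_unit]
  have R: "cstar_algebra ?R" by (rule gen(1))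
  have "?S \<subseteq> closure (span ?S)" by (rule order_trans[OF span_superset closure_subset])
  then have K: "?s a b \<in> closure (span ?S)" if "a \<in> carrier A" "b \<in> carrier B" for a b
    using SI[OF that] by (rule subsetD)
  have "\<exists>h. h \<in> cstar_hom (tensor_alg A B) ?R \<and>
    (\<forall>a\<in>carrier A. \<forall>b\<in>carrier B. h (tensor_elem A B a b) = ?s a b)"
  proof (rule tensor_extension[OF A B R])
    show "cnorm ?R (\<Oplus>\<^bsub>?R\<^esub>k\<in>{..<n}. ?s (a k) (b k)) \<le> spatial_norm A B n a b"
      if a: "\<And>k. k < n \<Longrightarrow> a k \<in> carrier A" and b: "\<And>k. k < n \<Longrightarrow> b k \<in> carrier B" for n :: nat and a b
    proof -
      have "(\<Oplus>\<^bsub>?R\<^esub>k\<in>{..<n}. ?s (a k) (b k)) = cj g (\<Sum>k<n. ten (P (a k)) (Q (b k)))"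
        unfolding cj_sum[OF g] by (rule op_alg_finsum[OF R K[OF a b]])
      then show ?thesis using spatial_norm_ge[OF A B a b P Q] by (simp add: norm_cj[OF g])
    qed
    show "?s (star A a) (star B b) = star ?R (?s a b)" if "a \<in> carrier A" "b \<in> carrier B" for a b
      by (rule op_alg_star[OF star[OF that], symmetric])
    show "?s a b \<in> carrier ?R" if "a \<in> carrier A" "b \<in> carrier B" for a b
      unfolding op_alg_simps by (rule K[OF that])
    show "?s (a \<otimes>\<^bsub>A\<^esub> a') (b \<otimes>\<^bsub>B\<^esub> b') = ?s a b \<otimes>\<^bsub>?R\<^esub> ?s a' b'"
      if "a \<in> carrier A" "b \<in> carrier B" "a' \<in> carrier A" "b' \<in> carrier B" for a b a' b'
      unfolding op_alg_simps by (rule mult[OF that, symmetric])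
    show "?s (c \<odot>\<^bsub>A\<^esub> a) b = c \<odot>\<^bsub>?R\<^esub> ?s a b" if "a \<in> carrier A" "b \<in> carrier B" for c a b
      unfolding op_alg_simps by (rule smult[OF that])
    show "?e = \<one>\<^bsub>?R\<^esub>" unfolding op_alg_simps ..
  qed
  then obtain h where h: "h \<in> cstar_hom (tensor_alg A B) ?R"
    "\<forall>a\<in>carrier A. \<forall>b\<in>carrier B. h (tensor_elem A B a b) = ?s a b" by blast
  \<comment> \<open>In \<open>op_alg\<close> the star is a description, so an adjoint of a member of
    the closure must first be known to exist.\<close>
  have adj_R: "adj f (star ?R f)" if f: "f \<in> carrier ?R" for f
  proof -
    obtain k where k: "adj f k" using gen(3)[of f] f unfolding op_alg_simps by blast
    show ?thesis unfolding op_alg_star[OF k] by (rule k)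
  qed
  note hD = cstar_homD[OF h(1), unfolded op_alg_simps]
  have "trep (tensor_alg A B) h"
    unfolding trep_def
  proof (intro conjI ballI allI)
    fix x assume x: "x \<in> carrier (tensor_alg A B)"
    show "adj (h x) (h (star (tensor_alg A B) x))"
      unfolding hD(6)[OF x] by (rule adj_R) (use hD(1)[OF x] in simp)
  qed (fact hD)+
  then show ?thesis using h(2) by blast
qed

lemma cj_inverse_apply: "bij g \<Longrightarrow> cj g f (reidx (inv_into UNIV g) x) = reidx (inv_into UNIV g) (f x)"
  by (simp add: cj_apply reidx_inv)

text \<open>The two bracketings of a triple tensor product are unitarily equivalent by regrouping
  the three indices. Since one pair of indices is always packed by \<open>g\<close>, the regrouping
  is a permutation of pairs that unpacks and repacks.\<close>

lemma norm_reassociate: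
  fixes g :: "'u \<times> 'u \<Rightarrow> 'u" and S T U :: "nat \<Rightarrow> 'u bop"
  assumes g: "bij g" and cl: "\<And>k. k < n \<Longrightarrow> clin (S k)" "\<And>k. k < n \<Longrightarrow> clin (T k)" "\<And>k. k < n \<Longrightarrow> clin (U k)"
  shows "norm (\<Sum>k<n. ten (S k) (cj g (ten (T k) (U k)))) = norm (\<Sum>k<n. ten (cj g (ten (S k) (T k))) (U k))"
proof -
  \<comment> \<open>Unpacks \<open>w\<close> into two indices, packs \<open>x\<close> with the first
    of them, and leaves the second alone.\<close>
  define \<phi> where "\<phi> = (\<lambda>(x, w). (g (x, fst (inv_into UNIV g w)), snd (inv_into UNIV g w)))"
  let ?V = "reidx (inv_into UNIV g)"
  have gi: "inv_into UNIV g (g p) = p" "g (inv_into UNIV g w) = w" for p w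
    using g by (auto simp: bij_is_inj bij_is_surj surj_f_inv_f)
  have inj_g: "inj (inv_into UNIV g)" using g by (simp add: bij_imp_bij_inv bij_is_inj)
  have \<phi>: "bij \<phi>"
  proof (rule o_bij)
    let ?\<psi> = "\<lambda>(p, z). (fst (inv_into UNIV g p), g (snd (inv_into UNIV g p), z))"
    show "?\<psi> \<circ> \<phi> = id" "\<phi> \<circ> ?\<psi> = id" by (auto simp: \<phi>_def gi)
  qed
  have inj_\<phi>: "inj (inv_into UNIV \<phi>)" using \<phi> by (simp add: bij_imp_bij_inv bij_is_inj)
  have inv_\<phi>: "inv_into UNIV \<phi> (p, z) = (fst (inv_into UNIV g p), g (snd (inv_into UNIV g p), z))" for p z
    by (rule inv_f_eq[OF bij_is_inj[OF \<phi>]]) (simp add: \<phi>_def gi)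
  have V: "reidx (inv_into UNIV \<phi>) (vten x (?V (vten y z))) = vten (?V (vten x y)) z" for x y z
  proof (rule vten_eqI)
    fix p z'
    obtain i j where "inv_into UNIV g p = (i, j)" by (cases "inv_into UNIV g p")
    then show "ap (reidx (inv_into UNIV \<phi>) (vten x (?V (vten y z)))) (p, z') = ap (vten (?V (vten x y)) z) (p, z')"
      by (simp add: ap_reidx inj_\<phi> inj_g inv_\<phi> gi)
  qed
  have eq: "cj \<phi> (ten S (cj g (ten T U))) = ten (cj g (ten S T)) U"
    if cl: "clin S" "clin T" "clin U" for S T U :: "'u bop"
  proof (rule blinfun_eq_dl)
    note cl' = clin_cj[OF g clin_ten[OF cl(1,2)]] clin_cj[OF g clin_ten[OF cl(2,3)]]
    show "clin (cj \<phi> (ten S (cj g (ten T U))))" "clin (ten (cj g (ten S T)) U)"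
      by (intro clin_cj[OF \<phi>] clin_ten cl cl')+
    fix k :: "'u \<times> 'u"
    obtain p z where k: "k = (p, z)" by (cases k)
    obtain x y where p: "p = g (x, y)" using gi(2)[of p] by (metis prod.collapse)
    have Vdl: "?V (dl (x, y)) = dl p"
    proof (rule l2_eqI)
      fix i
      have "inv_into UNIV g i = (x, y) \<longleftrightarrow> i = p" unfolding p by (metis gi)
      then show "ap (?V (dl (x, y))) i = ap (dl p) i" by (simp add: ap_reidx[OF inj_g])
    qed
    have dlk: "dl k = vten (?V (vten (dl x) (dl y))) (dl z)"
      by (simp add: k vten_dl Vdl)
    have "cj \<phi> (ten S (cj g (ten T U))) (dl k)
        = reidx (inv_into UNIV \<phi>) (ten S (cj g (ten T U)) (vten (dl x) (?V (vten (dl y) (dl z)))))"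
      unfolding dlk V[symmetric] by (rule cj_inverse_apply[OF \<phi>])
    also have "\<dots> = reidx (inv_into UNIV \<phi>) (vten (S (dl x)) (?V (vten (T (dl y)) (U (dl z)))))"
      by (simp add: ten_vten cl cl' cj_inverse_apply[OF g])
    also have "\<dots> = ten (cj g (ten S T)) U (dl k)"
      unfolding dlk V by (simp add: ten_vten cl cl' cj_inverse_apply[OF g])
    finally show "cj \<phi> (ten S (cj g (ten T U))) (dl k) = ten (cj g (ten S T)) U (dl k)" .
  qed
  have "cj \<phi> (\<Sum>k<n. ten (S k) (cj g (ten (T k) (U k)))) = (\<Sum>k<n. ten (cj g (ten (S k) (T k))) (U k))"
    unfolding cj_sum[OF \<phi>] by (rule sum.cong[OF refl]) (simp add: eq cl)
  then show ?thesis using norm_cj[OF \<phi>, of "\<Sum>k<n. ten (S k) (cj g (ten (T k) (U k)))"] by simp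
qed

lemma dense_carrier: assumes "cstar_algebra A" shows "dense_sums A (carrier A)"
proof -
  interpret cstar_algebra A by fact
  show ?thesis
    unfolding dense_sums_def
  proof (intro conjI ballI allI impI)
    fix x and e :: real assume x: "x \<in> carrier A" and e: "0 < e"
    have "x \<in> sums_of A (carrier A)" using sums_of.add[OF sums_of.zero[of A "carrier A"] x] x by simp
    then show "\<exists>u\<in>sums_of A (carrier A). cnorm A (x \<ominus>\<^bsub>A\<^esub> u) < e"
      using x e by (intro bexI[of _ x]) (simp_all add: minus_eq r_neg cnorm_zero)
  qed simp
qed

context
  fixes A B C :: "(nat \<Rightarrow> 'x) cstar"
  assumes A: "cstar_algebra A" and B: "cstar_algebra B" and C: "cstar_algebra C"
begin

interpretation A: cstar_algebra A by (rule A)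
interpretation B: cstar_algebra B by (rule B)
interpretation C: cstar_algebra C by (rule C)

text \<open>An arbitrary representation of B \<otimes> C need not come from a pair of
  representations. Those that do are norming, which is enough, and for them the sum regroups into
  one for a product representation of A \<otimes> B and a representation of C.\<close>

lemma cnorm_triple_sum_le:
  assumes a: "\<And>k. k < n \<Longrightarrow> a k \<in> carrier A" and b: "\<And>k. k < n \<Longrightarrow> b k \<in> carrier B"
    and c: "\<And>k. k < n \<Longrightarrow> c k \<in> carrier C"
  shows "spatial_norm A (tensor_alg B C) n a (\<lambda>k. tensor_elem B C (b k) (c k))
    \<le> spatial_norm (tensor_alg A B) C n (\<lambda>k. tensor_elem A B (a k) (b k)) c" (is "_ \<le> ?M")
proof -
  let ?AB = "tensor_alg A B" and ?BC = "tensor_alg B C"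
  have AB: "cstar_algebra ?AB" and BC: "cstar_algebra ?BC" by (rule tensor_alg_cstar A B C)+
  have ab: "tensor_elem A B (a k) (b k) \<in> carrier ?AB" if "k < n" for k
    by (rule tensor_elem_closed[OF A B a[OF that] b[OF that]])
  have bc: "tensor_elem B C (b k) (c k) \<in> carrier ?BC" if "k < n" for k
    by (rule tensor_elem_closed[OF B C b[OF that] c[OF that]])
  obtain g :: "(nat \<Rightarrow> 'x) \<times> (nat \<Rightarrow> 'x) \<Rightarrow> nat \<Rightarrow> 'x" where g: "bij g" using bij_pair_code by blast
  have M: "0 \<le> ?M"
    by (rule order_trans[OF norm_ge_zero spatial_norm_ge[OF AB C ab c trep_zero_rep trep_zero_rep]])
  have swap: "norm (\<Sum>k<n. ten (S k) (T k)) = norm (\<Sum>k<n. ten (T k) (S k))"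
    if "\<And>k. k < n \<Longrightarrow> clin (S k)" "\<And>k. k < n \<Longrightarrow> clin (T k)" for S T :: "nat \<Rightarrow> (nat \<Rightarrow> 'x) bop"
  proof -
    have "(\<Sum>k<n. ten (S k) (T k)) = cj prod.swap (\<Sum>k<n. ten (T k) (S k))"
      using that by (simp add: cj_sum[OF bij_prod_swap] cj_swap_ten)
    then show ?thesis by (simp add: norm_cj[OF bij_prod_swap])
  qed
  show ?thesis
  proof (rule spatial_norm_le[OF A BC a bc])
    fix P \<sigma> :: "(nat \<Rightarrow> 'x) \<Rightarrow> (nat \<Rightarrow> 'x) bop" assume P: "trep A P" and \<sigma>: "trep ?BC \<sigma>"
    let ?d = "\<lambda>k. tensor_elem B C (b k) (c k)"
    \<comment> \<open>The product representations of B \<otimes> C, moved back to the common Hilbert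
      space by \<open>g\<close>.\<close>
    define \<T> where "\<T> = {\<tau>. trep ?BC \<tau> \<and> (\<exists>Q R. trep B Q \<and> trep C R \<and>
      (\<forall>b\<in>carrier B. \<forall>c\<in>carrier C. \<tau> (tensor_elem B C b c) = cj g (ten (Q b) (R c))))}"
    note Pcl = trepD(5)[OF P a]
    \<comment> \<open>The factors are interchanged because the comparison lemma varies the
      representation in the first tensor factor.\<close>
    have "norm (\<Sum>k<n. ten (\<sigma> (?d k)) (P (a k))) \<le> ?M"
    proof (rule norm_tensor_sum_le_of_norming[OF BC \<sigma>, where \<T> = \<T>])
      show "trep ?BC \<tau>" if "\<tau> \<in> \<T>" for \<tau> using that by (simp add: \<T>_def)
      show "?d k \<in> carrier ?BC" if "k < n" for k by (rule bc[OF that])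
      show "clin (P (a k))" if "k < n" for k by (rule Pcl[OF that])
      show "0 \<le> ?M" by (rule M)
      show "norm (\<Sum>k<n. ten (\<tau> (?d k)) (P (a k))) \<le> ?M" if \<tau>: "\<tau> \<in> \<T>" for \<tau>
      proof -
        obtain Q R where Q: "trep B Q" and R: "trep C R" and
          eq: "\<And>b c. \<lbrakk>b \<in> carrier B; c \<in> carrier C\<rbrakk> \<Longrightarrow> \<tau> (tensor_elem B C b c) = cj g (ten (Q b) (R c))"
          using \<tau> unfolding \<T>_def by blast
        have \<tau>': "trep ?BC \<tau>" using \<tau> by (simp add: \<T>_def)
        obtain \<rho> where \<rho>: "trep ?AB \<rho>" and
          \<rho>_eq: "\<And>a b. \<lbrakk>a \<in> carrier A; b \<in> carrier B\<rbrakk> \<Longrightarrow> \<rho> (tensor_elem A B a b) = cj g (ten (P a) (Q b))"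
          using product_representation[OF A B P Q g] by blast
        have "norm (\<Sum>k<n. ten (\<tau> (?d k)) (P (a k))) = norm (\<Sum>k<n. ten (P (a k)) (\<tau> (?d k)))"
          by (rule swap[OF trepD(5)[OF \<tau>' bc] Pcl])
        also have "(\<Sum>k<n. ten (P (a k)) (\<tau> (?d k))) = (\<Sum>k<n. ten (P (a k)) (cj g (ten (Q (b k)) (R (c k)))))"
          by (rule sum.cong[OF refl]) (simp add: eq b c)
        also have "norm \<dots> = norm (\<Sum>k<n. ten (cj g (ten (P (a k)) (Q (b k)))) (R (c k)))"
          by (rule norm_reassociate[OF g Pcl trepD(5)[OF Q b] trepD(5)[OF R c]])
        also have "(\<Sum>k<n. ten (cj g (ten (P (a k)) (Q (b k)))) (R (c k)))
            = (\<Sum>k<n. ten (\<rho> (tensor_elem A B (a k) (b k))) (R (c k)))"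
          by (rule sum.cong[OF refl]) (simp add: \<rho>_eq a b)
        also have "norm \<dots> \<le> ?M" by (rule spatial_norm_ge[OF AB C ab c \<rho> R])
        finally show ?thesis .
      qed
      \<comment> \<open>The family is norming on finite sums of elementary tensors, where the norm
        is by construction a supremum over pairs of representations. Density together with
        contractivity of each \<open>\<tau>\<close> extends this to all \<open>x\<close>.\<close>
      show "cnorm ?BC x \<le> K" if x: "x \<in> carrier ?BC" and K: "0 \<le> K" and le: "\<And>\<tau>. \<tau> \<in> \<T> \<Longrightarrow> norm (\<tau> x) \<le> K" for x K
      proof (rule field_le_epsilon)
        fix e :: real assume e: "0 < e"
        interpret BC: cstar_algebra ?BC by (rule BC)
        obtain m :: nat and b' c' where bc': "\<And>k. k < m \<Longrightarrow> b' k \<in> carrier B" "\<And>k. k < m \<Longrightarrow> c' k \<in> carrier C"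
          and near: "cnorm ?BC (x \<ominus>\<^bsub>?BC\<^esub> (\<Oplus>\<^bsub>?BC\<^esub>k\<in>{..<m}. tensor_elem B C (b' k) (c' k))) < e / 2"
          using spatial_tensor_approx[OF B C] x half_gt_zero[OF e] by meson
        let ?y = "\<Oplus>\<^bsub>?BC\<^esub>k\<in>{..<m}. tensor_elem B C (b' k) (c' k)"
        have yc: "?y \<in> carrier ?BC" using bc' tensor_elem_closed[OF B C] by (intro BC.finsum_lessThan_closed) auto
        have "cnorm ?BC ?y = spatial_norm B C m b' c'" by (rule cnorm_tensor_sum[OF B C bc'])
        also have "\<dots> \<le> K + e / 2"
        proof (rule spatial_norm_le[OF B C bc'])
          fix Q R :: "(nat \<Rightarrow> 'x) \<Rightarrow> (nat \<Rightarrow> 'x) bop" assume QR: "trep B Q" "trep C R"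
          obtain \<tau> where \<tau>: "trep ?BC \<tau>"
            "\<And>b c. \<lbrakk>b \<in> carrier B; c \<in> carrier C\<rbrakk> \<Longrightarrow> \<tau> (tensor_elem B C b c) = cj g (ten (Q b) (R c))"
            using product_representation[OF B C QR g] by blast
          have \<tau>\<T>: "\<tau> \<in> \<T>" using \<tau> QR unfolding \<T>_def by blast
          have "\<tau> ?y = (\<Sum>k<m. \<tau> (tensor_elem B C (b' k) (c' k)))"
            using bc' tensor_elem_closed[OF B C] by (intro trep_finsum[OF BC \<tau>(1)]) auto
          also have "\<dots> = cj g (\<Sum>k<m. ten (Q (b' k)) (R (c' k)))"
            unfolding cj_sum[OF g] by (rule sum.cong[OF refl]) (simp add: \<tau>(2) bc')
          finally have "norm (\<Sum>k<m. ten (Q (b' k)) (R (c' k))) = norm (\<tau> ?y)" by (simp add: norm_cj[OF g])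
          also have "\<tau> ?y = \<tau> x + \<tau> (?y \<ominus>\<^bsub>?BC\<^esub> x)"
          proof -
            have "?y = x \<oplus>\<^bsub>?BC\<^esub> (?y \<ominus>\<^bsub>?BC\<^esub> x)"
            proof -
              have "x \<oplus>\<^bsub>?BC\<^esub> (?y \<oplus>\<^bsub>?BC\<^esub> \<ominus>\<^bsub>?BC\<^esub> x) = (x \<oplus>\<^bsub>?BC\<^esub> \<ominus>\<^bsub>?BC\<^esub> x) \<oplus>\<^bsub>?BC\<^esub> ?y"
                using x yc by (simp only: BC.a_ac BC.a_inv_closed)
              then show ?thesis using x yc by (simp add: BC.minus_eq BC.r_neg)
            qed
            then show ?thesis using trepD(1)[OF \<tau>(1) x, of "?y \<ominus>\<^bsub>?BC\<^esub> x"] x yc by simp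
          qed
          also have "norm \<dots> \<le> norm (\<tau> x) + norm (\<tau> (?y \<ominus>\<^bsub>?BC\<^esub> x))" by (rule norm_triangle_ineq)
          also have "\<dots> \<le> K + e / 2"
          proof (rule add_mono[OF le[OF \<tau>\<T>]])
            have "norm (\<tau> (?y \<ominus>\<^bsub>?BC\<^esub> x)) \<le> cnorm ?BC (?y \<ominus>\<^bsub>?BC\<^esub> x)"
              using x yc by (intro trep_norm_le[OF BC \<tau>(1)]) simp
            then show "norm (\<tau> (?y \<ominus>\<^bsub>?BC\<^esub> x)) \<le> e / 2"
              using near BC.cnorm_diff_commute[OF x yc] by simp
          qed
          finally show "norm (\<Sum>k<m. ten (Q (b' k)) (R (c' k))) \<le> K + e / 2" .
        qed
        finally have "cnorm ?BC ?y \<le> K + e / 2" .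
        then show "cnorm ?BC x \<le> K + e"
          using BC.abs_cnorm_diff_le[OF x yc] near by simp
      qed
    qed
    moreover have "norm (\<Sum>k<n. ten (P (a k)) (\<sigma> (?d k))) = norm (\<Sum>k<n. ten (\<sigma> (?d k)) (P (a k)))"
      by (rule swap[OF Pcl trepD(5)[OF \<sigma> bc]])
    ultimately show "norm (\<Sum>k<n. ten (P (a k)) (\<sigma> (?d k))) \<le> ?M" by simp
  qed
qed

lemma dense_triple:
  "dense_sums (tensor_alg (tensor_alg A B) C)
    ((\<lambda>(a, b, c). tensor_elem (tensor_alg A B) C (tensor_elem A B a b) c) ` (carrier A \<times> carrier B \<times> carrier C))"
proof -
  have "{tensor_elem (tensor_alg A B) C x c |x c. x \<in> (\<lambda>(a, b). tensor_elem A B a b) ` (carrier A \<times> carrier B) \<and> c \<in> carrier C}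
    = (\<lambda>(a, b, c). tensor_elem (tensor_alg A B) C (tensor_elem A B a b) c) ` (carrier A \<times> carrier B \<times> carrier C)"
    by force
  then show ?thesis
    using dense_tensor_elem_subsets[OF tensor_alg_cstar[OF A B] C dense_tensor_elem[OF A B] dense_carrier[OF C]] by simp
qed

lemma triple_hom_eqI:
  assumes "cstar_algebra R" "f \<in> cstar_hom (tensor_alg (tensor_alg A B) C) R" "h \<in> cstar_hom (tensor_alg (tensor_alg A B) C) R"
    and "\<And>a b c. \<lbrakk>a \<in> carrier A; b \<in> carrier B; c \<in> carrier C\<rbrakk> \<Longrightarrow>
      f (tensor_elem (tensor_alg A B) C (tensor_elem A B a b) c) = h (tensor_elem (tensor_alg A B) C (tensor_elem A B a b) c)"
  shows "f = h"
  by (rule cstar_hom_eqI[OF assms(2,3) tensor_alg_cstar[OF tensor_alg_cstar[OF A B] C] assms(1) dense_triple])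
    (use assms(4) in auto)

lemma tensor_assoc_props:
  shows "tensor_assoc A B C \<in> cstar_hom (tensor_alg (tensor_alg A B) C) (tensor_alg A (tensor_alg B C))"
    and "\<lbrakk>a \<in> carrier A; b \<in> carrier B; c \<in> carrier C\<rbrakk> \<Longrightarrow>
      tensor_assoc A B C (tensor_elem (tensor_alg A B) C (tensor_elem A B a b) c)
        = tensor_elem A (tensor_alg B C) a (tensor_elem B C b c)"
proof -
  let ?AB = "tensor_alg A B" and ?BC = "tensor_alg B C"
  let ?L = "tensor_alg ?AB C" and ?R = "tensor_alg A ?BC"
  have AB: "cstar_algebra ?AB" and BC: "cstar_algebra ?BC" by (rule tensor_alg_cstar A B C)+
  have L: "cstar_algebra ?L" and R: "cstar_algebra ?R" by (rule tensor_alg_cstar A C AB BC)+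
  let ?X = "carrier A \<times> carrier B \<times> carrier C"
  let ?t = "\<lambda>(a, b, c). tensor_elem ?AB C (tensor_elem A B a b) c"
  let ?s = "\<lambda>(a, b, c). tensor_elem A ?BC a (tensor_elem B C b c)"
  note ec = tensor_elem_closed[OF A B] tensor_elem_closed[OF B C] tensor_elem_closed[OF AB C] tensor_elem_closed[OF A BC]
  note em = tensor_elem_mult[OF A B] tensor_elem_mult[OF B C] tensor_elem_mult[OF AB C] tensor_elem_mult[OF A BC]
  note es = tensor_elem_star[OF A B] tensor_elem_star[OF B C] tensor_elem_star[OF AB C] tensor_elem_star[OF A BC]
  note el = tensor_elem_smult[OF A B] tensor_elem_smult[OF B C] tensor_elem_smult[OF AB C] tensor_elem_smult[OF A BC]
  note eo = tensor_elem_one[OF A B] tensor_elem_one[OF B C] tensor_elem_one[OF AB C] tensor_elem_one[OF A BC]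
  have "\<exists>h\<in>cstar_hom ?L ?R. \<forall>x\<in>?X. h (?t x) = ?s x"
  proof (rule cstar_hom_extension[OF L R])
    show "dense_sums ?L (?t ` ?X)" by (rule dense_triple)
    show "?t x \<in> carrier ?L" "?s x \<in> carrier ?R" if "x \<in> ?X" for x
      using that by (auto simp: ec)
    show "\<exists>x\<in>?X. ?t x = \<one>\<^bsub>?L\<^esub> \<and> ?s x = \<one>\<^bsub>?R\<^esub>"
      by (intro bexI[of _ "(\<one>\<^bsub>A\<^esub>, \<one>\<^bsub>B\<^esub>, \<one>\<^bsub>C\<^esub>)"]) (auto simp: eo)
    show "\<exists>z\<in>?X. ?t z = ?t x \<otimes>\<^bsub>?L\<^esub> ?t y \<and> ?s z = ?s x \<otimes>\<^bsub>?R\<^esub> ?s y" if "x \<in> ?X" "y \<in> ?X" for x y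
      using that
      by (intro bexI[of _ "(fst x \<otimes>\<^bsub>A\<^esub> fst y, fst (snd x) \<otimes>\<^bsub>B\<^esub> fst (snd y), snd (snd x) \<otimes>\<^bsub>C\<^esub> snd (snd y))"])
        (auto simp: em ec)
    show "\<exists>z\<in>?X. ?t z = k \<odot>\<^bsub>?L\<^esub> ?t x \<and> ?s z = k \<odot>\<^bsub>?R\<^esub> ?s x" if "x \<in> ?X" for k x
      using that by (intro bexI[of _ "(k \<odot>\<^bsub>A\<^esub> fst x, snd x)"]) (auto simp: el ec A.smult_closed)
    show "\<exists>z\<in>?X. ?t z = star ?L (?t x) \<and> ?s z = star ?R (?s x)" if "x \<in> ?X" for x
      using that by (intro bexI[of _ "(star A (fst x), star B (fst (snd x)), star C (snd (snd x)))"])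
        (auto simp: es ec A.star_closed B.star_closed C.star_closed)
    show "cnorm ?R (\<Oplus>\<^bsub>?R\<^esub>k\<in>{..<n}. ?s (x k)) \<le> cnorm ?L (\<Oplus>\<^bsub>?L\<^esub>k\<in>{..<n}. ?t (x k))"
      if "\<And>k. k < n \<Longrightarrow> x k \<in> ?X" for n :: nat and x
    proof -
      let ?a = "\<lambda>k. fst (x k)" and ?b = "\<lambda>k. fst (snd (x k))" and ?c = "\<lambda>k. snd (snd (x k))"
      have abc: "?a k \<in> carrier A" "?b k \<in> carrier B" "?c k \<in> carrier C" if "k < n" for k
        using \<open>\<And>k. k < n \<Longrightarrow> x k \<in> ?X\<close>[OF that] by auto
      have "cnorm ?R (\<Oplus>\<^bsub>?R\<^esub>k\<in>{..<n}. ?s (x k)) = spatial_norm A ?BC n ?a (\<lambda>k. tensor_elem B C (?b k) (?c k))"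
        unfolding case_prod_unfold by (rule cnorm_tensor_sum[OF A BC]) (simp_all add: abc ec)
      also have "\<dots> \<le> spatial_norm ?AB C n (\<lambda>k. tensor_elem A B (?a k) (?b k)) ?c"
        by (rule cnorm_triple_sum_le[OF abc])
      also have "\<dots> = cnorm ?L (\<Oplus>\<^bsub>?L\<^esub>k\<in>{..<n}. ?t (x k))"
        unfolding case_prod_unfold by (rule cnorm_tensor_sum[OF AB C, symmetric]) (simp_all add: abc ec)
      finally show ?thesis .
    qed
  qed
  then obtain h where "h \<in> cstar_hom ?L ?R" "\<forall>x\<in>?X. h (?t x) = ?s x" by blast
  then have "\<exists>!h. h \<in> cstar_hom ?L ?R \<and> (\<forall>a\<in>carrier A. \<forall>b\<in>carrier B. \<forall>c\<in>carrier C.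
      h (tensor_elem ?AB C (tensor_elem A B a b) c) = tensor_elem A ?BC a (tensor_elem B C b c))"
    by (intro ex_ex1I[OF exI[of _ h]] triple_hom_eqI[OF R]) auto
  from theI'[OF this] show "tensor_assoc A B C \<in> cstar_hom ?L ?R"
    "\<lbrakk>a \<in> carrier A; b \<in> carrier B; c \<in> carrier C\<rbrakk> \<Longrightarrow>
      tensor_assoc A B C (tensor_elem ?AB C (tensor_elem A B a b) c) = tensor_elem A ?BC a (tensor_elem B C b c)"
    unfolding tensor_assoc_def by blast+
qed

lemma dense_triple_right:
  "dense_sums (tensor_alg A (tensor_alg B C))
    ((\<lambda>(a, b, c). tensor_elem A (tensor_alg B C) a (tensor_elem B C b c)) ` (carrier A \<times> carrier B \<times> carrier C))"
proof -
  have "{tensor_elem A (tensor_alg B C) a x |a x. a \<in> carrier A \<and> x \<in> (\<lambda>(b, c). tensor_elem B C b c) ` (carrier B \<times> carrier C)}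
    = (\<lambda>(a, b, c). tensor_elem A (tensor_alg B C) a (tensor_elem B C b c)) ` (carrier A \<times> carrier B \<times> carrier C)"
    by force
  then show ?thesis
    using dense_tensor_elem_subsets[OF A tensor_alg_cstar[OF B C] dense_carrier[OF A] dense_tensor_elem[OF B C]] by simp
qed

end

text \<open>No new norm estimate is required: the map is the associator for the reversed triple
  between flips, A \<otimes> (B \<otimes> C) to (B \<otimes> C) \<otimes> A to (C \<otimes> B)
  \<otimes> A to C \<otimes> (B \<otimes> A) to C \<otimes> (A \<otimes> B) to (A \<otimes> B)
  \<otimes> C.\<close>

lemma tensor_assoc_inv_props:
  fixes A B C :: "(nat \<Rightarrow> 'x) cstar"
  assumes A: "cstar_algebra A" and B: "cstar_algebra B" and C: "cstar_algebra C"
  shows "tensor_assoc_inv A B C \<in> cstar_hom (tensor_alg A (tensor_alg B C)) (tensor_alg (tensor_alg A B) C)"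
    and "\<lbrakk>a \<in> carrier A; b \<in> carrier B; c \<in> carrier C\<rbrakk> \<Longrightarrow>
      tensor_assoc_inv A B C (tensor_elem A (tensor_alg B C) a (tensor_elem B C b c))
        = tensor_elem (tensor_alg A B) C (tensor_elem A B a b) c"
proof -
  let ?AB = "tensor_alg A B" and ?BC = "tensor_alg B C" and ?BA = "tensor_alg B A" and ?CB = "tensor_alg C B"
  note algs = tensor_alg_cstar[OF A B] tensor_alg_cstar[OF B C] tensor_alg_cstar[OF B A] tensor_alg_cstar[OF C B]
  note AB = algs(1) and BC = algs(2) and BA = algs(3) and CB = algs(4)
  let ?L = "tensor_alg ?AB C" and ?R = "tensor_alg A ?BC"
  have L: "cstar_algebra ?L" and R: "cstar_algebra ?R" by (rule tensor_alg_cstar A C AB BC)+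
  note f1 = flip_hom_props[OF A BC]
  note f2 = tensor_hom_props[OF BC CB A A flip_hom_props(1)[OF B C] id_hom_cstar_hom[OF A]]
  note f3 = tensor_assoc_props[OF C B A]
  note f4 = tensor_hom_props[OF C C BA AB id_hom_cstar_hom[OF C] flip_hom_props(1)[OF B A]]
  note f5 = flip_hom_props[OF C AB]
  note h2 = cstar_hom_compose[OF f1(1) f2(1) R]
  note h3 = cstar_hom_compose[OF h2 f3(1) R]
  note h4 = cstar_hom_compose[OF h3 f4(1) R]
  note h5 = cstar_hom_compose[OF h4 f5(1) R]
  note ec = tensor_elem_closed[OF A B] tensor_elem_closed[OF B C] tensor_elem_closed[OF A BC] tensor_elem_closed[OF C B]
    tensor_elem_closed[OF B A]
  have ex: "\<exists>h. h \<in> cstar_hom ?R ?L \<and> (\<forall>a\<in>carrier A. \<forall>b\<in>carrier B. \<forall>c\<in>carrier C.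
      h (tensor_elem A ?BC a (tensor_elem B C b c)) = tensor_elem ?AB C (tensor_elem A B a b) c)"
    by (rule exI, rule conjI[OF h5])
      (simp add: ec f1(2) f2(2) f3(2) f4(2) f5(2) flip_hom_props(2)[OF B C] flip_hom_props(2)[OF B A] id_hom_apply)
  then have "\<exists>!h. h \<in> cstar_hom ?R ?L \<and> (\<forall>a\<in>carrier A. \<forall>b\<in>carrier B. \<forall>c\<in>carrier C.
      h (tensor_elem A ?BC a (tensor_elem B C b c)) = tensor_elem ?AB C (tensor_elem A B a b) c)"
    by (rule ex_ex1I) (rule cstar_hom_eqI[OF _ _ R L dense_triple_right[OF A B C]], auto)
  from theI'[OF this] show "tensor_assoc_inv A B C \<in> cstar_hom ?R ?L"
    "\<lbrakk>a \<in> carrier A; b \<in> carrier B; c \<in> carrier C\<rbrakk> \<Longrightarrow>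
      tensor_assoc_inv A B C (tensor_elem A ?BC a (tensor_elem B C b c)) = tensor_elem ?AB C (tensor_elem A B a b) c"
    unfolding tensor_assoc_inv_def by blast+
qed

section \<open>Characters of finite-dimensional commutative C*-algebras\<close>

text \<open>A homogeneous system with more unknowns than equations has a nontrivial solution. The
  induction on the equations is Gaussian elimination.\<close>

lemma exists_linear_relation:
  fixes m :: "'k \<Rightarrow> 's \<Rightarrow> complex"
  assumes "finite S" "finite I" "card S < card I"
  shows "\<exists>c. (\<exists>k\<in>I. c k \<noteq> 0) \<and> (\<forall>s\<in>S. (\<Sum>k\<in>I. c k * m k s) = 0)"
  using assms
proof (induction S arbitrary: I m rule: finite_induct)
  case empty
  then obtain k where "k \<in> I" by fastforce
  then show ?case by (intro exI[of _ "\<lambda>_. 1"]) auto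
next
  case (insert s S)
  show ?case
  proof (cases "\<exists>j\<in>I. m j s \<noteq> 0")
    case False
    then have zero: "\<And>k. k \<in> I \<Longrightarrow> m k s = 0" by blast
    obtain c where "\<exists>k\<in>I. c k \<noteq> 0" "\<forall>t\<in>S. (\<Sum>k\<in>I. c k * m k t) = 0"
      using insert.IH[of I m] insert.prems insert.hyps by auto
    then show ?thesis using zero by (intro exI[of _ c]) auto
  next
    case True
    then obtain j where j: "j \<in> I" "m j s \<noteq> 0" by blast
    let ?I = "I - {j}"
    \<comment> \<open>Subtracts the multiple of the pivot row \<open>j\<close> that clears the
      column \<open>s\<close>.\<close>
    define m' where "m' k t = m k t - m k s / m j s * m j t" for k t
    have "card S < card ?I" using insert.prems insert.hyps j by simp
    then obtain c where c: "\<exists>k\<in>?I. c k \<noteq> 0" "\<And>t. t \<in> S \<Longrightarrow> (\<Sum>k\<in>?I. c k * m' k t) = 0"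
      using insert.IH[of ?I m'] insert.prems by auto
    \<comment> \<open>The coefficient of the pivot is forced by the equation belonging to
      \<open>s\<close>.\<close>
    define a where "a = - (\<Sum>k\<in>?I. c k * m k s) / m j s"
    define c' where "c' = c(j := a)"
    have sum: "(\<Sum>k\<in>I. c' k * m k t) = a * m j t + (\<Sum>k\<in>?I. c k * m k t)" for t
    proof -
      have "(\<Sum>k\<in>I. c' k * m k t) = c' j * m j t + (\<Sum>k\<in>?I. c' k * m k t)"
        using insert.prems j by (simp add: sum.remove)
      also have "(\<Sum>k\<in>?I. c' k * m k t) = (\<Sum>k\<in>?I. c k * m k t)"
        by (rule sum.cong) (auto simp: c'_def)
      finally show ?thesis by (simp add: c'_def)
    qed
    have m'_sum: "(\<Sum>k\<in>?I. c k * m' k t) = a * m j t + (\<Sum>k\<in>?I. c k * m k t)" for t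
    proof -
      have "(\<Sum>k\<in>?I. c k * m' k t) = (\<Sum>k\<in>?I. c k * m k t) - (\<Sum>k\<in>?I. c k * m k s) / m j s * m j t"
        by (simp add: m'_def ring_distribs sum_subtractf sum_distrib_right sum_divide_distrib mult.assoc)
      then show ?thesis by (simp add: a_def)
    qed
    have "(\<Sum>k\<in>I. c' k * m k t) = 0" if "t \<in> insert s S" for t
    proof (cases "t = s")
      case True
      then show ?thesis unfolding sum using j by (simp add: a_def)
    next
      case False
      then show ?thesis using c(2)[of t] that by (simp add: sum m'_sum)
    qed
    moreover have "\<exists>k\<in>I. c' k \<noteq> 0" using c(1) by (auto simp: c'_def)
    ultimately show ?thesis by blast
  qed
qed

section \<open>Polynomials in one element and eigenvectors\<close>

context cstar_algebra
begin

text \<open>\<open>poly_act x v p\<close> is \<open>p(x) v\<close>.\<close>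

definition poly_act :: "'a \<Rightarrow> 'a \<Rightarrow> complex poly \<Rightarrow> 'a" where
  "poly_act x v p = fold_coeffs (\<lambda>a w. a \<odot> v \<oplus> x \<otimes> w) p \<zero>"

lemma poly_act_0: "poly_act x v 0 = \<zero>"
  by (simp add: poly_act_def)

lemma poly_act_pCons:
  assumes "x \<in> carrier A" "v \<in> carrier A"
  shows "poly_act x v (pCons a p) = a \<odot> v \<oplus> x \<otimes> poly_act x v p"
proof (cases "a = 0 \<and> p = 0")
  case True
  then show ?thesis using assms by (simp add: poly_act_0 smult_zero)
next
  case False
  then show ?thesis by (auto simp: poly_act_def fold_coeffs_pCons_coeff_not_0_eq fold_coeffs_pCons_not_0_0_eq)
qed

lemma poly_act_closed:
  assumes "x \<in> carrier A" "v \<in> carrier A" shows "poly_act x v p \<in> carrier A"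
  by (induction p) (auto simp: poly_act_0 poly_act_pCons assms smult_closed)

lemma poly_act_add:
  assumes xv: "x \<in> carrier A" "v \<in> carrier A"
  shows "poly_act x v (p + q) = poly_act x v p \<oplus> poly_act x v q"
proof (induction p q rule: poly_induct2)
  case 0 show ?case by (simp add: poly_act_0)
next
  case (pCons a p b q)
  note [simp] = xv poly_act_closed[OF xv] smult_closed
  show ?case by (simp add: poly_act_pCons pCons smult_l_distr r_distr a_ac)
qed

lemma poly_act_smult:
  assumes xv: "x \<in> carrier A" "v \<in> carrier A"
  shows "poly_act x v (Polynomial.smult c p) = c \<odot> poly_act x v p"
proof (induction p)
  case 0 show ?case by (simp add: poly_act_0 smult_zero_right)
next
  case (pCons a p)
  note [simp] = xv poly_act_closed[OF xv] smult_closed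
  show ?case by (simp add: poly_act_pCons pCons smult_r_distr smult_assoc smult_mult_right)
qed

lemma poly_act_root_factor:
  assumes xv: "x \<in> carrier A" "v \<in> carrier A"
  shows "poly_act x v ([:- l, 1:] * q) = x \<otimes> poly_act x v q \<ominus> l \<odot> poly_act x v q"
proof -
  note [simp] = xv poly_act_closed[OF xv] smult_closed
  have "poly_act x v ([:- l, 1:] * q) = poly_act x v (Polynomial.smult (- l) q + pCons 0 q)" by simp
  also have "\<dots> = (- 1 * l) \<odot> poly_act x v q \<oplus> x \<otimes> poly_act x v q"
    unfolding poly_act_add[OF xv] by (simp add: poly_act_smult poly_act_pCons smult_zero del: smult_minus_left)
  also have "\<dots> = x \<otimes> poly_act x v q \<ominus> l \<odot> poly_act x v q"
    unfolding smult_assoc[OF poly_act_closed[OF xv]] by (simp add: smult_minus1 minus_eq a_comm)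
  finally show ?thesis .
qed

text \<open>Applying the powers of \<open>x\<close> with exponents 0 to \<open>card S\<close> to
  \<open>v\<close> gives one vector more than there are members of the spanning set
  \<open>S\<close>, so their coordinate vectors satisfy a nontrivial linear relation.\<close>

lemma annihilating_poly:
  assumes fd: "cstar_finite_dimensional A" and xv: "x \<in> carrier A" "v \<in> carrier A"
  shows "\<exists>p. p \<noteq> 0 \<and> poly_act x v p = \<zero>"
proof -
  obtain S where S: "finite S" "S \<subseteq> carrier A" and span: "\<And>y. y \<in> carrier A \<Longrightarrow> \<exists>c. y = (\<Oplus>s\<in>S. c s \<odot> s)"
    using fd unfolding cstar_finite_dimensional_def by blast
  define L where "L c = (\<Oplus>s\<in>S. c s \<odot> s)" for c
  have Lc: "L c \<in> carrier A" for c unfolding L_def using S smult_closed by (intro finsum_closed) auto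
  have L_add: "L (\<lambda>s. c s + d s) = L c \<oplus> L d" for c d
  proof -
    have "L (\<lambda>s. c s + d s) = (\<Oplus>s\<in>S. c s \<odot> s \<oplus> d s \<odot> s)"
      unfolding L_def using S smult_closed smult_l_distr by (intro finsum_cong') auto
    then show ?thesis unfolding L_def using S smult_closed by (subst (asm) finsum_addf) auto
  qed
  have L_smult: "L (\<lambda>s. a * c s) = a \<odot> L c" for a c
    unfolding L_def using S
  proof (induction S)
    case empty then show ?case by (simp add: smult_zero_right)
  next
    case (insert s S)
    then show ?case
      using smult_closed by (simp add: finsum_insert Pi_def finsum_closed subset_iff smult_r_distr smult_assoc)
  qed
  have L_zero: "L (\<lambda>_. 0) = \<zero>" using L_smult[of 0 "\<lambda>_. 0"] Lc by (simp add: smult_zero)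
  define w where "w k = poly_act x v (monom 1 k)" for k
  have "\<forall>k. \<exists>c. w k = L c" using span poly_act_closed[OF xv] unfolding w_def L_def by blast
  then obtain m where m: "\<And>k. w k = L (m k)" by metis
  obtain c where c: "\<exists>k\<in>{..card S}. c k \<noteq> 0" "\<And>s. s \<in> S \<Longrightarrow> (\<Sum>k\<le>card S. c k * m k s) = 0"
    using exists_linear_relation[of S "{..card S}" m] S by auto
  define p where "p = (\<Sum>k\<le>card S. monom (c k) k)"
  have "poly_act x v (\<Sum>k\<in>I. monom (c k) k) = L (\<lambda>s. \<Sum>k\<in>I. c k * m k s)" if "finite I" for I
    using that
  proof (induction I)
    case empty show ?case by (simp add: poly_act_0 L_zero)
  next
    case (insert k I)
    have "monom (c k) k = Polynomial.smult (c k) (monom 1 k)" by (simp add: smult_monom)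
    then have "poly_act x v (monom (c k) k) = L (\<lambda>s. c k * m k s)"
      using m[of k] by (simp add: poly_act_smult[OF xv] L_smult w_def)
    then show ?case using insert by (simp add: poly_act_add[OF xv] L_add)
  qed
  then have "poly_act x v p = L (\<lambda>s. \<Sum>k\<le>card S. c k * m k s)" by (simp add: p_def)
  also have "\<dots> = L (\<lambda>_. 0)"
    unfolding L_def using S c(2) smult_closed by (intro finsum_cong') auto
  finally have "poly_act x v p = \<zero>" by (simp add: L_zero)
  moreover have "p \<noteq> 0"
  proof -
    obtain k where k: "k \<le> card S" "c k \<noteq> 0" using c(1) by auto
    have "coeff p k = c k" using k by (simp add: p_def coeff_sum)
    then show ?thesis using k by auto
  qed
  ultimately show ?thesis by blast
qed

text \<open>Ideals are the domains in which eigenvectors are sought: the search must be confined to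
  the annihilator of a given element, and restricted further to eigenspaces.\<close>

definition cideal :: "'a set \<Rightarrow> bool" where
  "cideal J \<longleftrightarrow> J \<subseteq> carrier A \<and> \<zero> \<in> J \<and> (\<forall>v\<in>J. \<forall>w\<in>J. v \<oplus> w \<in> J) \<and> (\<forall>c. \<forall>v\<in>J. c \<odot> v \<in> J) \<and>
     (\<forall>x\<in>carrier A. \<forall>v\<in>J. x \<otimes> v \<in> J)"

text \<open>Split a linear factor X - l off an annihilating polynomial of \<open>v\<close>. If the
  cofactor does not annihilate \<open>v\<close>, it produces an eigenvector for \<open>l\<close>;
  otherwise it is an annihilating polynomial of smaller degree. A nonzero constant cannot annihilate
  the nonzero \<open>v\<close>, so the descent stops in time.\<close>

lemma exists_eigenvector:
  assumes fd: "cstar_finite_dimensional A" and J: "cideal J" and v: "v \<in> J" "v \<noteq> \<zero>" and x: "x \<in> carrier A"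
  shows "\<exists>w\<in>J. w \<noteq> \<zero> \<and> (\<exists>l. x \<otimes> w = l \<odot> w)"
proof -
  have vc: "v \<in> carrier A" using J v by (auto simp: cideal_def)
  note xv = x vc
  have inJ: "poly_act x v p \<in> J" for p
  proof (induction p)
    case 0 then show ?case using J by (simp add: poly_act_0 cideal_def)
  next
    case (pCons a p)
    then show ?case using J v x by (simp add: poly_act_pCons[OF xv] cideal_def)
  qed
  have "p \<noteq> 0 \<Longrightarrow> poly_act x v p = \<zero> \<Longrightarrow> ?thesis" for p
  proof (induction "degree p" arbitrary: p rule: less_induct)
    case less
    show ?case
    proof (cases "degree p = 0")
      case True
      then obtain a where a: "p = [:a:]" by (metis degree_eq_zeroE)
      then have "a \<odot> v = \<zero>" using less.prems xv by (simp add: poly_act_pCons[OF xv] poly_act_0 smult_closed)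
      then have "cmod a * cnorm A v = 0" using cnorm_smult[OF vc, of a] by (simp add: cnorm_zero)
      then have "v = \<zero>" using a less.prems cnorm_eq_0_iff[OF vc] by auto
      then show ?thesis using v by simp
    next
      case False
      then have "\<not> constant (poly p)" by (simp add: constant_degree)
      then obtain l where "poly p l = 0" using fundamental_theorem_of_algebra by blast
      then obtain q where q: "p = [:- l, 1:] * q" by (metis dvdE poly_eq_0_iff_dvd)
      have q0: "q \<noteq> 0" using less.prems q by auto
      have "degree p = degree [:- l, 1:] + degree q" unfolding q using q0 by (intro degree_mult_eq) auto
      then have deg: "degree q < degree p" by simp
      show ?thesis
      proof (cases "poly_act x v q = \<zero>")
        case True
        then show ?thesis using less.hyps[OF deg q0] by blast
      next
        case False
        have cl: "x \<otimes> poly_act x v q \<in> carrier A" "l \<odot> poly_act x v q \<in> carrier A"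
          using x poly_act_closed[OF xv] smult_closed by auto
        have "x \<otimes> poly_act x v q \<ominus> l \<odot> poly_act x v q = \<zero>"
          using less.prems(2) poly_act_root_factor[OF xv] q by simp
        then have "x \<otimes> poly_act x v q = l \<odot> poly_act x v q"
          using cl by (metis minus_eq minus_equality minus_minus a_inv_closed)
        then show ?thesis using False inJ by blast
      qed
    qed
  qed
  then show ?thesis using annihilating_poly[OF fd xv] by blast
qed

text \<open>By commutativity, an eigenspace of one element inside an ideal is again an ideal, so the
  members of a finite spanning set can be treated one after the other. A joint eigenvector of a
  spanning set is an eigenvector of every linear combination.\<close>

lemma joint_eigenvector:
  assumes fd: "cstar_finite_dimensional A" and comm: "cstar_commutative A"
    and J: "cideal J" and v: "v \<in> J" "v \<noteq> \<zero>"
  shows "\<exists>w\<in>J. w \<noteq> \<zero> \<and> (\<forall>x\<in>carrier A. \<exists>l. x \<otimes> w = l \<odot> w)"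
proof -
  obtain S where S: "finite S" "S \<subseteq> carrier A" and span: "\<And>y. y \<in> carrier A \<Longrightarrow> \<exists>c. y = (\<Oplus>s\<in>S. c s \<odot> s)"
    using fd unfolding cstar_finite_dimensional_def by blast
  have "\<exists>w\<in>J. w \<noteq> \<zero> \<and> (\<forall>x\<in>S. \<exists>l. x \<otimes> w = l \<odot> w)"
    using S J v
  proof (induction S arbitrary: J v)
    case empty then show ?case by blast
  next
    case (insert s S)
    have s: "s \<in> carrier A" using insert.prems by simp
    obtain u l where u: "u \<in> J" "u \<noteq> \<zero>" "s \<otimes> u = l \<odot> u"
      using exists_eigenvector[OF fd insert.prems(2,3,4) s] by blast
    let ?J = "{w \<in> J. s \<otimes> w = l \<odot> w}"
    have Jc: "\<And>w. w \<in> J \<Longrightarrow> w \<in> carrier A" using insert.prems(2) by (auto simp: cideal_def)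
    have J': "cideal ?J"
      unfolding cideal_def
    proof (intro conjI ballI allI)
      show "?J \<subseteq> carrier A" using Jc by blast
      show "\<zero> \<in> ?J" using insert.prems(2) s by (simp add: cideal_def smult_zero_right)
      show "w \<oplus> w' \<in> ?J" if "w \<in> ?J" "w' \<in> ?J" for w w'
      proof -
        have "w \<in> carrier A" "w' \<in> carrier A" using that Jc by simp_all
        then have "s \<otimes> (w \<oplus> w') = l \<odot> (w \<oplus> w')" using that s by (simp add: r_distr smult_r_distr)
        then show ?thesis using that insert.prems(2) by (simp add: cideal_def)
      qed
      show "c \<odot> w \<in> ?J" if w: "w \<in> ?J" for c w
      proof -
        have "s \<otimes> (c \<odot> w) = c \<odot> (l \<odot> w)" using w s Jc by (simp add: smult_mult_right)
        also have "\<dots> = l \<odot> (c \<odot> w)" using w Jc by (simp add: smult_assoc[symmetric] mult.commute)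
        finally show ?thesis using w insert.prems(2) by (simp add: cideal_def)
      qed
      show "x \<otimes> w \<in> ?J" if x: "x \<in> carrier A" and w: "w \<in> ?J" for x w
      proof -
        have wc: "w \<in> carrier A" using w Jc by blast
        have "s \<otimes> (x \<otimes> w) = x \<otimes> (s \<otimes> w)"
          using comm s x wc unfolding cstar_commutative_def by (metis m_assoc)
        also have "\<dots> = l \<odot> (x \<otimes> w)" using w x wc by (simp add: smult_mult_right)
        finally show ?thesis using w x insert.prems(2) by (simp add: cideal_def)
      qed
    qed
    have "\<exists>w\<in>?J. w \<noteq> \<zero> \<and> (\<forall>x\<in>S. \<exists>l. x \<otimes> w = l \<odot> w)"
      by (rule insert.IH[OF _ J' _ u(2)]) (use u insert.prems in auto)
    then show ?case by blast
  qed
  then obtain w where w: "w \<in> J" "w \<noteq> \<zero>" and eig: "\<And>s. s \<in> S \<Longrightarrow> \<exists>l. s \<otimes> w = l \<odot> w" by blast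
  have wc: "w \<in> carrier A" using w J by (auto simp: cideal_def)
  have "\<exists>l. (\<Oplus>s\<in>S'. c s \<odot> s) \<otimes> w = l \<odot> w" if "finite S'" "S' \<subseteq> S" for c S'
    using that
  proof (induction S')
    case empty
    show ?case using wc by (intro exI[of _ 0]) (simp add: smult_zero)
  next
    case (insert s S')
    have sc: "s \<in> carrier A" "S' \<subseteq> carrier A" using insert.prems S by auto
    have fc: "(\<Oplus>s\<in>S'. c s \<odot> s) \<in> carrier A" using sc smult_closed by (intro finsum_closed) auto
    obtain l where l: "(\<Oplus>s\<in>S'. c s \<odot> s) \<otimes> w = l \<odot> w" using insert by blast
    obtain l' where l': "s \<otimes> w = l' \<odot> w" using eig insert.prems by blast
    have "(\<Oplus>s\<in>insert s S'. c s \<odot> s) = c s \<odot> s \<oplus> (\<Oplus>s\<in>S'. c s \<odot> s)"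
      using insert.hyps sc smult_closed by (intro finsum_insert) auto
    then have "(\<Oplus>s\<in>insert s S'. c s \<odot> s) \<otimes> w = (c s * l' + l) \<odot> w"
      using sc fc wc l l' by (simp add: l_distr smult_closed smult_mult_left smult_l_distr smult_assoc)
    then show ?case by blast
  qed
  then have "\<exists>l. x \<otimes> w = l \<odot> w" if "x \<in> carrier A" for x
    using span[OF that] S by blast
  then show ?thesis using w by blast
qed

section \<open>Characters obtained from joint eigenvectors\<close>

definition is_character :: "('a \<Rightarrow> complex) \<Rightarrow> bool" where
  "is_character \<omega> \<longleftrightarrow> (\<forall>x\<in>carrier A. \<forall>y\<in>carrier A. \<omega> (x \<oplus> y) = \<omega> x + \<omega> y) \<and>
     (\<forall>c. \<forall>x\<in>carrier A. \<omega> (c \<odot> x) = c * \<omega> x) \<and>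
     (\<forall>x\<in>carrier A. \<forall>y\<in>carrier A. \<omega> (x \<otimes> y) = \<omega> x * \<omega> y) \<and>
     (\<forall>x\<in>carrier A. \<omega> (star A x) = cnj (\<omega> x)) \<and> \<omega> \<one> = 1"

lemma character_of_eigenvector:
  assumes w: "w \<in> carrier A" "w \<noteq> \<zero>" and eig: "\<And>x. x \<in> carrier A \<Longrightarrow> \<exists>l. x \<otimes> w = l \<odot> w"
  shows "\<exists>\<omega>. is_character \<omega> \<and> (\<forall>x\<in>carrier A. x \<otimes> w = \<omega> x \<odot> w)"
proof -
  obtain \<omega> where \<omega>: "\<And>x. x \<in> carrier A \<Longrightarrow> x \<otimes> w = \<omega> x \<odot> w" using eig by metis
  have cancel: "a = b" if "a \<odot> v = b \<odot> v" "v \<in> carrier A" "v \<noteq> \<zero>" for a b v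
  proof -
    have "(a - b) \<odot> v = a \<odot> v \<oplus> (- b) \<odot> v" using that smult_l_distr[of v a "- b"] by simp
    also have "\<dots> = (b + - b) \<odot> v" unfolding that(1) using that smult_l_distr[of v b "- b"] by simp
    finally have "(a - b) \<odot> v = \<zero>" using that by (simp add: smult_zero)
    then have "cmod (a - b) * cnorm A v = 0" using cnorm_smult[of v "a - b"] that by (simp add: cnorm_zero)
    then show ?thesis using that cnorm_eq_0_iff by simp
  qed
  have "is_character \<omega>"
    unfolding is_character_def
  proof (intro conjI ballI allI)
    fix x y c assume x: "x \<in> carrier A"
    show "\<omega> (c \<odot> x) = c * \<omega> x"
      using \<omega>[of "c \<odot> x"] \<omega>[OF x] x w by (intro cancel[OF _ w]) (simp add: smult_closed smult_mult_left smult_assoc)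
    \<comment> \<open>Evaluate the product of the star of \<open>w\<close>, the star of
      \<open>x\<close>, and \<open>w\<close> in two ways. The scalars can then be compared because
      the star of \<open>w\<close> times \<open>w\<close> is nonzero, by the C*-identity.\<close>
    show "\<omega> (star A x) = cnj (\<omega> x)"
    proof (rule cancel)
      let ?s = "star A w"
      have sw: "?s \<in> carrier A" using w star_closed by simp
      have "cnorm A (?s \<otimes> w) \<noteq> 0" using cstar_identity[OF w(1)] cnorm_eq_0_iff w by simp
      then show "?s \<otimes> w \<noteq> \<zero>" using cnorm_zero by auto
      show "?s \<otimes> w \<in> carrier A" using sw w by simp
      have "\<omega> (star A x) \<odot> (?s \<otimes> w) = ?s \<otimes> (star A x \<otimes> w)"
        using \<omega>[OF star_closed[OF x]] sw w by (simp add: smult_mult_right)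
      also have "\<dots> = star A (x \<otimes> w) \<otimes> w" using x w sw by (simp add: star_mult star_closed m_assoc)
      also have "\<dots> = cnj (\<omega> x) \<odot> (?s \<otimes> w)" using \<omega>[OF x] w sw by (simp add: star_smult smult_mult_left)
      finally show "\<omega> (star A x) \<odot> (?s \<otimes> w) = cnj (\<omega> x) \<odot> (?s \<otimes> w)" .
    qed
    assume y: "y \<in> carrier A"
    show "\<omega> (x \<oplus> y) = \<omega> x + \<omega> y"
      using \<omega>[of "x \<oplus> y"] \<omega>[OF x] \<omega>[OF y] x y w by (intro cancel[OF _ w]) (simp add: l_distr smult_l_distr)
    show "\<omega> (x \<otimes> y) = \<omega> x * \<omega> y"
    proof (rule cancel[OF _ w])
      have "\<omega> (x \<otimes> y) \<odot> w = x \<otimes> (y \<otimes> w)" using \<omega>[of "x \<otimes> y"] x y w by (simp add: m_assoc)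
      also have "\<dots> = (\<omega> x * \<omega> y) \<odot> w"
        using \<omega>[OF x] \<omega>[OF y] x w by (simp add: smult_mult_right smult_assoc[symmetric] mult.commute)
      finally show "\<omega> (x \<otimes> y) \<odot> w = (\<omega> x * \<omega> y) \<odot> w" .
    qed
  next
    show "\<omega> \<one> = 1" using \<omega>[of \<one>] w by (intro cancel[OF _ w]) (simp add: smult_one)
  qed
  then show ?thesis using \<omega> by blast
qed

text \<open>If \<open>(1 - z\<^sup>2) g = 1\<close>, then \<open>1 - z\<^sup>2 \<ge> \<delta>\<close> for some \<open>\<delta> > 0\<close>, whence \<open>\<parallel>z\<^sup>2\<parallel> \<le> 1 - \<delta>\<close>. The number \<open>\<rho> < 1\<close>
  makes up for the fact that the square root of \<open>1 - x\<close> is available for \<open>\<parallel>x\<parallel> < 1\<close> only.\<close>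

lemma one_minus_square_not_invertible:
  assumes comm: "cstar_commutative A" and z: "z \<in> carrier A" "star A z = z" "cnorm A z = 1" and g: "g \<in> carrier A"
  shows "(\<one> \<ominus> z \<otimes> z) \<otimes> g \<noteq> \<one>"
proof
  assume inv: "(\<one> \<ominus> z \<otimes> z) \<otimes> g = \<one>"
  have mc: "x \<otimes> y = y \<otimes> x" if "x \<in> carrier A" "y \<in> carrier A" for x y
    using comm that by (simp add: cstar_commutative_def)
  let ?w = "z \<otimes> z"
  have wc: "?w \<in> carrier A" and ws: "star A ?w = ?w" using z by (simp_all add: star_mult)
  let ?u = "\<one> \<ominus> ?w"
  have uc: "?u \<in> carrier A" and us: "star A ?u = ?u"
    using wc ws by (simp_all add: minus_eq star_add star_minus star_one)
  \<comment> \<open>The star of \<open>g\<close> is an inverse of the self-adjoint \<open>?u\<close>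
    as well, and inverses are unique.\<close>
  have gs: "star A g = g"
  proof -
    have "?u \<otimes> star A g = \<one>"
      using arg_cong[OF inv, of "star A"] uc us g mc[OF star_closed[OF g] uc] by (simp add: star_mult star_one)
    then have "star A g = (g \<otimes> ?u) \<otimes> star A g" using inv mc[OF g uc] g star_closed by simp
    also have "\<dots> = g" using \<open>?u \<otimes> star A g = \<one>\<close> g uc star_closed by (simp add: m_assoc)
    finally show ?thesis .
  qed
  define \<gamma> where "\<gamma> = cnorm A g"
  have \<gamma>0: "0 \<le> \<gamma>" using cnorm_nonneg[OF g] by (simp add: \<gamma>_def)
  \<comment> \<open>Small enough that \<open>\<delta> g\<close> has norm below 1, so that 1 -
    \<delta> g has a square root \<open>l\<close>. As \<open>g\<close> inverts \<open>?u\<close>,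
    multiplying \<open>?u\<close> by l^2 subtracts exactly \<open>\<delta>\<close>.\<close>
  define \<delta> where "\<delta> = 1 / (2 * (\<gamma> + 1))"
  have \<delta>: "0 < \<delta>" "\<delta> \<le> 1" "\<delta> * \<gamma> < 1" using \<gamma>0 by (simp_all add: \<delta>_def field_simps)
  let ?d = "complex_of_real \<delta>"
  obtain l where l: "l \<in> carrier A" "star A l = l" "l \<otimes> l = \<one> \<ominus> ?d \<odot> g"
  proof -
    have cs: "?d \<odot> g \<in> carrier A" "star A (?d \<odot> g) = ?d \<odot> g" using g gs by (simp_all add: smult_closed star_smult)
    have lt: "cnorm A (?d \<odot> g) < 1" using \<delta> g by (simp add: cnorm_smult \<gamma>_def)
    show thesis by (rule sqrt_one_minus[OF cs lt]) (rule that)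
  qed
  let ?ll = "l \<otimes> l"
  have llc: "?ll \<in> carrier A" using l(1) by simp
  define K where "K = cnorm A (?ll \<otimes> ?w)"
  have K0: "0 \<le> K" using cnorm_nonneg llc wc by (simp add: K_def)
  \<comment> \<open>Close enough to 1 that the error caused by replacing \<open>?w\<close> with
    \<open>\<rho> ?w\<close>, which is at most (1 - \<rho>) K, stays below the gain
    \<open>\<delta>\<close>.\<close>
  define \<rho> where "\<rho> = 1 - \<delta> / (2 * (K + 1))"
  have \<rho>: "0 \<le> \<rho>" "\<rho> < 1" "(1 - \<rho>) * K < \<delta>"
  proof -
    have "\<delta> / (2 * (K + 1)) \<le> 1" using \<delta> K0 by (simp add: field_simps)
    then show "0 \<le> \<rho>" by (simp add: \<rho>_def)
    show "\<rho> < 1" using \<delta> K0 by (simp add: \<rho>_def)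
    have "(1 - \<rho>) * K \<le> (1 - \<rho>) * (K + 1)" using \<open>\<rho> < 1\<close> by (intro mult_left_mono) auto
    also have "\<dots> = \<delta> / 2" using K0 by (simp add: \<rho>_def field_simps)
    finally show "(1 - \<rho>) * K < \<delta>" using \<delta> by simp
  qed
  let ?r = "complex_of_real \<rho>"
  have wn: "cnorm A ?w \<le> 1" using cnorm_mult[OF z(1) z(1)] z by simp
  obtain h where h: "h \<in> carrier A" "star A h = h" "h \<otimes> h = \<one> \<ominus> ?r \<odot> ?w"
  proof -
    have cs: "?r \<odot> ?w \<in> carrier A" "star A (?r \<odot> ?w) = ?r \<odot> ?w" using wc ws by (simp_all add: smult_closed star_smult)
    have lt: "cnorm A (?r \<odot> ?w) < 1"
      using \<rho> wc mult_left_mono[OF wn \<rho>(1)] by (simp add: cnorm_smult)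
    show thesis by (rule sqrt_one_minus[OF cs lt]) (rule that)
  qed
  \<comment> \<open>Up to that error its square is l^2 (1 - z^2), which equals 1 - z^2 - \<delta>.
    So z^2 + q^2 is nearly 1 - \<delta>.\<close>
  let ?q = "l \<otimes> h"
  have qc: "?q \<in> carrier A" and qs: "star A ?q = ?q" using l h mc by (simp_all add: star_mult)
  have "?q \<otimes> ?q = ?ll \<otimes> (h \<otimes> h)" using l h mc by (metis m_assoc m_closed)
  also have "\<dots> = ?ll \<ominus> ?r \<odot> (?ll \<otimes> ?w)"
    unfolding h(3) using llc wc by (simp add: minus_eq r_distr r_minus smult_closed smult_mult_right)
  also have "?r \<odot> (?ll \<otimes> ?w) = (?ll \<otimes> ?w) \<ominus> complex_of_real (1 - \<rho>) \<odot> (?ll \<otimes> ?w)"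
  proof -
    have lw: "?ll \<otimes> ?w \<in> carrier A" using llc wc by simp
    have "?r \<odot> (?ll \<otimes> ?w) = (1 + (-1) * complex_of_real (1 - \<rho>)) \<odot> (?ll \<otimes> ?w)" by simp
    also have "\<dots> = (?ll \<otimes> ?w) \<ominus> complex_of_real (1 - \<rho>) \<odot> (?ll \<otimes> ?w)"
      unfolding smult_l_distr[OF lw] smult_assoc[OF lw] smult_one[OF lw] minus_eq
      using smult_minus1[OF smult_closed[OF lw]] by simp
    finally show ?thesis .
  qed
  finally have qq: "?q \<otimes> ?q = ?ll \<ominus> ((?ll \<otimes> ?w) \<ominus> complex_of_real (1 - \<rho>) \<odot> (?ll \<otimes> ?w))" .
  have llu: "?ll \<ominus> ?ll \<otimes> ?w = ?u \<ominus> ?d \<odot> \<one>"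
  proof -
    have "?ll \<ominus> ?ll \<otimes> ?w = ?ll \<otimes> ?u" using llc wc by (simp add: minus_eq r_distr r_minus)
    also have "\<dots> = ?u \<ominus> ?d \<odot> (g \<otimes> ?u)"
      unfolding l(3) using g uc by (simp add: minus_eq l_distr l_minus smult_closed smult_mult_left)
    finally show ?thesis using inv mc[OF g uc] by simp
  qed
  let ?e = "complex_of_real (1 - \<rho>) \<odot> (?ll \<otimes> ?w)"
  have ec: "?e \<in> carrier A" using llc wc smult_closed by simp
  have dc: "?d \<odot> \<one> \<in> carrier A" using smult_closed by simp
  have "?w \<oplus> ?q \<otimes> ?q = ?w \<oplus> ((?ll \<ominus> ?ll \<otimes> ?w) \<oplus> ?e)"
    unfolding qq using llc wc ec by (simp add: minus_eq minus_add a_assoc)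
  also have "\<dots> = (\<one> \<ominus> ?d \<odot> \<one>) \<oplus> ?e"
  proof -
    have "?w \<oplus> ((\<one> \<oplus> \<ominus> ?w \<oplus> \<ominus> (?d \<odot> \<one>)) \<oplus> ?e) = (?w \<oplus> \<ominus> ?w) \<oplus> ((\<one> \<oplus> \<ominus> (?d \<odot> \<one>)) \<oplus> ?e)"
      using wc ec dc by (simp only: a_ac one_closed a_closed a_inv_closed)
    then show ?thesis unfolding llu using wc ec dc by (simp add: minus_eq r_neg)
  qed
  also have "\<one> \<ominus> ?d \<odot> \<one> = complex_of_real (1 - \<delta>) \<odot> \<one>"
  proof -
    have "complex_of_real (1 - \<delta>) \<odot> \<one> = (1 + (-1) * ?d) \<odot> \<one>" by simp
    also have "\<dots> = \<one> \<ominus> ?d \<odot> \<one>"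
      unfolding smult_l_distr[OF one_closed] smult_assoc[OF one_closed] smult_one[OF one_closed] minus_eq
      using smult_minus1[OF dc] by simp
    finally show ?thesis by simp
  qed
  finally have eq: "?w \<oplus> ?q \<otimes> ?q = complex_of_real (1 - \<delta>) \<odot> \<one> \<oplus> ?e" .
  \<comment> \<open>The norm of z^2 + q^2 is at least the squared norm of \<open>z\<close>, which is
    1, yet the formula just found makes it smaller than 1.\<close>
  have "1 \<le> cnorm A (?w \<oplus> ?q \<otimes> ?q)"
    using cnorm_sq_le_sum_squares[OF z(1,2) qc qs mc[OF z(1) qc]] z(3) by simp
  also have "\<dots> \<le> cnorm A (complex_of_real (1 - \<delta>) \<odot> \<one>) + cnorm A ?e"
    unfolding eq using ec smult_closed by (intro cnorm_triangle) auto
  also have "\<dots> = \<bar>1 - \<delta>\<bar> * cnorm A \<one> + \<bar>1 - \<rho>\<bar> * K"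
    using llc wc by (simp only: cnorm_smult one_closed m_closed norm_of_real K_def)
  also have "\<dots> \<le> (1 - \<delta>) * 1 + (1 - \<rho>) * K"
    using \<delta> \<rho> cnorm_one_le cnorm_nonneg[OF one_closed] K0 by (intro add_mono mult_mono) auto
  also have "\<dots> < 1" using \<rho>(3) by simp
  finally show False by simp
qed

text \<open>Take a nonzero polynomial that annihilates 1 when evaluated at \<open>u\<close>. If its
  constant term is 0, injectivity cancels a factor \<open>u\<close>; otherwise the relation can be
  solved for 1 as \<open>u\<close> times a multiple of a polynomial in \<open>u\<close>.\<close>

lemma injective_imp_invertible:
  assumes fd: "cstar_finite_dimensional A" and u: "u \<in> carrier A"
    and inj: "\<And>v. v \<in> carrier A \<Longrightarrow> u \<otimes> v = \<zero> \<Longrightarrow> v = \<zero>"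
  shows "\<exists>g\<in>carrier A. u \<otimes> g = \<one>"
proof -
  note ac = poly_act_closed[OF u one_closed]
  have "p \<noteq> 0 \<Longrightarrow> poly_act u \<one> p = \<zero> \<Longrightarrow> ?thesis" for p
  proof (induction p)
    case 0 then show ?case by simp
  next
    case (pCons a p)
    have eq: "a \<odot> \<one> \<oplus> u \<otimes> poly_act u \<one> p = \<zero>"
      using pCons.prems poly_act_pCons[OF u one_closed] by simp
    show ?case
    proof (cases "a = 0")
      case True
      then have "u \<otimes> poly_act u \<one> p = \<zero>" using eq u ac by (simp add: smult_zero)
      then have "poly_act u \<one> p = \<zero>" by (rule inj[OF ac])
      then show ?thesis using pCons True by auto
    next
      case False
      have "\<ominus> (u \<otimes> poly_act u \<one> p) = a \<odot> \<one>"
        using eq u ac smult_closed by (intro minus_equality) auto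
      then have m: "(-1) \<odot> (u \<otimes> poly_act u \<one> p) = a \<odot> \<one>" using u ac smult_minus1 by simp
      have "u \<otimes> ((1 / a * -1) \<odot> poly_act u \<one> p) = (1 / a) \<odot> ((-1) \<odot> (u \<otimes> poly_act u \<one> p))"
        using u ac by (simp only: smult_mult_right smult_assoc smult_closed m_closed)
      also have "\<dots> = (1 / a * a) \<odot> \<one>" unfolding m by (simp only: smult_assoc one_closed)
      also have "\<dots> = \<one>" using False by (simp add: smult_one)
      finally show ?thesis using smult_closed[OF ac] by blast
    qed
  qed
  then show ?thesis using annihilating_poly[OF fd u one_closed] by blast
qed

text \<open>Normalise the star of \<open>b\<close> times \<open>b\<close> to an element
  \<open>z\<close> of norm 1. As 1 - z^2 is not invertible, its annihilator is a nonzero ideal. The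
  character given by a joint eigenvector in that ideal kills 1 - z^2, so its value at
  \<open>z\<close> has modulus 1, which says that its value at \<open>b\<close> has modulus the norm
  of \<open>b\<close>.\<close>

lemma exists_norming_character:
  assumes fd: "cstar_finite_dimensional A" and comm: "cstar_commutative A" and b: "b \<in> carrier A" "b \<noteq> \<zero>"
  shows "\<exists>\<omega>. is_character \<omega> \<and> cmod (\<omega> b) = cnorm A b"
proof -
  have mc: "x \<otimes> y = y \<otimes> x" if "x \<in> carrier A" "y \<in> carrier A" for x y
    using comm that by (simp add: cstar_commutative_def)
  let ?N = "cnorm A b"
  have N: "0 < ?N" using cnorm_nonneg[OF b(1)] cnorm_eq_0_iff[OF b(1)] b(2) by simp
  let ?y = "star A b \<otimes> b"
  have yc: "?y \<in> carrier A" and ys: "star A ?y = ?y" using b by (simp_all add: star_closed star_mult star_star)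
  define k where "k = complex_of_real (1 / ?N\<^sup>2)"
  define z where "z = k \<odot> ?y"
  have z: "z \<in> carrier A" "star A z = z" using yc ys by (simp_all add: z_def k_def smult_closed star_smult)
  have zn: "cnorm A z = 1" using N yc cstar_identity[OF b(1)] by (simp add: z_def k_def cnorm_smult norm_divide norm_power)
  let ?u = "\<one> \<ominus> z \<otimes> z"
  have uc: "?u \<in> carrier A" using z by simp
  obtain v where v: "v \<in> carrier A" "?u \<otimes> v = \<zero>" "v \<noteq> \<zero>"
    using injective_imp_invertible[OF fd uc] one_minus_square_not_invertible[OF comm z zn] by blast
  let ?J = "{v \<in> carrier A. ?u \<otimes> v = \<zero>}"
  have J: "cideal ?J"
    unfolding cideal_def
  proof (intro conjI ballI allI)
    show "c \<odot> w \<in> ?J" if "w \<in> ?J" for c w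
      using that uc by (simp add: smult_closed smult_mult_right smult_zero_right)
    show "x \<otimes> w \<in> ?J" if x: "x \<in> carrier A" and w: "w \<in> ?J" for x w
    proof -
      have wc: "w \<in> carrier A" using w by simp
      have "?u \<otimes> (x \<otimes> w) = x \<otimes> (?u \<otimes> w)" using mc[OF uc x] x wc uc by (simp add: m_assoc[symmetric])
      then show ?thesis using w x by simp
    qed
  qed (use uc in \<open>auto simp: r_distr\<close>)
  obtain w where w: "w \<in> ?J" "w \<noteq> \<zero>" "\<And>x. x \<in> carrier A \<Longrightarrow> \<exists>l. x \<otimes> w = l \<odot> w"
    using joint_eigenvector[OF fd comm J, of v] v by blast
  have wc: "w \<in> carrier A" using w by simp
  obtain \<omega> where \<omega>: "is_character \<omega>" and \<omega>w: "\<And>x. x \<in> carrier A \<Longrightarrow> x \<otimes> w = \<omega> x \<odot> w"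
    using character_of_eigenvector[OF wc w(2,3)] by blast
  note X = \<omega>[unfolded is_character_def]
  have "\<omega> ?u \<odot> w = \<zero>" using \<omega>w[OF uc] w(1) by simp
  then have "cmod (\<omega> ?u) * cnorm A w = 0" using cnorm_smult[OF wc, of "\<omega> ?u"] by (simp add: cnorm_zero)
  then have "\<omega> ?u = 0" using cnorm_eq_0_iff[OF wc] w(2) by simp
  moreover have "\<omega> ?u = 1 - \<omega> z * \<omega> z"
  proof -
    have zz: "z \<otimes> z \<in> carrier A" using z by simp
    have "?u = \<one> \<oplus> (-1) \<odot> (z \<otimes> z)" using smult_minus1[OF zz] by (simp add: minus_eq)
    then have "\<omega> ?u = \<omega> \<one> + \<omega> ((-1) \<odot> (z \<otimes> z))" using X smult_closed[OF zz] by simp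
    also have "\<omega> ((-1) \<odot> (z \<otimes> z)) = (-1) * \<omega> (z \<otimes> z)" using X zz by blast
    finally show ?thesis using X z by simp
  qed
  ultimately have "\<omega> z * \<omega> z = 1" by simp
  then have "cmod (\<omega> z) * cmod (\<omega> z) = 1" by (metis norm_mult norm_one)
  then have "cmod (\<omega> z) = 1" by (metis norm_ge_zero power2_eq_square power2_eq_1_iff le_minus_one_simps(3))
  moreover have "\<omega> z = k * (cnj (\<omega> b) * \<omega> b)" using X yc b star_closed by (simp add: z_def)
  ultimately have "cmod k * (cmod (\<omega> b) * cmod (\<omega> b)) = 1" by (simp add: norm_mult)
  moreover have "cmod k = 1 / ?N\<^sup>2" using N by (simp add: k_def norm_divide norm_power)
  ultimately have "1 / ?N\<^sup>2 * (cmod (\<omega> b))\<^sup>2 = 1" by (simp only: power2_eq_square)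
  moreover have "?N\<^sup>2 \<noteq> 0" using N by simp
  ultimately have "(cmod (\<omega> b))\<^sup>2 = ?N\<^sup>2" by (simp add: divide_eq_1_iff del: power_eq_0_iff)
  then have "cmod (\<omega> b) = ?N" by (rule power2_eq_imp_eq) (use N in auto)
  then show ?thesis using \<omega> by blast
qed

lemma trep_character:
  assumes "is_character \<omega>" shows "trep A (\<lambda>x. opscl (\<omega> x) id_blinfun)"
  using assms unfolding is_character_def trep_def
  by (auto simp: opscl_distrib adj_def cip_scl_left cip_scl_right scl_simps intro!: blinfun_eqI)

end

text \<open>A character gives representations by scalar operators. Used in both factors, it turns a
  sum of elementary tensors into the scalar that the character takes on the sum of the products.
  Choosing a character that attains the norm of that sum shows that multiplication is contractive
  for the spatial norm.\<close>

lemma mult_hom_props: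
  fixes B :: "(nat \<Rightarrow> 'x) cstar"
  assumes B: "cstar_algebra B" and fd: "cstar_finite_dimensional B" and comm: "cstar_commutative B"
  shows "mult_hom B \<in> cstar_hom (tensor_alg B B) B"
    and "\<lbrakk>b \<in> carrier B; b' \<in> carrier B\<rbrakk> \<Longrightarrow> mult_hom B (tensor_elem B B b b') = b \<otimes>\<^bsub>B\<^esub> b'"
proof -
  interpret B: cstar_algebra B by (rule B)
  have mc: "x \<otimes>\<^bsub>B\<^esub> y = y \<otimes>\<^bsub>B\<^esub> x" if "x \<in> carrier B" "y \<in> carrier B" for x y
    using comm that by (simp add: cstar_commutative_def)
  have ex: "\<exists>h. h \<in> cstar_hom (tensor_alg B B) B \<and>
    (\<forall>b\<in>carrier B. \<forall>b'\<in>carrier B. h (tensor_elem B B b b') = b \<otimes>\<^bsub>B\<^esub> b')"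
  proof (rule tensor_extension[OF B B B])
    show "(a \<otimes>\<^bsub>B\<^esub> a') \<otimes>\<^bsub>B\<^esub> (b \<otimes>\<^bsub>B\<^esub> b') = (a \<otimes>\<^bsub>B\<^esub> b) \<otimes>\<^bsub>B\<^esub> (a' \<otimes>\<^bsub>B\<^esub> b')"
      if "a \<in> carrier B" "b \<in> carrier B" "a' \<in> carrier B" "b' \<in> carrier B" for a b a' b'
      using that mc by (metis B.m_assoc B.m_closed)
    show "star B a \<otimes>\<^bsub>B\<^esub> star B b = star B (a \<otimes>\<^bsub>B\<^esub> b)" if "a \<in> carrier B" "b \<in> carrier B" for a b
      using that mc[OF B.star_closed[OF that(1)] B.star_closed[OF that(2)]] by (simp add: B.star_mult)
    show "cnorm B (\<Oplus>\<^bsub>B\<^esub>k\<in>{..<n}. a k \<otimes>\<^bsub>B\<^esub> b k) \<le> spatial_norm B B n a b"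
      if a: "\<And>k. k < n \<Longrightarrow> a k \<in> carrier B" and b: "\<And>k. k < n \<Longrightarrow> b k \<in> carrier B" for n :: nat and a b
    proof -
      let ?y = "\<Oplus>\<^bsub>B\<^esub>k\<in>{..<n}. a k \<otimes>\<^bsub>B\<^esub> b k"
      have yc: "?y \<in> carrier B" using a b by (intro B.finsum_lessThan_closed) auto
      show ?thesis
      proof (cases "?y = \<zero>\<^bsub>B\<^esub>")
        case True
        then show ?thesis
          using order_trans[OF norm_ge_zero spatial_norm_ge[OF B B a b trep_zero_rep trep_zero_rep]]
          by (simp add: B.cnorm_zero)
      next
        case False
        then obtain \<omega> where \<omega>: "B.is_character \<omega>" "cmod (\<omega> ?y) = cnorm B ?y"
          using B.exists_norming_character[OF fd comm yc] by blast
        let ?P = "\<lambda>x. opscl (\<omega> x) id_blinfun :: (nat \<Rightarrow> 'x) bop"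
        note X = \<omega>(1)[unfolded B.is_character_def]
        have \<omega>y: "\<omega> ?y = (\<Sum>k<n. \<omega> (a k) * \<omega> (b k))"
          using a b
        proof (induction n)
          case 0
          have "\<omega> \<zero>\<^bsub>B\<^esub> = 0" using X B.smult_zero[of "\<one>\<^bsub>B\<^esub>"] by (metis B.one_closed mult_zero_left)
          then show ?case by simp
        next
          case (Suc n)
          then show ?case using X by (simp add: B.finsum_lessThan_Suc B.finsum_lessThan_closed)
        qed
        \<comment> \<open>The operator acts as the scalar \<open>\<omega> ?y\<close>, so a single
          unit vector already gives the lower bound for its norm.\<close>
        have "(\<Sum>k<n. ten (?P (a k)) (?P (b k))) (dl p) = scl (\<omega> ?y) (dl p)" for p
        proof -
          have "ten (?P x) (?P y) (dl p) = scl (\<omega> x * \<omega> y) (dl p)" for x y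
            by (cases p) (simp add: vten_dl[symmetric] ten_vten clin_opscl clin_id vten_scl scl_simps mult.commute)
          then have "(\<Sum>k<n. ten (?P (a k)) (?P (b k))) (dl p) = (\<Sum>k<n. scl (\<omega> (a k) * \<omega> (b k)) (dl p))"
            by (simp add: blinfun.sum_left)
          also have "\<dots> = scl (\<Sum>k<n. \<omega> (a k) * \<omega> (b k)) (dl p)"
            by (induction n) (simp_all add: scl_simps)
          finally show ?thesis by (simp add: \<omega>y)
        qed
        then have "cmod (\<omega> ?y) \<le> norm (\<Sum>k<n. ten (?P (a k)) (?P (b k)))"
          using norm_blinfun[of "\<Sum>k<n. ten (?P (a k)) (?P (b k))" "dl undefined"] by (simp add: norm_scl)
        also have "\<dots> \<le> spatial_norm B B n a b"
          by (rule spatial_norm_ge[OF B B a b B.trep_character[OF \<omega>(1)] B.trep_character[OF \<omega>(1)]])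
        finally show ?thesis using \<omega>(2) by simp
      qed
    qed
  qed (auto simp: B.smult_mult_left)
  note * = the_tensor_hom[OF B B B ex mult_hom_def]
  show "mult_hom B \<in> cstar_hom (tensor_alg B B) B" by (rule *(1))
  show "\<lbrakk>b \<in> carrier B; b' \<in> carrier B\<rbrakk> \<Longrightarrow> mult_hom B (tensor_elem B B b b') = b \<otimes>\<^bsub>B\<^esub> b'" by (rule *(2))
qed

section \<open>The convolution product of quantum families of maps\<close>

text \<open>Restricting the composite keeps it extensional, as membership in
  \<open>cstar_hom\<close> requires.\<close>

definition hcomp :: "'a cstar \<Rightarrow> ('b \<Rightarrow> 'c) \<Rightarrow> ('a \<Rightarrow> 'b) \<Rightarrow> 'a \<Rightarrow> 'c" where
  "hcomp A g f = (\<lambda>x\<in>carrier A. g (f x))"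

lemma hcomp_apply: "x \<in> carrier A \<Longrightarrow> hcomp A g f x = g (f x)"
  by (simp add: hcomp_def)

lemma hcomp_hom:
  "\<lbrakk>f \<in> cstar_hom A B; g \<in> cstar_hom B C; cstar_algebra A\<rbrakk> \<Longrightarrow> hcomp A g f \<in> cstar_hom A C"
  unfolding hcomp_def by (rule cstar_hom_compose)

lemma hcomp_id: "f \<in> cstar_hom A B \<Longrightarrow> hcomp A f (id_hom A) = f" "f \<in> cstar_hom A B \<Longrightarrow> hcomp A (id_hom B) f = f"
  by (auto simp: hcomp_def id_hom_def cstar_homD intro!: extensionalityI[OF restrict_extensional cstar_homD(7)])

lemma tensor_hom_comp:
  fixes A B C A' B' C' :: "(nat \<Rightarrow> 'x) cstar"
  assumes A: "cstar_algebra A" and B: "cstar_algebra B" and C: "cstar_algebra C"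
    and A': "cstar_algebra A'" and B': "cstar_algebra B'" and C': "cstar_algebra C'"
    and f: "f \<in> cstar_hom A B" and g: "g \<in> cstar_hom B C"
    and f': "f' \<in> cstar_hom A' B'" and g': "g' \<in> cstar_hom B' C'"
    and x: "x \<in> carrier (tensor_alg A A')"
  shows "tensor_hom B C B' C' g g' (tensor_hom A B A' B' f f' x)
    = tensor_hom A C A' C' (hcomp A g f) (hcomp A' g' f') x"
proof -
  note AA = tensor_alg_cstar[OF A A'] and CC = tensor_alg_cstar[OF C C']
  note p1 = tensor_hom_props[OF A B A' B' f f'] and p2 = tensor_hom_props[OF B C B' C' g g']
  note h = hcomp_hom[OF f g A] and h' = hcomp_hom[OF f' g' A']
  note p3 = tensor_hom_props[OF A C A' C' h h']
  have "hcomp (tensor_alg A A') (tensor_hom B C B' C' g g') (tensor_hom A B A' B' f f')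
    = tensor_hom A C A' C' (hcomp A g f) (hcomp A' g' f')"
    by (rule tensor_hom_eqI[OF A A' CC hcomp_hom[OF p1(1) p2(1) AA] p3(1)])
      (simp add: hcomp_apply tensor_elem_closed[OF A A'] p1(2) p2(2) p3(2) cstar_homD(1)[OF f] cstar_homD(1)[OF f'])
  then show ?thesis using x by (metis hcomp_apply)
qed

lemma tensor_hom_id:
  fixes A B :: "(nat \<Rightarrow> 'x) cstar"
  assumes A: "cstar_algebra A" and B: "cstar_algebra B"
  shows "tensor_hom A A B B (id_hom A) (id_hom B) = id_hom (tensor_alg A B)"
proof -
  note AB = tensor_alg_cstar[OF A B]
  note p = tensor_hom_props[OF A A B B id_hom_cstar_hom[OF A] id_hom_cstar_hom[OF B]]
  show ?thesis
    by (rule tensor_hom_eqI[OF A B AB p(1) id_hom_cstar_hom[OF AB]])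
      (simp add: p(2) id_hom_apply tensor_elem_closed[OF A B])
qed

lemma tensor_assoc_natural:
  fixes A B C A' B' C' :: "(nat \<Rightarrow> 'x) cstar"
  assumes A: "cstar_algebra A" and B: "cstar_algebra B" and C: "cstar_algebra C"
    and A': "cstar_algebra A'" and B': "cstar_algebra B'" and C': "cstar_algebra C'"
    and f: "f \<in> cstar_hom A A'" and g: "g \<in> cstar_hom B B'" and h: "h \<in> cstar_hom C C'"
    and x: "x \<in> carrier (tensor_alg (tensor_alg A B) C)"
  shows "tensor_assoc A' B' C'
      (tensor_hom (tensor_alg A B) (tensor_alg A' B') C C' (tensor_hom A A' B B' f g) h x)
    = tensor_hom A A' (tensor_alg B C) (tensor_alg B' C') f (tensor_hom B B' C C' g h) (tensor_assoc A B C x)"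
proof -
  note AB = tensor_alg_cstar[OF A B] and AB' = tensor_alg_cstar[OF A' B']
    and BC = tensor_alg_cstar[OF B C] and BC' = tensor_alg_cstar[OF B' C']
  note L = tensor_alg_cstar[OF AB C] and R' = tensor_alg_cstar[OF A' BC']
  note fg = tensor_hom_props[OF A A' B B' f g] and gh = tensor_hom_props[OF B B' C C' g h]
  note l = tensor_hom_props[OF AB AB' C C' fg(1) h] and r = tensor_hom_props[OF A A' BC BC' f gh(1)]
  note a = tensor_assoc_props[OF A B C] and a' = tensor_assoc_props[OF A' B' C']
  note cl = cstar_homD(1)[OF f] cstar_homD(1)[OF g] cstar_homD(1)[OF h] tensor_elem_closed[OF A B]
    tensor_elem_closed[OF B C] tensor_elem_closed[OF AB C]
  have "hcomp (tensor_alg (tensor_alg A B) C) (tensor_assoc A' B' C')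
      (tensor_hom (tensor_alg A B) (tensor_alg A' B') C C' (tensor_hom A A' B B' f g) h)
    = hcomp (tensor_alg (tensor_alg A B) C)
      (tensor_hom A A' (tensor_alg B C) (tensor_alg B' C') f (tensor_hom B B' C C' g h)) (tensor_assoc A B C)"
    by (rule triple_hom_eqI[OF A B C R' hcomp_hom[OF l(1) a'(1) L] hcomp_hom[OF a(1) r(1) L]])
      (simp add: hcomp_apply cl fg(2) gh(2) l(2) r(2) a(2) a'(2))
  then show ?thesis using x by (metis hcomp_apply)
qed

text \<open>The map \<open>(m \<otimes> I)(I \<otimes> F \<otimes> I) : (B \<otimes> X) \<otimes> (B \<otimes> Y) \<rightarrow> B \<otimes> (X \<otimes> Y)\<close>, composed as in
  \<^const>\<open>product_hom\<close>.\<close>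

definition shuffle_mult :: "'u cstar \<Rightarrow> 'u cstar \<Rightarrow> 'u cstar \<Rightarrow> 'u \<Rightarrow> 'u" where
  "shuffle_mult B X Y =
     (let BX = tensor_alg B X; BY = tensor_alg B Y; XB = tensor_alg X B; BB = tensor_alg B B; XY = tensor_alg X Y;
          assoc1 = tensor_assoc B X BY;
          assoc2 = tensor_hom B B (tensor_alg X BY) (tensor_alg XB Y) (id_hom B) (tensor_assoc_inv X B Y);
          id_F_id = tensor_hom B B (tensor_alg XB Y) (tensor_alg BX Y)
                      (id_hom B) (tensor_hom XB BX Y Y (flip_hom X B) (id_hom Y));
          assoc3 = tensor_hom B B (tensor_alg BX Y) (tensor_alg B XY) (id_hom B) (tensor_assoc B X Y);
          assoc4 = tensor_assoc_inv B B XY;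
          m_id = tensor_hom BB B XY XY (mult_hom B) (id_hom XY)
      in (\<lambda>w\<in>carrier (tensor_alg BX BY). m_id (assoc4 (assoc3 (id_F_id (assoc2 (assoc1 w)))))))"

locale fd_comm =
  fixes B :: "(nat \<Rightarrow> 'x) cstar"
  assumes B: "cstar_algebra B" and fd: "cstar_finite_dimensional B" and comm: "cstar_commutative B"
begin

lemma shuffle_mult_props:
  fixes X Y :: "(nat \<Rightarrow> 'x) cstar"
  assumes X: "cstar_algebra X" and Y: "cstar_algebra Y"
  shows "shuffle_mult B X Y \<in> cstar_hom (tensor_alg (tensor_alg B X) (tensor_alg B Y)) (tensor_alg B (tensor_alg X Y))"
    and "\<lbrakk>b \<in> carrier B; x \<in> carrier X; b' \<in> carrier B; y \<in> carrier Y\<rbrakk> \<Longrightarrow>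
      shuffle_mult B X Y (tensor_elem (tensor_alg B X) (tensor_alg B Y) (tensor_elem B X b x) (tensor_elem B Y b' y))
      = tensor_elem B (tensor_alg X Y) (b \<otimes>\<^bsub>B\<^esub> b') (tensor_elem X Y x y)"
proof -
  interpret B: cstar_algebra B by (rule B)
  note BX = tensor_alg_cstar[OF B X] and BY = tensor_alg_cstar[OF B Y] and XB = tensor_alg_cstar[OF X B]
    and BB = tensor_alg_cstar[OF B B] and XY = tensor_alg_cstar[OF X Y]
  note X_BY = tensor_alg_cstar[OF X BY] and XB_Y = tensor_alg_cstar[OF XB Y] and BX_Y = tensor_alg_cstar[OF BX Y]
    and B_XY = tensor_alg_cstar[OF B XY]
  note T = tensor_alg_cstar[OF BX BY]
  note iB = id_hom_cstar_hom[OF B]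
  note a1 = tensor_assoc_props[OF B X BY]
  note ai = tensor_assoc_inv_props[OF X B Y]
  note a2 = tensor_hom_props[OF B B X_BY XB_Y iB ai(1)]
  note fl = flip_hom_props[OF X B]
  note F1 = tensor_hom_props[OF XB BX Y Y fl(1) id_hom_cstar_hom[OF Y]]
  note F = tensor_hom_props[OF B B XB_Y BX_Y iB F1(1)]
  note as = tensor_assoc_props[OF B X Y]
  note a3 = tensor_hom_props[OF B B BX_Y B_XY iB as(1)]
  note a4 = tensor_assoc_inv_props[OF B B XY]
  note mu = mult_hom_props[OF B fd comm]
  note m = tensor_hom_props[OF BB B XY XY mu(1) id_hom_cstar_hom[OF XY]]
  \<comment> \<open>Written as nested restricted compositions, the map is a homomorphism by
    composing the six homomorphisms involved.\<close>
  have eq: "shuffle_mult B X Y = hcomp (tensor_alg (tensor_alg B X) (tensor_alg B Y))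
    (hcomp (tensor_alg B (tensor_alg X (tensor_alg B Y)))
      (hcomp (tensor_alg B (tensor_alg (tensor_alg X B) Y))
        (hcomp (tensor_alg B (tensor_alg (tensor_alg B X) Y))
          (hcomp (tensor_alg B (tensor_alg B (tensor_alg X Y)))
            (tensor_hom (tensor_alg B B) B (tensor_alg X Y) (tensor_alg X Y) (mult_hom B) (id_hom (tensor_alg X Y)))
            (tensor_assoc_inv B B (tensor_alg X Y)))
          (tensor_hom B B (tensor_alg (tensor_alg B X) Y) (tensor_alg B (tensor_alg X Y)) (id_hom B) (tensor_assoc B X Y)))
        (tensor_hom B B (tensor_alg (tensor_alg X B) Y) (tensor_alg (tensor_alg B X) Y) (id_hom B)
          (tensor_hom (tensor_alg X B) (tensor_alg B X) Y Y (flip_hom X B) (id_hom Y))))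
      (tensor_hom B B (tensor_alg X (tensor_alg B Y)) (tensor_alg (tensor_alg X B) Y) (id_hom B) (tensor_assoc_inv X B Y)))
    (tensor_assoc B X (tensor_alg B Y))"
    unfolding shuffle_mult_def Let_def hcomp_def
    by (rule restrict_ext) (simp add: cstar_homD(1)[OF a1(1)] cstar_homD(1)[OF a2(1)] cstar_homD(1)[OF F(1)] cstar_homD(1)[OF a3(1)])
  show "shuffle_mult B X Y \<in> cstar_hom (tensor_alg (tensor_alg B X) (tensor_alg B Y)) (tensor_alg B (tensor_alg X Y))"
    unfolding eq
    by (rule hcomp_hom[OF a1(1) hcomp_hom[OF a2(1) hcomp_hom[OF F(1) hcomp_hom[OF a3(1) hcomp_hom[OF a4(1) m(1)]]]]])
      (rule tensor_alg_cstar B X_BY XB_Y BX_Y B_XY T)+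
  note cl = tensor_elem_closed[OF B X] tensor_elem_closed[OF B Y] tensor_elem_closed[OF BX BY]
    tensor_elem_closed[OF X BY] tensor_elem_closed[OF XB Y] tensor_elem_closed[OF X B] tensor_elem_closed[OF BX Y]
    tensor_elem_closed[OF B XY] tensor_elem_closed[OF X Y] tensor_elem_closed[OF B B]
  show "shuffle_mult B X Y (tensor_elem (tensor_alg B X) (tensor_alg B Y) (tensor_elem B X b x) (tensor_elem B Y b' y))
      = tensor_elem B (tensor_alg X Y) (b \<otimes>\<^bsub>B\<^esub> b') (tensor_elem X Y x y)"
    if "b \<in> carrier B" "x \<in> carrier X" "b' \<in> carrier B" "y \<in> carrier Y"
    unfolding shuffle_mult_def Let_def
    using that by (simp add: cl a1(2) a2(2) ai(2) F(2) F1(2) fl(2) a3(2) as(2) a4(2) m(2) mu(2) id_hom_apply)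
qed

lemma dense_quadruple:
  fixes X Y :: "(nat \<Rightarrow> 'x) cstar"
  assumes X: "cstar_algebra X" and Y: "cstar_algebra Y"
  shows "dense_sums (tensor_alg (tensor_alg B X) (tensor_alg B Y))
    {tensor_elem (tensor_alg B X) (tensor_alg B Y) (tensor_elem B X b x) (tensor_elem B Y b' y) |b x b' y.
      b \<in> carrier B \<and> x \<in> carrier X \<and> b' \<in> carrier B \<and> y \<in> carrier Y}" (is "dense_sums ?T ?S")
proof -
  have "{tensor_elem (tensor_alg B X) (tensor_alg B Y) u v |u v.
      u \<in> (\<lambda>(b, x). tensor_elem B X b x) ` (carrier B \<times> carrier X) \<and>
      v \<in> (\<lambda>(b, y). tensor_elem B Y b y) ` (carrier B \<times> carrier Y)} = ?S" by force
  then show ?thesis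
    using dense_tensor_elem_subsets[OF tensor_alg_cstar[OF B X] tensor_alg_cstar[OF B Y]
        dense_tensor_elem[OF B X] dense_tensor_elem[OF B Y]] by simp
qed

lemma shuffle_mult_natural:
  fixes X Y X' Y' :: "(nat \<Rightarrow> 'x) cstar"
  assumes X: "cstar_algebra X" and Y: "cstar_algebra Y" and X': "cstar_algebra X'" and Y': "cstar_algebra Y'"
    and f: "f \<in> cstar_hom X X'" and g: "g \<in> cstar_hom Y Y'"
    and w: "w \<in> carrier (tensor_alg (tensor_alg B X) (tensor_alg B Y))"
  shows "tensor_hom B B (tensor_alg X Y) (tensor_alg X' Y') (id_hom B) (tensor_hom X X' Y Y' f g) (shuffle_mult B X Y w)
    = shuffle_mult B X' Y' (tensor_hom (tensor_alg B X) (tensor_alg B X') (tensor_alg B Y) (tensor_alg B Y')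
        (tensor_hom B B X X' (id_hom B) f) (tensor_hom B B Y Y' (id_hom B) g) w)"
proof -
  interpret B: cstar_algebra B by (rule B)
  note BX = tensor_alg_cstar[OF B X] and BY = tensor_alg_cstar[OF B Y] and XY = tensor_alg_cstar[OF X Y]
    and BX' = tensor_alg_cstar[OF B X'] and BY' = tensor_alg_cstar[OF B Y'] and XY' = tensor_alg_cstar[OF X' Y']
  note T = tensor_alg_cstar[OF BX BY] and R = tensor_alg_cstar[OF B XY']
  note iB = id_hom_cstar_hom[OF B]
  note s = shuffle_mult_props[OF X Y] and s' = shuffle_mult_props[OF X' Y']
  note fg = tensor_hom_props[OF X X' Y Y' f g]
  note l = tensor_hom_props[OF B B XY XY' iB fg(1)]
  note bf = tensor_hom_props[OF B B X X' iB f] and bg = tensor_hom_props[OF B B Y Y' iB g]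
  note r = tensor_hom_props[OF BX BX' BY BY' bf(1) bg(1)]
  note cl = tensor_elem_closed[OF B X] tensor_elem_closed[OF B Y] tensor_elem_closed[OF BX BY] tensor_elem_closed[OF X Y]
    cstar_homD(1)[OF f] cstar_homD(1)[OF g]
  have "hcomp (tensor_alg (tensor_alg B X) (tensor_alg B Y))
      (tensor_hom B B (tensor_alg X Y) (tensor_alg X' Y') (id_hom B) (tensor_hom X X' Y Y' f g)) (shuffle_mult B X Y)
    = hcomp (tensor_alg (tensor_alg B X) (tensor_alg B Y)) (shuffle_mult B X' Y')
      (tensor_hom (tensor_alg B X) (tensor_alg B X') (tensor_alg B Y) (tensor_alg B Y')
        (tensor_hom B B X X' (id_hom B) f) (tensor_hom B B Y Y' (id_hom B) g))"
    by (rule cstar_hom_eqI[OF hcomp_hom[OF s(1) l(1) T] hcomp_hom[OF r(1) s'(1) T] T R dense_quadruple[OF X Y]])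
      (auto simp: hcomp_apply cl s(2) s'(2) l(2) r(2) fg(2) bf(2) bg(2) id_hom_apply)
  then show ?thesis using w by (metis hcomp_apply)
qed

text \<open>Both sides are homomorphisms, so elementary tensors decide. There the component in
  \<open>B\<close> is a product of three factors, bracketed in two ways, and the other three
  components are regrouped by the associator.\<close>

lemma shuffle_mult_assoc:
  fixes X Y Z :: "(nat \<Rightarrow> 'x) cstar"
  assumes X: "cstar_algebra X" and Y: "cstar_algebra Y" and Z: "cstar_algebra Z"
    and w: "w \<in> carrier (tensor_alg (tensor_alg (tensor_alg B X) (tensor_alg B Y)) (tensor_alg B Z))"
  shows "tensor_hom B B (tensor_alg (tensor_alg X Y) Z) (tensor_alg X (tensor_alg Y Z)) (id_hom B) (tensor_assoc X Y Z)
      (shuffle_mult B (tensor_alg X Y) Z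
        (tensor_hom (tensor_alg (tensor_alg B X) (tensor_alg B Y)) (tensor_alg B (tensor_alg X Y)) (tensor_alg B Z) (tensor_alg B Z)
          (shuffle_mult B X Y) (id_hom (tensor_alg B Z)) w))
    = shuffle_mult B X (tensor_alg Y Z)
        (tensor_hom (tensor_alg B X) (tensor_alg B X) (tensor_alg (tensor_alg B Y) (tensor_alg B Z)) (tensor_alg B (tensor_alg Y Z))
          (id_hom (tensor_alg B X)) (shuffle_mult B Y Z)
          (tensor_assoc (tensor_alg B X) (tensor_alg B Y) (tensor_alg B Z) w))"
proof -
  interpret B: cstar_algebra B by (rule B)
  let ?BX = "tensor_alg B X" and ?BY = "tensor_alg B Y" and ?BZ = "tensor_alg B Z"
  let ?XY = "tensor_alg X Y" and ?YZ = "tensor_alg Y Z"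
  note BX = tensor_alg_cstar[OF B X] and BY = tensor_alg_cstar[OF B Y] and BZ = tensor_alg_cstar[OF B Z]
  note XY = tensor_alg_cstar[OF X Y] and YZ = tensor_alg_cstar[OF Y Z]
  note BXBY = tensor_alg_cstar[OF BX BY] and BYBZ = tensor_alg_cstar[OF BY BZ]
  note B_XY = tensor_alg_cstar[OF B XY] and B_YZ = tensor_alg_cstar[OF B YZ]
  note XY_Z = tensor_alg_cstar[OF XY Z] and X_YZ = tensor_alg_cstar[OF X YZ]
  note T = tensor_alg_cstar[OF BXBY BZ] and R = tensor_alg_cstar[OF B X_YZ]
  note iB = id_hom_cstar_hom[OF B]
  note s1 = shuffle_mult_props[OF X Y] and s2 = shuffle_mult_props[OF Y Z]
    and s3 = shuffle_mult_props[OF XY Z] and s4 = shuffle_mult_props[OF X YZ]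
  note a = tensor_assoc_props[OF X Y Z] and a' = tensor_assoc_props[OF BX BY BZ]
  note l1 = tensor_hom_props[OF BXBY B_XY BZ BZ s1(1) id_hom_cstar_hom[OF BZ]]
  note l2 = tensor_hom_props[OF B B XY_Z X_YZ iB a(1)]
  note r1 = tensor_hom_props[OF BX BX BYBZ B_YZ id_hom_cstar_hom[OF BX] s2(1)]
  let ?S = "{tensor_elem (tensor_alg ?BX ?BY) ?BZ (tensor_elem ?BX ?BY (tensor_elem B X b x) (tensor_elem B Y b' y))
      (tensor_elem B Z b'' z) |b x b' y b'' z. b \<in> carrier B \<and> x \<in> carrier X \<and> b' \<in> carrier B \<and> y \<in> carrier Y \<and>
      b'' \<in> carrier B \<and> z \<in> carrier Z}"
  have dense: "dense_sums (tensor_alg (tensor_alg ?BX ?BY) ?BZ) ?S"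
  proof -
    have "{tensor_elem (tensor_alg ?BX ?BY) ?BZ u v |u v.
        u \<in> {tensor_elem ?BX ?BY (tensor_elem B X b x) (tensor_elem B Y b' y) |b x b' y.
          b \<in> carrier B \<and> x \<in> carrier X \<and> b' \<in> carrier B \<and> y \<in> carrier Y} \<and>
        v \<in> (\<lambda>(b, z). tensor_elem B Z b z) ` (carrier B \<times> carrier Z)} = ?S"
    proof (intro equalityI subsetI)
      fix t assume "t \<in> ?S"
      then obtain b x b' y b'' z where t: "t = tensor_elem (tensor_alg ?BX ?BY) ?BZ
          (tensor_elem ?BX ?BY (tensor_elem B X b x) (tensor_elem B Y b' y)) (tensor_elem B Z b'' z)"
        and mem: "b \<in> carrier B" "x \<in> carrier X" "b' \<in> carrier B" "y \<in> carrier Y" "(b'', z) \<in> carrier B \<times> carrier Z"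
        by blast
      have "tensor_elem B Z b'' z \<in> (\<lambda>(b, z). tensor_elem B Z b z) ` (carrier B \<times> carrier Z)"
        by (rule image_eqI[OF _ mem(5)]) simp
      then show "t \<in> {tensor_elem (tensor_alg ?BX ?BY) ?BZ u v |u v.
        u \<in> {tensor_elem ?BX ?BY (tensor_elem B X b x) (tensor_elem B Y b' y) |b x b' y.
          b \<in> carrier B \<and> x \<in> carrier X \<and> b' \<in> carrier B \<and> y \<in> carrier Y} \<and>
        v \<in> (\<lambda>(b, z). tensor_elem B Z b z) ` (carrier B \<times> carrier Z)}"
        unfolding t using mem by blast
    qed (clarsimp, blast)
    then show ?thesis
      using dense_tensor_elem_subsets[OF BXBY BZ dense_quadruple[OF X Y] dense_tensor_elem[OF B Z]] by simp
  qed
  note cl = tensor_elem_closed[OF B X] tensor_elem_closed[OF B Y] tensor_elem_closed[OF B Z]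
    tensor_elem_closed[OF BX BY] tensor_elem_closed[OF BY BZ] tensor_elem_closed[OF BXBY BZ]
    tensor_elem_closed[OF X Y] tensor_elem_closed[OF Y Z] tensor_elem_closed[OF XY Z] tensor_elem_closed[OF X YZ]
    tensor_elem_closed[OF B XY] tensor_elem_closed[OF B YZ]
  have "hcomp (tensor_alg (tensor_alg ?BX ?BY) ?BZ)
      (tensor_hom B B (tensor_alg ?XY Z) (tensor_alg X ?YZ) (id_hom B) (tensor_assoc X Y Z))
      (hcomp (tensor_alg (tensor_alg ?BX ?BY) ?BZ) (shuffle_mult B ?XY Z)
        (tensor_hom (tensor_alg ?BX ?BY) (tensor_alg B ?XY) ?BZ ?BZ (shuffle_mult B X Y) (id_hom ?BZ)))
    = hcomp (tensor_alg (tensor_alg ?BX ?BY) ?BZ) (shuffle_mult B X ?YZ)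
      (hcomp (tensor_alg (tensor_alg ?BX ?BY) ?BZ)
        (tensor_hom ?BX ?BX (tensor_alg ?BY ?BZ) (tensor_alg B ?YZ) (id_hom ?BX) (shuffle_mult B Y Z))
        (tensor_assoc ?BX ?BY ?BZ))"
    by (rule cstar_hom_eqI[OF hcomp_hom[OF hcomp_hom[OF l1(1) s3(1) T] l2(1) T]
          hcomp_hom[OF hcomp_hom[OF a'(1) r1(1) T] s4(1) T] T R dense])
      (auto simp: hcomp_apply cl s1(2) s2(2) s3(2) s4(2) a(2) a'(2) l1(2) l2(2) r1(2) id_hom_apply B.m_assoc)
  then have "hcomp (tensor_alg (tensor_alg ?BX ?BY) ?BZ)
      (tensor_hom B B (tensor_alg ?XY Z) (tensor_alg X ?YZ) (id_hom B) (tensor_assoc X Y Z))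
      (hcomp (tensor_alg (tensor_alg ?BX ?BY) ?BZ) (shuffle_mult B ?XY Z)
        (tensor_hom (tensor_alg ?BX ?BY) (tensor_alg B ?XY) ?BZ ?BZ (shuffle_mult B X Y) (id_hom ?BZ))) w
    = hcomp (tensor_alg (tensor_alg ?BX ?BY) ?BZ) (shuffle_mult B X ?YZ)
      (hcomp (tensor_alg (tensor_alg ?BX ?BY) ?BZ)
        (tensor_hom ?BX ?BX (tensor_alg ?BY ?BZ) (tensor_alg B ?YZ) (id_hom ?BX) (shuffle_mult B Y Z))
        (tensor_assoc ?BX ?BY ?BZ)) w" by (rule fun_cong)
  then show ?thesis unfolding hcomp_apply[OF w] .
qed

section \<open>Coassociativity of the induced map\<close>

lemma product_hom_eq:
  fixes A C :: "(nat \<Rightarrow> 'x) cstar"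
  assumes A: "cstar_algebra A" and C: "cstar_algebra C"
    and \<Delta>: "\<Delta> \<in> cstar_hom A (tensor_alg A A)" and \<Phi>: "\<Phi> \<in> cstar_hom A (tensor_alg B C)"
  shows "product_hom A \<Delta> B C \<Phi> = hcomp A (shuffle_mult B C C)
    (hcomp A (tensor_hom A (tensor_alg B C) A (tensor_alg B C) \<Phi> \<Phi>) \<Delta>)"
proof -
  note BC = tensor_alg_cstar[OF B C]
  note p = tensor_hom_props[OF A BC A BC \<Phi> \<Phi>]
  show ?thesis
    unfolding product_hom_def shuffle_mult_def Let_def hcomp_def
    by (rule restrict_ext) (simp add: cstar_homD(1)[OF p(1)] cstar_homD(1)[OF \<Delta>])
qed

lemma coassociative:
  fixes A C :: "(nat \<Rightarrow> 'x) cstar"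
  assumes A: "cstar_algebra A" and C: "cstar_algebra C"
    and \<Delta>: "\<Delta> \<in> cstar_hom A (tensor_alg A A)" and \<Phi>: "\<Phi> \<in> cstar_hom A (tensor_alg B C)"
    and \<Gamma>: "\<Gamma> \<in> cstar_hom C (tensor_alg C C)"
    and coassoc: "\<And>a. a \<in> carrier A \<Longrightarrow>
        tensor_assoc A A A (tensor_hom A (tensor_alg A A) A A \<Delta> (id_hom A) (\<Delta> a)) =
        tensor_hom A A A (tensor_alg A A) (id_hom A) \<Delta> (\<Delta> a)"
    and ind: "\<And>a. a \<in> carrier A \<Longrightarrow>
        tensor_hom B B C (tensor_alg C C) (id_hom B) \<Gamma> (\<Phi> a) = product_hom A \<Delta> B C \<Phi> a"
    and a: "a \<in> carrier A"
  shows "tensor_hom B B C (tensor_alg C (tensor_alg C C)) (id_hom B)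
      (hcomp C (tensor_assoc C C C) (hcomp C (tensor_hom C (tensor_alg C C) C C \<Gamma> (id_hom C)) \<Gamma>)) (\<Phi> a)
    = tensor_hom B B C (tensor_alg C (tensor_alg C C)) (id_hom B)
      (hcomp C (tensor_hom C C C (tensor_alg C C) (id_hom C) \<Gamma>) \<Gamma>) (\<Phi> a)"
proof -
  let ?AA = "tensor_alg A A" and ?CC = "tensor_alg C C" and ?BC = "tensor_alg B C"
  let ?B2 = "tensor_alg B ?CC" and ?Q = "tensor_alg ?BC ?BC"
  note AA = tensor_alg_cstar[OF A A] and CC = tensor_alg_cstar[OF C C] and BC = tensor_alg_cstar[OF B C]
  note C_CC = tensor_alg_cstar[OF C CC] and CC_C = tensor_alg_cstar[OF CC C]
  note B2 = tensor_alg_cstar[OF B CC] and Q = tensor_alg_cstar[OF BC BC]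
  note AA_A = tensor_alg_cstar[OF AA A] and A_AA = tensor_alg_cstar[OF A AA]
  note iA = id_hom_cstar_hom[OF A] and iB = id_hom_cstar_hom[OF B] and iC = id_hom_cstar_hom[OF C]
    and iBC = id_hom_cstar_hom[OF BC]
  note \<Gamma>I = tensor_hom_props[OF C CC C C \<Gamma> iC] and I\<Gamma> = tensor_hom_props[OF C C C CC iC \<Gamma>]
  note \<alpha> = tensor_assoc_props[OF C C C]
  note BG = tensor_hom_props[OF B B C CC iB \<Gamma>]
  note PP = tensor_hom_props[OF A BC A BC \<Phi> \<Phi>]
  note S = shuffle_mult_props[OF C C]
  define P where "P = product_hom A \<Delta> B C \<Phi>"
  \<comment> \<open>The part of the composite before the copies of \<open>B\<close> are brought
    together. The shuffle acts on its values, so naturality can move \<open>\<Gamma>\<close> across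
    the shuffle.\<close>
  define \<Theta> where "\<Theta> = hcomp A (tensor_hom A ?BC A ?BC \<Phi> \<Phi>) \<Delta>"
  have \<Theta>: "\<Theta> \<in> cstar_hom A ?Q" unfolding \<Theta>_def by (rule hcomp_hom[OF \<Delta> PP(1) A])
  have P_eq: "P = hcomp A (shuffle_mult B C C) \<Theta>" unfolding P_def \<Theta>_def by (rule product_hom_eq[OF A C \<Delta> \<Phi>])
  have P: "P \<in> cstar_hom A ?B2" unfolding P_eq by (rule hcomp_hom[OF \<Theta> S(1) A])
  have P_ind: "hcomp A (tensor_hom B B C ?CC (id_hom B) \<Gamma>) \<Phi> = P"
    by (rule extensionalityI[OF _ cstar_homD(7)[OF P]]) (auto simp: hcomp_def P_def ind)
  have \<Phi>a: "\<Phi> a \<in> carrier ?BC" and \<Delta>a: "\<Delta> a \<in> carrier ?AA" and \<Theta>a: "\<Theta> a \<in> carrier ?Q"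
    by (rule cstar_homD(1)[OF \<Phi> a] cstar_homD(1)[OF \<Delta> a] cstar_homD(1)[OF \<Theta> a])+
  have Pa: "tensor_hom B B C ?CC (id_hom B) \<Gamma> (\<Phi> a) = shuffle_mult B C C (\<Theta> a)"
    using ind[OF a] P_eq by (simp add: P_def[symmetric] hcomp_apply[OF a])
  have \<Theta>a_eq: "\<Theta> a = tensor_hom A ?BC A ?BC \<Phi> \<Phi> (\<Delta> a)" by (simp add: \<Theta>_def hcomp_apply[OF a])
  note iBB = hcomp_id(1)[OF iB]
  have BI: "tensor_hom B B C C (id_hom B) (id_hom C) = id_hom ?BC" by (rule tensor_hom_id[OF B C])
  note PhiI = hcomp_id(2)[OF \<Phi>]
  let ?D1 = "tensor_hom A ?AA A A \<Delta> (id_hom A)" and ?D2 = "tensor_hom A A A ?AA (id_hom A) \<Delta>"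
  note D1 = tensor_hom_props[OF A AA A A \<Delta> iA] and D2 = tensor_hom_props[OF A A A AA iA \<Delta>]
  have D1a: "?D1 (\<Delta> a) \<in> carrier (tensor_alg ?AA A)" and D2a: "?D2 (\<Delta> a) \<in> carrier (tensor_alg A ?AA)"
    by (rule cstar_homD(1)[OF D1(1) \<Delta>a] cstar_homD(1)[OF D2(1) \<Delta>a])+
  let ?PP = "tensor_hom A ?BC A ?BC \<Phi> \<Phi>"
  let ?PP1 = "tensor_hom ?AA ?Q A ?BC ?PP \<Phi>" and ?PP2 = "tensor_hom A ?BC ?AA ?Q \<Phi> ?PP"
  note PP1 = tensor_hom_props[OF AA Q A BC PP(1) \<Phi>] and PP2 = tensor_hom_props[OF A BC AA Q \<Phi> PP(1)]
  \<comment> \<open>Both sides are \<open>P\<close> \<otimes> \<open>\<Phi>\<close> applied to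
    \<open>\<Delta> a\<close>: tensoring is functorial, \<open>\<Gamma>\<close> after
    \<open>\<Phi>\<close> is \<open>P\<close> by \<open>ind\<close>, and \<open>P\<close> is the
    shuffle after \<open>\<Theta>\<close>. The block \<open>right\<close> is its mirror
    image.\<close>
  have left: "tensor_hom ?BC ?B2 ?BC ?BC (tensor_hom B B C ?CC (id_hom B) \<Gamma>) (tensor_hom B B C C (id_hom B) (id_hom C)) (\<Theta> a)
      = tensor_hom ?Q ?B2 ?BC ?BC (shuffle_mult B C C) (id_hom ?BC) (?PP1 (?D1 (\<Delta> a)))"
  proof -
    have "tensor_hom ?BC ?B2 ?BC ?BC (tensor_hom B B C ?CC (id_hom B) \<Gamma>) (id_hom ?BC) (\<Theta> a)
        = tensor_hom A ?B2 A ?BC P \<Phi> (\<Delta> a)"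
      unfolding \<Theta>a_eq tensor_hom_comp[OF A BC B2 A BC BC \<Phi> BG(1) \<Phi> iBC \<Delta>a] P_ind PhiI ..
    moreover have "?PP1 (?D1 (\<Delta> a)) = tensor_hom A ?Q A ?BC \<Theta> \<Phi> (\<Delta> a)"
      unfolding tensor_hom_comp[OF A AA Q A A BC \<Delta> PP(1) iA \<Phi> \<Delta>a] hcomp_id(1)[OF \<Phi>] \<Theta>_def ..
    moreover have "tensor_hom ?Q ?B2 ?BC ?BC (shuffle_mult B C C) (id_hom ?BC) (tensor_hom A ?Q A ?BC \<Theta> \<Phi> (\<Delta> a))
        = tensor_hom A ?B2 A ?BC P \<Phi> (\<Delta> a)"
      unfolding tensor_hom_comp[OF A Q B2 A BC BC \<Theta> S(1) \<Phi> iBC \<Delta>a] PhiI P_eq ..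
    ultimately show ?thesis unfolding BI by simp
  qed
  have right: "tensor_hom ?BC ?BC ?BC ?B2 (tensor_hom B B C C (id_hom B) (id_hom C)) (tensor_hom B B C ?CC (id_hom B) \<Gamma>) (\<Theta> a)
      = tensor_hom ?BC ?BC ?Q ?B2 (id_hom ?BC) (shuffle_mult B C C) (?PP2 (?D2 (\<Delta> a)))"
  proof -
    have "tensor_hom ?BC ?BC ?BC ?B2 (id_hom ?BC) (tensor_hom B B C ?CC (id_hom B) \<Gamma>) (\<Theta> a)
        = tensor_hom A ?BC A ?B2 \<Phi> P (\<Delta> a)"
      unfolding \<Theta>a_eq tensor_hom_comp[OF A BC BC A BC B2 \<Phi> iBC \<Phi> BG(1) \<Delta>a] P_ind PhiI ..
    moreover have "?PP2 (?D2 (\<Delta> a)) = tensor_hom A ?BC A ?Q \<Phi> \<Theta> (\<Delta> a)"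
      unfolding tensor_hom_comp[OF A A BC A AA Q iA \<Phi> \<Delta> PP(1) \<Delta>a] hcomp_id(1)[OF \<Phi>] \<Theta>_def ..
    moreover have "tensor_hom ?BC ?BC ?Q ?B2 (id_hom ?BC) (shuffle_mult B C C) (tensor_hom A ?BC A ?Q \<Phi> \<Theta> (\<Delta> a))
        = tensor_hom A ?BC A ?B2 \<Phi> P (\<Delta> a)"
      unfolding tensor_hom_comp[OF A BC BC A Q B2 \<Phi> iBC \<Theta> S(1) \<Delta>a] PhiI P_eq ..
    ultimately show ?thesis unfolding BI by simp
  qed
  have "tensor_hom B B C (tensor_alg C ?CC) (id_hom B)
      (hcomp C (tensor_assoc C C C) (hcomp C (tensor_hom C ?CC C C \<Gamma> (id_hom C)) \<Gamma>)) (\<Phi> a)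
    = tensor_hom B B (tensor_alg ?CC C) (tensor_alg C ?CC) (id_hom B) (tensor_assoc C C C)
        (tensor_hom B B C (tensor_alg ?CC C) (id_hom B) (hcomp C (tensor_hom C ?CC C C \<Gamma> (id_hom C)) \<Gamma>) (\<Phi> a))"
    unfolding tensor_hom_comp[OF B B B C CC_C C_CC iB iB hcomp_hom[OF \<Gamma> \<Gamma>I(1) C] \<alpha>(1) \<Phi>a] iBB ..
  also have "tensor_hom B B C (tensor_alg ?CC C) (id_hom B) (hcomp C (tensor_hom C ?CC C C \<Gamma> (id_hom C)) \<Gamma>) (\<Phi> a)
    = tensor_hom B B ?CC (tensor_alg ?CC C) (id_hom B) (tensor_hom C ?CC C C \<Gamma> (id_hom C)) (shuffle_mult B C C (\<Theta> a))"
    unfolding Pa[symmetric] tensor_hom_comp[OF B B B C CC CC_C iB iB \<Gamma> \<Gamma>I(1) \<Phi>a] iBB ..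
  also have "\<dots> = shuffle_mult B ?CC C (tensor_hom ?Q ?B2 ?BC ?BC (shuffle_mult B C C) (id_hom ?BC) (?PP1 (?D1 (\<Delta> a))))"
    unfolding shuffle_mult_natural[OF C C CC C \<Gamma> iC \<Theta>a] left ..
  \<comment> \<open>The bracketing changes here: the associator is carried backwards through the
    shuffles and then through three copies of \<open>\<Phi>\<close> to A \<otimes> A \<otimes> A,
    where coassociativity of \<open>\<Delta>\<close> applies.\<close>
  also have "tensor_hom B B (tensor_alg ?CC C) (tensor_alg C ?CC) (id_hom B) (tensor_assoc C C C) \<dots>
    = shuffle_mult B C ?CC (tensor_hom ?BC ?BC ?Q ?B2 (id_hom ?BC) (shuffle_mult B C C)
        (tensor_assoc ?BC ?BC ?BC (?PP1 (?D1 (\<Delta> a)))))"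
    by (rule shuffle_mult_assoc[OF C C C cstar_homD(1)[OF PP1(1) D1a]])
  also have "tensor_assoc ?BC ?BC ?BC (?PP1 (?D1 (\<Delta> a))) = ?PP2 (tensor_assoc A A A (?D1 (\<Delta> a)))"
    by (rule tensor_assoc_natural[OF A A A BC BC BC \<Phi> \<Phi> \<Phi> D1a])
  also have "tensor_assoc A A A (?D1 (\<Delta> a)) = ?D2 (\<Delta> a)" by (rule coassoc[OF a])
  also have "shuffle_mult B C ?CC (tensor_hom ?BC ?BC ?Q ?B2 (id_hom ?BC) (shuffle_mult B C C) (?PP2 (?D2 (\<Delta> a))))
    = tensor_hom B B ?CC (tensor_alg C ?CC) (id_hom B) (tensor_hom C C C ?CC (id_hom C) \<Gamma>) (shuffle_mult B C C (\<Theta> a))"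
    unfolding shuffle_mult_natural[OF C C C CC iC \<Gamma> \<Theta>a] right ..
  also have "\<dots> = tensor_hom B B C (tensor_alg C ?CC) (id_hom B) (hcomp C (tensor_hom C C C ?CC (id_hom C) \<Gamma>) \<Gamma>) (\<Phi> a)"
    unfolding Pa[symmetric] tensor_hom_comp[OF B B B C CC C_CC iB iB \<Gamma> I\<Gamma>(1) \<Phi>a] iBB ..
  finally show ?thesis .
qed

end

theorem theorem9:
  fixes A B C :: "(nat \<Rightarrow> 'x) cstar"
    and \<Delta> \<Phi> :: "(nat \<Rightarrow> 'x) \<Rightarrow> (nat \<Rightarrow> 'x)"
  assumes "compact_quantum_semigroup A \<Delta>"
    and "cstar_finitely_generated A"
    and "cstar_algebra B"
    and "cstar_finite_dimensional B"
    and "cstar_commutative B"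
    and "quantum_family_of_all_maps A B C \<Phi>"
  defines "induces \<equiv> \<lambda>\<Gamma>. \<Gamma> \<in> cstar_hom C (tensor_alg C C) \<and>
      (\<forall>a\<in>carrier A. tensor_hom B B C (tensor_alg C C) (id_hom B) \<Gamma> (\<Phi> a) =
         product_hom A \<Delta> B C \<Phi> a)"
  shows "(\<exists>!\<Gamma>. induces \<Gamma>) \<and> (\<forall>\<Gamma>. induces \<Gamma> \<longrightarrow> compact_quantum_semigroup C \<Gamma>)"
proof -
  interpret fd_comm B by (rule fd_comm.intro[OF assms(3-5)])
  have A: "cstar_algebra A" and \<Delta>: "\<Delta> \<in> cstar_hom A (tensor_alg A A)"
    and coassoc: "\<And>a. a \<in> carrier A \<Longrightarrow>
        tensor_assoc A A A (tensor_hom A (tensor_alg A A) A A \<Delta> (id_hom A) (\<Delta> a)) =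
        tensor_hom A A A (tensor_alg A A) (id_hom A) \<Delta> (\<Delta> a)"
    using assms(1) unfolding compact_quantum_semigroup_def by blast+
  have C: "cstar_algebra C" and \<Phi>: "\<Phi> \<in> cstar_hom A (tensor_alg B C)"
    and univ: "\<And>D \<Psi>. \<lbrakk>cstar_algebra D; \<Psi> \<in> cstar_hom A (tensor_alg B D)\<rbrakk> \<Longrightarrow>
      \<exists>!\<Lambda>. \<Lambda> \<in> cstar_hom C D \<and> (\<forall>a\<in>carrier A. tensor_hom B B C D (id_hom B) \<Lambda> (\<Phi> a) = \<Psi> a)"
    using assms(6) unfolding quantum_family_of_all_maps_def by blast+
  note CC = tensor_alg_cstar[OF C C] and BC = tensor_alg_cstar[OF B C]
  note C_CC = tensor_alg_cstar[OF C CC]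
  note iC = id_hom_cstar_hom[OF C] and iB = id_hom_cstar_hom[OF B]
  have "product_hom A \<Delta> B C \<Phi> \<in> cstar_hom A (tensor_alg B (tensor_alg C C))"
    unfolding product_hom_eq[OF A C \<Delta> \<Phi>]
    by (rule hcomp_hom[OF hcomp_hom[OF \<Delta> tensor_hom_props(1)[OF A BC A BC \<Phi> \<Phi>] A] shuffle_mult_props(1)[OF C C] A])
  \<comment> \<open>The universal property with C \<otimes> C as the parameter algebra.\<close>
  then have ex1: "\<exists>!\<Gamma>. induces \<Gamma>" unfolding induces_def by (rule univ[OF CC])
  have "compact_quantum_semigroup C \<Gamma>" if "induces \<Gamma>" for \<Gamma>
  proof -
    have \<Gamma>: "\<Gamma> \<in> cstar_hom C (tensor_alg C C)"
      and ind: "\<And>a. a \<in> carrier A \<Longrightarrow>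
        tensor_hom B B C (tensor_alg C C) (id_hom B) \<Gamma> (\<Phi> a) = product_hom A \<Delta> B C \<Phi> a"
      using that unfolding induces_def by blast+
    let ?L1 = "hcomp C (tensor_assoc C C C) (hcomp C (tensor_hom C (tensor_alg C C) C C \<Gamma> (id_hom C)) \<Gamma>)"
    let ?L2 = "hcomp C (tensor_hom C C C (tensor_alg C C) (id_hom C) \<Gamma>) \<Gamma>"
    have L1: "?L1 \<in> cstar_hom C (tensor_alg C (tensor_alg C C))"
      by (rule hcomp_hom[OF hcomp_hom[OF \<Gamma> tensor_hom_props(1)[OF C CC C C \<Gamma> iC] C] tensor_assoc_props(1)[OF C C C] C])
    have L2: "?L2 \<in> cstar_hom C (tensor_alg C (tensor_alg C C))"
      by (rule hcomp_hom[OF \<Gamma> tensor_hom_props(1)[OF C C C CC iC \<Gamma>] C])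
    \<comment> \<open>The family to be represented is the one that \<open>?L2\<close> induces, so
      \<open>?L2\<close> represents it by construction and only \<open>?L1\<close> calls for
      \<open>coassociative\<close>.\<close>
    let ?\<Psi> = "hcomp A (tensor_hom B B C (tensor_alg C (tensor_alg C C)) (id_hom B) ?L2) \<Phi>"
    have \<Psi>: "?\<Psi> \<in> cstar_hom A (tensor_alg B (tensor_alg C (tensor_alg C C)))"
      by (rule hcomp_hom[OF \<Phi> tensor_hom_props(1)[OF B B C C_CC iB L2] A])
    have "?L1 = ?L2"
    proof -
      define P where "P M \<longleftrightarrow> M \<in> cstar_hom C (tensor_alg C (tensor_alg C C)) \<and>
        (\<forall>a\<in>carrier A. tensor_hom B B C (tensor_alg C (tensor_alg C C)) (id_hom B) M (\<Phi> a) = ?\<Psi> a)" for M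
      have U: "\<exists>!M. P M" unfolding P_def by (rule univ[OF C_CC \<Psi>])
      have p1: "P ?L1"
        unfolding P_def using L1 coassociative[OF A C \<Delta> \<Phi> \<Gamma> coassoc ind] by (simp add: hcomp_apply)
      have p2: "P ?L2" unfolding P_def using L2 by (simp add: hcomp_apply)
      obtain M where M: "\<And>M'. P M' \<Longrightarrow> M' = M" using U by blast
      show ?thesis unfolding M[OF p1] M[OF p2] ..
    qed
    then have "?L1 c = ?L2 c" for c by simp
    then show ?thesis
      using C \<Gamma> unfolding compact_quantum_semigroup_def by (metis hcomp_apply)
  qed
  then show ?thesis using ex1 by blast
qed

end
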